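(* Let $n\ge 4$. For every iterated sequence $S$ for $\operatorname{Gr}(2,\mathbb C^n)$ one has $\operatorname{gr}_S(A_{2,n})\cong\mathbb C[p_{ij}]_{ij}/\operatorname{in}_{C_S}(I_{2,n})$, where $C_S$ is the maximal cone of $\operatorname{trop}(\operatorname{Gr}(2,\mathbb C^n))$ corresponding to the tree $T_S$. Moreover, for every maximal prime cone $C$ of $\operatorname{trop}(\operatorname{Gr}(2,\mathbb C^n))$ there exists a birational sequence $S$ such that $\mathbb C[p_{ij}]_{ij}/\operatorname{in}_C(I_{2,n})\cong\operatorname{gr}_S(A_{2,n})$.
   Context: $\mathbb C[p_{ij}]_{ij}$ is the polynomial ring in $p_{ij}$, $1\le i<j\le n$; $I_{2,n}$ is the Plücker ideal, generated by $p_{ij}p_{kl}-p_{ik}p_{jl}+p_{il}p_{jk}$ for $i<j<k<l$; $A_{2,n}=\mathbb C[p_{ij}]_{ij}/I_{2,n}$ with $\deg\bar p_{ij}=1$. For $1\le i<k\le n$ write $(i,k)$ for the positive root $\epsilon_i-\epsilon_k$ of $\mathfrak{sl}_n$, of height $k-i$; $f_{(i,k)}$ is the elementary matrix with $f_{(i,k)}e_i=e_k$, $f_{(i,k)}e_l=0$ for $l\neq i$, and $U_{-(i,k)}=\{\exp(zf_{(i,k)})\mid z\in\mathbb C\}$. Put $d=2(n-2)$. A birational sequence for $\operatorname{Gr}(2,\mathbb C^n)$ is a sequence $S=(\beta_1,\dots,\beta_d)$ of positive roots such that $U_{-\beta_1}\times\dots\times U_{-\beta_d}\to\operatorname{Gr}(2,\mathbb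 C^n)$, $(u_1,\dots,u_d)\mapsto u_1\cdots u_d\cdot\langle e_1,e_2\rangle$, is birational. An iterated sequence is a (necessarily birational) sequence $S=((i_n,n),(j_n,n),\dots,(i_3,3),(j_3,3))$ with $i_k\ne j_k$ in $\{1,\dots,k-1\}$ for all $3\le k\le n$. Valuation. Let $P_{ij}\in\mathbb C[x_1,\dots,x_d]$ be the coefficient of $e_i\wedge e_j$ in $\exp(x_1f_{\beta_1})\cdots\exp(x_df_{\beta_d})(e_1\wedge e_2)$. Let $\Psi(m)=\sum m_i\operatorname{ht}(\beta_i)$; $m\prec_\Psi m'$ iff $\Psi(m)<\Psi(m')$, or $\Psi(m)=\Psi(m')$ and $m>_{lex}m'$. For $0\neq f\in(A_{2,n})_r$, $\mathfrak v_S(f)$ is the $\prec_\Psi$-minimal exponent occurring in the polynomial obtained from $f$ by $\bar p_{ij}\mapsto P_{ij}$. $\operatorname{gr}_S(A_{2,n})=\bigoplus_{r\ge0}\bigoplus_{a\in\mathbb Z^d}F^r_{\succeq a}/F^r_{\succ a}$ with $F^r_{\succeq a}=\{0\}\cup\{f\in(A_{2,n})_r\mid\mathfrak v_S(f)\succeq_\Psi a\}$. Tree $T_S$. Start with the tree with one internal vertex and three leaves labelled $1,2,3$. For $k=4,\dots,n$ replace the edge with leaf $i_k$ by three edges forming a cherry with leaves labelled $i_k$ and $k$ (i.e. subdivide the leaf edge at $i_k$ and attach there a new leaf $k$). The result is the labelled trivalent tree $T_S$ with $n$ leaves. Tropical Grassmannian. $\operatorname{in}_w$ denotes initial forms/ideals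 of minimal $w$-weight. $\operatorname{trop}(\operatorname{Gr}(2,\mathbb C^n))=\{w\in\mathbb R^{\binom n2}\mid\operatorname{in}_w(I_{2,n})\text{ contains no monomial}\}$ with fan structure as a subfan of the Gröbner fan; $\operatorname{in}_C(I_{2,n})=\operatorname{in}_w(I_{2,n})$ for $w$ in the relative interior of $C$; a maximal cone $C$ is prime if $\operatorname{in}_C(I_{2,n})$ is prime. A labelled trivalent tree $T$ corresponds to the maximal cone containing in its relative interior the vector $\mathbf w_T$ with $(\mathbf w_T)_{ij}=-\#\{$internal edges on the path from leaf $i$ to leaf $j$ in $T\}$ (internal edge: joining two non-leaf vertices). *)

theory Defs
  imports "HOL-Analysis.Analysis" "HOL-Algebra.QuotRing" "HOL-Library.Poly_Mapping"
    "HOL-Library.Product_Plus"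
begin

type_synonym 'v cpoly = "('v \<Rightarrow>\<^sub>0 nat) \<Rightarrow>\<^sub>0 complex"

definition cpoly_ring :: "'v set \<Rightarrow> 'v cpoly ring" where
  "cpoly_ring V =
     \<lparr>carrier = {f. \<forall>m\<in>Poly_Mapping.keys f. Poly_Mapping.keys m \<subseteq> V},
      mult = (*), one = 1, zero = 0, add = (+)\<rparr>"

definition Const :: "complex \<Rightarrow> 'v cpoly" where
  "Const c = Poly_Mapping.single 0 c"

definition Var :: "'v \<Rightarrow> 'v cpoly" where
  "Var v = Poly_Mapping.single (Poly_Mapping.single v 1) 1"

text \<open>Evaluation at \<^term>\<open>x\<close> in a commutative ring into which the coefficients are mapped by
  \<^term>\<open>c\<close>.\<close>

definition cpoly_eval :: "(complex \<Rightarrow> 'b::comm_ring_1) \<Rightarrow> ('v \<Rightarrow> 'b) \<Rightarrow> 'v cpoly \<Rightarrow> 'b" where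
  "cpoly_eval c x f =
     (\<Sum>m\<in>Poly_Mapping.keys f. c (Poly_Mapping.lookup f m) *
        (\<Prod>v\<in>Poly_Mapping.keys m. x v ^ Poly_Mapping.lookup m v))"

definition homogeneous :: "nat \<Rightarrow> 'v cpoly \<Rightarrow> bool" where
  "homogeneous r f \<longleftrightarrow>
     (\<forall>m\<in>Poly_Mapping.keys f. (\<Sum>v\<in>Poly_Mapping.keys m. Poly_Mapping.lookup m v) = r)"

definition plucker_index :: "nat \<Rightarrow> (nat \<times> nat) set" where
  "plucker_index n = {(i, j). 1 \<le> i \<and> i < j \<and> j \<le> n}"

abbreviation plucker_poly_ring :: "nat \<Rightarrow> (nat \<times> nat) cpoly ring" where
  "plucker_poly_ring n \<equiv> cpoly_ring (plucker_index n)"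

definition plucker_ideal :: "nat \<Rightarrow> (nat \<times> nat) cpoly set" where
  "plucker_ideal n = genideal (plucker_poly_ring n)
     {Var (i, j) * Var (k, l) - Var (i, k) * Var (j, l) + Var (i, l) * Var (j, k) | i j k l.
        1 \<le> i \<and> i < j \<and> j < k \<and> k < l \<and> l \<le> n}"

definition plucker_algebra :: "nat \<Rightarrow> (nat \<times> nat) cpoly set ring" where
  "plucker_algebra n = plucker_poly_ring n Quot plucker_ideal n"

definition plucker_algebra_deg :: "nat \<Rightarrow> nat \<Rightarrow> (nat \<times> nat) cpoly set set" where
  "plucker_algebra_deg n r =
     {plucker_ideal n +>\<^bsub>plucker_poly_ring n\<^esub> f | f.
        f \<in> carrier (plucker_poly_ring n) \<and> homogeneous r f}"

text \<open>The positive root \<open>\<epsilon>\<^sub>i - \<epsilon>\<^sub>k\<close> is the pair \<open>(i, k)\<close>. Vectors are functions on the index set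
  \<open>{1..n}\<close>, extended by zero. Sequences are lists, so the coordinate called \<open>x\<^sub>k\<close> on paper has
  index \<open>k - 1\<close> here.\<close>

definition positive_roots :: "nat \<Rightarrow> (nat \<times> nat) set" where
  "positive_roots n = {(i, k). 1 \<le> i \<and> i < k \<and> k \<le> n}"

definition root_height :: "nat \<times> nat \<Rightarrow> int" where
  "root_height \<beta> = int (snd \<beta>) - int (fst \<beta>)"

definition unit_vec :: "nat \<Rightarrow> nat \<Rightarrow> 'a::comm_ring_1" where
  "unit_vec i = (\<lambda>l. if l = i then 1 else 0)"

definition root_op :: "nat \<times> nat \<Rightarrow> (nat \<Rightarrow> 'a::comm_ring_1) \<Rightarrow> nat \<Rightarrow> 'a" where
  "root_op \<beta> v = (\<lambda>l. if l = snd \<beta> then v (fst \<beta>) else 0)"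

text \<open>The operator \<open>exp (z f\<^sub>\<beta>)\<close>; the exponential series stops after the linear term because
  \<open>f\<^sub>\<beta> \<circ> f\<^sub>\<beta> = 0\<close>. This form makes sense over any commutative ring.\<close>

definition root_exp :: "'a::comm_ring_1 \<Rightarrow> nat \<times> nat \<Rightarrow> (nat \<Rightarrow> 'a) \<Rightarrow> nat \<Rightarrow> 'a" where
  "root_exp z \<beta> v = (\<lambda>l. v l + z * root_op \<beta> v l)"

lemma root_exp_is_exponential:
  fixes z :: complex
  assumes "\<beta> \<in> positive_roots n"
  shows "(\<lambda>m. z ^ m / fact m * (root_op \<beta> ^^ m) v l) sums root_exp z \<beta> v l"
proof -
  have two: "root_op \<beta> (root_op \<beta> u) = (\<lambda>l. 0)" for u :: "nat \<Rightarrow> complex"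
    using assms by (auto simp: root_op_def positive_roots_def fun_eq_iff)
  have zero: "root_op \<beta> (\<lambda>l. 0) = (\<lambda>l. 0 :: complex)"
    by (simp add: root_op_def fun_eq_iff)
  have high: "(root_op \<beta> ^^ Suc (Suc k)) v = (\<lambda>l. 0)" for k
    by (induction k) (simp_all add: two zero)
  have "z ^ m / fact m * (root_op \<beta> ^^ m) v l = 0" if "m \<notin> {0, 1}" for m
  proof -
    have "m = Suc (Suc (m - 2))"
      using that by (cases m; cases "m - 1") auto
    then obtain k where "m = Suc (Suc k)" ..
    then show ?thesis by (simp only: high mult_zero_right)
  qed
  then have "(\<lambda>m. z ^ m / fact m * (root_op \<beta> ^^ m) v l) sums
      (\<Sum>m\<in>{0, 1}. z ^ m / fact m * (root_op \<beta> ^^ m) v l)"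
    by (intro sums_finite) auto
  then show ?thesis by (simp add: root_exp_def)
qed

definition seq_act :: "(nat \<times> nat) list \<Rightarrow> (nat \<Rightarrow> 'a::comm_ring_1) \<Rightarrow> (nat \<Rightarrow> 'a) \<Rightarrow> nat \<Rightarrow> 'a" where
  "seq_act S z v = foldr (\<lambda>k. root_exp (z k) (S ! k)) [0..<length S] v"

text \<open>Coordinates of \<open>v \<and> w\<close> with respect to the basis \<open>e\<^sub>i \<and> e\<^sub>j\<close>, \<open>i < j\<close>.\<close>

definition wedge :: "(nat \<Rightarrow> 'a::comm_ring_1) \<Rightarrow> (nat \<Rightarrow> 'a) \<Rightarrow> nat \<times> nat \<Rightarrow> 'a" where
  "wedge v w = (\<lambda>(i, j). v i * w j - v j * w i)"

definition complex_space :: "nat \<Rightarrow> (nat \<Rightarrow> complex) set" where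
  "complex_space n = {v. \<forall>l. l \<notin> {1..n} \<longrightarrow> v l = 0}"

definition span2 :: "(nat \<Rightarrow> complex) \<Rightarrow> (nat \<Rightarrow> complex) \<Rightarrow> (nat \<Rightarrow> complex) set" where
  "span2 v w = {(\<lambda>l. a * v l + b * w l) | a b. True}"

definition indep2 :: "(nat \<Rightarrow> complex) \<Rightarrow> (nat \<Rightarrow> complex) \<Rightarrow> bool" where
  "indep2 v w \<longleftrightarrow> (\<forall>a b. (\<forall>l. a * v l + b * w l = 0) \<longrightarrow> a = 0 \<and> b = 0)"

definition Gr2 :: "nat \<Rightarrow> (nat \<Rightarrow> complex) set set" where
  "Gr2 n = {span2 v w | v w. v \<in> complex_space n \<and> w \<in> complex_space n \<and> indep2 v w}"

text \<open>All homogeneous coordinate vectors of a plane under the \<open>e\<^sub>i \<and> e\<^sub>j\<close> embedding; any two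
  differ by a nonzero scalar.\<close>

definition plucker_coords :: "(nat \<Rightarrow> complex) set \<Rightarrow> (nat \<times> nat \<Rightarrow> complex) set" where
  "plucker_coords W = {wedge v w | v w. indep2 v w \<and> W = span2 v w}"

definition Gr2_open :: "nat \<Rightarrow> (nat \<Rightarrow> complex) set set \<Rightarrow> bool" where
  "Gr2_open n V \<longleftrightarrow> (\<exists>E. E \<subseteq> {f \<in> carrier (plucker_poly_ring n). \<exists>r. homogeneous r f} \<and>
     V = {W \<in> Gr2 n. \<exists>f\<in>E. \<exists>p\<in>plucker_coords W. cpoly_eval id p f \<noteq> 0})"

definition Gr2_regular ::
  "nat \<Rightarrow> (nat \<Rightarrow> complex) set set \<Rightarrow> ((nat \<Rightarrow> complex) set \<Rightarrow> complex) \<Rightarrow> bool" where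
  "Gr2_regular n V g \<longleftrightarrow> (\<forall>W\<in>V. \<exists>V' r a b. Gr2_open n V' \<and> W \<in> V' \<and> V' \<subseteq> V \<and>
     a \<in> carrier (plucker_poly_ring n) \<and> b \<in> carrier (plucker_poly_ring n) \<and>
     homogeneous r a \<and> homogeneous r b \<and>
     (\<forall>W'\<in>V'. \<forall>p\<in>plucker_coords W'.
        cpoly_eval id p b \<noteq> 0 \<and> g W' = cpoly_eval id p a / cpoly_eval id p b))"

text \<open>The product \<open>U\<^sub>-\<^sub>\<beta>\<^sub>1 \<times> \<dots> \<times> U\<^sub>-\<^sub>\<beta>\<^sub>d\<close> is identified with affine \<open>d\<close>-space through
  \<open>z \<mapsto> (exp (z\<^sub>k f\<^sub>\<beta>\<^sub>k))\<^sub>k\<close>.\<close>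

definition affine_space :: "nat \<Rightarrow> (nat \<Rightarrow> complex) set" where
  "affine_space d = {z. \<forall>k. k \<ge> d \<longrightarrow> z k = 0}"

definition affine_open :: "nat \<Rightarrow> (nat \<Rightarrow> complex) set \<Rightarrow> bool" where
  "affine_open d U \<longleftrightarrow> (\<exists>E. E \<subseteq> carrier (cpoly_ring {..<d}) \<and>
     U = {z \<in> affine_space d. \<exists>f\<in>E. cpoly_eval id z f \<noteq> 0})"

definition seq_map :: "(nat \<times> nat) list \<Rightarrow> (nat \<Rightarrow> complex) \<Rightarrow> (nat \<Rightarrow> complex) set" where
  "seq_map S z = span2 (seq_act S z (unit_vec 1)) (seq_act S z (unit_vec 2))"

text \<open>Birational: an isomorphism between nonempty Zariski open subsets. The map itself is given by
  polynomials, so only regularity of the inverse has to be required.\<close>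

definition birational_sequence :: "nat \<Rightarrow> (nat \<times> nat) list \<Rightarrow> bool" where
  "birational_sequence n S \<longleftrightarrow>
     length S = 2 * (n - 2) \<and> set S \<subseteq> positive_roots n \<and>
     (\<exists>U V. affine_open (length S) U \<and> U \<noteq> {} \<and> Gr2_open n V \<and> V \<noteq> {} \<and>
        bij_betw (seq_map S) U V \<and>
        (\<forall>k<length S. Gr2_regular n V (\<lambda>W. inv_into U (seq_map S) W k)))"

definition iterated_choice :: "nat \<Rightarrow> (nat \<Rightarrow> nat) \<Rightarrow> (nat \<Rightarrow> nat) \<Rightarrow> bool" where
  "iterated_choice n i j \<longleftrightarrow>
     (\<forall>k\<in>{3..n}. i k \<in> {1..k - 1} \<and> j k \<in> {1..k - 1} \<and> i k \<noteq> j k)"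

definition iterated_sequence ::
  "nat \<Rightarrow> (nat \<Rightarrow> nat) \<Rightarrow> (nat \<Rightarrow> nat) \<Rightarrow> (nat \<times> nat) list" where
  "iterated_sequence n i j = concat (map (\<lambda>k. [(i k, k), (j k, k)]) (rev [3..<Suc n]))"

definition seq_poly :: "(nat \<times> nat) list \<Rightarrow> nat \<times> nat \<Rightarrow> nat cpoly" where
  "seq_poly S = wedge (seq_act S Var (unit_vec 1)) (seq_act S Var (unit_vec 2))"

definition seq_weight :: "(nat \<times> nat) list \<Rightarrow> (nat \<Rightarrow>\<^sub>0 int) \<Rightarrow> int" where
  "seq_weight S a = (\<Sum>k<length S. Poly_Mapping.lookup a k * root_height (S ! k))"

text \<open>The order of \<open>nat \<Rightarrow>\<^sub>0 int\<close> is the lexicographic order with respect to the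
  smallest index at which the arguments differ.\<close>

definition seq_less :: "(nat \<times> nat) list \<Rightarrow> (nat \<Rightarrow>\<^sub>0 int) \<Rightarrow> (nat \<Rightarrow>\<^sub>0 int) \<Rightarrow> bool" where
  "seq_less S a b \<longleftrightarrow> seq_weight S a < seq_weight S b \<or>
     (seq_weight S a = seq_weight S b \<and> a > b)"

definition exponent :: "(nat \<Rightarrow>\<^sub>0 nat) \<Rightarrow> (nat \<Rightarrow>\<^sub>0 int)" where
  "exponent m = Poly_Mapping.map int m"

text \<open>The image of a residue class, computed on an arbitrary representative: the polynomials
  \<^term>\<open>seq_poly S\<close> satisfy the relations of \<^term>\<open>plucker_ideal n\<close>.\<close>

definition seq_subst :: "(nat \<times> nat) list \<Rightarrow> (nat \<times> nat) cpoly set \<Rightarrow> nat cpoly" where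
  "seq_subst S X = cpoly_eval Const (seq_poly S) (SOME f. f \<in> X)"

definition seq_valuation :: "(nat \<times> nat) list \<Rightarrow> (nat \<times> nat) cpoly set \<Rightarrow> (nat \<Rightarrow>\<^sub>0 int)" where
  "seq_valuation S X = (THE a. a \<in> exponent ` Poly_Mapping.keys (seq_subst S X) \<and>
     (\<forall>b\<in>exponent ` Poly_Mapping.keys (seq_subst S X). b \<noteq> a \<longrightarrow> seq_less S a b))"

text \<open>The direct sum of the quotients \<open>F g / F' g\<close> over \<open>g \<in> G\<close>. Its elements are finitely
  supported families of cosets; products of cosets are formed on representatives.\<close>

definition coset_rep :: "'a set \<Rightarrow> 'a" where
  "coset_rep X = (SOME x. x \<in> X)"

definition assoc_graded_ring ::
  "('a, 'm) ring_scheme \<Rightarrow> 'g::comm_monoid_add set \<Rightarrow> ('g \<Rightarrow> 'a set) \<Rightarrow> ('g \<Rightarrow> 'a set)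
     \<Rightarrow> ('g \<Rightarrow> 'a set) ring" where
  "assoc_graded_ring R G F F' =
     \<lparr>carrier = {x \<in> (\<Pi>\<^sub>E g\<in>G. {F' g +>\<^bsub>R\<^esub> f | f. f \<in> F g}). finite {g \<in> G. x g \<noteq> F' g}},
      mult = (\<lambda>x y. \<lambda>k\<in>G. F' k +>\<^bsub>R\<^esub>
         finsum R (\<lambda>(g, h). coset_rep (x g) \<otimes>\<^bsub>R\<^esub> coset_rep (y h))
           {(g, h) \<in> G \<times> G. g + h = k \<and> x g \<noteq> F' g \<and> y h \<noteq> F' h}),
      one = (\<lambda>g\<in>G. F' g +>\<^bsub>R\<^esub> (if g = 0 then \<one>\<^bsub>R\<^esub> else \<zero>\<^bsub>R\<^esub>)),
      zero = (\<lambda>g\<in>G. F' g),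
      add = (\<lambda>x y. \<lambda>g\<in>G. x g <+>\<^bsub>R\<^esub> y g)\<rparr>"

definition filt_ge ::
  "nat \<Rightarrow> (nat \<times> nat) list \<Rightarrow> nat \<times> (nat \<Rightarrow>\<^sub>0 int) \<Rightarrow> (nat \<times> nat) cpoly set set" where
  "filt_ge n S = (\<lambda>(r, a). {\<zero>\<^bsub>plucker_algebra n\<^esub>} \<union>
     {f \<in> plucker_algebra_deg n r. f \<noteq> \<zero>\<^bsub>plucker_algebra n\<^esub> \<and>
        (seq_valuation S f = a \<or> seq_less S a (seq_valuation S f))})"

definition filt_gt ::
  "nat \<Rightarrow> (nat \<times> nat) list \<Rightarrow> nat \<times> (nat \<Rightarrow>\<^sub>0 int) \<Rightarrow> (nat \<times> nat) cpoly set set" where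
  "filt_gt n S = (\<lambda>(r, a). {\<zero>\<^bsub>plucker_algebra n\<^esub>} \<union>
     {f \<in> plucker_algebra_deg n r. f \<noteq> \<zero>\<^bsub>plucker_algebra n\<^esub> \<and> seq_less S a (seq_valuation S f)})"

definition seq_grades :: "(nat \<times> nat) list \<Rightarrow> (nat \<times> (nat \<Rightarrow>\<^sub>0 int)) set" where
  "seq_grades S = UNIV \<times> {a. Poly_Mapping.keys a \<subseteq> {..<length S}}"

definition seq_graded_algebra ::
  "nat \<Rightarrow> (nat \<times> nat) list \<Rightarrow> (nat \<times> (nat \<Rightarrow>\<^sub>0 int) \<Rightarrow> (nat \<times> nat) cpoly set set) ring" where
  "seq_graded_algebra n S =
     assoc_graded_ring (plucker_algebra n) (seq_grades S) (filt_ge n S) (filt_gt n S)"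

text \<open>The complex scalars, as elements of degree zero.\<close>

definition seq_graded_scalar ::
  "nat \<Rightarrow> (nat \<times> nat) list \<Rightarrow> complex \<Rightarrow> nat \<times> (nat \<Rightarrow>\<^sub>0 int) \<Rightarrow> (nat \<times> nat) cpoly set set" where
  "seq_graded_scalar n S c = (\<lambda>g\<in>seq_grades S. filt_gt n S g +>\<^bsub>plucker_algebra n\<^esub>
     (if g = 0 then plucker_ideal n +>\<^bsub>plucker_poly_ring n\<^esub> Const c
      else \<zero>\<^bsub>plucker_algebra n\<^esub>))"

text \<open>Isomorphism of algebras over the complex numbers, the algebra structures being given by the
  maps \<^term>\<open>\<iota>\<close> and \<^term>\<open>\<iota>'\<close> from the complex numbers.\<close>

definition algebra_isomorphic ::
  "('a, 'm) ring_scheme \<Rightarrow> (complex \<Rightarrow> 'a) \<Rightarrow> ('b, 'k) ring_scheme \<Rightarrow> (complex \<Rightarrow> 'b) \<Rightarrow> bool" where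
  "algebra_isomorphic R \<iota> R' \<iota>' \<longleftrightarrow> (\<exists>h\<in>ring_iso R R'. \<forall>c. h (\<iota> c) = \<iota>' c)"

definition graded_algebra_iso_quotient ::
  "nat \<Rightarrow> (nat \<times> nat) list \<Rightarrow> (nat \<times> nat) cpoly set \<Rightarrow> bool" where
  "graded_algebra_iso_quotient n S J \<longleftrightarrow>
     algebra_isomorphic (seq_graded_algebra n S) (seq_graded_scalar n S)
       (plucker_poly_ring n Quot J) (\<lambda>c. J +>\<^bsub>plucker_poly_ring n\<^esub> Const c)"

definition weight_space :: "nat \<Rightarrow> (nat \<times> nat \<Rightarrow> real) set" where
  "weight_space n = {w. \<forall>e. e \<notin> plucker_index n \<longrightarrow> w e = 0}"

definition monomial_weight :: "('v \<Rightarrow> real) \<Rightarrow> ('v \<Rightarrow>\<^sub>0 nat) \<Rightarrow> real" where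
  "monomial_weight w m = (\<Sum>v\<in>Poly_Mapping.keys m. w v * real (Poly_Mapping.lookup m v))"

definition initial_form :: "('v \<Rightarrow> real) \<Rightarrow> 'v cpoly \<Rightarrow> 'v cpoly" where
  "initial_form w f =
     (\<Sum>m\<in>{m \<in> Poly_Mapping.keys f.
              \<forall>m'\<in>Poly_Mapping.keys f. monomial_weight w m \<le> monomial_weight w m'}.
        Poly_Mapping.single m (Poly_Mapping.lookup f m))"

definition initial_ideal :: "nat \<Rightarrow> (nat \<times> nat \<Rightarrow> real) \<Rightarrow> (nat \<times> nat) cpoly set" where
  "initial_ideal n w = genideal (plucker_poly_ring n) (initial_form w ` plucker_ideal n)"

definition trop_Gr2 :: "nat \<Rightarrow> (nat \<times> nat \<Rightarrow> real) set" where
  "trop_Gr2 n = {w \<in> weight_space n. \<forall>m. Poly_Mapping.single m 1 \<notin> initial_ideal n w}"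

text \<open>The cones of the fan are the closures, in the product topology, of the sets of weights with
  a common initial ideal.\<close>

definition groebner_fan :: "nat \<Rightarrow> (nat \<times> nat \<Rightarrow> real) set set" where
  "groebner_fan n =
     {closure {w' \<in> weight_space n. initial_ideal n w' = initial_ideal n w} | w.
        w \<in> weight_space n}"

definition trop_fan :: "nat \<Rightarrow> (nat \<times> nat \<Rightarrow> real) set set" where
  "trop_fan n = {C \<in> groebner_fan n. C \<subseteq> trop_Gr2 n}"

definition trop_maximal_cones :: "nat \<Rightarrow> (nat \<times> nat \<Rightarrow> real) set set" where
  "trop_maximal_cones n = {C \<in> trop_fan n. \<forall>D\<in>trop_fan n. C \<subseteq> D \<longrightarrow> D = C}"

text \<open>Affine hull and relative interior for sets of real functions; the library versions are
  restricted to types in the class of real vector spaces resp. Euclidean spaces.\<close>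

definition fun_affine_hull :: "('e \<Rightarrow> real) set \<Rightarrow> ('e \<Rightarrow> real) set" where
  "fun_affine_hull C =
     {(\<lambda>e. \<Sum>w\<in>A. u w * w e) | A u. finite A \<and> A \<subseteq> C \<and> sum u A = 1}"

definition fun_rel_interior :: "('e \<Rightarrow> real) set \<Rightarrow> ('e \<Rightarrow> real) set" where
  "fun_rel_interior C = (top_of_set (fun_affine_hull C)) interior_of C"

text \<open>The initial ideal is the same for all weights in the relative interior of a cone.\<close>

definition cone_initial_ideal ::
  "nat \<Rightarrow> (nat \<times> nat \<Rightarrow> real) set \<Rightarrow> (nat \<times> nat) cpoly set" where
  "cone_initial_ideal n C = initial_ideal n (SOME w. w \<in> fun_rel_interior C)"

definition prime_cone :: "nat \<Rightarrow> (nat \<times> nat \<Rightarrow> real) set \<Rightarrow> bool" where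
  "prime_cone n C \<longleftrightarrow> primeideal (cone_initial_ideal n C) (plucker_poly_ring n)"

text \<open>A tree is given by its set of edges.\<close>

datatype tree_vertex = Leaf nat | Inner nat

definition tripod :: "tree_vertex set set" where
  "tripod = {{Inner 3, Leaf 1}, {Inner 3, Leaf 2}, {Inner 3, Leaf 3}}"

text \<open>Subdivide the edge at leaf \<^term>\<open>i\<close> by a new vertex and attach leaf \<^term>\<open>k\<close> to it.\<close>

definition attach_leaf ::
  "nat \<Rightarrow> nat \<Rightarrow> tree_vertex set set \<Rightarrow> tree_vertex set set" where
  "attach_leaf i k E =
     (\<lambda>e. if Leaf i \<in> e then insert (Inner k) (e - {Leaf i}) else e) ` E \<union>
     {{Inner k, Leaf i}, {Inner k, Leaf k}}"

definition iterated_tree :: "nat \<Rightarrow> (nat \<Rightarrow> nat) \<Rightarrow> tree_vertex set set" where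
  "iterated_tree n i = fold (\<lambda>k. attach_leaf (i k) k) [4..<Suc n] tripod"

definition path_edges :: "'v list \<Rightarrow> 'v set set" where
  "path_edges p = {{p ! l, p ! Suc l} | l. Suc l < length p}"

definition tree_path :: "'v set set \<Rightarrow> 'v \<Rightarrow> 'v \<Rightarrow> 'v list" where
  "tree_path E x y =
     (THE p. p \<noteq> [] \<and> hd p = x \<and> last p = y \<and> distinct p \<and> path_edges p \<subseteq> E)"

definition tree_weight :: "nat \<Rightarrow> tree_vertex set set \<Rightarrow> nat \<times> nat \<Rightarrow> real" where
  "tree_weight n E = (\<lambda>(i, j). if (i, j) \<in> plucker_index n
     then - real (card {e \<in> path_edges (tree_path E (Leaf i) (Leaf j)). e \<subseteq> range Inner})
     else 0)"

definition tree_cone :: "nat \<Rightarrow> tree_vertex set set \<Rightarrow> (nat \<times> nat \<Rightarrow> real) set" where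
  "tree_cone n E =
     (THE C. C \<in> trop_maximal_cones n \<and> tree_weight n E \<in> fun_rel_interior C)"

end

theory Submission
  imports Defs
begin

text \<open>With respect to the order defined by an iterated sequence every polynomial \<open>P\<^sub>a\<^sub>b\<close> has a leading
  monomial with coefficient \<open>1\<close> or \<open>-1\<close>. Products of Pluecker coordinates with the same leading monomial
  are connected by exchanges along quadruples of indices, each of which is the initial part of a
  Pluecker relation. Subduction then identifies the associated graded algebra with the monomial
  algebra generated by the leading monomials, and its presenting ideal, the kernel of a monomial
  map, with \<open>in\<^sub>w(I\<^sub>2\<^sub>,\<^sub>n)\<close> for every \<open>w\<close> satisfying the strict four-point conditions which say that,
  for each \<open>k\<close>, the leaves \<open>i\<^sub>k\<close> and \<open>k\<close> form a cherry among the leaves \<open>1, \<dots>, k\<close>. The path lengths of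
  \<open>T\<^sub>S\<close> are such a \<open>w\<close>.

  Conversely, the three-term relations force every point of the tropical Grassmannian to satisfy
  the four-point condition. Splitting off cherries one at a time puts it, after a permutation of
  the leaves, into the cone of an iterated tree. A maximal cone is therefore determined by the
  strict four-point conditions of a generic weight, and since a permutation of the variables up to
  sign preserves the Pluecker ideal, its initial ideal is again such a kernel.\<close>

section \<open>Polynomials and weights\<close>

text \<open>The valuation order and the real weights of a tropical cone are both additive maps from
  exponents to an ordered abelian group, so one argument serves for both if it uses nothing but
  strict inequalities between weights of leading monomials. The decisive inequality says which
  summand dominates when a minor is expanded along row \<open>k\<close> in terms of rows
  \<open>i k\<close> and \<open>j k\<close>. For the valuation order the candidates tie under
  \<Psi>, because heights telescope, and the lexicographic rule decides. A real weight does not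
  separate monomials, so equality of weights must never be taken for equality of monomials; the
  latter is recovered from the Pluecker relations, whose lowest parts the monomial map has to kill.
  Since \<open>P\<close> is constant for the pair \<open>1, 2\<close>, exponents also forget the
  degree. An additional variable with index \<open>dm\<close> restores it and spreads the graded
  pieces over disjoint sets of monomials of one polynomial ring. The cherry conditions mention only
  quadruples that contain \<open>i k\<close> and \<open>k\<close>; that they already fix the type of
  every quadruple is what identifies the cones.\<close>

abbreviation lookup where "lookup \<equiv> Poly_Mapping.lookup"
abbreviation keys where "keys \<equiv> Poly_Mapping.keys"
abbreviation single where "single \<equiv> Poly_Mapping.single"

section \<open>Polynomial rings, their ideals and cosets\<close>

lemma cpoly_ring_simps [simp]:
  "mult (cpoly_ring V) = (*)" "one (cpoly_ring V) = 1" "zero (cpoly_ring V) = 0" "add (cpoly_ring V) = (+)"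
  by (simp_all add: cpoly_ring_def)

lemma in_cpoly_carrier: "f \<in> carrier (cpoly_ring V) \<longleftrightarrow> (\<forall>m\<in>keys f. keys m \<subseteq> V)"
  by (simp add: cpoly_ring_def)

lemma cpoly_carrier_zero [simp]: "0 \<in> carrier (cpoly_ring V)"
  and cpoly_carrier_one [simp]: "1 \<in> carrier (cpoly_ring V)"
  by (auto simp: in_cpoly_carrier)

lemma cpoly_carrier_add [intro]:
  "f \<in> carrier (cpoly_ring V) \<Longrightarrow> g \<in> carrier (cpoly_ring V) \<Longrightarrow> f + g \<in> carrier (cpoly_ring V)"
  using Poly_Mapping.keys_add[of f g] by (auto simp: in_cpoly_carrier)

lemma cpoly_carrier_uminus [intro]:
  "f \<in> carrier (cpoly_ring V) \<Longrightarrow> - f \<in> carrier (cpoly_ring V)"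
  by (auto simp: in_cpoly_carrier in_keys_iff)

lemma cpoly_carrier_diff [intro]:
  "f \<in> carrier (cpoly_ring V) \<Longrightarrow> g \<in> carrier (cpoly_ring V) \<Longrightarrow> f - g \<in> carrier (cpoly_ring V)"
  using cpoly_carrier_add[of f V "- g"] by auto

lemma cpoly_carrier_mult [intro]:
  assumes "f \<in> carrier (cpoly_ring V)" "g \<in> carrier (cpoly_ring V)"
  shows "f * g \<in> carrier (cpoly_ring V)"
  unfolding in_cpoly_carrier
proof
  fix m assume "m \<in> keys (f * g)"
  then obtain a b where "m = a + b" "a \<in> keys f" "b \<in> keys g"
    using keys_mult[of f g] by blast
  then show "keys m \<subseteq> V"
    using assms Poly_Mapping.keys_add[of a b] unfolding in_cpoly_carrier by blast
qed

lemma cpoly_carrier_sum [intro]: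
  "(\<And>x. x \<in> A \<Longrightarrow> f x \<in> carrier (cpoly_ring V)) \<Longrightarrow> sum f A \<in> carrier (cpoly_ring V)"
  by (induction A rule: infinite_finite_induct) auto

lemma cpoly_carrier_power [intro]:
  "f \<in> carrier (cpoly_ring V) \<Longrightarrow> f ^ r \<in> carrier (cpoly_ring V)"
  by (induction r) auto

lemma cpoly_carrier_prod [intro]:
  "(\<And>x. x \<in> A \<Longrightarrow> f x \<in> carrier (cpoly_ring V)) \<Longrightarrow> prod f A \<in> carrier (cpoly_ring V)"
  by (induction A rule: infinite_finite_induct) auto

lemma cpoly_carrier_single [intro]: "keys m \<subseteq> V \<Longrightarrow> single m c \<in> carrier (cpoly_ring V)"
  by (auto simp: in_cpoly_carrier)

lemma Const_carrier [simp]: "Const c \<in> carrier (cpoly_ring V)"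
  by (auto simp: Const_def)

lemma Var_carrier [simp]: "v \<in> V \<Longrightarrow> Var v \<in> carrier (cpoly_ring V)"
  by (auto simp: Var_def)

lemma cring_cpoly: "cring (cpoly_ring V)"
proof (rule cringI)
  show "abelian_group (cpoly_ring V)"
  proof (rule abelian_groupI)
    fix x assume "x \<in> carrier (cpoly_ring V)"
    then show "\<exists>y\<in>carrier (cpoly_ring V). y \<oplus>\<^bsub>cpoly_ring V\<^esub> x = \<zero>\<^bsub>cpoly_ring V\<^esub>"
      by (intro bexI[of _ "- x"]) auto
  qed (auto simp: algebra_simps)
  show "comm_monoid (cpoly_ring V)"
    by (rule comm_monoidI) (auto simp: algebra_simps)
qed (auto simp: algebra_simps)

lemma ring_cpoly: "ring (cpoly_ring V)"
  using cring_cpoly cring.axioms(1) by blast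

text \<open>Negation is multiplication by \<open>- 1\<close>, so an ideal can be verified without
  ever computing inverses in the additive group.\<close>

lemma ideal_cpolyI:
  assumes "J \<subseteq> carrier (cpoly_ring V)" "0 \<in> J" "\<And>f g. f \<in> J \<Longrightarrow> g \<in> J \<Longrightarrow> f + g \<in> J"
    "\<And>f g. f \<in> J \<Longrightarrow> g \<in> carrier (cpoly_ring V) \<Longrightarrow> g * f \<in> J"
  shows "ideal J (cpoly_ring V)"
proof (rule idealI)
  interpret R: cring "cpoly_ring V" by (rule cring_cpoly)
  have inv: "inv\<^bsub>add_monoid (cpoly_ring V)\<^esub> f = - f" if "f \<in> J" for f
    using R.minus_equality[of "- f" f] that assms(1) unfolding a_inv_def by auto
  show "subgroup J (add_monoid (cpoly_ring V))"
  proof (unfold_locales)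
    fix x assume "x \<in> J"
    moreover have "(- 1) * x \<in> J" using \<open>x \<in> J\<close> by (intro assms(4)) auto
    ultimately show "inv\<^bsub>add_monoid (cpoly_ring V)\<^esub> x \<in> J" using inv by simp
  qed (use assms in auto)
  show "ring (cpoly_ring V)" by (rule ring_cpoly)
qed (use assms in \<open>auto simp: mult.commute\<close>)

lemma ideal_cpolyD:
  assumes "ideal J (cpoly_ring V)"
  shows "J \<subseteq> carrier (cpoly_ring V)" "0 \<in> J" "f \<in> J \<Longrightarrow> g \<in> J \<Longrightarrow> f + g \<in> J"
    "f \<in> J \<Longrightarrow> g \<in> carrier (cpoly_ring V) \<Longrightarrow> g * f \<in> J"
    "f \<in> J \<Longrightarrow> - f \<in> J" "f \<in> J \<Longrightarrow> g \<in> J \<Longrightarrow> f - g \<in> J"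
proof -
  interpret ideal J "cpoly_ring V" by fact
  show "J \<subseteq> carrier (cpoly_ring V)" using a_subset by simp
  show "0 \<in> J" using additive_subgroup.zero_closed[OF additive_subgroup_axioms] by simp
  show add: "f \<in> J \<Longrightarrow> g \<in> J \<Longrightarrow> f + g \<in> J" for f g
    using additive_subgroup.a_closed[OF additive_subgroup_axioms] by simp
  show mult: "f \<in> J \<Longrightarrow> g \<in> carrier (cpoly_ring V) \<Longrightarrow> g * f \<in> J" for f g
    using I_l_closed by simp
  show neg: "f \<in> J \<Longrightarrow> - f \<in> J" for f
    using mult[of f "- 1"] cpoly_carrier_uminus[of 1 V] by auto
  show "f \<in> J \<Longrightarrow> g \<in> J \<Longrightarrow> f - g \<in> J" using add[of f "- g"] neg[of g] by simp
qed

lemma ideal_cpoly_sum: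
  assumes "ideal J (cpoly_ring V)" "\<And>x. x \<in> A \<Longrightarrow> f x \<in> J"
  shows "sum f A \<in> J"
  using assms(2) by (induction A rule: infinite_finite_induct) (auto intro: ideal_cpolyD[OF assms(1)])

lemma coset_cpoly: "J +>\<^bsub>cpoly_ring V\<^esub> f = {h + f | h. h \<in> J}"
  by (auto simp: a_r_coset_def r_coset_def)

lemma coset_cpoly_eq_iff:
  assumes "ideal J (cpoly_ring V)" 
  shows "J +>\<^bsub>cpoly_ring V\<^esub> f = J +>\<^bsub>cpoly_ring V\<^esub> g \<longleftrightarrow> f - g \<in> J"
proof
  assume eq: "J +>\<^bsub>cpoly_ring V\<^esub> f = J +>\<^bsub>cpoly_ring V\<^esub> g"
  have "f \<in> J +>\<^bsub>cpoly_ring V\<^esub> f"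
    unfolding coset_cpoly using ideal_cpolyD(2)[OF assms] by force
  then show "f - g \<in> J" unfolding eq unfolding coset_cpoly by auto
next
  assume d: "f - g \<in> J"
  have "h + f \<in> {h + g | h. h \<in> J}" if "h \<in> J" for h
  proof -
    have "h + (f - g) \<in> J" using that d ideal_cpolyD(3)[OF assms] by auto
    moreover have "h + f = (h + (f - g)) + g" by simp
    ultimately show ?thesis by blast
  qed
  moreover have "h + g \<in> {h + f | h. h \<in> J}" if "h \<in> J" for h
  proof -
    have "h - (f - g) \<in> J" using that d ideal_cpolyD(6)[OF assms] by auto
    moreover have "h + g = (h - (f - g)) + f" by simp
    ultimately show ?thesis by blast
  qed
  ultimately show "J +>\<^bsub>cpoly_ring V\<^esub> f = J +>\<^bsub>cpoly_ring V\<^esub> g" unfolding coset_cpoly by auto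
qed

lemma poly_mapping_expand: "f = (\<Sum>m\<in>keys f. single m (lookup f m))"
  by (rule poly_mapping_eqI) (simp add: lookup_sum lookup_single when_def sum.delta' in_keys_iff)

text \<open>Serves on two levels: for polynomials, where it reduces an additive statement to single
  terms, and for exponents, which are themselves finitely supported maps, where it reduces a
  statement about monomials to powers of one variable. The set \<open>A\<close> carries a
  restriction on the support through the induction, because all summands are cut out of
  \<open>f\<close>.\<close>

lemma poly_mapping_linear_induct [consumes 1, case_names zero single add]:
  assumes "keys f \<subseteq> A" "P 0" "\<And>m c. m \<in> A \<Longrightarrow> P (single m c)"
    "\<And>g h. keys g \<subseteq> A \<Longrightarrow> keys h \<subseteq> A \<Longrightarrow> P g \<Longrightarrow> P h \<Longrightarrow> P (g + h)"
  shows "P (f :: 'a \<Rightarrow>\<^sub>0 'b::comm_monoid_add)"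
proof -
  have "P (\<Sum>m\<in>B. single m (lookup f m)) \<and> keys (\<Sum>m\<in>B. single m (lookup f m)) \<subseteq> A"
    if "finite B" "B \<subseteq> A" for B
    using that
  proof (induction B rule: finite_induct)
    case (insert x B)
    let ?r = "\<Sum>m\<in>B. single m (lookup f m)"
    have 1: "keys (single x (lookup f x)) \<subseteq> A" "keys ?r \<subseteq> A" "P ?r" "P (single x (lookup f x))"
      using insert assms(3)[of x] by auto
    have "keys (single x (lookup f x) + ?r) \<subseteq> A"
      using Poly_Mapping.keys_add[of "single x (lookup f x)" ?r] 1 by blast
    then show ?case
      using assms(4)[OF 1(1,2,4,3)] insert by simp
  qed (use assms(2) in simp)
  from this[of "keys f"] assms(1) show ?thesis by (simp flip: poly_mapping_expand)
qed

lemma poly_mapping_linear_induct_UNIV [case_names zero single add]: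
  assumes "P 0" "\<And>m c. P (single m c)" "\<And>g h. P g \<Longrightarrow> P h \<Longrightarrow> P (g + h)"
  shows "P (f :: 'a \<Rightarrow>\<^sub>0 'b::comm_monoid_add)"
  by (rule poly_mapping_linear_induct[of f UNIV]) (use assms in auto)

section \<open>Evaluation of polynomials in commutative rings\<close>

definition mono_eval :: "('v \<Rightarrow> 'b::comm_ring_1) \<Rightarrow> ('v \<Rightarrow>\<^sub>0 nat) \<Rightarrow> 'b" where
  "mono_eval x m = (\<Prod>v\<in>keys m. x v ^ lookup m v)"

lemma mono_eval_superset:
  assumes "finite A" "keys m \<subseteq> A"
  shows "mono_eval x m = (\<Prod>v\<in>A. x v ^ lookup m v)"
  unfolding mono_eval_def using assms
  by (intro prod.mono_neutral_left) (auto simp: in_keys_iff)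

lemma mono_eval_add: "mono_eval x (m + m') = mono_eval x m * mono_eval x m'"
proof -
  have k: "keys (m + m') \<subseteq> keys m \<union> keys m'" by (rule Poly_Mapping.keys_add)
  show ?thesis
    by (subst (1 2 3) mono_eval_superset[of "keys m \<union> keys m'"])
      (use k in \<open>auto simp: lookup_add power_add prod.distrib\<close>)
qed

lemma mono_eval_zero [simp]: "mono_eval x 0 = 1"
  by (simp add: mono_eval_def)

lemma mono_eval_single [simp]: "mono_eval x (single v r) = x v ^ r"
  by (simp add: mono_eval_def)

text \<open>Two instances occur: \<open>id\<close>, for values at complex points, and
  \<open>Const\<close>, for substitution of polynomials.\<close>

definition coeff_hom :: "(complex \<Rightarrow> 'b::comm_ring_1) \<Rightarrow> bool" where
  "coeff_hom c \<longleftrightarrow> c 1 = 1 \<and> (\<forall>a b. c (a + b) = c a + c b) \<and> (\<forall>a b. c (a * b) = c a * c b)"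

lemma coeff_homD:
  assumes "coeff_hom c"
  shows "c 0 = 0" "c 1 = 1" "c (a + b) = c a + c b" "c (a * b) = c a * c b"
  using assms unfolding coeff_hom_def by (auto, metis add_cancel_right_left)

lemma coeff_hom_id [simp]: "coeff_hom id"
  by (simp add: coeff_hom_def)

lemma Const_add: "Const (a + b) = Const a + Const b"
  and Const_mult: "Const (a * b) = Const a * Const b"
  and Const_0 [simp]: "Const 0 = 0" and Const_1 [simp]: "Const 1 = 1"
  by (simp_all add: Const_def single_add mult_single)

lemma coeff_hom_Const [simp]: "coeff_hom Const"
  by (simp add: coeff_hom_def Const_add Const_mult)

lemma cpoly_eval_zero [simp]: "cpoly_eval c x 0 = 0"
  by (simp add: cpoly_eval_def)

lemma cpoly_eval_add:
  assumes "coeff_hom c"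
  shows "cpoly_eval c x (f + g) = cpoly_eval c x f + cpoly_eval c x g"
  unfolding cpoly_eval_def
  by (rule setsum_keys_plus_distrib) (simp_all add: coeff_homD[OF assms] algebra_simps)

lemma cpoly_eval_single:
  assumes "coeff_hom c"
  shows "cpoly_eval c x (single m a) = c a * mono_eval x m"
  by (simp add: cpoly_eval_def coeff_homD[OF assms] mono_eval_def)

lemma cpoly_eval_mult:
  assumes "coeff_hom c"
  shows "cpoly_eval c x (f * g) = cpoly_eval c x f * cpoly_eval c x g"
proof (induction f rule: poly_mapping_linear_induct_UNIV)
  case (single m a)
  show ?case
  proof (induction g rule: poly_mapping_linear_induct_UNIV)
    case (single m' b)
    show ?case
      by (simp only: mult_single cpoly_eval_single[OF assms] mono_eval_add coeff_homD[OF assms] ac_simps)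
  qed (simp_all only: cpoly_eval_add[OF assms] distrib_left cpoly_eval_zero mult_zero_right)
qed (simp_all only: cpoly_eval_add[OF assms] distrib_right cpoly_eval_zero mult_zero_left)

lemma cpoly_eval_one: "coeff_hom c \<Longrightarrow> cpoly_eval c x 1 = 1"
  using cpoly_eval_single[of c x 0 1] by (simp add: coeff_homD)

lemma cpoly_eval_uminus:
  assumes "coeff_hom c" shows "cpoly_eval c x (- f) = - cpoly_eval c x f"
  using cpoly_eval_add[OF assms, of x f "- f"] by (simp add: add_eq_0_iff)

lemma cpoly_eval_diff:
  assumes "coeff_hom c" shows "cpoly_eval c x (f - g) = cpoly_eval c x f - cpoly_eval c x g"
  using cpoly_eval_add[OF assms, of x f "- g"] by (simp add: cpoly_eval_uminus[OF assms])

lemma cpoly_eval_sum: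
  assumes "coeff_hom c" shows "cpoly_eval c x (sum f A) = (\<Sum>a\<in>A. cpoly_eval c x (f a))"
  by (induction A rule: infinite_finite_induct) (simp_all add: cpoly_eval_add[OF assms])

lemma cpoly_eval_prod:
  assumes "coeff_hom c" shows "cpoly_eval c x (prod f A) = (\<Prod>a\<in>A. cpoly_eval c x (f a))"
  by (induction A rule: infinite_finite_induct)
    (simp_all add: cpoly_eval_mult[OF assms] cpoly_eval_one[OF assms])

lemma cpoly_eval_power:
  assumes "coeff_hom c" shows "cpoly_eval c x (f ^ r) = cpoly_eval c x f ^ r"
  by (induction r) (simp_all add: cpoly_eval_mult[OF assms] cpoly_eval_one[OF assms])

lemma cpoly_eval_Var: "coeff_hom c \<Longrightarrow> cpoly_eval c x (Var v) = x v"
  by (simp add: Var_def cpoly_eval_single coeff_homD)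

lemma cpoly_eval_Const: "coeff_hom c \<Longrightarrow> cpoly_eval c x (Const a) = c a"
  by (simp add: Const_def cpoly_eval_single)

lemma cpoly_eval_cong:
  assumes "f \<in> carrier (cpoly_ring V)" "\<And>v. v \<in> V \<Longrightarrow> x v = y v"
  shows "cpoly_eval c x f = cpoly_eval c y f"
  unfolding cpoly_eval_def
  by (intro sum.cong refl arg_cong2[where f = "(*)"] prod.cong)
    (use assms in \<open>auto simp: in_cpoly_carrier subset_iff\<close>)

lemmas cpoly_eval_simps = cpoly_eval_add cpoly_eval_mult cpoly_eval_one cpoly_eval_uminus
  cpoly_eval_diff cpoly_eval_sum cpoly_eval_prod cpoly_eval_power cpoly_eval_Var cpoly_eval_Const

text \<open>Allows an inclusion of a generated ideal in a kernel to be tested on the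
  generators.\<close>

lemma cpoly_eval_kernel_ideal:
  assumes "coeff_hom c"
  shows "ideal {f \<in> carrier (cpoly_ring V). cpoly_eval c x f = 0} (cpoly_ring V)"
  by (rule ideal_cpolyI) (auto simp: cpoly_eval_simps[OF assms])

section \<open>Homogeneous components and filtrations by weight\<close>

definition wpart :: "('m \<Rightarrow> 'g) \<Rightarrow> 'g \<Rightarrow> ('m \<Rightarrow>\<^sub>0 complex) \<Rightarrow> ('m \<Rightarrow>\<^sub>0 complex)" where
  "wpart M c f = Poly_Mapping.mapp (\<lambda>m a. if M m = c then a else 0) f"

lemma lookup_wpart: "lookup (wpart M c f) m = (if M m = c then lookup f m else 0)"
  by (auto simp: wpart_def lookup_mapp when_def in_keys_iff)

lemma keys_wpart: "keys (wpart M c f) = {m \<in> keys f. M m = c}"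
  by (auto simp: in_keys_iff lookup_wpart split: if_splits)

lemma wpart_add: "wpart M c (f + g) = wpart M c f + wpart M c g"
  and wpart_diff: "wpart M c (f - g) = wpart M c f - wpart M c g"
  and wpart_zero [simp]: "wpart M c 0 = 0"
  by (rule poly_mapping_eqI; simp add: lookup_wpart lookup_add lookup_minus)+

lemma wpart_single: "wpart M c (single m a) = (if M m = c then single m a else 0)"
  by (rule poly_mapping_eqI) (auto simp: lookup_wpart lookup_single when_def)

lemma wpart_wpart: "wpart M c (wpart M c' f) = (if c = c' then wpart M c f else 0)"
  by (rule poly_mapping_eqI) (auto simp: lookup_wpart)

lemma wpart_carrier: "f \<in> carrier (cpoly_ring V) \<Longrightarrow> wpart M c f \<in> carrier (cpoly_ring V)"
  by (auto simp: in_cpoly_carrier keys_wpart)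

lemma wpart_decompose: "f = (\<Sum>c\<in>M ` keys f. wpart M c f)"
  by (rule poly_mapping_eqI)
    (auto simp: lookup_sum lookup_wpart in_keys_iff)

text \<open>The target is an arbitrary ordered abelian group: it is instantiated with the reals and
  with a lexicographically ordered group that encodes the order of the valuation.\<close>

definition weight_hom :: "(('v \<Rightarrow>\<^sub>0 nat) \<Rightarrow> 'g::linordered_ab_group_add) \<Rightarrow> bool" where
  "weight_hom M \<longleftrightarrow> (\<forall>a b. M (a + b) = M a + M b)"

lemma weight_hom_add: "weight_hom M \<Longrightarrow> M (a + b) = M a + M b"
  by (simp add: weight_hom_def)

lemma weight_hom_zero: "weight_hom M \<Longrightarrow> M 0 = 0"
  using weight_hom_add[of M 0 0] by simp

definition weight_ge :: "('m \<Rightarrow> 'g::linorder) \<Rightarrow> 'g \<Rightarrow> ('m \<Rightarrow>\<^sub>0 complex) \<Rightarrow> bool" where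
  "weight_ge M c f \<longleftrightarrow> (\<forall>m\<in>keys f. c \<le> M m)"

definition weight_gt :: "('m \<Rightarrow> 'g::linorder) \<Rightarrow> 'g \<Rightarrow> ('m \<Rightarrow>\<^sub>0 complex) \<Rightarrow> bool" where
  "weight_gt M c f \<longleftrightarrow> (\<forall>m\<in>keys f. c < M m)"

lemma weight_ge_zero [simp]: "weight_ge M c 0" and weight_gt_zero [simp]: "weight_gt M c 0"
  by (simp_all add: weight_ge_def weight_gt_def)

lemma weight_gt_imp_ge: "weight_gt M c f \<Longrightarrow> weight_ge M c f"
  by (auto simp: weight_ge_def weight_gt_def)

lemma weight_ge_add: "weight_ge M c f \<Longrightarrow> weight_ge M c g \<Longrightarrow> weight_ge M c (f + g)"
  and weight_gt_add: "weight_gt M c f \<Longrightarrow> weight_gt M c g \<Longrightarrow> weight_gt M c (f + g)"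
  using Poly_Mapping.keys_add[of f g] by (auto simp: weight_ge_def weight_gt_def)

lemma weight_ge_uminus: "weight_ge M c (- f) = weight_ge M c f"
  and weight_gt_uminus: "weight_gt M c (- f) = weight_gt M c f"
  by (auto simp: weight_ge_def weight_gt_def in_keys_iff)

lemma weight_ge_diff: "weight_ge M c f \<Longrightarrow> weight_ge M c g \<Longrightarrow> weight_ge M c (f - g)"
  using weight_ge_add[of M c f "- g"] by (simp add: weight_ge_uminus)

lemma weight_gt_sum: "(\<And>a. a \<in> A \<Longrightarrow> weight_gt M c (f a)) \<Longrightarrow> weight_gt M c (sum f A)"
  by (induction A rule: infinite_finite_induct) (auto intro: weight_gt_add)

lemma keys_multE:
  assumes "m \<in> keys (f * g)"
  obtains a b where "m = a + b" "a \<in> keys f" "b \<in> keys g"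
  using assms keys_mult[of f g] by blast

lemma weight_ge_mult:
  assumes "weight_hom M" "weight_ge M c f" "weight_ge M c' g"
  shows "weight_ge M (c + c') (f * g)"
  using assms(2,3) unfolding weight_ge_def
  by (auto elim!: keys_multE simp: weight_hom_add[OF assms(1)] intro!: add_mono)

lemma weight_gt_mult:
  assumes "weight_hom M" "weight_gt M c f" "weight_ge M c' g"
  shows "weight_gt M (c + c') (f * g)"
  using assms(2,3) unfolding weight_ge_def weight_gt_def
  by (auto elim!: keys_multE simp: weight_hom_add[OF assms(1)] intro!: add_less_le_mono)

lemma weight_gt_mult2:
  assumes "weight_hom M" "weight_ge M c f" "weight_gt M c' g"
  shows "weight_gt M (c + c') (f * g)"
  using weight_gt_mult[OF assms(1,3,2)] by (simp add: ac_simps)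

lemma wpart_eq_0: "weight_gt M c f \<Longrightarrow> wpart M c f = 0"
  by (rule poly_mapping_eqI) (auto simp: lookup_wpart weight_gt_def in_keys_iff)

lemma weight_gt_diff_wpart: "weight_ge M c f \<Longrightarrow> weight_gt M c (f - wpart M c f)"
  by (auto simp: weight_ge_def weight_gt_def in_keys_iff lookup_minus lookup_wpart order_less_le
      split: if_splits)

lemma weight_ge_wpart: "weight_ge M c (wpart M c f)"
  by (auto simp: weight_ge_def keys_wpart)

text \<open>Multiplication by a monomial translates the grading, so no lower bound on the weights in
  \<open>f\<close> enters, in contrast to products of two polynomials.\<close>

lemma wpart_mult_single:
  assumes "weight_hom M"
  shows "wpart M c (single m a * f) = single m a * wpart M (c - M m) f"
proof (induction f rule: poly_mapping_linear_induct_UNIV)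
  case (single m' b)
  have "M (m + m') = c \<longleftrightarrow> M m' = c - M m"
    unfolding weight_hom_add[OF assms] by (metis add_diff_cancel_left' add_diff_eq diff_add_cancel add.commute)
  then show ?case by (simp add: mult_single wpart_single)
qed (simp_all add: wpart_add distrib_left)

text \<open>Below the two bounds there is nothing to convolve with: splitting off the lowest
  components leaves products of strictly larger weight, and \<open>wpart\<close> annihilates
  those.\<close>

lemma wpart_mult:
  assumes M: "weight_hom M" and f: "weight_ge M c f" and g: "weight_ge M c' g"
  shows "wpart M (c + c') (f * g) = wpart M c f * wpart M c' g"
proof -
  let ?f = "wpart M c f" and ?g = "wpart M c' g"
  have hom: "wpart M (c + c') (p * q) = p * q"
    if p: "\<forall>m\<in>keys p. M m = c" and q: "\<forall>m\<in>keys q. M m = c'" for p q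
  proof (rule poly_mapping_eqI)
    fix m
    have "M m = c + c'" if "m \<in> keys (p * q)"
      using that p q by (auto simp: weight_hom_add[OF M] elim!: keys_multE)
    then show "lookup (wpart M (c + c') (p * q)) m = lookup (p * q) m"
      by (auto simp: lookup_wpart in_keys_iff)
  qed
  have fg: "f * g = ?f * ?g + (f - ?f) * g + ?f * (g - ?g)" by (simp add: algebra_simps)
  have 1: "weight_gt M (c + c') ((f - ?f) * g)"
    by (intro weight_gt_mult[OF M] weight_gt_diff_wpart f g)
  have 2: "weight_gt M (c + c') (?f * (g - ?g))"
    by (intro weight_gt_mult2[OF M] weight_gt_diff_wpart g weight_ge_wpart)
  show ?thesis
    by (subst fg) (simp add: wpart_add wpart_eq_0[OF 1] wpart_eq_0[OF 2] hom keys_wpart)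
qed

section \<open>Leading monomials for iterated sequences\<close>

text \<open>Alternating extension of the variables to all pairs of indices. The relations then make
  sense for four indices in any order, and a permutation of the leaves acts on variables without any
  sorting.\<close>

definition pvar :: "nat \<Rightarrow> nat \<Rightarrow> (nat \<times> nat) cpoly" where
  "pvar a b = (if a < b then Var (a, b) else if b < a then - Var (b, a) else 0)"

lemma pvar_swap: "pvar b a = - pvar a b"
  by (simp add: pvar_def)

lemma pvar_carrier [intro]: "a \<in> {1..n} \<Longrightarrow> b \<in> {1..n} \<Longrightarrow> pvar a b \<in> carrier (plucker_poly_ring n)"
  by (auto simp: pvar_def plucker_index_def)

definition plucker_rel :: "nat \<Rightarrow> nat \<Rightarrow> nat \<Rightarrow> nat \<Rightarrow> (nat \<times> nat) cpoly" where
  "plucker_rel a b c d = pvar a b * pvar c d - pvar a c * pvar b d + pvar a d * pvar b c"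

text \<open>The relation is an alternating function of its four indices; adjacent transpositions
  suffice, since a sorting procedure uses no other exchanges.\<close>

lemma plucker_rel_swap:
  "plucker_rel b a c d = - plucker_rel a b c d"
  "plucker_rel a c b d = - plucker_rel a b c d"
  "plucker_rel a b d c = - plucker_rel a b c d"
  unfolding plucker_rel_def pvar_swap[of b a] pvar_swap[of c b] pvar_swap[of d c] by (simp_all add: algebra_simps)

lemma plucker_gens_carrier:
  "{Var (i, j) * Var (k, l) - Var (i, k) * Var (j, l) + Var (i, l) * Var (j, k) | i j k l.
        1 \<le> i \<and> i < j \<and> j < k \<and> k < l \<and> l \<le> n} \<subseteq> carrier (plucker_poly_ring n)"
proof -
  have "Var (a, b) \<in> carrier (plucker_poly_ring n)" if "1 \<le> a" "a < b" "b \<le> n" for a b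
    using that by (auto simp: plucker_index_def)
  then show ?thesis
    by (auto intro!: cpoly_carrier_add cpoly_carrier_diff cpoly_carrier_mult)
qed

lemma ideal_plucker: "ideal (plucker_ideal n) (plucker_poly_ring n)"
  unfolding plucker_ideal_def by (rule ring.genideal_ideal[OF ring_cpoly plucker_gens_carrier])

lemma plucker_rel_in_ideal:
  assumes "a \<in> {1..n}" "b \<in> {1..n}" "c \<in> {1..n}" "d \<in> {1..n}"
  shows "plucker_rel a b c d \<in> plucker_ideal n"
proof -
  let ?I = "plucker_ideal n"
  have neg: "- f \<in> ?I \<longleftrightarrow> f \<in> ?I" for f
    using ideal_cpolyD(5)[OF ideal_plucker, of f n] ideal_cpolyD(5)[OF ideal_plucker, of "- f" n] by auto
  have eq: "plucker_rel a b c d \<in> ?I" if "a = b \<or> b = c \<or> c = d \<or> a = c \<or> b = d \<or> a = d" for a b c d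
  proof -
    have p0: "pvar a a = 0" for a by (simp add: pvar_def)
    have "plucker_rel a b c d = 0"
      using that
    proof (elim disjE)
      assume "a = c" then show ?thesis by (simp add: plucker_rel_def p0 pvar_swap[of b c])
    next
      assume "b = d" then show ?thesis by (simp add: plucker_rel_def p0 pvar_swap[of c d])
    next
      assume "a = d" then show ?thesis by (simp add: plucker_rel_def p0 pvar_swap[of b d] pvar_swap[of c d])
    qed (simp_all add: plucker_rel_def p0)
    then show ?thesis using ideal_cpolyD(2)[OF ideal_plucker] by simp
  qed
  have s: "plucker_rel b a c d \<in> ?I \<longleftrightarrow> plucker_rel a b c d \<in> ?I"
    "plucker_rel a c b d \<in> ?I \<longleftrightarrow> plucker_rel a b c d \<in> ?I"
    "plucker_rel a b d c \<in> ?I \<longleftrightarrow> plucker_rel a b c d \<in> ?I" for a b c d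
    using neg[of "plucker_rel a b c d"] plucker_rel_swap[where a = a and b = b and c = c and d = d] by simp_all
  have 1: "plucker_rel a b c d \<in> ?I" if "1 \<le> a" "a < b" "b < c" "c < d" "d \<le> n" for a b c d
    unfolding plucker_ideal_def
    by (rule subsetD[OF ring.genideal_self[OF ring_cpoly plucker_gens_carrier]])
      (use that in \<open>auto simp: plucker_rel_def pvar_def\<close>)
  \<comment> \<open>Insertion sort: \<open>2\<close> inserts \<open>a\<close> into an increasing
    triple, \<open>3\<close> inserts \<open>b\<close> into an increasing pair, and the final case
    distinction sorts \<open>c\<close> and \<open>d\<close>. Repeated indices give the zero
    relation.\<close>
  have 2: "plucker_rel a b c d \<in> ?I" if "a \<in> {1..n}" "1 \<le> b" "b < c" "c < d" "d \<le> n" for a b c d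
  proof -
    consider "a < b" | "b < a" "a < c" | "c < a" "a < d" | "d < a" | "a = b \<or> a = c \<or> a = d" by linarith
    then show ?thesis
    proof cases
      case c: 1 then show ?thesis using 1[of a b c d] that by auto
    next
      case 2
      then have "plucker_rel b a c d \<in> ?I" using 1 that by auto
      then show ?thesis using s(1)[of a b c d] by simp
    next
      case 3
      then have "plucker_rel b c a d \<in> ?I" using 1 that by auto
      then show ?thesis using s(1)[of a b c d] s(2)[of b a c d] by simp
    next
      case 4
      then have "plucker_rel b c d a \<in> ?I" using 1 that by auto
      then show ?thesis using s(1)[of a b c d] s(2)[of b a c d] s(3)[of b c a d] by simp
    next
      case 5 then show ?thesis by (intro eq) auto
    qed
  qed
  have 3: "plucker_rel a b c d \<in> ?I" if "a \<in> {1..n}" "b \<in> {1..n}" "1 \<le> c" "c < d" "d \<le> n" for a b c d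
  proof -
    consider "b < c" | "c < b" "b < d" | "d < b" | "b = c \<or> b = d" by linarith
    then show ?thesis
    proof cases
      case 1 then show ?thesis using 2 that by auto
    next
      case c: 2
      then have "plucker_rel a c b d \<in> ?I" using 2 that by auto
      then show ?thesis using s(2)[of a b c d] by simp
    next
      case 3
      then have "plucker_rel a c d b \<in> ?I" using 2 that by auto
      then show ?thesis using s(2)[of a b c d] s(3)[of a c b d] by simp
    next
      case 4 then show ?thesis by (intro eq) auto
    qed
  qed
  show ?thesis
  proof (cases c d rule: linorder_cases)
    case less then show ?thesis using 3[of a b c d] assms by auto
  next
    case equal then show ?thesis by (intro eq) auto
  next
    case greater
    then have "plucker_rel a b d c \<in> ?I" using 3[of a b d c] assms by auto
    then show ?thesis using s(3)[of a b c d] by simp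
  qed
qed

lemma concat_pairs_nth:
  "l < length xs \<Longrightarrow> concat (map (\<lambda>x. [f x, g x]) xs) ! (2 * l) = f (xs ! l)"
  "l < length xs \<Longrightarrow> concat (map (\<lambda>x. [f x, g x]) xs) ! Suc (2 * l) = g (xs ! l)"
proof (induction xs arbitrary: l)
  case (Cons x xs)
  { case 1 then show ?case using Cons.IH(1) by (cases l) auto }
  { case 2 then show ?case using Cons.IH(2) by (cases l) auto }
qed auto

lemma single_power: "single m (a :: complex) ^ r = single (of_nat r * (m :: nat \<Rightarrow>\<^sub>0 nat)) (a ^ r)"
  by (induction r) (simp_all add: mult_single distrib_right)

text \<open>Apart from the term at \<open>m\<close>, everything is strictly heavier than
  \<open>m\<close>. This singles out a monomial even when the weight does not separate monomials,
  and it is stable under products because both error terms stay strictly heavier.\<close>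

definition leads :: "(('v \<Rightarrow>\<^sub>0 nat) \<Rightarrow> 'g::linordered_ab_group_add) \<Rightarrow> 'v cpoly \<Rightarrow> ('v \<Rightarrow>\<^sub>0 nat) \<Rightarrow> complex \<Rightarrow> bool"
  where "leads M f m a \<longleftrightarrow> weight_gt M (M m) (f - single m a)"

lemma leads_ge: "leads M f m a \<Longrightarrow> weight_ge M (M m) f"
  using weight_ge_add[of M "M m" "f - single m a" "single m a"] weight_gt_imp_ge[of M "M m" "f - single m a"]
  by (auto simp: leads_def weight_ge_def[of _ _ "single m a"])

lemma leads_single: "leads M (single m a) m a"
  by (simp add: leads_def)

lemma leads_mult:
  assumes M: "weight_hom M" and f: "leads M f m a" and g: "leads M g m' a'"
  shows "leads M (f * g) (m + m') (a * a')"
proof -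
  have "f * g - single (m + m') (a * a') = (f - single m a) * g + single m a * (g - single m' a')"
    by (simp add: mult_single[symmetric] algebra_simps)
  moreover have "weight_gt M (M m + M m') ((f - single m a) * g)"
    using weight_gt_mult[OF M, of "M m" "f - single m a" "M m'" g] f leads_ge[OF g]
    by (simp add: leads_def)
  moreover have "weight_gt M (M m + M m') (single m a * (g - single m' a'))"
    using weight_gt_mult2[OF M, of "M m" "single m a" "M m'" "g - single m' a'"] g
      leads_ge[OF leads_single, of M m a]
    by (simp add: leads_def)
  ultimately show ?thesis
    using weight_gt_add by (simp add: leads_def weight_hom_add[OF M])
qed

lemma leads_power:
  assumes M: "weight_hom M" and f: "leads M f (m :: nat \<Rightarrow>\<^sub>0 nat) a"
  shows "leads M (f ^ r) (of_nat r * m) (a ^ r)"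
proof (induction r)
  case 0 show ?case using leads_single[of M 0 1] by simp
next
  case (Suc r) show ?case using leads_mult[OF M f Suc] by (simp add: distrib_right)
qed

lemma leads_prod:
  assumes M: "weight_hom M" and f: "\<And>x. x \<in> A \<Longrightarrow> leads M (f x) (m x) (a x)"
  shows "leads M (prod f A) (sum m A) (prod a A)"
  using f
proof (induction A rule: infinite_finite_induct)
  case (insert x F)
  then show ?case using leads_mult[OF M, of "f x" "m x" "a x"] by simp
qed (use leads_single[of M 0 1] in simp_all)

section \<open>The coordinate functions of an iterated sequence\<close>

locale iterated_seq =
  fixes n :: nat and i j :: "nat \<Rightarrow> nat"
  assumes choice: "iterated_choice n i j" and n_ge: "3 \<le> n"
begin

abbreviation "S \<equiv> iterated_sequence n i j"

text \<open>\<open>dm\<close> is the number of variables and hence the first index that no root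
  uses; it later names the additional variable that records the degree. The list of roots starts
  with \<open>k = n\<close>, so the variables of \<open>(i k, k)\<close> and \<open>(j k, k)\<close>
  sit at \<open>2 * (n - k)\<close> and its successor.\<close>

definition "dm = 2 * (n - 2)"
definition xi :: "nat \<Rightarrow> nat" where "xi k = 2 * (n - k)"
definition yi :: "nat \<Rightarrow> nat" where "yi k = Suc (2 * (n - k))"

lemma ij:
  assumes "3 \<le> k" "k \<le> n"
  shows "1 \<le> i k" "i k < k" "1 \<le> j k" "j k < k" "i k \<noteq> j k" "i k \<le> n" "j k \<le> n"
    "i k \<noteq> 0" "j k \<noteq> 0" "i k \<noteq> k" "j k \<noteq> k"
proof -
  have "i k \<in> {1..k - 1} \<and> j k \<in> {1..k - 1} \<and> i k \<noteq> j k"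
    using choice assms by (auto simp: iterated_choice_def)
  then show "1 \<le> i k" "i k < k" "1 \<le> j k" "j k < k" "i k \<noteq> j k" "i k \<le> n" "j k \<le> n"
    "i k \<noteq> 0" "j k \<noteq> 0" "i k \<noteq> k" "j k \<noteq> k"
    using assms by auto
qed

lemma length_seq: "length S = dm"
  using n_ge
  by (simp add: iterated_sequence_def length_concat comp_def sum_list_triv dm_def del: upt_Suc)

lemma seq_nth:
  assumes "3 \<le> k" "k \<le> n"
  shows "S ! xi k = (i k, k)" "S ! yi k = (j k, k)"
proof -
  have "rev [3..<Suc n] ! (n - k) = k" using assms by (simp add: rev_nth del: upt_Suc)
  then show "S ! xi k = (i k, k)" "S ! yi k = (j k, k)"
    unfolding iterated_sequence_def xi_def yi_def using assms
    by (subst concat_pairs_nth; simp del: upt_Suc)+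
qed

text \<open>The action of the tail of the sequence that belongs to the levels
  \<open>3, ..., k\<close>. Since the last root acts first, this is the state after the coordinates
  up to \<open>k\<close> have been built.\<close>

definition pact :: "(nat \<Rightarrow> 'a::comm_ring_1) \<Rightarrow> (nat \<Rightarrow> 'a) \<Rightarrow> nat \<Rightarrow> nat \<Rightarrow> 'a" where
  "pact z v k = foldr (\<lambda>l. root_exp (z l) (S ! l)) [2 * (n - k)..<dm] v"

lemma pact_step:
  assumes "3 \<le> k" "k \<le> n"
  shows "pact z v k = (\<lambda>l. if l = k then pact z v (k - 1) k + z (yi k) * pact z v (k - 1) (j k)
    + z (xi k) * pact z v (k - 1) (i k) else pact z v (k - 1) l)"
proof -
  have "[2 * (n - k)..<dm] = xi k # yi k # [2 * (n - (k - 1))..<dm]"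
  proof -
    have "2 * (n - k) < dm" "Suc (2 * (n - k)) < dm" "Suc (Suc (2 * (n - k))) = 2 * (n - (k - 1))"
      using assms by (auto simp: dm_def)
    then show ?thesis by (metis upt_conv_Cons xi_def yi_def)
  qed
  then show ?thesis
    unfolding pact_def using ij[OF assms]
    by (auto simp: seq_nth[OF assms] root_exp_def root_op_def fun_eq_iff)
qed

lemma pact_above:
  assumes "2 \<le> k" "k \<le> n" "k < l \<or> l \<le> 2"
  shows "pact z v k l = v l"
  using assms
proof (induction k rule: dec_induct)
  case base show ?case by (simp add: pact_def dm_def)
next
  case (step m) then show ?case by (subst pact_step) auto
qed

lemma pact_stable:
  assumes "2 \<le> k" "k \<le> m" "m \<le> n" "l \<le> k"
  shows "pact z v m l = pact z v k l"
  using assms(2,3)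
proof (induction m rule: dec_induct)
  case (step m) then show ?case using assms by (subst pact_step) auto
qed auto

lemma seq_act_pact: "seq_act S z v = pact z v n"
  by (simp add: seq_act_def pact_def length_seq)

text \<open>Both factors of level \<open>k\<close> write only to coordinate \<open>k\<close> and
  read only earlier coordinates, and no factor of another level touches it. Applied to the two basis
  vectors: in the n x 2 matrix of the image plane the first two rows form the identity, and row
  \<open>k\<close> is a combination of the rows \<open>i k\<close> and \<open>j k\<close>.\<close>

lemma seq_act_rec:
  assumes "3 \<le> k" "k \<le> n"
  shows "seq_act S z v k = v k + z (yi k) * seq_act S z v (j k) + z (xi k) * seq_act S z v (i k)"
proof -
  have "pact z v n k = pact z v k k" using pact_stable[of k n k] assms by auto
  also have "\<dots> = pact z v (k - 1) k + z (yi k) * pact z v (k - 1) (j k) + z (xi k) * pact z v (k - 1) (i k)"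
    by (subst pact_step[OF assms]) simp
  also have "pact z v (k - 1) k = v k" using pact_above[of "k - 1" k z v] assms by (auto simp: not_le)
  also have "pact z v (k - 1) (j k) = pact z v n (j k)"
    by (rule pact_stable[symmetric]) (use assms ij[OF assms] in linarith)+
  also have "pact z v (k - 1) (i k) = pact z v n (i k)"
    by (rule pact_stable[symmetric]) (use assms ij[OF assms] in linarith)+
  finally show ?thesis by (simp add: seq_act_pact)
qed

lemma seq_act_outside: "l \<le> 2 \<or> n < l \<Longrightarrow> seq_act S z v l = v l"
  using n_ge pact_above[of n l z v] by (auto simp: seq_act_pact)

text \<open>Kept over an arbitrary ring: with \<open>Var\<close> as argument these are the
  polynomials \<open>P\<close>, with complex arguments the Pluecker coordinates of a point of the
  image.\<close>

definition minor :: "(nat \<Rightarrow> 'a::comm_ring_1) \<Rightarrow> nat \<Rightarrow> nat \<Rightarrow> 'a" where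
  "minor z a b = wedge (seq_act S z (unit_vec 1)) (seq_act S z (unit_vec 2)) (a, b)"

lemma minor_swap: "minor z b a = - minor z a b"
  and minor_same [simp]: "minor z a a = 0"
  by (simp_all add: minor_def wedge_def)

lemma minor_12: "minor z 1 2 = 1"
  by (simp add: minor_def wedge_def seq_act_outside unit_vec_def)

text \<open>Linearity of the minor in row \<open>k\<close>. For \<open>a = i k\<close> or
  \<open>a = j k\<close> one summand is a minor with equal rows and vanishes.\<close>

lemma minor_rec:
  assumes "3 \<le> k" "k \<le> n"
  shows "minor z a k = z (xi k) * minor z a (i k) + z (yi k) * minor z a (j k)"
  unfolding minor_def wedge_def prod.case
    seq_act_rec[OF assms, of z "unit_vec 1"] seq_act_rec[OF assms, of z "unit_vec 2"]
  using assms by (simp add: unit_vec_def algebra_simps)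

lemma minor_plucker:
  "minor z a b * minor z c d - minor z a c * minor z b d + minor z a d * minor z b c = 0"
  by (simp add: minor_def wedge_def algebra_simps)

text \<open>Follows the expansion along the row of the larger index. In the case
  \<open>other\<close> the pair formed by \<open>a\<close> and \<open>j k\<close> may degenerate,
  which is why that induction hypothesis is guarded.\<close>

lemma pair_induct [consumes 4, case_names swap base first other]:
  assumes "a \<in> {1..n}" "b \<in> {1..n}" "a \<noteq> b" "n \<ge> 3"
    and swap: "\<And>a b. a < b \<Longrightarrow> b \<le> n \<Longrightarrow> 1 \<le> a \<Longrightarrow> P a b \<Longrightarrow> P b a"
    and base: "P 1 2"
    and first: "\<And>k. 3 \<le> k \<Longrightarrow> k \<le> n \<Longrightarrow> P (i k) (j k) \<Longrightarrow> P (i k) k"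
    and other: "\<And>k a. 3 \<le> k \<Longrightarrow> k \<le> n \<Longrightarrow> 1 \<le> a \<Longrightarrow> a < k \<Longrightarrow> a \<noteq> i k \<Longrightarrow>
      P a (i k) \<Longrightarrow> (a \<noteq> j k \<Longrightarrow> P a (j k)) \<Longrightarrow> P a k"
  shows "P a b"
proof -
  have up: "P a k \<and> P k a" if "1 \<le> a" "a < k" "k \<le> n" for a k
    using that
  proof (induction k arbitrary: a rule: less_induct)
    case (less k)
    have IH: "P c e" if "1 \<le> c" "c < k" "1 \<le> e" "e < k" "c \<noteq> e" for c e
      using less.IH[of c e] less.IH[of e c] less.prems(3) that
      by (cases c e rule: linorder_cases) auto
    have "P a k"
    proof (cases "k < 3")
      case True
      then have "a = 1" "k = 2" using less.prems by auto
      then show ?thesis using base by simp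
    next
      case False
      then have k: "3 \<le> k" "k \<le> n" using less.prems by auto
      show ?thesis
      proof (cases "a = i k")
        case True
        then show ?thesis using first[OF k IH] ij[OF k] by simp
      next
        case False
        have 1: "P a (i k)" using IH ij[OF k] less.prems False by simp
        have 2: "P a (j k)" if "a \<noteq> j k" using IH ij[OF k] less.prems that by simp
        show ?thesis by (rule other[OF k less.prems(1,2) False 1 2])
      qed
    qed
    moreover from this have "P k a" by (rule swap[rotated 3]) (use less.prems in auto)
    ultimately show ?case ..
  qed
  show ?thesis using up[of a b] up[of b a] assms(1-3) by (cases a b rule: linorder_cases) auto
qed

text \<open>Always takes the summand of \<open>minor_rec\<close> with the variable of
  \<open>(i k, k)\<close>, unless that summand vanishes because \<open>a = i k\<close>. No order
  enters here, so the same exponents serve for every admissible weight.\<close>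

function lead :: "nat \<Rightarrow> nat \<Rightarrow> (nat \<Rightarrow>\<^sub>0 nat)" where
  "lead a b = (if b < a then lead b a
     else if 3 \<le> b \<and> b \<le> n \<and> a < b
       then (if a = i b then single (yi b) 1 + lead (i b) (j b) else single (xi b) 1 + lead a (i b))
     else 0)"
  by auto
termination
\<comment> \<open>The unit added for a descending pair pays for the call that merely swaps the
  arguments.\<close>
proof (relation "Wellfounded.measure (\<lambda>(a, b). 2 * max a b + (if b < a then 1 else 0))", goal_cases)
  case (2 a b) then show ?case by (simp add: max_def)
next
  case (3 a b) then show ?case using ij(2,4)[of b] by simp
next
  case (4 a b) then show ?case using ij(2)[of b] by simp
qed simp

function sg :: "nat \<Rightarrow> nat \<Rightarrow> complex" where
  "sg a b = (if b < a then - sg b a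
     else if 3 \<le> b \<and> b \<le> n \<and> a < b then (if a = i b then sg (i b) (j b) else sg a (i b))
     else if a < b then 1 else 0)"
  by auto
termination
proof (relation "Wellfounded.measure (\<lambda>(a, b). 2 * max a b + (if b < a then 1 else 0))", goal_cases)
  case (2 a b) then show ?case by (simp add: max_def)
next
  case (3 a b) then show ?case using ij(2,4)[of b] by simp
next
  case (4 a b) then show ?case using ij(2)[of b] by simp
qed simp

declare lead.simps [simp del] sg.simps [simp del]

lemma lead_swap: "lead b a = lead a b"
  by (cases a b rule: linorder_cases) (simp_all add: lead.simps[of a b] lead.simps[of b a])

lemma sg_swap: "sg b a = - sg a b"
  by (cases a b rule: linorder_cases) (simp_all add: sg.simps[of a b] sg.simps[of b a] sg.simps[of b b])

lemma lead_first: "3 \<le> k \<Longrightarrow> k \<le> n \<Longrightarrow> lead (i k) k = single (yi k) 1 + lead (i k) (j k)"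
  and sg_first: "3 \<le> k \<Longrightarrow> k \<le> n \<Longrightarrow> sg (i k) k = sg (i k) (j k)"
  using ij[of k] by (simp_all add: lead.simps[of "i k" k] sg.simps[of "i k" k])

lemma lead_other: "3 \<le> k \<Longrightarrow> k \<le> n \<Longrightarrow> a < k \<Longrightarrow> a \<noteq> i k \<Longrightarrow> lead a k = single (xi k) 1 + lead a (i k)"
  and sg_other: "3 \<le> k \<Longrightarrow> k \<le> n \<Longrightarrow> a < k \<Longrightarrow> a \<noteq> i k \<Longrightarrow> sg a k = sg a (i k)"
  by (simp_all add: lead.simps[of a k] sg.simps[of a k])

lemma lead_12: "lead 1 2 = 0" and sg_12: "sg 1 2 = 1"
  by (simp_all add: lead.simps[of _ 2] sg.simps[of _ 2])

lemma sg_cases: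
  assumes "a \<in> {1..n}" "b \<in> {1..n}" "a \<noteq> b"
  shows "sg a b = 1 \<or> sg a b = - 1"
  using assms n_ge
proof (induction a b rule: pair_induct)
  case (swap a b) then show ?case by (auto simp: sg_swap[of b a])
next
  case (other k a) then show ?case by (simp add: sg_other)
qed (simp_all add: sg_first sg_12 del: One_nat_def)

text \<open>Homogenized by the additional variable: the minor for the pair \<open>1, 2\<close> is
  the constant \<open>1\<close>, so without it exponents would not see the degree of a Pluecker
  monomial.\<close>

definition tlead :: "nat \<Rightarrow> nat \<Rightarrow> (nat \<Rightarrow>\<^sub>0 nat)" where
  "tlead a b = single dm 1 + lead a b"

lemma tlead_swap: "tlead b a = tlead a b"
  by (simp add: tlead_def lead_swap)

definition lmon :: "(nat \<times> nat \<Rightarrow>\<^sub>0 nat) \<Rightarrow> (nat \<Rightarrow>\<^sub>0 nat)" where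
  "lmon m = (\<Sum>e\<in>keys m. of_nat (lookup m e) * tlead (fst e) (snd e))"

lemma lmon_add: "lmon (m + m') = lmon m + lmon m'"
  unfolding lmon_def by (rule setsum_keys_plus_distrib) (simp_all add: distrib_right)

lemma lmon_zero [simp]: "lmon 0 = 0"
  by (simp add: lmon_def)

lemma lmon_single: "lmon (single (a, b) r) = of_nat r * tlead a b"
  by (simp add: lmon_def)

definition smon :: "(nat \<times> nat \<Rightarrow>\<^sub>0 nat) \<Rightarrow> complex" where
  "smon m = mono_eval (\<lambda>e. sg (fst e) (snd e)) m"

lemma smon_add: "smon (m + m') = smon m * smon m'"
  by (simp add: smon_def mono_eval_add)

lemma smon_cases:
  assumes "keys m \<subseteq> plucker_index n"
  shows "smon m = 1 \<or> smon m = - 1"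
proof -
  have pm: "(\<forall>v\<in>A. f v = 1 \<or> f v = - 1) \<Longrightarrow> prod f A = (1 :: complex) \<or> prod f A = - 1" for f and A :: "(nat \<times> nat) set"
    by (induction A rule: infinite_finite_induct) auto
  have pw: "sg (fst e) (snd e) ^ r = 1 \<or> sg (fst e) (snd e) ^ r = - 1" if "e \<in> keys m" for e r
  proof -
    have "sg (fst e) (snd e) = 1 \<or> sg (fst e) (snd e) = - 1"
      using sg_cases[of "fst e" "snd e"] that assms by (fastforce simp: plucker_index_def)
    then show ?thesis by (induction r) auto
  qed
  show ?thesis unfolding smon_def mono_eval_def by (rule pm) (use pw in simp)
qed

text \<open>\<open>psi\<close> is the monomial map into the algebra of leading terms,
  \<open>phi\<close> the actual parametrization, both homogenized by the variable \<open>dm\<close>.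
  Their comparison through lowest components drives the whole argument.\<close>

definition psi :: "(nat \<times> nat) cpoly \<Rightarrow> nat cpoly" where
  "psi = cpoly_eval Const (\<lambda>e. single (tlead (fst e) (snd e)) (sg (fst e) (snd e)))"

definition phi :: "(nat \<times> nat) cpoly \<Rightarrow> nat cpoly" where
  "phi = cpoly_eval Const (\<lambda>e. Var dm * seq_poly S e)"

lemmas phi_simps = cpoly_eval_simps[OF coeff_hom_Const,
    where x = "\<lambda>e. Var dm * seq_poly S e", folded phi_def]
lemmas psi_simps = cpoly_eval_simps[OF coeff_hom_Const,
    where x = "\<lambda>e. single (tlead (fst e) (snd e)) (sg (fst e) (snd e))", folded psi_def]

lemma psi_zero [simp]: "psi 0 = 0" and phi_zero [simp]: "phi 0 = 0"
  by (simp_all add: psi_def phi_def)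

lemma psi_single: "psi (single m a) = single (lmon m) (a * smon m)"
proof -
  have prod_single: "(\<Prod>e\<in>A. single (f e) (g e)) = single (sum f A) (prod g A :: complex)"
    for f :: "nat \<times> nat \<Rightarrow> nat \<Rightarrow>\<^sub>0 nat" and g A
    by (induction A rule: infinite_finite_induct) (simp_all add: mult_single)
  show ?thesis
    unfolding psi_def cpoly_eval_single[OF coeff_hom_Const] mono_eval_def single_power prod_single
      lmon_def[symmetric]
    by (simp add: smon_def mono_eval_def Const_def mult_single)
qed

lemma psi_pvar:
  assumes "a \<in> {1..n}" "b \<in> {1..n}" "a \<noteq> b"
  shows "psi (pvar a b) = single (tlead a b) (sg a b)"
  using assms by (cases a b rule: linorder_cases)
    (auto simp: pvar_def psi_simps tlead_swap[of a b] sg_swap[of a b] single_uminus)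

lemma seq_poly_minor: "seq_poly S (a, b) = minor Var a b"
  by (simp add: minor_def seq_poly_def)

text \<open>The relations are homogeneous quadrics, so a common factor \<open>u\<close> is harmless.
  It covers the plain parametrization (\<open>u = 1\<close>) together with the homogenized one
  (\<open>u = Var dm\<close>).\<close>

lemma eval_plucker_ideal:
  assumes "f \<in> plucker_ideal n"
  shows "cpoly_eval Const (\<lambda>e. u * seq_poly S e) f = 0"
proof -
  note simps = cpoly_eval_simps[OF coeff_hom_Const, where x = "\<lambda>e. u * seq_poly S e"]
  let ?K = "{f \<in> carrier (plucker_poly_ring n). cpoly_eval Const (\<lambda>e. u * seq_poly S e) f = 0}"
  have "plucker_ideal n \<subseteq> ?K"
    unfolding plucker_ideal_def
  proof (rule ring.genideal_minimal[OF ring_cpoly])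
    show "ideal ?K (plucker_poly_ring n)"
      by (rule cpoly_eval_kernel_ideal) simp
    have "cpoly_eval Const (\<lambda>e. u * seq_poly S e)
        (Var (a, b) * Var (c, d) - Var (a, c) * Var (b, d) + Var (a, d) * Var (b, c)) =
      u * u * (minor Var a b * minor Var c d - minor Var a c * minor Var b d + minor Var a d * minor Var b c)"
      for a b c d
      unfolding simps seq_poly_minor by (simp add: algebra_simps)
    note vanish = this[unfolded minor_plucker mult_zero_right]
    show "{Var (i, j) * Var (k, l) - Var (i, k) * Var (j, l) + Var (i, l) * Var (j, k) | i j k l.
        1 \<le> i \<and> i < j \<and> j < k \<and> k < l \<and> l \<le> n} \<subseteq> ?K"
      by (intro subsetI CollectI conjI, erule subsetD[OF plucker_gens_carrier]) (auto simp: vanish)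
  qed
  then show ?thesis using assms by auto
qed

lemma phi_plucker_ideal: "f \<in> plucker_ideal n \<Longrightarrow> phi f = 0"
  by (simp add: phi_def eval_plucker_ideal)

end

text \<open>The assumption is the strict part of the four-point condition for a cherry formed by
  \<open>i k\<close> and \<open>k\<close> among the leaves up to \<open>k\<close>. The accompanying
  equality of the two smaller sums is automatic, because \<open>tlead a k\<close> and
  \<open>tlead a (i k)\<close> differ by a shift independent of \<open>a\<close>.\<close>

locale weighted_seq = iterated_seq +
  fixes M :: "(nat \<Rightarrow>\<^sub>0 nat) \<Rightarrow> 'g::linordered_ab_group_add"
  assumes hom: "weight_hom M"
    and cherry: "\<lbrakk>3 \<le> k; k \<le> n; 1 \<le> a; a < k; 1 \<le> b; b < k; a \<noteq> b; a \<noteq> i k; b \<noteq> i k\<rbrakk> \<Longrightarrow>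
      M (tlead a k) + M (tlead b (i k)) < M (tlead a b) + M (tlead (i k) k)"
begin

abbreviation wt :: "nat \<Rightarrow> nat \<Rightarrow> 'g" where "wt a b \<equiv> M (tlead a b)"

text \<open>Induction along \<open>minor_rec\<close>: the cherry inequality with
  \<open>b = j k\<close> says that the summand with the variable of \<open>(j k, k)\<close> is the
  heavier one.\<close>

lemma leads_minor:
  assumes "a \<in> {1..n}" "b \<in> {1..n}" "a \<noteq> b"
  shows "leads M (minor Var a b) (lead a b) (sg a b)"
  using assms n_ge
proof (induction a b rule: pair_induct)
  case (swap a b)
  have "minor Var b a - single (lead b a) (sg b a) = - (minor Var a b - single (lead a b) (sg a b))"
    by (simp add: minor_swap[of Var a b] lead_swap[of a b] sg_swap[of a b] single_uminus)
  then show ?case using swap by (simp only: leads_def weight_gt_uminus lead_swap[of a b])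
next
  case base show ?case unfolding minor_12 lead_12 sg_12 using leads_single[of M 0 1] by simp
next
  case (first k)
  have "leads M (Var (yi k)) (single (yi k) 1) 1" unfolding Var_def by (rule leads_single)
  from leads_mult[OF hom this first(3)] show ?case
    by (simp only: minor_rec[OF first(1,2)] minor_same lead_first[OF first(1,2)] sg_first[OF first(1,2)]) simp
next
  case (other k a)
  have x: "leads M (Var (xi k)) (single (xi k) 1) 1" and y: "leads M (Var (yi k)) (single (yi k) 1) 1"
    unfolding Var_def by (rule leads_single)+
  have 1: "leads M (Var (xi k) * minor Var a (i k)) (lead a k) (sg a k)"
    using leads_mult[OF hom x other(6)] other by (simp add: lead_other sg_other)
  have 2: "weight_gt M (M (lead a k)) (Var (yi k) * minor Var a (j k))"
  proof (cases "a = j k")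
    case False
    note l = leads_mult[OF hom y other(7)[OF False]]
    have "M (tlead a k) + M (tlead (j k) (i k)) < M (tlead a (j k)) + M (tlead (i k) k)"
      using cherry[of k a "j k"] other False ij[of k] by auto
    \<comment> \<open>Here \<open>lead (i k) k\<close> splits into the variable \<open>yi k\<close>
      and \<open>lead (i k) (j k)\<close>; the latter occurs on the other side as well and
      cancels.\<close>
    then have "M (lead a k) < M (single (yi k) 1 + lead a (j k))"
      by (simp add: tlead_def weight_hom_add[OF hom] lead_first[OF other(1,2)] lead_swap[of "i k" "j k"] algebra_simps)
    then show ?thesis using leads_ge[OF l] by (auto simp: weight_gt_def weight_ge_def)
  qed simp
  show ?case
    using weight_gt_add[OF 1[unfolded leads_def] 2]
    unfolding leads_def minor_rec[OF other(1,2), of Var a] by (simp add: algebra_simps)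
qed

lemma leads_phi_mono:
  assumes "keys m \<subseteq> plucker_index n"
  shows "leads M (mono_eval (\<lambda>e. Var dm * seq_poly S e) m) (lmon m) (smon m)"
proof -
  have *: "leads M (Var dm * seq_poly S e) (tlead (fst e) (snd e)) (sg (fst e) (snd e))" if "e \<in> keys m" for e
  proof -
    obtain a b where e: "e = (a, b)" by (cases e)
    then have "a \<in> {1..n}" "b \<in> {1..n}" "a \<noteq> b" using that assms by (auto simp: plucker_index_def)
    from leads_mult[OF hom leads_single[of M "single dm 1" 1] leads_minor[OF this]] show ?thesis
      by (simp add: e seq_poly_minor tlead_def Var_def)
  qed
  show ?thesis
    unfolding mono_eval_def lmon_def smon_def by (intro leads_prod leads_power hom *)
qed

text \<open>Cancellation need not be excluded: if the leading terms of the lowest component of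
  \<open>f\<close> cancel, its image under \<open>psi\<close> is zero and the statement merely says
  that \<open>phi f\<close> is heavier than \<open>c\<close>.\<close>

lemma phi_leading_part:
  assumes f: "f \<in> carrier (plucker_poly_ring n)" and ge: "weight_ge (M \<circ> lmon) c f"
  shows "weight_gt M c (phi f - psi (wpart (M \<circ> lmon) c f))"
proof -
  have "keys f \<subseteq> {m. keys m \<subseteq> plucker_index n \<and> c \<le> M (lmon m)}"
    using f ge by (auto simp: in_cpoly_carrier weight_ge_def)
  then show ?thesis
  proof (induction f rule: poly_mapping_linear_induct)
    case (single m a)
    have l: "leads M (phi (single m a)) (lmon m) (a * smon m)"
      using leads_mult[OF hom leads_single[of M 0 a] leads_phi_mono[of m]] single
      by (simp add: phi_def cpoly_eval_single Const_def)
    show ?case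
    proof (cases "M (lmon m) = c")
      case True then show ?thesis using l by (simp add: wpart_single psi_single leads_def)
    next
      case False
      then have "c < M (lmon m)" using single by auto
      then show ?thesis using leads_ge[OF l] False by (auto simp: wpart_single weight_ge_def weight_gt_def)
    qed
  next
    case (add g h)
    then show ?case using weight_gt_add[OF add(3,4)] by (simp add: phi_simps psi_simps wpart_add algebra_simps)
  qed simp
qed

lemma wpart_phi:
  assumes "f \<in> carrier (plucker_poly_ring n)" "weight_ge (M \<circ> lmon) c f"
  shows "wpart M c (phi f) = psi (wpart (M \<circ> lmon) c f)"
proof -
  have "wpart M c (psi (wpart (M \<circ> lmon) c f)) = psi (wpart (M \<circ> lmon) c f)"
  proof (induction f rule: poly_mapping_linear_induct_UNIV)
    case (single m a) show ?case by (simp add: wpart_single psi_single)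
  qed (simp_all add: wpart_add psi_simps)
  then show ?thesis
    using wpart_eq_0[OF phi_leading_part[OF assms]] by (simp add: wpart_diff)
qed

text \<open>One half of the comparison of initial ideals with the kernel of \<open>psi\<close>:
  since \<open>phi\<close> kills the Pluecker ideal, \<open>psi\<close> kills lowest components of
  its elements.\<close>

lemma plucker_ideal_leading_part:
  assumes "f \<in> plucker_ideal n" "weight_ge (M \<circ> lmon) c f"
  shows "psi (wpart (M \<circ> lmon) c f) = 0"
  using wpart_phi[of f c] phi_plucker_ideal[OF assms(1)] ideal_cpolyD(1)[OF ideal_plucker] assms by auto

end

section \<open>Exchanges of leading monomials\<close>

context iterated_seq begin

text \<open>A leading exponent only uses variables of levels up to the larger index. By this
  triangularity the exponents at level \<open>k\<close> can be read off without interference from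
  pairs of earlier leaves.\<close>

lemma keys_lead:
  assumes "a \<in> {1..n}" "b \<in> {1..n}" "a \<noteq> b"
  shows "keys (lead a b) \<subseteq> {2 * (n - max a b)..<dm}"
  using assms n_ge
proof (induction a b rule: pair_induct)
  case (swap a b) then show ?case by (simp add: lead_swap[of b a] max.commute)
next
  case base show ?case unfolding lead_12 by simp
next
  case (first k)
  have "keys (lead (i k) k) \<subseteq> {yi k} \<union> keys (lead (i k) (j k))"
    unfolding lead_first[OF first(1,2)] using Poly_Mapping.keys_add[of "single (yi k) 1" "lead (i k) (j k)"] by auto
  also have "\<dots> \<subseteq> {2 * (n - max (i k) k)..<dm}"
  proof -
    have "{2 * (n - max (i k) (j k))..<dm} \<subseteq> {2 * (n - max (i k) k)..<dm}"
      using ij[OF first(1,2)] by auto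
    moreover have "yi k \<in> {2 * (n - max (i k) k)..<dm}"
      using first(1,2) ij[OF first(1,2)] by (auto simp: yi_def dm_def)
    ultimately show ?thesis using first(3) by blast
  qed
  finally show ?case .
next
  case (other k a)
  have "keys (lead a k) \<subseteq> {xi k} \<union> keys (lead a (i k))"
    unfolding lead_other[OF other(1,2,4,5)] using Poly_Mapping.keys_add[of "single (xi k) 1" "lead a (i k)"] by auto
  also have "\<dots> \<subseteq> {2 * (n - max a k)..<dm}"
  proof -
    have "{2 * (n - max a (i k))..<dm} \<subseteq> {2 * (n - max a k)..<dm}"
      using ij[OF other(1,2)] other(4) by auto
    moreover have "xi k \<in> {2 * (n - max a k)..<dm}"
      using other(1-4) by (auto simp: xi_def dm_def)
    ultimately show ?thesis using other(6) by blast
  qed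
  finally show ?case .
qed

text \<open>Monomials in the Pluecker variables are treated as multigraphs on the leaves; unordered
  pairs suit them because leading exponents are symmetric in the two indices.\<close>

definition edges :: "nat \<Rightarrow> nat set set" where
  "edges k = {{a, b} | a b. a \<in> {1..k} \<and> b \<in> {1..k} \<and> a \<noteq> b}"

definition elead :: "nat set \<Rightarrow> (nat \<Rightarrow>\<^sub>0 nat)" where
  "elead e = tlead (Min e) (Max e)"

lemma elead_pair: "a \<noteq> b \<Longrightarrow> elead {a, b} = tlead a b"
  by (cases a b rule: linorder_cases) (auto simp: elead_def tlead_swap[of b a])

abbreviation mlead :: "nat set multiset \<Rightarrow> (nat \<Rightarrow>\<^sub>0 nat)" where
  "mlead E \<equiv> (\<Sum>e\<in>#E. elead e)"

text \<open>Contraction of the cherry \<open>{i k, k}\<close>.\<close>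

definition contract :: "nat \<Rightarrow> nat set \<Rightarrow> nat set" where
  "contract k e = (if k \<in> e then insert (i k) (e - {k}) else e)"

lemma edges_cases:
  assumes "e \<in> edges k" "3 \<le> k" "k \<le> n"
  obtains (cherry) "e = {i k, k}" | (new) a where "1 \<le> a" "a < k" "a \<noteq> i k" "e = {a, k}"
    | (old) a b where "1 \<le> a" "a < k" "1 \<le> b" "b < k" "a \<noteq> b" "e = {a, b}" "k \<notin> e"
proof -
  obtain a b where ab: "a \<in> {1..k}" "b \<in> {1..k}" "a \<noteq> b" "e = {a, b}"
    using assms(1) by (auto simp: edges_def)
  consider "a = k" | "b = k" | "a \<noteq> k" "b \<noteq> k" by blast
  then show thesis
  proof cases
    case 1
    then show thesis using ab cherry new[of b] by (cases "b = i k") (auto simp: insert_commute)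
  next
    case 2
    then show thesis using ab cherry new[of a] by (cases "a = i k") auto
  next
    case 3
    then show thesis using ab old[of a b] by auto
  qed
qed

lemma edge_old: "1 \<le> a \<Longrightarrow> a < k \<Longrightarrow> 1 \<le> b \<Longrightarrow> b < k \<Longrightarrow> a \<noteq> b \<Longrightarrow> {a, b} \<in> edges (k - 1)"
  unfolding edges_def by (intro CollectI exI[of _ a] exI[of _ b]) auto

lemma edge_new: "1 \<le> a \<Longrightarrow> a < k \<Longrightarrow> {a, k} \<in> edges k"
  unfolding edges_def by (intro CollectI exI[of _ a] exI[of _ k]) auto

lemma edges_mono: "edges (k - 1) \<subseteq> edges k"
proof
  fix e assume "e \<in> edges (k - 1)"
  then obtain a b where "a \<in> {1..k - 1}" "b \<in> {1..k - 1}" "a \<noteq> b" "e = {a, b}"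
    by (auto simp: edges_def)
  then show "e \<in> edges k" unfolding edges_def by (intro CollectI exI[of _ a] exI[of _ b]) auto
qed

lemma contract_new: "a \<noteq> k \<Longrightarrow> contract k {a, k} = {a, i k}"
  by (auto simp: contract_def)

lemma contract_edges:
  assumes "e \<in> edges k" "e \<noteq> {i k, k}" "3 \<le> k" "k \<le> n"
  shows "contract k e \<in> edges (k - 1)"
  using assms(1,3,4)
proof (cases rule: edges_cases)
  case (new a) then show ?thesis using contract_new[of a k] edge_old[of a k "i k"] ij[OF assms(3,4)] by simp
next
  case (old a b) then show ?thesis using edge_old[of a k b] by (simp add: contract_def)
qed (use assms in simp)

text \<open>The variable \<open>xi k\<close> detects edges from \<open>k\<close> other than the
  cherry, \<open>yi k\<close> detects the cherry, and what remains is the exponent of the contracted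
  edge. This is what makes an induction over \<open>k\<close> possible.\<close>

lemma lookup_elead:
  assumes "e \<in> edges k" "3 \<le> k" "k \<le> n"
  shows "lookup (elead e) (xi k) = (if k \<in> e \<and> e \<noteq> {i k, k} then 1 else 0)"
    "lookup (elead e) (yi k) = (if e = {i k, k} then 1 else 0)"
    "e \<noteq> {i k, k} \<Longrightarrow> elead e = (if k \<in> e then single (xi k) 1 else 0) + elead (contract k e)"
proof -
  have idx: "xi k < dm" "yi k < dm" "xi k \<noteq> yi k" using assms by (auto simp: xi_def yi_def dm_def)
  have small: "lookup (lead a b) (xi k) = 0 \<and> lookup (lead a b) (yi k) = 0"
    if "1 \<le> a" "a < k" "1 \<le> b" "b < k" "a \<noteq> b" for a b
  proof -
    have "keys (lead a b) \<subseteq> {2 * (n - max a b)..<dm}" using that assms by (intro keys_lead) auto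
    moreover have "xi k < 2 * (n - max a b)" "yi k < 2 * (n - max a b)"
      using that assms by (auto simp: xi_def yi_def)
    ultimately have "xi k \<notin> keys (lead a b)" "yi k \<notin> keys (lead a b)" by auto
    then show ?thesis by (simp add: in_keys_iff)
  qed
  show "lookup (elead e) (xi k) = (if k \<in> e \<and> e \<noteq> {i k, k} then 1 else 0)"
    "lookup (elead e) (yi k) = (if e = {i k, k} then 1 else 0)"
    "e \<noteq> {i k, k} \<Longrightarrow> elead e = (if k \<in> e then single (xi k) 1 else 0) + elead (contract k e)"
    using assms
  proof (atomize (full), cases rule: edges_cases)
    case cherry
    then show "lookup (elead e) (xi k) = (if k \<in> e \<and> e \<noteq> {i k, k} then 1 else 0) \<and>
      lookup (elead e) (yi k) = (if e = {i k, k} then 1 else 0) \<and>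
      (e \<noteq> {i k, k} \<longrightarrow> elead e = (if k \<in> e then single (xi k) 1 else 0) + elead (contract k e))"
      using idx ij[OF assms(2,3)] small[of "i k" "j k"]
      by (simp add: elead_pair tlead_def lead_first[OF assms(2,3)] lookup_add lookup_single)
  next
    case (new a)
    then have "e \<noteq> {i k, k}" by (auto simp: doubleton_eq_iff)
    then show "lookup (elead e) (xi k) = (if k \<in> e \<and> e \<noteq> {i k, k} then 1 else 0) \<and>
      lookup (elead e) (yi k) = (if e = {i k, k} then 1 else 0) \<and>
      (e \<noteq> {i k, k} \<longrightarrow> elead e = (if k \<in> e then single (xi k) 1 else 0) + elead (contract k e))"
      using idx ij[OF assms(2,3)] small[of a "i k"] new contract_new[of a k]
      by (simp add: elead_pair tlead_def lead_other[OF assms(2,3)] lookup_add lookup_single ac_simps)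
  next
    case (old a b)
    then have "e \<noteq> {i k, k}" by auto
    then show "lookup (elead e) (xi k) = (if k \<in> e \<and> e \<noteq> {i k, k} then 1 else 0) \<and>
      lookup (elead e) (yi k) = (if e = {i k, k} then 1 else 0) \<and>
      (e \<noteq> {i k, k} \<longrightarrow> elead e = (if k \<in> e then single (xi k) 1 else 0) + elead (contract k e))"
      using idx small[of a b] old
      by (simp add: elead_pair tlead_def contract_def lookup_add lookup_single)
  qed
qed

lemma tlead_other: "3 \<le> k \<Longrightarrow> k \<le> n \<Longrightarrow> a < k \<Longrightarrow> a \<noteq> i k \<Longrightarrow> tlead a k = single (xi k) 1 + tlead a (i k)"
  by (simp add: tlead_def lead_other ac_simps)

definition nnew :: "nat \<Rightarrow> nat set multiset \<Rightarrow> nat" where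
  "nnew k E = size (filter_mset (\<lambda>e. k \<in> e) E)"

definition free :: "nat \<Rightarrow> nat set multiset \<Rightarrow> bool" where
  "free k E \<longleftrightarrow> set_mset E \<subseteq> edges k - {{i k, k}}"

lemma mlead_contract:
  assumes "free k E" "3 \<le> k" "k \<le> n"
  shows "mlead E = of_nat (nnew k E) * single (xi k) 1 + mlead (image_mset (contract k) E)"
  using assms(1)
proof (induction E)
  case (add e E)
  then have "elead e = (if k \<in> e then single (xi k) 1 else 0) + elead (contract k e)"
    by (intro lookup_elead assms) (auto simp: free_def)
  then show ?case using add by (auto simp: free_def nnew_def algebra_simps)
qed (simp add: nnew_def)

lemma lookup_mlead: "lookup (mlead E) x = (\<Sum>e\<in>#E. lookup (elead e) x)"
  by (induction E) (simp_all add: lookup_add)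

lemma lookup_mlead_free:
  assumes "free k E" "3 \<le> k" "k \<le> n"
  shows "lookup (mlead E) (xi k) = nnew k E"
  using assms(1) unfolding lookup_mlead
proof (induction E)
  case (add e E)
  then have "lookup (elead e) (xi k) = (if k \<in> e \<and> e \<noteq> {i k, k} then 1 else 0)"
    by (intro lookup_elead assms) (auto simp: free_def)
  then show ?case using add by (auto simp: free_def nnew_def)
qed (simp add: nnew_def)

lemma count_cherry:
  assumes "set_mset E \<subseteq> edges k" "3 \<le> k" "k \<le> n"
  shows "lookup (mlead E) (yi k) = count E {i k, k}"
  using assms(1) unfolding lookup_mlead
proof (induction E)
  case (add e E)
  then have "lookup (elead e) (yi k) = (if e = {i k, k} then 1 else 0)"
    by (intro lookup_elead assms) auto
  then show ?case using add by auto
qed simp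

end

section \<open>Exchange moves and connectedness of the fibres of the monomial map\<close>

context weighted_seq begin

text \<open>The situation in which the lowest part of the Pluecker relation on
  \<open>a, b, c, d\<close> consists of its first two products.\<close>

definition quad :: "nat \<Rightarrow> nat \<Rightarrow> nat \<Rightarrow> nat \<Rightarrow> bool" where
  "quad a b c d \<longleftrightarrow> distinct [a, b, c, d] \<and> wt a b + wt c d = wt a c + wt b d \<and>
     wt a b + wt c d < wt a d + wt b c"

definition move :: "nat \<Rightarrow> nat set multiset \<Rightarrow> nat set multiset \<Rightarrow> bool" where
  "move k E E' \<longleftrightarrow> (\<exists>a b c d G. {a, b, c, d} \<subseteq> {1..k} \<and> quad a b c d \<and>
     E = add_mset {a, b} (add_mset {c, d} G) \<and> E' = add_mset {a, c} (add_mset {b, d} G))"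

lemma moveI:
  "{a, b, c, d} \<subseteq> {1..k} \<Longrightarrow> quad a b c d \<Longrightarrow>
    move k (add_mset {a, b} (add_mset {c, d} G)) (add_mset {a, c} (add_mset {b, d} G))"
  unfolding move_def by blast

lemma move_add:
  assumes "move k E E'"
  shows "move k (add_mset e E) (add_mset e E')"
proof -
  obtain a b c d G where "{a, b, c, d} \<subseteq> {1..k}" "quad a b c d"
    and "E = add_mset {a, b} (add_mset {c, d} G)" "E' = add_mset {a, c} (add_mset {b, d} G)"
    using assms unfolding move_def by blast
  then show ?thesis
    using moveI[of a b c d k "add_mset e G"] by (simp add: add_mset_commute[of e])
qed

abbreviation conn :: "nat \<Rightarrow> nat set multiset \<Rightarrow> nat set multiset \<Rightarrow> bool" where
  "conn k \<equiv> (move k)\<^sup>*\<^sup>*"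

lemma conn_add: "conn k E E' \<Longrightarrow> conn k (add_mset e E) (add_mset e E')"
  by (induction rule: rtranclp_induct) (auto intro: rtranclp.rtrancl_into_rtrancl move_add)

lemma conn_union: "conn k E E' \<Longrightarrow> conn k (G + E) (G + E')"
  by (induction G) (auto intro: conn_add)

lemma wt_swap: "wt b a = wt a b"
  by (simp add: tlead_swap)

lemma wt_other: "3 \<le> k \<Longrightarrow> k \<le> n \<Longrightarrow> a < k \<Longrightarrow> a \<noteq> i k \<Longrightarrow> wt a k = M (single (xi k) 1) + wt a (i k)"
  by (subst tlead_other) (simp_all add: weight_hom_add[OF hom])

text \<open>The exchange that swaps the ends \<open>k\<close> and \<open>i k\<close> of two edges.
  The equality holds since \<open>k\<close> and \<open>i k\<close> differ by a constant shift; the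
  inequality is the assumption of the locale.\<close>

lemma quad_cherry:
  assumes "3 \<le> k" "k \<le> n" "1 \<le> a" "a < k" "1 \<le> b" "b < k" "a \<noteq> b" "a \<noteq> i k" "b \<noteq> i k"
  shows "quad a k (i k) b"
  unfolding quad_def
  using cherry[OF assms] wt_other[of k a] wt_other[of k b] assms ij[OF assms(1,2)]
    wt_swap[of b "i k"] wt_swap[of b k] wt_swap[of "i k" k]
  by (auto simp: ac_simps)

text \<open>Both multigraphs arise from one contracted multigraph by choosing which of the ends at
  \<open>i k\<close> are moved to \<open>k\<close>. The numbers of moved ends agree, so one exchange
  creates a common edge, which is then split off.\<close>

lemma conn_contract_eq:
  assumes "free k E" "free k E'" "image_mset (contract k) E = image_mset (contract k) E'"
    "nnew k E = nnew k E'" "3 \<le> k" "k \<le> n"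
  shows "conn k E E'"
  using assms(1-4)
proof (induction "size E" arbitrary: E E' rule: less_induct)
  case less
  have common: "conn k F F'"
    if F: "size F = size E" "free k F" "free k F'" "image_mset (contract k) F = image_mset (contract k) F'"
      "nnew k F = nnew k F'" "e \<in># F" "e \<in># F'" for F F' e
  proof -
    obtain G where G: "F = add_mset e G" using F(6) by (metis insert_DiffM)
    obtain G' where G': "F' = add_mset e G'" using F(7) by (metis insert_DiffM)
    have "conn k G G'"
      by (rule less.hyps) (use F in \<open>auto simp: G G' free_def nnew_def split: if_splits\<close>)
    then show ?thesis unfolding G G' by (rule conn_add)
  qed
  show ?case
  proof (cases "nnew k E = 0")
    case True
    then have "nnew k E' = 0" using less.prems(4) by simp
    with True have "\<forall>e\<in>#E. k \<notin> e" "\<forall>e\<in>#E'. k \<notin> e"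
      by (simp_all add: nnew_def)
    then have "image_mset (contract k) E = E" "image_mset (contract k) E' = E'"
      by (auto simp: contract_def intro!: multiset.map_ident_strong)
    then have "E = E'" using less.prems(3) by argo
    then show ?thesis by simp
  next
    case False
    have new: "\<exists>a. 1 \<le> a \<and> a < k \<and> a \<noteq> i k \<and> {a, k} \<in># F" if "nnew k F \<noteq> 0" "free k F" for F
    proof -
      note n0 = that(1)
      obtain e where e: "e \<in># F" "k \<in> e" using n0 unfolding nnew_def by (metis filter_mset_eq_mempty_iff size_empty)
      then have "e \<in> edges k" "e \<noteq> {i k, k}" using that(2) by (auto simp: free_def)
      from this(1) assms(5,6) show ?thesis
        by (cases rule: edges_cases) (use e \<open>e \<noteq> {i k, k}\<close> in auto)
    qed
    have other: "{a, k} \<in># F' \<or> {a, i k} \<in># F'"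
      if "{a, k} \<in># F" "image_mset (contract k) F = image_mset (contract k) F'" "free k F'" "a < k" "a \<noteq> i k"
      for F F' a
    proof -
      have "{a, i k} \<in># image_mset (contract k) F"
        using imageI[OF that(1), of "contract k"] contract_new[of a k] that(4) by simp
      then have "{a, i k} \<in># image_mset (contract k) F'" unfolding that(2) .
      then obtain e where e: "e \<in># F'" "contract k e = {a, i k}" by auto
      then have "e \<in> edges k" "e \<noteq> {i k, k}" using that(3) by (auto simp: free_def)
      from this(1) assms(5,6) show ?thesis
      proof (cases rule: edges_cases)
        case (new b)
        then have "b = a" using e(2) contract_new[of b k] that(5) by (auto simp: doubleton_eq_iff)
        then show ?thesis using new e by simp
      next
        case (old b c) then show ?thesis using e by (simp add: contract_def)
      qed (use \<open>e \<noteq> {i k, k}\<close> in simp)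
    qed
    obtain a where a: "1 \<le> a" "a < k" "a \<noteq> i k" "{a, k} \<in># E" using new[OF False less.prems(1)] by blast
    obtain b where b: "1 \<le> b" "b < k" "b \<noteq> i k" "{b, k} \<in># E'"
      using new[of E'] False less.prems(2,4) by auto
    show ?thesis
    proof (cases "{a, k} \<in># E' \<or> {b, k} \<in># E")
      case True
      then show ?thesis using common[of E E'] less.prems a b by blast
    next
      case False
      \<comment> \<open>\<open>E\<close> joins \<open>a\<close> to \<open>k\<close> and
        \<open>b\<close> to \<open>i k\<close>, while \<open>E'\<close> has \<open>b\<close> at
        \<open>k\<close> and \<open>a\<close> at \<open>i k\<close>; exchanging these ends in
        \<open>E\<close> produces the common edge.\<close>
      then have ai: "{a, i k} \<in># E'" using other[of a E E'] a less.prems by auto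
      have bi: "{b, i k} \<in># E" using other[of b E' E] b less.prems False by auto
      have ab: "a \<noteq> b" using a False by auto
      have "{a, k} \<noteq> {b, i k}" using a b ij[OF assms(5,6)] by (auto simp: doubleton_eq_iff)
      moreover obtain G1 where "E = add_mset {a, k} G1" using multi_member_split[OF a(4)] by blast
      ultimately obtain G where G: "E = add_mset {a, k} (add_mset {b, i k} G)"
        using bi multi_member_split[of "{b, i k}" G1] by auto
      define E1 where "E1 = add_mset {a, i k} (add_mset {b, k} G)"
      have "move k (add_mset {a, k} (add_mset {i k, b} G)) (add_mset {a, i k} (add_mset {k, b} G))"
        by (rule moveI[OF _ quad_cherry[OF assms(5,6) a(1,2) b(1,2) ab a(3) b(3)]])
          (use a b ij[OF assms(5,6)] in simp)
      then have m: "move k E E1" by (simp add: G E1_def insert_commute)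
      have c: "contract k {a, i k} = {a, i k}" "contract k {b, i k} = {b, i k}"
        "contract k {a, k} = {a, i k}" "contract k {b, k} = {b, i k}"
        using a b ij[OF assms(5,6)] contract_new[of a k] contract_new[of b k] by (auto simp: contract_def)
      have "conn k E1 E'"
      proof (rule common[of E1 E' "{a, i k}"])
        show "free k E1"
          using less.prems(1) a b ij[OF assms(5,6)] edge_new[of b k] edge_old[of a k "i k"] edges_mono[of k]
          unfolding G E1_def free_def by (auto simp: doubleton_eq_iff)
        show "image_mset (contract k) E1 = image_mset (contract k) E'"
          using less.prems(3) unfolding G E1_def by (simp add: c add_mset_commute)
        show "nnew k E1 = nnew k E'"
          using less.prems(4) a b ij[OF assms(5,6)] unfolding G E1_def nnew_def by simp
      qed (use less.prems ai in \<open>auto simp: G E1_def\<close>)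
      then show ?thesis using m by (simp add: converse_rtranclp_into_rtranclp)
    qed
  qed
qed

text \<open>The lift goes against the direction of the move: a multigraph over the target is given
  and one over the source is constructed. A chain of moves can thus be followed back from a
  prescribed endpoint.\<close>

lemma move_lift:
  assumes m: "move (k - 1) F1 F2" and E2: "free k E2" "image_mset (contract k) E2 = F2"
    and k: "3 \<le> k" "k \<le> n"
  obtains E1 where "free k E1" "image_mset (contract k) E1 = F1" "nnew k E1 = nnew k E2" "move k E1 E2"
proof -
  obtain a b c d G where abcd: "{a, b, c, d} \<subseteq> {1..k - 1}" and q: "quad a b c d"
    and F1: "F1 = add_mset {a, b} (add_mset {c, d} G)" and F2: "F2 = add_mset {a, c} (add_mset {b, d} G)"
    using m unfolding move_def by blast
  obtain e1 E' where e1: "E2 = add_mset e1 E'" "contract k e1 = {a, c}"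
      "image_mset (contract k) E' = add_mset {b, d} G"
    using E2(2) F2 by (metis msed_map_invR)
  obtain e2 G' where e2: "E' = add_mset e2 G'" "contract k e2 = {b, d}" "image_mset (contract k) G' = G"
    using e1(3) by (metis msed_map_invR)
  have dist: "a \<noteq> b" "a \<noteq> c" "a \<noteq> d" "b \<noteq> c" "b \<noteq> d" "c \<noteq> d" using q by (auto simp: quad_def)
  have lt: "a < k" "b < k" "c < k" "d < k" "1 \<le> a" "1 \<le> b" "1 \<le> c" "1 \<le> d" using abcd k by auto
  \<comment> \<open>The four vertices are distinct, so at most one of them is \<open>i k\<close>,
    and at most one of \<open>e1\<close>, \<open>e2\<close> contains \<open>k\<close>. The map
    \<open>r\<close> undoes the contraction at that vertex.\<close>
  define r where "r x = (if x = i k \<and> (k \<in> e1 \<or> k \<in> e2) then k else x)" for x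
  have shape: "(k \<notin> e \<and> e = {x, y}) \<or> (k \<in> e \<and> x = i k \<and> e = {k, y}) \<or> (k \<in> e \<and> y = i k \<and> e = {x, k})"
    if "e \<in># E2" "contract k e = {x, y}" for e x y
  proof -
    have "e \<in> edges k" "e \<noteq> {i k, k}" using that(1) E2(1) by (auto simp: free_def)
    from this(1) k show ?thesis
    proof (cases rule: edges_cases)
      case (new z)
      then have "{z, i k} = {x, y}" using that(2) contract_new[of z k] by auto
      then show ?thesis using new by (auto simp: doubleton_eq_iff)
    next
      case (old z u)
      then have "e = {x, y}" using that(2) by (simp add: contract_def)
      then show ?thesis using old(7) by blast
    qed (use \<open>e \<noteq> {i k, k}\<close> in simp)
  qed
  have s1: "(k \<notin> e1 \<and> e1 = {a, c}) \<or> (k \<in> e1 \<and> a = i k \<and> e1 = {k, c}) \<or> (k \<in> e1 \<and> c = i k \<and> e1 = {a, k})"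
    by (rule shape) (use e1 in auto)
  have s2: "(k \<notin> e2 \<and> e2 = {b, d}) \<or> (k \<in> e2 \<and> b = i k \<and> e2 = {k, d}) \<or> (k \<in> e2 \<and> d = i k \<and> e2 = {b, k})"
    by (rule shape) (use e1 e2 in auto)
  have re1: "e1 = {r a, r c}" and re2: "e2 = {r b, r d}"
    using s1 s2 dist unfolding r_def by auto
  have rk: "r x \<in> {1..k}" if "1 \<le> x" "x < k" for x using that k by (auto simp: r_def)
  have contr: "contract k {r x, r y} = {x, y}" if "x < k" "y < k" "x \<noteq> y" for x y
    using that by (auto simp: r_def contract_def)
  have rcherry: "{r x, r y} \<noteq> {i k, k}" if "x < k" "y < k" "x \<noteq> y" for x y
    using that ij[OF k] by (auto simp: r_def doubleton_eq_iff)
  have redge: "{r x, r y} \<in> edges k" if "1 \<le> x" "1 \<le> y" "x < k" "y < k" "x \<noteq> y" for x y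
    unfolding edges_def using that by (intro CollectI exI[of _ "r x"] exI[of _ "r y"]) (auto simp: r_def)
  \<comment> \<open>Replacing \<open>i k\<close> by \<open>k\<close> changes weights by a term that
    depends on the vertex only. Each of the three pairings of the quadruple receives the sum of all
    four terms, so equality and inequality persist.\<close>
  define h where "h x = (if x = i k \<and> (k \<in> e1 \<or> k \<in> e2) then M (single (xi k) 1) else 0)" for x
  have wr: "wt (r x) (r y) = wt x y + h x + h y" if "x < k" "y < k" "x \<noteq> y" for x y
    using that k wt_other[of k x] wt_other[of k y] wt_swap[of y "i k"] wt_swap[of k y]
    by (auto simp: r_def h_def ac_simps)
  have rq: "quad (r a) (r b) (r c) (r d)"
  proof -
    have "distinct [r a, r b, r c, r d]" using dist lt by (auto simp: r_def)
    moreover have "wt (r a) (r b) + wt (r c) (r d) = wt (r a) (r c) + wt (r b) (r d)"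
      using q wr lt dist unfolding quad_def by (simp add: ac_simps)
    moreover have "wt (r a) (r b) + wt (r c) (r d) < wt (r a) (r d) + wt (r b) (r c)"
    proof -
      have "wt (r a) (r b) + wt (r c) (r d) = (wt a b + wt c d) + (h a + h b + h c + h d)"
        using wr lt dist by (simp add: ac_simps)
      also have "\<dots> < (wt a d + wt b c) + (h a + h b + h c + h d)"
        by (rule add_strict_right_mono) (use q in \<open>unfold quad_def, blast\<close>)
      also have "\<dots> = wt (r a) (r d) + wt (r b) (r c)"
        using wr lt dist by (simp add: ac_simps)
      finally show ?thesis .
    qed
    ultimately show ?thesis by (simp add: quad_def)
  qed
  define E1 where "E1 = add_mset {r a, r b} (add_mset {r c, r d} G')"
  have E2_eq: "E2 = add_mset {r a, r c} (add_mset {r b, r d} G')"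
    using e1 e2 re1 re2 by simp
  show thesis
  proof (rule that[of E1])
    show "move k E1 E2" unfolding E1_def E2_eq
      by (rule moveI[OF _ rq]) (use rk lt in auto)
    show "free k E1" using E2(1) redge rcherry lt dist unfolding E1_def E2_eq free_def by simp
    show "image_mset (contract k) E1 = F1" using e2(3) contr lt dist unfolding E1_def F1 by simp
    have "k \<in> {r x, r y} \<longleftrightarrow> (x = i k \<or> y = i k) \<and> (k \<in> e1 \<or> k \<in> e2)" if "x < k" "y < k" for x y
      using that by (auto simp: r_def)
    then show "nnew k E1 = nnew k E2" using lt dist unfolding nnew_def E1_def E2_eq by auto
  qed
qed

text \<open>The chain is lifted from its end \<open>E'\<close>; the start of the lifted chain has
  the same contraction as \<open>E\<close>, and \<open>conn_contract_eq\<close> joins the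
  two.\<close>

lemma conn_lift:
  assumes "conn (k - 1) F F'" "free k E" "image_mset (contract k) E = F" "3 \<le> k" "k \<le> n"
    "free k E'" "image_mset (contract k) E' = F'" "nnew k E' = nnew k E"
  shows "conn k E E'"
  using assms(1,6-8)
proof (induction arbitrary: E' rule: rtranclp_induct)
  case base
  then show ?case using assms by (intro conn_contract_eq) auto
next
  case (step F1 F2)
  obtain E1 where "free k E1" "image_mset (contract k) E1 = F1" "nnew k E1 = nnew k E'" "move k E1 E'"
    using move_lift[OF step(2,4,5) assms(4,5)] by blast
  then show ?case using step.IH[of E1] step.prems by auto
qed

text \<open>The exponent of \<open>yi k\<close> is the multiplicity of the cherry, which can be
  removed from both sides; that of \<open>xi k\<close> is the number of remaining edges at
  \<open>k\<close>; the rest is the exponent of the contraction, to which the induction hypothesis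
  applies. On two leaves there is only one edge, and the size decides.\<close>

theorem mlead_eq_imp_conn:
  assumes "2 \<le> k" "k \<le> n" "set_mset E \<subseteq> edges k" "set_mset E' \<subseteq> edges k" "mlead E = mlead E'" "size E = size E'"
  shows "conn k E E'"
  using assms
proof (induction k arbitrary: E E' rule: dec_induct)
  case base
  have two: "{1..2::nat} = {1, 2}" by auto
  have "edges 2 \<subseteq> {{1, 2}}" unfolding edges_def two by (auto simp: insert_commute)
  then have "F = replicate_mset (size F) {1, 2}" if "set_mset F \<subseteq> edges 2" for F
    using that \<open>edges 2 \<subseteq> _\<close> by (metis order_trans set_mset_subset_singletonD)
  then have "E = E'" using base by metis
  then show ?case by simp
next
  case (step k')
  define k where "k = Suc k'"
  have k: "3 \<le> k" "k \<le> n" "k - 1 = k'" using step by (auto simp: k_def)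
  define A where "A = filter_mset (\<lambda>e. e \<noteq> {i k, k}) E"
  define A' where "A' = filter_mset (\<lambda>e. e \<noteq> {i k, k}) E'"
  have ed: "set_mset E \<subseteq> edges k" "set_mset E' \<subseteq> edges k" using step.prems by (auto simp: k_def)
  define y where "y = count E {i k, k}"
  have y': "count E' {i k, k} = y"
    using count_cherry[OF ed(1) k(1,2)] count_cherry[OF ed(2) k(1,2)] step.prems by (simp add: y_def)
  have E: "E = replicate_mset y {i k, k} + A"
    unfolding A_def y_def by (subst multiset_partition[of E "\<lambda>e. e = {i k, k}"]) (simp add: filter_eq_replicate_mset)
  have E': "E' = replicate_mset y {i k, k} + A'"
    unfolding A'_def y'[symmetric]
    by (subst multiset_partition[of E' "\<lambda>e. e = {i k, k}"]) (simp add: filter_eq_replicate_mset)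
  have fr: "free k A" "free k A'" using ed by (auto simp: free_def A_def A'_def)
  have ml: "mlead A = mlead A'" using step.prems(4) unfolding E E' by simp
  have nn: "nnew k A' = nnew k A"
    using lookup_mlead_free[OF fr(1) k(1,2)] lookup_mlead_free[OF fr(2) k(1,2)] ml by simp
  have "mlead (image_mset (contract k) A) = mlead (image_mset (contract k) A')"
    using mlead_contract[OF fr(1) k(1,2)] mlead_contract[OF fr(2) k(1,2)] ml nn by simp
  moreover have "size A = size A'" using step.prems(5) unfolding E E' by simp
  moreover have "set_mset (image_mset (contract k) F) \<subseteq> edges k'" if "free k F" for F
    using that contract_edges[OF _ _ k(1,2)] k(3) by (auto simp: free_def)
  ultimately have "conn k' (image_mset (contract k) A) (image_mset (contract k) A')"
    using step.IH fr step.prems(1) by auto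
  then have "conn k A A'"
    using conn_lift[of k _ _ A A'] k fr nn by auto
  then show ?case unfolding k_def[symmetric] E E' by (rule conn_union)
qed

end

section \<open>Subduction and initial ideals\<close>

definition mdeg :: "('v \<Rightarrow>\<^sub>0 nat) \<Rightarrow> nat" where
  "mdeg m = (\<Sum>v\<in>keys m. lookup m v)"

lemma mdeg_add: "mdeg (a + b) = mdeg a + mdeg b"
  unfolding mdeg_def by (rule setsum_keys_plus_distrib) auto

lemma mdeg_single [simp]: "mdeg (single v r) = r"
  by (simp add: mdeg_def)

lemma mdeg_zero [simp]: "mdeg 0 = 0"
  by (simp add: mdeg_def)

lemma homogeneous_mdeg: "homogeneous r f \<longleftrightarrow> (\<forall>m\<in>keys f. mdeg m = r)"
  by (simp add: homogeneous_def mdeg_def)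

lemma homogeneous_zero [simp]: "homogeneous r 0"
  by (simp add: homogeneous_def)

lemma homogeneous_add: "homogeneous r f \<Longrightarrow> homogeneous r g \<Longrightarrow> homogeneous r (f + g)"
  using Poly_Mapping.keys_add[of f g] by (auto simp: homogeneous_mdeg)

lemma homogeneous_uminus: "homogeneous r f \<Longrightarrow> homogeneous r (- f)"
  by (auto simp: homogeneous_mdeg in_keys_iff)

lemma homogeneous_diff: "homogeneous r f \<Longrightarrow> homogeneous r g \<Longrightarrow> homogeneous r (f - g)"
  using homogeneous_add[of r f "- g"] homogeneous_uminus[of r g] by simp

lemma homogeneous_sum: "(\<And>x. x \<in> A \<Longrightarrow> homogeneous r (f x)) \<Longrightarrow> homogeneous r (sum f A)"
  by (induction A rule: infinite_finite_induct) (auto intro: homogeneous_add)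

lemma homogeneous_mult: "homogeneous r f \<Longrightarrow> homogeneous s g \<Longrightarrow> homogeneous (r + s) (f * g)"
  unfolding homogeneous_mdeg by (auto simp: mdeg_add elim!: keys_multE)

lemma homogeneous_Const [simp]: "homogeneous 0 (Const c)"
  by (simp add: homogeneous_mdeg Const_def)

lemma homogeneous_Var [simp]: "homogeneous 1 (Var v)"
  by (simp add: homogeneous_mdeg Var_def)

lemma homogeneous_prod:
  "(\<And>x. x \<in> A \<Longrightarrow> homogeneous (r x) (f x)) \<Longrightarrow> homogeneous (sum r A) (prod f A)"
proof (induction A rule: infinite_finite_induct)
  case (insert x F) then show ?case by (simp add: homogeneous_mult)
qed (use homogeneous_Const[of 1] in simp_all)

lemma homogeneous_wpart: "homogeneous r f \<Longrightarrow> homogeneous r (wpart M c f)"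
  by (auto simp: homogeneous_mdeg keys_wpart)

lemma finite_monomials_degree:
  assumes "finite V"
  shows "finite {m :: 'v \<Rightarrow>\<^sub>0 nat. keys m \<subseteq> V \<and> mdeg m = r}" (is "finite ?A")
proof -
  let ?h = "\<lambda>m :: 'v \<Rightarrow>\<^sub>0 nat. restrict (lookup m) V"
  have "?h ` ?A \<subseteq> V \<rightarrow>\<^sub>E {..r}"
  proof (clarify, intro PiE_I)
    fix m :: "'v \<Rightarrow>\<^sub>0 nat" and v assume m: "keys m \<subseteq> V" "r = mdeg m" and "v \<in> V"
    show "?h m v \<in> {..mdeg m}"
    proof (cases "v \<in> keys m")
      case True
      then have "lookup m v \<le> mdeg m" unfolding mdeg_def by (intro member_le_sum) auto
      then show ?thesis using \<open>v \<in> V\<close> by simp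
    qed (use \<open>v \<in> V\<close> in \<open>simp add: in_keys_iff\<close>)
  qed auto
  then have "finite (?h ` ?A)" using assms by (meson finite_PiE finite_atMost finite_subset)
  moreover have "inj_on ?h ?A"
  proof (intro inj_onI poly_mapping_eqI)
    fix m m' :: "'v \<Rightarrow>\<^sub>0 nat" and v assume a: "m \<in> ?A" "m' \<in> ?A" "?h m = ?h m'"
    show "lookup m v = lookup m' v"
    proof (cases "v \<in> V")
      case True then show ?thesis using fun_cong[OF a(3), of v] by simp
    next
      case False
      then have "v \<notin> keys m" "v \<notin> keys m'" using a by auto
      then show ?thesis by (simp add: in_keys_iff)
    qed
  qed
  ultimately show ?thesis using finite_imageD by blast
qed

lemma finite_plucker_index: "finite (plucker_index n)"
  by (rule finite_subset[of _ "{1..n} \<times> {1..n}"]) (auto simp: plucker_index_def)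

lemma wpart_cong:
  assumes "\<And>m. m \<in> keys f \<Longrightarrow> M m = M' m"
  shows "wpart M c f = wpart M' c f"
proof (rule poly_mapping_eqI)
  fix m show "lookup (wpart M c f) m = lookup (wpart M' c f) m"
    using assms[of m] by (cases "m \<in> keys f") (auto simp: lookup_wpart in_keys_iff)
qed

lemma Const_uminus: "Const (- x) = - Const x"
  by (simp add: Const_def single_uminus)

context iterated_seq begin

lemma psi_wpart: "wpart M c (psi u) = psi (wpart (M \<circ> lmon) c u)"
proof (induction u rule: poly_mapping_linear_induct_UNIV)
  case (single m a) show ?case by (simp add: wpart_single psi_single)
qed (simp_all add: wpart_add psi_simps)

text \<open>The sign normalizes the variable: on an edge, \<open>psi\<close> takes it to a monomial
  with coefficient \<open>1\<close>. Hence the difference of two products \<open>qmon\<close> with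
  equal leading exponents lies in the kernel of \<open>psi\<close>.\<close>

definition qvar :: "nat set \<Rightarrow> (nat \<times> nat) cpoly" where
  "qvar e = Const (sg (Min e) (Max e)) * pvar (Min e) (Max e)"

lemma qvar_pair: "a \<noteq> b \<Longrightarrow> qvar {a, b} = Const (sg a b) * pvar a b"
proof (cases a b rule: linorder_cases)
  case greater
  then show ?thesis by (simp add: qvar_def pvar_swap[of a b] sg_swap[of a b] Const_uminus)
qed (auto simp: qvar_def)

abbreviation qmon :: "nat set multiset \<Rightarrow> (nat \<times> nat) cpoly" where
  "qmon E \<equiv> (\<Prod>e\<in>#E. qvar e)"

lemma qmon_exists:
  assumes "keys m \<subseteq> plucker_index n"
  shows "\<exists>E. set_mset E \<subseteq> edges n \<and> qmon E = single m (smon m) \<and> mlead E = lmon m \<and> size E = mdeg m"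
  using assms
proof (induction m rule: poly_mapping_linear_induct)
  case zero
  show ?case by (rule exI[of _ "{#}"]) (simp add: smon_def)
next
  case (single v r)
  obtain a b where v: "v = (a, b)" "1 \<le> a" "a < b" "b \<le> n" using single by (auto simp: plucker_index_def)
  have q: "qvar {a, b} = single (single (a, b) 1) (sg a b)"
    using v by (simp add: qvar_pair pvar_def Const_def Var_def mult_single)
  have "qmon (replicate_mset r {a, b}) = single (single v r) (smon (single v r))" for r
  proof (induction r)
    case (Suc r)
    then show ?case
      using smon_add[of "single v 1" "single v r"] by (simp add: q v(1) mult_single flip: single_add) (simp add: smon_def)
  qed (simp add: smon_def)
  moreover have "mlead (replicate_mset r {a, b}) = lmon (single v r)" for r
    using v by (induction r) (simp_all add: lmon_single elead_pair distrib_right)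
  moreover have "{a, b} \<in> edges n" using v by (fastforce simp: edges_def)
  ultimately show ?case by (intro exI[of _ "replicate_mset r {a, b}"]) auto
next
  case (add m m')
  then obtain E E' where "set_mset E \<subseteq> edges n" "qmon E = single m (smon m)" "mlead E = lmon m" "size E = mdeg m"
    "set_mset E' \<subseteq> edges n" "qmon E' = single m' (smon m')" "mlead E' = lmon m'" "size E' = mdeg m'"
    by blast
  then show ?case by (intro exI[of _ "E + E'"]) (auto simp: mult_single smon_add lmon_add mdeg_add)
qed

lemma lookup_tlead_dm:
  assumes "a \<in> {1..n}" "b \<in> {1..n}" "a \<noteq> b"
  shows "lookup (tlead a b) dm = 1"
proof -
  have "dm \<notin> keys (lead a b)" using keys_lead[OF assms] by auto
  then show ?thesis by (simp add: tlead_def lookup_add in_keys_iff)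
qed

lemma lookup_lmon_dm:
  assumes "keys m \<subseteq> plucker_index n"
  shows "lookup (lmon m) dm = mdeg m"
  using assms
proof (induction m rule: poly_mapping_linear_induct)
  case (single v r)
  then obtain a b where "v = (a, b)" "1 \<le> a" "a < b" "b \<le> n" by (auto simp: plucker_index_def)
  moreover have "lookup (of_nat r * p) dm = r * lookup p dm" for p :: "nat \<Rightarrow>\<^sub>0 nat" and r
    by (induction r) (simp_all add: distrib_right lookup_add)
  ultimately show ?case using lookup_tlead_dm[of a b] by (simp add: lmon_single)
qed (simp_all add: lmon_add lookup_add mdeg_add)

end

context weighted_seq begin

abbreviation Mp :: "(nat \<times> nat \<Rightarrow>\<^sub>0 nat) \<Rightarrow> 'g" where "Mp \<equiv> M \<circ> lmon"

lemma Mp_hom: "weight_hom Mp"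
  by (simp add: weight_hom_def lmon_add weight_hom_add[OF hom])

lemma pvar_weight: 
  assumes "a \<in> {1..n}" "b \<in> {1..n}" "a \<noteq> b"
  shows "m \<in> keys (pvar a b) \<Longrightarrow> Mp m = wt a b" "homogeneous 1 (pvar a b)"
  using assms by (auto simp: pvar_def Var_def lmon_single tlead_swap[of b a] homogeneous_mdeg
      in_keys_iff lookup_single when_def split: if_splits)

lemma qmon_weight:
  assumes "set_mset E \<subseteq> edges n"
  shows "weight_ge Mp (M (mlead E)) (qmon E) \<and> homogeneous (size E) (qmon E) \<and> qmon E \<in> carrier (plucker_poly_ring n)"
  using assms
proof (induction E)
  case empty
  show ?case using homogeneous_Const[of 1] by (simp add: weight_ge_def weight_hom_zero[OF hom])
next
  case (add e E)
  then obtain a b where ab: "a \<in> {1..n}" "b \<in> {1..n}" "a \<noteq> b" "e = {a, b}" by (auto simp: edges_def)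
  have "weight_ge Mp 0 (Const c)" for c by (simp add: weight_ge_def Const_def weight_hom_zero[OF hom])
  moreover have "weight_ge Mp (wt a b) (pvar a b)" using pvar_weight(1)[OF ab(1-3)] by (auto simp: weight_ge_def)
  ultimately have q: "weight_ge Mp (M (elead e)) (qvar e)"
    using weight_ge_mult[OF Mp_hom, of 0 "Const (sg a b)" "wt a b" "pvar a b"] ab
    by (simp add: qvar_pair elead_pair)
  have h: "homogeneous 1 (qvar e)"
    using homogeneous_mult[OF homogeneous_Const pvar_weight(2)[OF ab(1-3)], of "sg a b"] ab by (simp add: qvar_pair)
  have c: "qvar e \<in> carrier (plucker_poly_ring n)"
    unfolding ab(4) qvar_pair[OF ab(3)] by (intro cpoly_carrier_mult Const_carrier pvar_carrier ab(1,2))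
  have IH: "weight_ge Mp (M (mlead E)) (qmon E)" "homogeneous (size E) (qmon E)"
    "qmon E \<in> carrier (plucker_poly_ring n)"
    using add.IH add.prems by (auto simp: comp_def)
  show ?case
    using weight_ge_mult[OF Mp_hom q IH(1)] homogeneous_mult[OF h IH(2)] cpoly_carrier_mult[OF c IH(3)]
    by (simp add: weight_hom_add[OF hom] comp_def)
qed

text \<open>Agreement with the Pluecker ideal up to terms heavier than \<open>c\<close>. The witness
  has to be homogeneous of degree \<open>r\<close>, since subduction must stay in one
  degree.\<close>

definition small :: "nat \<Rightarrow> 'g \<Rightarrow> (nat \<times> nat) cpoly \<Rightarrow> bool" where
  "small r c f \<longleftrightarrow> (\<exists>g\<in>plucker_ideal n. homogeneous r g \<and> weight_gt Mp c (f - g))"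

lemma small_zero [simp]: "small r c 0"
  unfolding small_def using ideal_cpolyD(2)[OF ideal_plucker] by (intro bexI[of _ 0]) auto

lemma small_add: "small r c f \<Longrightarrow> small r c g \<Longrightarrow> small r c (f + g)"
  unfolding small_def
proof (elim bexE conjE)
  fix f' g' assume a: "f' \<in> plucker_ideal n" "g' \<in> plucker_ideal n" "homogeneous r f'" "homogeneous r g'"
    "weight_gt Mp c (f - f')" "weight_gt Mp c (g - g')"
  have "weight_gt Mp c (f + g - (f' + g'))"
    using weight_gt_add[OF a(5,6)] by (simp add: algebra_simps)
  then show "\<exists>h\<in>plucker_ideal n. homogeneous r h \<and> weight_gt Mp c (f + g - h)"
    using a homogeneous_add ideal_cpolyD(3)[OF ideal_plucker] by blast
qed

lemma small_sum: "(\<And>x. x \<in> A \<Longrightarrow> small r c (f x)) \<Longrightarrow> small r c (sum f A)"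
  by (induction A rule: infinite_finite_induct) (auto intro: small_add)

lemma weight_ge_Const: "weight_ge Mp 0 (Const a)"
  by (simp add: weight_ge_def Const_def weight_hom_zero[OF hom])

lemma weight_gt_Const_mult: "weight_gt Mp c f \<Longrightarrow> weight_gt Mp c (Const a * f)"
  using weight_gt_mult2[OF Mp_hom, of 0 "Const a" c f]
  by (simp add: weight_ge_def Const_def weight_hom_zero[OF hom])

lemma small_Const:
  assumes "small r c f" shows "small r c (Const a * f)"
proof -
  obtain g where g: "g \<in> plucker_ideal n" "homogeneous r g" "weight_gt Mp c (f - g)"
    using assms by (auto simp: small_def)
  have "weight_gt Mp c (Const a * f - Const a * g)"
    using weight_gt_Const_mult[OF g(3), of a] by (simp add: right_diff_distrib)
  moreover have "Const a * g \<in> plucker_ideal n" using g by (intro ideal_cpolyD(4)[OF ideal_plucker]) auto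
  moreover have "homogeneous r (Const a * g)" using homogeneous_mult[OF homogeneous_Const g(2), of a] by simp
  ultimately show ?thesis unfolding small_def by blast
qed

text \<open>The definition of \<open>quad\<close> only knows weights. But the lowest component of
  the Pluecker relation is the binomial formed by the first two products, and \<open>psi\<close>
  must annihilate it; a difference of two nonzero terms vanishes only if exponents and signs
  agree.\<close>

lemma quad_leading:
  assumes "{a, b, c, d} \<subseteq> {1..n}" "quad a b c d"
  shows "tlead a b + tlead c d = tlead a c + tlead b d" "sg a b * sg c d = sg a c * sg b d"
proof -
  have dist: "a \<noteq> b" "a \<noteq> c" "a \<noteq> d" "b \<noteq> c" "b \<noteq> d" "c \<noteq> d" using assms(2) by (auto simp: quad_def)
  have abcd: "a \<in> {1..n}" "b \<in> {1..n}" "c \<in> {1..n}" "d \<in> {1..n}" using assms(1) by auto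
  let ?w = "wt a b + wt c d"
  have keys_prod: "Mp m = wt x y + wt z u" if "m \<in> keys (pvar x y * pvar z u)"
    "x \<in> {1..n}" "y \<in> {1..n}" "x \<noteq> y" "z \<in> {1..n}" "u \<in> {1..n}" "z \<noteq> u" for m x y z u
    using that pvar_weight(1)[of x y] pvar_weight(1)[of z u]
    by (auto elim!: keys_multE simp: lmon_add weight_hom_add[OF hom])
  have w1: "wpart Mp ?w (pvar a b * pvar c d) = pvar a b * pvar c d"
    using keys_prod[of _ a b c d] abcd dist by (intro poly_mapping_eqI) (auto simp: lookup_wpart in_keys_iff)
  have w2: "wpart Mp ?w (pvar a c * pvar b d) = pvar a c * pvar b d"
    using keys_prod[of _ a c b d] abcd dist assms(2)
    by (intro poly_mapping_eqI) (auto simp: lookup_wpart in_keys_iff quad_def)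
  have gt: "weight_gt Mp ?w (pvar a d * pvar b c)"
    using keys_prod[of _ a d b c] abcd dist assms(2) by (auto simp: weight_gt_def quad_def)
  have "weight_ge Mp ?w (plucker_rel a b c d)"
    unfolding plucker_rel_def using gt weight_ge_wpart[of Mp ?w "pvar a b * pvar c d"]
      weight_ge_wpart[of Mp ?w "pvar a c * pvar b d"]
    unfolding w1 w2 by (intro weight_ge_add weight_ge_diff weight_gt_imp_ge[OF gt])
  from plucker_ideal_leading_part[OF plucker_rel_in_ideal[OF abcd] this]
  have "psi (pvar a b * pvar c d - pvar a c * pvar b d) = 0"
    unfolding plucker_rel_def wpart_add wpart_diff w1 w2 wpart_eq_0[OF gt] by simp
  then have eq: "single (tlead a b + tlead c d) (sg a b * sg c d) = single (tlead a c + tlead b d) (sg a c * sg b d)"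
    using abcd dist by (simp add: psi_simps psi_pvar mult_single)
  have nz: "sg a b * sg c d \<noteq> 0" using sg_cases[of a b] sg_cases[of c d] abcd dist by auto
  have "lookup (single (tlead a c + tlead b d) (sg a c * sg b d)) (tlead a b + tlead c d) \<noteq> 0"
    unfolding eq[symmetric] using nz by simp
  then show t: "tlead a b + tlead c d = tlead a c + tlead b d"
    by (simp add: lookup_single when_def split: if_splits)
  show "sg a b * sg c d = sg a c * sg b d"
    using arg_cong[OF eq, of "\<lambda>p. lookup p (tlead a b + tlead c d)"] unfolding t by simp
qed

text \<open>The witness is the Pluecker relation times the untouched edges. What remains is the
  third product, which is heavier by the inequality in \<open>quad\<close>.\<close>

lemma move_small:
  assumes "move n E E'" "set_mset E \<subseteq> edges n"
  shows "mlead E' = mlead E" "size E' = size E" "set_mset E' \<subseteq> edges n"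
    "small (size E) (M (mlead E)) (qmon E - qmon E')"
proof -
  obtain a b c d G where abcd: "{a, b, c, d} \<subseteq> {1..n}" and q: "quad a b c d"
    and E: "E = add_mset {a, b} (add_mset {c, d} G)" and E': "E' = add_mset {a, c} (add_mset {b, d} G)"
    using assms(1) unfolding move_def by blast
  have dist: "a \<noteq> b" "a \<noteq> c" "a \<noteq> d" "b \<noteq> c" "b \<noteq> d" "c \<noteq> d" using q by (auto simp: quad_def)
  have in_n: "a \<in> {1..n}" "b \<in> {1..n}" "c \<in> {1..n}" "d \<in> {1..n}" using abcd by auto
  note ql = quad_leading[OF abcd q]
  show "mlead E' = mlead E" using ql(1) dist unfolding E E' by (simp add: elead_pair add.assoc[symmetric])
  show "size E' = size E" unfolding E E' by simp
  have ed: "{x, y} \<in> edges n" if "x \<in> {1..n}" "y \<in> {1..n}" "x \<noteq> y" for x y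
    using that by (auto simp: edges_def)
  have G: "set_mset G \<subseteq> edges n" using assms(2) E by auto
  then show "set_mset E' \<subseteq> edges n" using ed in_n dist unfolding E' by simp
  let ?s = "sg a b * sg c d"
  define h where "h = Const ?s * qmon G"
  define g where "g = h * plucker_rel a b c d"
  have qG: "weight_ge Mp (M (mlead G)) (qmon G)" "homogeneous (size G) (qmon G)" "qmon G \<in> carrier (plucker_poly_ring n)"
    using qmon_weight[OF G] by auto
  have hh: "h \<in> carrier (plucker_poly_ring n)" "homogeneous (size G) h" "weight_ge Mp (M (mlead G)) h"
    using qG homogeneous_mult[OF homogeneous_Const qG(2), of ?s]
      weight_ge_mult[OF Mp_hom weight_ge_Const qG(1), of ?s] by (auto simp: h_def)
  have "qmon E = h * (pvar a b * pvar c d)"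
    using dist unfolding E h_def by (simp add: qvar_pair Const_mult ac_simps)
  moreover have "qmon E' = h * (pvar a c * pvar b d)"
    using dist unfolding E' h_def ql(2) by (simp add: qvar_pair Const_mult ac_simps)
  ultimately have diff: "qmon E - qmon E' - g = - (h * (pvar a d * pvar b c))"
    unfolding g_def plucker_rel_def by (simp add: algebra_simps)
  have pw: "weight_ge Mp (wt x y) (pvar x y)" if "x \<in> {1..n}" "y \<in> {1..n}" "x \<noteq> y" for x y
    using pvar_weight(1)[OF that] by (auto simp: weight_ge_def)
  have "weight_ge Mp (M (mlead G) + (wt a d + wt b c)) (h * (pvar a d * pvar b c))"
    by (intro weight_ge_mult Mp_hom hh pw in_n dist)
  moreover have "M (mlead E) < M (mlead G) + (wt a d + wt b c)"
  proof -
    have "wt a b + wt c d < wt a d + wt b c" using q unfolding quad_def by blast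
    from add_strict_left_mono[OF this, of "M (mlead G)"] show ?thesis
      using dist unfolding E by (simp add: elead_pair weight_hom_add[OF hom] ac_simps)
  qed
  ultimately have "weight_gt Mp (M (mlead E)) (qmon E - qmon E' - g)"
    unfolding diff weight_gt_uminus by (auto simp: weight_gt_def weight_ge_def)
  moreover have "g \<in> plucker_ideal n"
    unfolding g_def by (intro ideal_cpolyD(4)[OF ideal_plucker] plucker_rel_in_ideal in_n hh)
  moreover have "homogeneous (size E) g"
  proof -
    have "homogeneous 2 (pvar x y * pvar z u)" if "x \<in> {1..n}" "y \<in> {1..n}" "x \<noteq> y"
      "z \<in> {1..n}" "u \<in> {1..n}" "z \<noteq> u" for x y z u
      using homogeneous_mult[OF pvar_weight(2)[OF that(1-3)] pvar_weight(2)[OF that(4-6)]] by (simp add: numeral_2_eq_2)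
    then have "homogeneous 2 (plucker_rel a b c d)"
      unfolding plucker_rel_def using in_n dist by (intro homogeneous_add homogeneous_diff) auto
    from homogeneous_mult[OF hh(2) this] show ?thesis by (simp add: g_def E)
  qed
  ultimately show "small (size E) (M (mlead E)) (qmon E - qmon E')"
    unfolding small_def by blast
qed

lemma conn_small:
  assumes "conn n E E'" "set_mset E \<subseteq> edges n"
  shows "mlead E' = mlead E \<and> size E' = size E \<and> set_mset E' \<subseteq> edges n \<and>
    small (size E) (M (mlead E)) (qmon E - qmon E')"
  using assms(1)
proof (induction rule: rtranclp_induct)
  case base then show ?case using assms(2) by simp
next
  case (step F F')
  note ms = move_small[OF step(2)]
  have "small (size E) (M (mlead E)) ((qmon E - qmon F) + (qmon F - qmon F'))"
    using step(3) ms(4) by (intro small_add) auto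
  then show ?case using step(3) ms(1-3) by auto
qed

text \<open>Inside one fibre of \<open>lmon\<close>, being killed by \<open>psi\<close> means that
  the signed coefficients sum to zero. Then \<open>u\<close> is a combination of differences against
  one fixed monomial, and each difference is resolved by a chain of exchanges.\<close>

lemma kernel_small_lmon:
  assumes u: "u \<in> carrier (plucker_poly_ring n)" "psi u = 0" "\<And>m. m \<in> keys u \<Longrightarrow> lmon m = e"
  shows "small (lookup e dm) (M e) u"
proof (cases "u = 0")
  case False
  then obtain m0 where m0: "m0 \<in> keys u" by (metis all_not_in_conv keys_eq_empty)
  have idx: "keys m \<subseteq> plucker_index n" if "m \<in> keys u" for m using that u(1) by (auto simp: in_cpoly_carrier)
  have s2: "smon m * smon m = 1" if "m \<in> keys u" for m using smon_cases[OF idx[OF that]] by auto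
  let ?c = "\<lambda>m. lookup u m * smon m"
  have "psi u = (\<Sum>m\<in>keys u. psi (single m (lookup u m)))"
    by (subst poly_mapping_expand) (simp add: psi_simps)
  also have "\<dots> = (\<Sum>m\<in>keys u. single e (?c m))"
    by (intro sum.cong refl) (simp add: psi_single u(3))
  also have "\<dots> = single e (\<Sum>m\<in>keys u. ?c m)"
  proof -
    have "(\<Sum>m\<in>A. single e (f m)) = single e (sum f A)" for A and f :: "(nat \<times> nat \<Rightarrow>\<^sub>0 nat) \<Rightarrow> complex"
      by (induction A rule: infinite_finite_induct) (simp_all add: single_add)
    then show ?thesis .
  qed
  finally have "single e (\<Sum>m\<in>keys u. ?c m) = 0" using u(2) by simp
  then have sum0: "(\<Sum>m\<in>keys u. ?c m) = 0" by (metis lookup_single_eq lookup_zero)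
  have "u = (\<Sum>m\<in>keys u. single m (lookup u m))" by (rule poly_mapping_expand)
  also have "\<dots> = (\<Sum>m\<in>keys u. Const (?c m) * single m (smon m))"
    using s2 by (intro sum.cong refl) (simp add: Const_def mult_single mult.assoc)
  \<comment> \<open>The subtracted sum is the base monomial times the sum of all signed
    coefficients, which is zero.\<close>
  also have "\<dots> = (\<Sum>m\<in>keys u. Const (?c m) * (single m (smon m) - single m0 (smon m0)))"
  proof -
    have Csum: "(\<Sum>m\<in>A. Const (f m)) = Const (\<Sum>m\<in>A. f m)" for A and f :: "(nat \<times> nat \<Rightarrow>\<^sub>0 nat) \<Rightarrow> complex"
      by (induction A rule: infinite_finite_induct) (simp_all add: Const_add)
    have "(\<Sum>m\<in>keys u. Const (?c m) * single m0 (smon m0)) = 0"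
      unfolding sum_distrib_right[symmetric] Csum sum0 by simp
    then show ?thesis by (simp add: right_diff_distrib sum_subtractf)
  qed
  finally have ueq: "u = (\<Sum>m\<in>keys u. Const (?c m) * (single m (smon m) - single m0 (smon m0)))" .
  show ?thesis
  proof (subst ueq, intro small_sum small_Const)
    fix m assume m: "m \<in> keys u"
    obtain E where E: "set_mset E \<subseteq> edges n" "qmon E = single m (smon m)" "mlead E = lmon m" "size E = mdeg m"
      using qmon_exists[OF idx[OF m]] by blast
    obtain E0 where E0: "set_mset E0 \<subseteq> edges n" "qmon E0 = single m0 (smon m0)" "mlead E0 = lmon m0" "size E0 = mdeg m0"
      using qmon_exists[OF idx[OF m0]] by blast
    have deg: "mdeg m = lookup e dm" "mdeg m0 = lookup e dm"
      using lookup_lmon_dm[OF idx[OF m]] lookup_lmon_dm[OF idx[OF m0]] u(3)[OF m] u(3)[OF m0] by auto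
    have "conn n E E0"
      by (rule mlead_eq_imp_conn) (use n_ge E E0 deg u(3) m m0 in auto)
    from conn_small[OF this E(1)] show "small (lookup e dm) (M e) (single m (smon m) - single m0 (smon m0))"
      using E E0 deg u(3)[OF m] by simp
  qed
qed simp

text \<open>One weight may merge several fibres of \<open>lmon\<close>, but \<open>psi\<close> keeps
  them apart, so each fibre can be treated on its own and the witnesses added.\<close>

lemma kernel_small:
  assumes u: "u \<in> carrier (plucker_poly_ring n)" "psi u = 0" and w: "\<And>m. m \<in> keys u \<Longrightarrow> Mp m = c"
  shows "\<exists>g\<in>plucker_ideal n. weight_gt Mp c (u - g) \<and> (\<forall>r. homogeneous r u \<longrightarrow> homogeneous r g)"
proof -
  have "\<exists>g\<in>plucker_ideal n. weight_gt Mp c (wpart lmon e u - g) \<and> homogeneous (lookup e dm) g"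
    if "e \<in> lmon ` keys u" for e
  proof -
    have "small (lookup e dm) (M e) (wpart lmon e u)"
    proof (rule kernel_small_lmon)
      show "psi (wpart lmon e u) = 0"
        using psi_wpart[of id e u] u(2) by (simp add: comp_def id_def)
    qed (use u in \<open>auto simp: wpart_carrier keys_wpart\<close>)
    moreover have "M e = c" using that w by auto
    ultimately show ?thesis by (auto simp: small_def)
  qed
  then obtain g where g: "\<And>e. e \<in> lmon ` keys u \<Longrightarrow> g e \<in> plucker_ideal n \<and>
      weight_gt Mp c (wpart lmon e u - g e) \<and> homogeneous (lookup e dm) (g e)"
    by metis
  let ?g = "\<Sum>e\<in>lmon ` keys u. g e"
  have "u - ?g = (\<Sum>e\<in>lmon ` keys u. wpart lmon e u - g e)"
    by (subst (1) wpart_decompose[of u lmon]) (simp add: sum_subtractf)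
  moreover have "weight_gt Mp c (\<Sum>e\<in>lmon ` keys u. wpart lmon e u - g e)"
    by (rule weight_gt_sum) (use g in blast)
  ultimately have 1: "weight_gt Mp c (u - ?g)" by (simp only:)
  have 2: "?g \<in> plucker_ideal n"
    by (rule ideal_cpoly_sum[OF ideal_plucker]) (use g in blast)
  have 3: "homogeneous r ?g" if r: "homogeneous r u" for r
  proof (rule homogeneous_sum)
    fix e assume e: "e \<in> lmon ` keys u"
    then obtain m where "m \<in> keys u" "e = lmon m" by auto
    then have "lookup e dm = r"
      using lookup_lmon_dm[of m] u(1) r by (auto simp: in_cpoly_carrier homogeneous_mdeg)
    then show "homogeneous r (g e)" using g[OF e] by simp
  qed
  show ?thesis by (intro bexI[of _ ?g] conjI 1 2 allI impI 3)
qed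

text \<open>Replacing the lowest part as long as its image under \<^term>\<open>psi\<close> vanishes stops, since only
  finitely many weights occur in a fixed degree.\<close>

theorem subduction:
  assumes f: "f \<in> carrier (plucker_poly_ring n)" "homogeneous r f" "f \<notin> plucker_ideal n"
  shows "\<exists>f' c. f' \<in> carrier (plucker_poly_ring n) \<and> homogeneous r f' \<and> f - f' \<in> plucker_ideal n \<and>
    weight_ge Mp c f' \<and> psi (wpart Mp c f') \<noteq> 0"
proof -
  define W where "W = Mp ` {m. keys m \<subseteq> plucker_index n \<and> mdeg m = r}"
  have finW: "finite W"
    unfolding W_def by (intro finite_imageI finite_monomials_degree finite_plucker_index)
  show ?thesis
    using f
  proof (induction "card {x \<in> W. Min (Mp ` keys f) \<le> x}" arbitrary: f rule: less_induct)
    case less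
    let ?c = "Min (Mp ` keys f)"
    have min: "?c \<in> Mp ` keys p \<and> weight_ge Mp ?c p" if "p \<notin> plucker_ideal n" "?c = Min (Mp ` keys p)" for p
    proof -
      have "keys p \<noteq> {}" using that(1) ideal_cpolyD(2)[OF ideal_plucker] by auto
      then show ?thesis using that(2) by (auto simp: weight_ge_def)
    qed
    have c: "?c \<in> Mp ` keys f" "weight_ge Mp ?c f" using min[OF less.prems(3)] by auto
    show ?case
    proof (cases "psi (wpart Mp ?c f) = 0")
      case False
      then show ?thesis using less.prems c ideal_cpolyD(2)[OF ideal_plucker]
        by (intro exI[of _ f] exI[of _ ?c]) auto
    next
      case True
      have "\<exists>g\<in>plucker_ideal n. weight_gt Mp ?c (wpart Mp ?c f - g) \<and>
          (\<forall>r. homogeneous r (wpart Mp ?c f) \<longrightarrow> homogeneous r g)"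
        by (rule kernel_small[OF wpart_carrier[OF less.prems(1)] True]) (simp add: keys_wpart)
      then obtain g where g0: "g \<in> plucker_ideal n" and g1: "weight_gt Mp ?c (wpart Mp ?c f - g) \<and>
          (\<forall>r. homogeneous r (wpart Mp ?c f) \<longrightarrow> homogeneous r g)"
        by (rule bexE)
      note g = g0 conjunct1[OF g1]
      have gr: "homogeneous r g"
        by (rule conjunct2[OF g1, rule_format, OF homogeneous_wpart[OF less.prems(2)]])
      let ?f = "f - g"
      have gc: "g \<in> carrier (plucker_poly_ring n)" using g(1) ideal_cpolyD(1)[OF ideal_plucker] by auto
      have f2: "?f \<in> carrier (plucker_poly_ring n)" "homogeneous r ?f"
        using less.prems(1) gc homogeneous_diff[OF less.prems(2) gr] by auto
      have ni: "?f \<notin> plucker_ideal n"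
        using less.prems(3) g(1) ideal_cpolyD(3)[OF ideal_plucker, of ?f n g] by auto
      have gt: "weight_gt Mp ?c ?f"
        using weight_gt_add[OF weight_gt_diff_wpart[OF c(2)] g(2)] by simp
      have ne: "keys ?f \<noteq> {}" using ni ideal_cpolyD(2)[OF ideal_plucker] by auto
      have lt: "?c < Min (Mp ` keys ?f)" using gt ne by (auto simp: weight_gt_def)
      have cW: "?c \<in> W" using c(1) less.prems by (auto simp: W_def in_cpoly_carrier homogeneous_mdeg)
      have "{x \<in> W. Min (Mp ` keys ?f) \<le> x} \<subset> {x \<in> W. ?c \<le> x}"
      proof (rule psubsetI)
        show "{x \<in> W. Min (Mp ` keys ?f) \<le> x} \<subseteq> {x \<in> W. ?c \<le> x}"
          using less_le_trans[OF lt] by (blast intro: less_imp_le)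
        have "?c \<notin> {x \<in> W. Min (Mp ` keys ?f) \<le> x}" using lt leD by blast
        moreover have "?c \<in> {x \<in> W. ?c \<le> x}" using cW by blast
        ultimately show "{x \<in> W. Min (Mp ` keys ?f) \<le> x} \<noteq> {x \<in> W. ?c \<le> x}" by metis
      qed
      then have "card {x \<in> W. Min (Mp ` keys ?f) \<le> x} < card {x \<in> W. ?c \<le> x}"
        using finW by (intro psubset_card_mono) auto
      from less.hyps[OF this f2 ni] obtain f' c' where f': "f' \<in> carrier (plucker_poly_ring n)" "homogeneous r f'"
        "?f - f' \<in> plucker_ideal n" "weight_ge Mp c' f'" "psi (wpart Mp c' f') \<noteq> 0" by blast
      have "f - f' = (?f - f') + g" by simp
      then have "f - f' \<in> plucker_ideal n"
        using ideal_cpolyD(3)[OF ideal_plucker f'(3) g(1)] by simp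
      then show ?thesis using f' by blast
    qed
  qed
qed

text \<open>In each degree the Pluecker ideal is the full kernel of the parametrization: otherwise
  subduction would produce a representative whose image has a nonzero lowest component. Hence
  nonzero homogeneous classes have nonzero images, and their valuation makes sense.\<close>

theorem phi_eq_0_imp_ideal:
  assumes "f \<in> carrier (plucker_poly_ring n)" "homogeneous r f" "phi f = 0"
  shows "f \<in> plucker_ideal n"
proof (rule ccontr)
  assume "f \<notin> plucker_ideal n"
  from subduction[OF assms(1,2) this] obtain f' c where f': "f' \<in> carrier (plucker_poly_ring n)"
    "f - f' \<in> plucker_ideal n" "weight_ge Mp c f'" "psi (wpart Mp c f') \<noteq> 0" by blast
  have "phi f' = 0" using phi_plucker_ideal[OF f'(2)] assms(3) by (simp add: phi_simps)
  then show False using wpart_phi[OF f'(1,3)] f'(4) by simp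
qed

end

section \<open>Initial forms and initial ideals for real weights\<close>

lemma monomial_weight_add: "monomial_weight w (a + b) = monomial_weight w a + monomial_weight w b"
  unfolding monomial_weight_def
  using setsum_keys_plus_distrib[of "\<lambda>v r. w v * real r" a b] by (simp add: distrib_left)

lemma weight_hom_monomial_weight: "weight_hom (monomial_weight w)"
  by (simp add: weight_hom_def monomial_weight_add)

lemma monomial_weight_single [simp]: "monomial_weight w (single v r) = w v * real r"
  by (simp add: monomial_weight_def)

lemma initial_form_zero [simp]: "initial_form w 0 = 0"
  by (simp add: initial_form_def)

lemma initial_form_eq_wpart:
  fixes f :: "'v cpoly" and w
  assumes "f \<noteq> 0"
  defines "c \<equiv> Min (monomial_weight w ` keys f)"
  shows "initial_form w f = wpart (monomial_weight w) c f" "weight_ge (monomial_weight w) c f"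
    "\<exists>m\<in>keys f. monomial_weight w m = c"
proof -
  have ne: "keys f \<noteq> {}" using assms by simp
  then show "weight_ge (monomial_weight w) c f" by (auto simp: weight_ge_def c_def)
  have "c \<in> monomial_weight w ` keys f" unfolding c_def using ne by (intro Min_in) auto
  then show ex: "\<exists>m\<in>keys f. monomial_weight w m = c" by auto
  have "{m \<in> keys f. \<forall>m'\<in>keys f. monomial_weight w m \<le> monomial_weight w m'} = keys (wpart (monomial_weight w) c f)"
  proof -
    obtain m0 where m0: "m0 \<in> keys f" "monomial_weight w m0 = c" using ex by blast
    have ge: "c \<le> monomial_weight w m" if "m \<in> keys f" for m
      using \<open>weight_ge _ c f\<close> that by (simp add: weight_ge_def)
    have "(\<forall>m'\<in>keys f. monomial_weight w m \<le> monomial_weight w m') \<longleftrightarrow> monomial_weight w m = c"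
      if "m \<in> keys f" for m
      using ge[OF that] ge m0 by (metis order_antisym)
    then show ?thesis unfolding keys_wpart by blast
  qed
  then have "initial_form w f = (\<Sum>m\<in>keys (wpart (monomial_weight w) c f). single m (lookup f m))"
    by (simp add: initial_form_def)
  also have "\<dots> = (\<Sum>m\<in>keys (wpart (monomial_weight w) c f). single m (lookup (wpart (monomial_weight w) c f) m))"
    by (intro sum.cong refl) (auto simp: lookup_wpart keys_wpart)
  also have "\<dots> = wpart (monomial_weight w) c f" by (rule poly_mapping_expand[symmetric])
  finally show "initial_form w f = wpart (monomial_weight w) c f" .
qed

lemma initial_forms_carrier: "initial_form w ` plucker_ideal n \<subseteq> carrier (plucker_poly_ring n)"
proof clarify
  fix f assume "f \<in> plucker_ideal n"
  then show "initial_form w f \<in> carrier (plucker_poly_ring n)"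
    using ideal_cpolyD(1)[OF ideal_plucker] initial_form_eq_wpart(1)[of f w]
    by (cases "f = 0") (auto simp: wpart_carrier subset_iff)
qed

lemma ideal_initial: "ideal (initial_ideal n w) (plucker_poly_ring n)"
  unfolding initial_ideal_def by (rule ring.genideal_ideal[OF ring_cpoly initial_forms_carrier])

text \<open>Every lower bound \<open>c\<close> is allowed: if it is not attained, the component is
  zero. Later arguments can therefore use components instead of minima over supports.\<close>

lemma wpart_in_initial_ideal:
  assumes "f \<in> plucker_ideal n" "weight_ge (monomial_weight w) c f"
  shows "wpart (monomial_weight w) c f \<in> initial_ideal n w"
proof (cases "wpart (monomial_weight w) c f = 0")
  case True then show ?thesis using ideal_cpolyD(2)[OF ideal_initial] by simp
next
  case False
  then obtain m where m: "m \<in> keys f" "monomial_weight w m = c"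
    using keys_wpart[of "monomial_weight w" c f] keys_eq_empty[of "wpart (monomial_weight w) c f"] by blast
  then have "f \<noteq> 0" by auto
  moreover have "Min (monomial_weight w ` keys f) = c"
    using m assms(2) by (intro Min_eqI) (auto simp: weight_ge_def)
  ultimately have "initial_form w f = wpart (monomial_weight w) c f" using initial_form_eq_wpart(1) by metis
  then show ?thesis
    using ring.genideal_self[OF ring_cpoly initial_forms_carrier, of w n] assms(1)
    unfolding initial_ideal_def by auto
qed

lemma initial_ideal_subset:
  assumes "ideal J (plucker_poly_ring n)"
    "\<And>f c. f \<in> plucker_ideal n \<Longrightarrow> weight_ge (monomial_weight w) c f \<Longrightarrow> wpart (monomial_weight w) c f \<in> J"
  shows "initial_ideal n w \<subseteq> J"
  unfolding initial_ideal_def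
proof (rule ring.genideal_minimal[OF ring_cpoly assms(1)], clarify)
  fix f assume "f \<in> plucker_ideal n"
  then show "initial_form w f \<in> J"
    using assms(2) initial_form_eq_wpart[of f w] ideal_cpolyD(2)[OF assms(1)] by (cases "f = 0") auto
qed

text \<open>The kernel of \<open>psi\<close> is homogeneous for the weight, so its elements may be
  split into components; a component killed by \<open>psi\<close> is, by
  \<open>kernel_small\<close>, the lowest component of an element of the Pluecker ideal. The other
  inclusion is \<open>plucker_ideal_leading_part\<close>.\<close>

theorem initial_ideal_eq_kernel:
  fixes M :: "(nat \<Rightarrow>\<^sub>0 nat) \<Rightarrow> real"
  assumes ws: "weighted_seq n i j M"
    and w: "\<And>a b. 1 \<le> a \<Longrightarrow> a < b \<Longrightarrow> b \<le> n \<Longrightarrow> w (a, b) = M (iterated_seq.tlead n i j a b)"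
  shows "initial_ideal n w = {f \<in> carrier (plucker_poly_ring n). iterated_seq.psi n i j f = 0}" (is "_ = ?K")
proof -
  interpret weighted_seq n i j M by fact
  have mw: "monomial_weight w m = Mp m" if "keys m \<subseteq> plucker_index n" for m
    using that
  proof (induction m rule: poly_mapping_linear_induct)
    case (single v r)
    have "M (of_nat r * p) = M p * real r" for r p
      by (induction r) (simp_all add: weight_hom_zero[OF hom] weight_hom_add[OF hom] algebra_simps)
    then show ?case using single w by (auto simp: plucker_index_def lmon_single)
  qed (simp_all add: monomial_weight_add lmon_add weight_hom_add[OF hom] weight_hom_zero[OF hom] monomial_weight_def[of w 0])
  have wp: "wpart (monomial_weight w) c f = wpart Mp c f" "weight_ge (monomial_weight w) c f = weight_ge Mp c f"
    if "f \<in> carrier (plucker_poly_ring n)" for f c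
  proof -
    have *: "monomial_weight w m = Mp m" if "m \<in> keys f" for m
      using that \<open>f \<in> _\<close> by (intro mw) (auto simp: in_cpoly_carrier)
    show "wpart (monomial_weight w) c f = wpart Mp c f" by (rule wpart_cong) (rule *)
    show "weight_ge (monomial_weight w) c f = weight_ge Mp c f" using * by (auto simp: weight_ge_def)
  qed
  have Ic: "f \<in> plucker_ideal n \<Longrightarrow> f \<in> carrier (plucker_poly_ring n)" for f
    using ideal_cpolyD(1)[OF ideal_plucker] by auto
  show ?thesis
  proof
    show "initial_ideal n w \<subseteq> ?K"
    proof (rule initial_ideal_subset)
      show "ideal ?K (plucker_poly_ring n)" unfolding psi_def by (rule cpoly_eval_kernel_ideal) simp
      fix f c assume f: "f \<in> plucker_ideal n" "weight_ge (monomial_weight w) c f"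
      then show "wpart (monomial_weight w) c f \<in> ?K"
        using plucker_ideal_leading_part[of f c] Ic[OF f(1)] wp[OF Ic[OF f(1)]] by (auto simp: wpart_carrier)
    qed
    show "?K \<subseteq> initial_ideal n w"
    proof clarify
      fix u assume u: "u \<in> carrier (plucker_poly_ring n)" "psi u = 0"
      have "wpart Mp c u \<in> initial_ideal n w" for c
      proof -
        have "psi (wpart Mp c u) = 0" using psi_wpart[of M c u] u(2) by simp
        then obtain g where g: "g \<in> plucker_ideal n" "weight_gt Mp c (wpart Mp c u - g)"
          using kernel_small[of "wpart Mp c u" c] u(1) by (auto simp: wpart_carrier keys_wpart)
        have "weight_ge Mp c g"
          using weight_ge_diff[OF weight_ge_wpart weight_gt_imp_ge[OF g(2)], of u] by simp
        moreover have "wpart Mp c g = wpart Mp c u"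
          using wpart_eq_0[OF g(2)] by (simp add: wpart_diff wpart_wpart)
        ultimately show ?thesis
          using wpart_in_initial_ideal[OF g(1), of w c] wp[OF Ic[OF g(1)]] by simp
      qed
      then have "(\<Sum>c\<in>Mp ` keys u. wpart Mp c u) \<in> initial_ideal n w"
        by (intro ideal_cpoly_sum[OF ideal_initial])
      then show "u \<in> initial_ideal n w" by (subst wpart_decompose[of u Mp])
    qed
  qed
qed

section \<open>Associated graded rings\<close>

text \<open>An associated graded ring whose graded pieces are detected by maps \<open>p g\<close> with independent
  images embeds into the common target of these maps.\<close>

locale graded_realization = A: cring A
  for A :: "('a, 'm) ring_scheme" (structure) +
  fixes G :: "'g::comm_monoid_add set" and F F' :: "'g \<Rightarrow> 'a set" and p :: "'g \<Rightarrow> 'a \<Rightarrow> 'b::comm_ring_1"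
  assumes G_zero: "0 \<in> G" and G_add: "g \<in> G \<Longrightarrow> h \<in> G \<Longrightarrow> g + h \<in> G"
    and F_carrier: "g \<in> G \<Longrightarrow> X \<in> F g \<Longrightarrow> X \<in> carrier A"
    and F_zero: "g \<in> G \<Longrightarrow> \<zero> \<in> F g"
    and F_add: "g \<in> G \<Longrightarrow> X \<in> F g \<Longrightarrow> Y \<in> F g \<Longrightarrow> X \<oplus> Y \<in> F g"
    and F_neg: "g \<in> G \<Longrightarrow> X \<in> F g \<Longrightarrow> \<ominus> X \<in> F g"
    and F'_iff: "g \<in> G \<Longrightarrow> X \<in> F' g \<longleftrightarrow> X \<in> F g \<and> p g X = 0"
    and p_add: "g \<in> G \<Longrightarrow> X \<in> F g \<Longrightarrow> Y \<in> F g \<Longrightarrow> p g (X \<oplus> Y) = p g X + p g Y"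
    and F_mult: "g \<in> G \<Longrightarrow> h \<in> G \<Longrightarrow> X \<in> F g \<Longrightarrow> Y \<in> F h \<Longrightarrow> X \<otimes> Y \<in> F (g + h)"
    and p_mult: "g \<in> G \<Longrightarrow> h \<in> G \<Longrightarrow> X \<in> F g \<Longrightarrow> Y \<in> F h \<Longrightarrow> p (g + h) (X \<otimes> Y) = p g X * p h Y"
    and F_one: "\<one> \<in> F 0" and p_one: "p 0 \<one> = 1"
    and indep: "finite B \<Longrightarrow> B \<subseteq> G \<Longrightarrow> (\<And>g. g \<in> B \<Longrightarrow> Xs g \<in> F g) \<Longrightarrow> (\<Sum>g\<in>B. p g (Xs g)) = 0 \<Longrightarrow>
      g \<in> B \<Longrightarrow> p g (Xs g) = 0"
begin

abbreviation "Gr \<equiv> assoc_graded_ring A G F F'"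
abbreviation cs :: "'g \<Rightarrow> 'a \<Rightarrow> 'a set" where "cs g X \<equiv> F' g +> X"

definition realize :: "('g \<Rightarrow> 'a set) \<Rightarrow> 'b" where
  "realize x = (\<Sum>g\<in>{g \<in> G. x g \<noteq> F' g}. p g (coset_rep (x g)))"

lemma p_zero: "g \<in> G \<Longrightarrow> p g \<zero> = 0"
  using p_add[of g \<zero> \<zero>] F_zero[of g] by simp

lemma p_neg: "g \<in> G \<Longrightarrow> X \<in> F g \<Longrightarrow> p g (\<ominus> X) = - p g X"
  using p_add[of g X "\<ominus> X"] F_neg[of g X] F_carrier[of g X] p_zero[of g]
  by (simp add: A.r_neg add_eq_0_iff)

lemma cs_iff: "Y \<in> cs g X \<longleftrightarrow> (\<exists>Z\<in>F' g. Y = Z \<oplus> X)"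
  by (auto simp: a_r_coset_def r_coset_def)

lemma F'_zero: "g \<in> G \<Longrightarrow> \<zero> \<in> F' g"
  by (simp add: F'_iff F_zero p_zero)

lemma cs_self: "g \<in> G \<Longrightarrow> X \<in> F g \<Longrightarrow> X \<in> cs g X"
  unfolding cs_iff using F'_zero[of g] F_carrier[of g X] by (intro bexI[of _ \<zero>]) auto

text \<open>Cosets are the fibres of \<open>p g\<close> on \<open>F g\<close>. From here on
  computations with cosets become equations in the common target.\<close>

lemma cs_mem:
  assumes "g \<in> G" "X \<in> F g"
  shows "Y \<in> cs g X \<longleftrightarrow> Y \<in> F g \<and> p g Y = p g X"
proof
  assume "Y \<in> cs g X"
  then obtain Z where "Z \<in> F' g" "Y = Z \<oplus> X" unfolding cs_iff by blast
  then show "Y \<in> F g \<and> p g Y = p g X" using assms by (simp add: F'_iff F_add p_add)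
next
  assume Y: "Y \<in> F g \<and> p g Y = p g X"
  have "Y \<oplus> \<ominus> X \<in> F' g"
    using Y assms by (simp add: F'_iff F_add F_neg p_add p_neg)
  moreover have "Y = (Y \<oplus> \<ominus> X) \<oplus> X"
    using Y assms F_carrier[of g Y] F_carrier[of g X] by (simp add: A.a_assoc A.l_neg)
  ultimately show "Y \<in> cs g X" unfolding cs_iff by blast
qed

lemma cs_eq_iff:
  assumes "g \<in> G" "X \<in> F g" "Y \<in> F g"
  shows "cs g X = cs g Y \<longleftrightarrow> p g X = p g Y"
proof
  assume "cs g X = cs g Y"
  then have "X \<in> cs g Y" using cs_self[OF assms(1,2)] by simp
  then show "p g X = p g Y" using cs_mem[OF assms(1,3), of X] by simp
next
  assume eq: "p g X = p g Y"
  show "cs g X = cs g Y"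
    by (rule Set.set_eqI) (simp only: cs_mem[OF assms(1,2)] cs_mem[OF assms(1,3)] eq)
qed

lemma cs_zero:
  assumes "g \<in> G" shows "cs g \<zero> = F' g"
  by (rule Set.set_eqI)
    (simp only: cs_mem[OF assms F_zero[OF assms]] p_zero[OF assms] F'_iff[OF assms])

lemma cs_eq_F': "g \<in> G \<Longrightarrow> X \<in> F g \<Longrightarrow> cs g X = F' g \<longleftrightarrow> p g X = 0"
  using cs_eq_iff[of g X \<zero>] cs_zero[of g] by (simp add: F_zero p_zero)

lemma rep:
  assumes "g \<in> G" "X \<in> F g"
  shows "coset_rep (cs g X) \<in> F g" "p g (coset_rep (cs g X)) = p g X"
proof -
  have "coset_rep (cs g X) \<in> cs g X"
    unfolding coset_rep_def using cs_self[OF assms] by (rule someI)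
  then show "coset_rep (cs g X) \<in> F g" "p g (coset_rep (cs g X)) = p g X"
    using cs_mem[OF assms] by auto
qed

text \<open>Computes a realization from arbitrary representatives and any sufficiently large finite
  index set, so that the representatives chosen inside \<open>realize\<close> never matter.\<close>

lemma realize_eq:
  assumes Z: "\<And>g. g \<in> G \<Longrightarrow> Z g \<in> F g" "\<And>g. g \<in> G \<Longrightarrow> z g = cs g (Z g)"
    and B: "finite B" "B \<subseteq> G" "\<And>g. g \<in> G \<Longrightarrow> p g (Z g) \<noteq> 0 \<Longrightarrow> g \<in> B"
  shows "realize z = (\<Sum>g\<in>B. p g (Z g))"
proof -
  have "z g \<noteq> F' g \<longleftrightarrow> p g (Z g) \<noteq> 0" if "g \<in> G" for g
    using Z(2)[OF that] cs_eq_F'[OF that Z(1)[OF that]] by simp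
  then have "{g \<in> G. z g \<noteq> F' g} = {g \<in> G. p g (Z g) \<noteq> 0}"
    by blast
  then have "realize z = (\<Sum>g\<in>{g \<in> G. p g (Z g) \<noteq> 0}. p g (coset_rep (z g)))"
    by (simp add: realize_def)
  also have "\<dots> = (\<Sum>g\<in>{g \<in> G. p g (Z g) \<noteq> 0}. p g (Z g))"
    by (rule sum.cong[OF refl]) (use Z rep(2) in simp)
  also have "\<dots> = (\<Sum>g\<in>B. p g (Z g))"
    using B by (intro sum.mono_neutral_left) auto
  finally show ?thesis .
qed

lemma carrier_rep:
  assumes "x \<in> carrier Gr" "g \<in> G"
  shows "coset_rep (x g) \<in> F g" "x g = cs g (coset_rep (x g))"
    "x g \<noteq> F' g \<longleftrightarrow> p g (coset_rep (x g)) \<noteq> 0"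
proof -
  have "x g \<in> {cs g f | f. f \<in> F g}"
    using assms unfolding assoc_graded_ring_def by (auto simp: PiE_iff)
  then obtain X where X: "X \<in> F g" "x g = cs g X" by blast
  show r: "coset_rep (x g) \<in> F g" using rep(1)[OF assms(2) X(1)] X by simp
  show e: "x g = cs g (coset_rep (x g))"
    using rep(2)[OF assms(2) X(1)] cs_eq_iff[OF assms(2) X(1) r] X by simp
  show "x g \<noteq> F' g \<longleftrightarrow> p g (coset_rep (x g)) \<noteq> 0"
    using cs_eq_F'[OF assms(2) r] e by simp
qed

definition supp :: "('g \<Rightarrow> 'a set) \<Rightarrow> 'g set" where
  "supp x = {g \<in> G. x g \<noteq> F' g}"

lemma finite_supp: "x \<in> carrier Gr \<Longrightarrow> finite (supp x)"
  by (simp add: assoc_graded_ring_def supp_def)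

lemma supp_G: "supp x \<subseteq> G"
  by (auto simp: supp_def)

lemma realize_carrier:
  assumes "x \<in> carrier Gr" "finite B" "supp x \<subseteq> B" "B \<subseteq> G"
  shows "realize x = (\<Sum>g\<in>B. p g (coset_rep (x g)))"
proof (rule realize_eq)
  fix g assume g: "g \<in> G"
  show "coset_rep (x g) \<in> F g" "x g = cs g (coset_rep (x g))"
    by (rule carrier_rep[OF assms(1) g])+
  assume "p g (coset_rep (x g)) \<noteq> 0"
  then have "g \<in> supp x" using carrier_rep(3)[OF assms(1) g] g by (simp add: supp_def)
  then show "g \<in> B" using assms(3) by blast
qed (use assms in auto)

lemma realize_add:
  assumes "x \<in> carrier Gr" "y \<in> carrier Gr"
  shows "realize (x \<oplus>\<^bsub>Gr\<^esub> y) = realize x + realize y"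
proof -
  let ?B = "supp x \<union> supp y" and ?X = "\<lambda>g. coset_rep (x g)" and ?Y = "\<lambda>g. coset_rep (y g)"
  have B: "finite ?B" "?B \<subseteq> G" using assms finite_supp supp_G by auto
  have "realize (x \<oplus>\<^bsub>Gr\<^esub> y) = (\<Sum>g\<in>?B. p g (?X g \<oplus> ?Y g))"
  proof (rule realize_eq)
    fix g assume g: "g \<in> G"
    note X = carrier_rep[OF assms(1) g] and Y = carrier_rep[OF assms(2) g]
    show "?X g \<oplus> ?Y g \<in> F g" using X Y g F_add by blast
    \<comment> \<open>Addition in the graded ring is the elementwise sum of cosets. For the less
      obvious inclusion \<open>u\<close> is written as its difference with the second representative
      plus that representative.\<close>
    have "u \<in> cs g (?X g \<oplus> ?Y g) \<longleftrightarrow> (\<exists>a\<in>cs g (?X g). \<exists>b\<in>cs g (?Y g). u = a \<oplus> b)" for u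
    proof
      assume u: "u \<in> cs g (?X g \<oplus> ?Y g)"
      then have u': "u \<in> F g" "p g u = p g (?X g) + p g (?Y g)"
        using cs_mem[OF g F_add[OF g X(1) Y(1)]] p_add[OF g X(1) Y(1)] by auto
      have "u = (u \<oplus> \<ominus> ?Y g) \<oplus> ?Y g"
        using F_carrier[OF g u'(1)] F_carrier[OF g Y(1)] by (simp add: A.a_assoc A.l_neg)
      moreover have "u \<oplus> \<ominus> ?Y g \<in> cs g (?X g)"
        using u' F_add[OF g u'(1) F_neg[OF g Y(1)]] p_add[OF g u'(1) F_neg[OF g Y(1)]] p_neg[OF g Y(1)]
          cs_mem[OF g X(1)] by simp
      moreover have "?Y g \<in> cs g (?Y g)" using cs_self[OF g Y(1)] .
      ultimately show "\<exists>a\<in>cs g (?X g). \<exists>b\<in>cs g (?Y g). u = a \<oplus> b" by blast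
    next
      assume "\<exists>a\<in>cs g (?X g). \<exists>b\<in>cs g (?Y g). u = a \<oplus> b"
      then obtain a b where ab: "a \<in> cs g (?X g)" "b \<in> cs g (?Y g)" "u = a \<oplus> b" by blast
      then have "a \<in> F g" "b \<in> F g" "p g a = p g (?X g)" "p g b = p g (?Y g)"
        using cs_mem[OF g X(1)] cs_mem[OF g Y(1)] by auto
      then show "u \<in> cs g (?X g \<oplus> ?Y g)"
        using cs_mem[OF g F_add[OF g X(1) Y(1)]] F_add[OF g] p_add[OF g] X(1) Y(1) ab(3) by simp
    qed
    then have "x g <+> y g = cs g (?X g \<oplus> ?Y g)"
      unfolding set_add_def set_mult_def by (subst X(2), subst Y(2)) auto
    then show "(x \<oplus>\<^bsub>Gr\<^esub> y) g = cs g (?X g \<oplus> ?Y g)"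
      using g by (simp add: assoc_graded_ring_def)
    assume "p g (?X g \<oplus> ?Y g) \<noteq> 0"
    then show "g \<in> ?B" using p_add[OF g X(1) Y(1)] X(3) Y(3) g by (auto simp: supp_def)
  qed (use B in auto)
  also have "\<dots> = (\<Sum>g\<in>?B. p g (?X g) + p g (?Y g))"
  proof (rule sum.cong[OF refl])
    fix g assume "g \<in> ?B"
    then have g: "g \<in> G" using B by blast
    show "p g (?X g \<oplus> ?Y g) = p g (?X g) + p g (?Y g)"
      by (rule p_add[OF g carrier_rep(1)[OF assms(1) g] carrier_rep(1)[OF assms(2) g]])
  qed
  also have "\<dots> = realize x + realize y"
    using realize_carrier[OF assms(1) B(1) _ B(2)] realize_carrier[OF assms(2) B(1) _ B(2)]
    by (simp add: sum.distrib)
  finally show ?thesis .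
qed

lemma F_finsum:
  assumes "finite T" "k \<in> G" "\<And>t. t \<in> T \<Longrightarrow> X t \<in> F k"
  shows "finsum A X T \<in> F k \<and> p k (finsum A X T) = (\<Sum>t\<in>T. p k (X t))"
  using assms(1,3)
proof (induction T rule: finite_induct)
  case empty then show ?case using assms(2) by (simp add: F_zero p_zero)
next
  case (insert t T)
  have "X \<in> T \<rightarrow> carrier A" using insert.prems F_carrier[OF assms(2)] by auto
  moreover have "X t \<in> carrier A" using insert.prems F_carrier[OF assms(2)] by auto
  ultimately have "finsum A X (insert t T) = X t \<oplus> finsum A X T"
    using insert.hyps by (simp add: A.finsum_insert)
  then show ?case using insert F_add[OF assms(2)] p_add[OF assms(2)] by simp
qed

lemma realize_mult:
  assumes "x \<in> carrier Gr" "y \<in> carrier Gr"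
  shows "realize (x \<otimes>\<^bsub>Gr\<^esub> y) = realize x * realize y"
proof -
  let ?X = "\<lambda>g. coset_rep (x g)" and ?Y = "\<lambda>g. coset_rep (y g)"
  let ?U = "supp x \<times> supp y" and ?add = "\<lambda>(g, h). g + h" and ?XY = "\<lambda>(g, h). ?X g \<otimes> ?Y h"
  define T where "T k = {t \<in> ?U. ?add t = k}" for k
  have finU: "finite ?U" using finite_supp assms by auto
  have T: "T k = {(g, h) \<in> G \<times> G. g + h = k \<and> x g \<noteq> F' g \<and> y h \<noteq> F' h}" for k
    by (auto simp: T_def supp_def)
  have finT: "finite (T k)" for k using finU by (simp add: T_def)
  have TX: "?XY t \<in> F k" "p k (?XY t) = (case t of (g, h) \<Rightarrow> p g (?X g) * p h (?Y h))" if "t \<in> T k" for t k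
  proof -
    obtain g h where t: "t = (g, h)" by (cases t)
    then have gh: "g \<in> G" "h \<in> G" "g + h = k" using that by (auto simp: T_def supp_def)
    note X = carrier_rep(1)[OF assms(1) gh(1)] and Y = carrier_rep(1)[OF assms(2) gh(2)]
    show "?XY t \<in> F k" using F_mult[OF gh(1,2) X Y] t gh(3) by simp
    show "p k (?XY t) = (case t of (g, h) \<Rightarrow> p g (?X g) * p h (?Y h))"
      using p_mult[OF gh(1,2) X Y] t gh(3) by simp
  qed
  have "realize (x \<otimes>\<^bsub>Gr\<^esub> y) = (\<Sum>k\<in>?add ` ?U. p k (finsum A ?XY (T k)))"
  proof (rule realize_eq)
    fix k assume k: "k \<in> G"
    show "finsum A ?XY (T k) \<in> F k" using F_finsum[of "T k" k ?XY, OF finT k TX(1)] by blast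
    show "(x \<otimes>\<^bsub>Gr\<^esub> y) k = cs k (finsum A ?XY (T k))"
      using k by (simp add: assoc_graded_ring_def T)
    assume nz: "p k (finsum A ?XY (T k)) \<noteq> 0"
    have "T k \<noteq> {}"
    proof
      assume "T k = {}" then show False using nz p_zero[OF k] by simp
    qed
    then show "k \<in> ?add ` ?U" by (auto simp: T_def)
  qed (use finU G_add supp_G in auto)
  also have "\<dots> = (\<Sum>k\<in>?add ` ?U. \<Sum>t\<in>T k. case t of (g, h) \<Rightarrow> p g (?X g) * p h (?Y h))"
  proof (rule sum.cong[OF refl])
    fix k assume "k \<in> ?add ` ?U"
    then have k: "k \<in> G" using G_add supp_G by auto
    have "p k (finsum A ?XY (T k)) = (\<Sum>t\<in>T k. p k (?XY t))"
      using F_finsum[of "T k" k ?XY, OF finT k TX(1)] by blast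
    also have "\<dots> = (\<Sum>t\<in>T k. case t of (g, h) \<Rightarrow> p g (?X g) * p h (?Y h))"
      by (rule sum.cong[OF refl TX(2)])
    finally show "p k (finsum A ?XY (T k)) = (\<Sum>t\<in>T k. case t of (g, h) \<Rightarrow> p g (?X g) * p h (?Y h))" .
  qed
  \<comment> \<open>The sets \<open>T k\<close> partition the pairs of the two supports according to
    the sum of their grades.\<close>
  also have "\<dots> = (\<Sum>t\<in>?U. case t of (g, h) \<Rightarrow> p g (?X g) * p h (?Y h))"
    unfolding T_def by (rule sum.image_gen[OF finU, symmetric])
  also have "\<dots> = (\<Sum>g\<in>supp x. \<Sum>h\<in>supp y. p g (?X g) * p h (?Y h))"
    by (rule sum.cartesian_product[symmetric])
  also have "\<dots> = (\<Sum>g\<in>supp x. p g (?X g)) * (\<Sum>h\<in>supp y. p h (?Y h))"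
    by (rule sum_product[symmetric])
  also have "\<dots> = realize x * realize y"
    using realize_carrier[OF assms(1) finite_supp[OF assms(1)] subset_refl supp_G]
      realize_carrier[OF assms(2) finite_supp[OF assms(2)] subset_refl supp_G] by simp
  finally show ?thesis .
qed

text \<open>Covers the unit and the complex scalars at once.\<close>

lemma realize_degree_zero:
  assumes "X \<in> F 0"
  shows "realize (\<lambda>g\<in>G. cs g (if g = 0 then X else \<zero>)) = p 0 X"
proof -
  have "realize (\<lambda>g\<in>G. cs g (if g = 0 then X else \<zero>)) = (\<Sum>g\<in>{0}. p g (if g = 0 then X else \<zero>))"
    by (rule realize_eq) (use assms G_zero F_zero p_zero in \<open>auto split: if_splits\<close>)
  then show ?thesis by simp
qed

lemma realize_one: "realize (\<one>\<^bsub>Gr\<^esub>) = 1"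
  using realize_degree_zero[OF F_one] p_one by (simp add: assoc_graded_ring_def)

lemma realize_inj: "inj_on realize (carrier Gr)"
proof (rule inj_onI)
  fix x y assume x: "x \<in> carrier Gr" and y: "y \<in> carrier Gr" and eq: "realize x = realize y"
  let ?B = "supp x \<union> supp y" and ?X = "\<lambda>g. coset_rep (x g)" and ?Y = "\<lambda>g. coset_rep (y g)"
  have B: "finite ?B" "?B \<subseteq> G" using x y finite_supp supp_G by auto
  have D: "?X g \<oplus> \<ominus> ?Y g \<in> F g" "p g (?X g \<oplus> \<ominus> ?Y g) = p g (?X g) - p g (?Y g)" if g: "g \<in> G" for g
    using F_add[OF g] F_neg[OF g] p_add[OF g] p_neg[OF g] carrier_rep(1)[OF x g] carrier_rep(1)[OF y g]
    by simp_all
  have "(\<Sum>g\<in>?B. p g (?X g \<oplus> \<ominus> ?Y g)) = (\<Sum>g\<in>?B. p g (?X g) - p g (?Y g))"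
    by (rule sum.cong[OF refl]) (use D(2) B in blast)
  also have "\<dots> = 0"
    using realize_carrier[OF x B(1) _ B(2)] realize_carrier[OF y B(1) _ B(2)] eq
    by (simp add: sum_subtractf)
  finally have sum0: "(\<Sum>g\<in>?B. p g (?X g \<oplus> \<ominus> ?Y g)) = 0" .
  have "x g = y g" if g: "g \<in> G" for g
  proof (cases "g \<in> ?B")
    case True
    have "p g (?X g \<oplus> \<ominus> ?Y g) = 0"
      by (rule indep[OF B _ sum0 True]) (use D(1) B in blast)
    then have "p g (?X g) = p g (?Y g)" using D(2)[OF g] by simp
    then have "cs g (?X g) = cs g (?Y g)"
      using cs_eq_iff[OF g carrier_rep(1)[OF x g] carrier_rep(1)[OF y g]] by simp
    then show ?thesis using carrier_rep(2)[OF x g] carrier_rep(2)[OF y g] by simp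
  next
    case False then show ?thesis using g by (simp add: supp_def)
  qed
  moreover have "x \<in> extensional G" "y \<in> extensional G"
    using x y by (auto simp: assoc_graded_ring_def PiE_iff)
  ultimately show "x = y" by (intro extensionalityI[of x G y])
qed

lemma realize_surj:
  assumes "finite B" "B \<subseteq> G" "\<And>g. g \<in> B \<Longrightarrow> X g \<in> F g"
  shows "(\<Sum>g\<in>B. p g (X g)) \<in> realize ` carrier Gr"
proof -
  define Z where "Z g = (if g \<in> B then X g else \<zero>)" for g
  have Z: "Z g \<in> F g" if "g \<in> G" for g using that assms(3) F_zero by (simp add: Z_def)
  define z where "z = (\<lambda>g\<in>G. cs g (Z g))"
  have out: "z g = F' g" if "g \<in> G" "g \<notin> B" for g using that cs_zero by (simp add: z_def Z_def)
  have "finite {g \<in> G. z g \<noteq> F' g}"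
    by (rule finite_subset[OF _ assms(1)]) (use out in blast)
  then have "z \<in> carrier Gr"
    using Z by (auto simp: assoc_graded_ring_def z_def)
  moreover have "realize z = (\<Sum>g\<in>B. p g (Z g))"
  proof (rule realize_eq)
    fix g assume g: "g \<in> G"
    show "Z g \<in> F g" "z g = cs g (Z g)" using Z[OF g] g by (simp_all add: z_def)
    assume "p g (Z g) \<noteq> 0"
    then show "g \<in> B" using p_zero[OF g] by (cases "g \<in> B") (simp_all add: Z_def)
  qed (use assms in auto)
  moreover have "(\<Sum>g\<in>B. p g (Z g)) = (\<Sum>g\<in>B. p g (X g))" by (simp add: Z_def)
  ultimately show ?thesis by (metis imageI)
qed

lemma realize_image_zero: "0 \<in> realize ` carrier Gr"
  using realize_surj[of "{}"] by simp

lemma realize_image_single: "g \<in> G \<Longrightarrow> X \<in> F g \<Longrightarrow> p g X \<in> realize ` carrier Gr"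
  using realize_surj[of "{g}" "\<lambda>_. X"] by simp

text \<open>Goes through representatives instead of the sum in the graded ring; closure of its
  carrier under addition is thereby never an issue.\<close>

lemma realize_image_add:
  assumes "u \<in> realize ` carrier Gr" "v \<in> realize ` carrier Gr"
  shows "u + v \<in> realize ` carrier Gr"
proof -
  obtain x y where x: "x \<in> carrier Gr" "u = realize x" and y: "y \<in> carrier Gr" "v = realize y"
    using assms by blast
  let ?B = "supp x \<union> supp y" and ?X = "\<lambda>g. coset_rep (x g)" and ?Y = "\<lambda>g. coset_rep (y g)"
  have B: "finite ?B" "?B \<subseteq> G" using x y finite_supp supp_G by auto
  have XY: "?X g \<in> F g" "?Y g \<in> F g" if "g \<in> ?B" for g
    using that carrier_rep(1)[OF x(1)] carrier_rep(1)[OF y(1)] B by blast+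
  have "u + v = (\<Sum>g\<in>?B. p g (?X g) + p g (?Y g))"
    using realize_carrier[OF x(1) B(1) _ B(2)] realize_carrier[OF y(1) B(1) _ B(2)] x y
    by (simp add: sum.distrib)
  also have "\<dots> = (\<Sum>g\<in>?B. p g (?X g \<oplus> ?Y g))"
    by (rule sum.cong[OF refl]) (use p_add XY B in \<open>metis subsetD\<close>)
  also have "\<dots> \<in> realize ` carrier Gr"
    by (rule realize_surj[OF B]) (use F_add XY B in \<open>metis subsetD\<close>)
  finally show ?thesis .
qed

text \<open>Both algebras embed into one ring with the same image: one through
  \<open>realize\<close>, the other as the quotient by the kernel of \<open>\<Psi>\<close>.\<close>

lemma algebra_iso_kernel:
  fixes \<Psi> :: "'v cpoly \<Rightarrow> 'b" and V :: "'v set"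
  defines "R \<equiv> cpoly_ring V"
  assumes J: "J = {f \<in> carrier R. \<Psi> f = 0}"
    and add: "\<And>f g. \<Psi> (f + g) = \<Psi> f + \<Psi> g" and mult: "\<And>f g. \<Psi> (f * g) = \<Psi> f * \<Psi> g" and one: "\<Psi> 1 = 1"
    and img: "realize ` carrier Gr = \<Psi> ` carrier R"
    and scal: "\<And>c. \<iota> c \<in> carrier Gr" "\<And>c. realize (\<iota> c) = \<Psi> (Const c)"
  shows "algebra_isomorphic Gr \<iota> (R Quot J) (\<lambda>c. J +>\<^bsub>R\<^esub> Const c)"
proof -
  have diff: "\<Psi> (f - g) = \<Psi> f - \<Psi> g" for f g
    using add[of "f - g" g] by (simp add: algebra_simps)
  have zero: "\<Psi> 0 = 0" using add[of 0 0] by simp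
  have I: "ideal J R"
    unfolding R_def J by (rule ideal_cpolyI) (auto simp: zero add mult)
  interpret I: ideal J R by (rule I)
  \<comment> \<open>The fibre of \<open>\<Psi>\<close> over the realization is itself a coset of
    \<open>J\<close>, so no preimage has to be chosen.\<close>
  define h where "h x = {f \<in> carrier R. \<Psi> f = realize x}" for x
  have coset: "J +>\<^bsub>R\<^esub> f = {f' \<in> carrier R. \<Psi> f' = \<Psi> f}" if "f \<in> carrier R" for f
  proof -
    have "f' \<in> J +>\<^bsub>R\<^esub> f \<longleftrightarrow> f' \<in> carrier R \<and> \<Psi> f' = \<Psi> f" for f'
    proof
      assume "f' \<in> J +>\<^bsub>R\<^esub> f"
      then show "f' \<in> carrier R \<and> \<Psi> f' = \<Psi> f"
        using that unfolding R_def coset_cpoly J by (auto simp: add)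
    next
      assume f': "f' \<in> carrier R \<and> \<Psi> f' = \<Psi> f"
      then have "f' - f \<in> J" using that by (auto simp: J R_def diff)
      then show "f' \<in> J +>\<^bsub>R\<^esub> f" unfolding R_def coset_cpoly by force
    qed
    then show ?thesis by blast
  qed
  have hc: "\<exists>f\<in>carrier R. \<Psi> f = realize x \<and> h x = J +>\<^bsub>R\<^esub> f" if "x \<in> carrier Gr" for x
  proof -
    have "realize x \<in> \<Psi> ` carrier R" unfolding img[symmetric] using that by (rule imageI)
    then obtain f where f: "f \<in> carrier R" "realize x = \<Psi> f" by (rule imageE)
    have "h x = J +>\<^bsub>R\<^esub> f" unfolding coset[OF f(1)] h_def f(2) ..
    then show ?thesis using f by (intro bexI[of _ f]) simp_all
  qed
  have hom: "h \<in> ring_hom Gr (R Quot J)"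
  proof (rule ring_hom_memI)
    fix x assume x: "x \<in> carrier Gr"
    then show "h x \<in> carrier (R Quot J)"
      using hc[OF x] unfolding FactRing_def A_RCOSETS_def' by auto
  next
    fix x y assume x: "x \<in> carrier Gr" and y: "y \<in> carrier Gr"
    obtain f where f: "f \<in> carrier R" "\<Psi> f = realize x" "h x = J +>\<^bsub>R\<^esub> f" using hc[OF x] by blast
    obtain g where g: "g \<in> carrier R" "\<Psi> g = realize y" "h y = J +>\<^bsub>R\<^esub> g" using hc[OF y] by blast
    have fg: "f * g \<in> carrier R" "f + g \<in> carrier R" using f g by (auto simp: R_def)
    have "h (x \<otimes>\<^bsub>Gr\<^esub> y) = J +>\<^bsub>R\<^esub> (f * g)"
      using coset[OF fg(1)] f(2) g(2) realize_mult[OF x y] by (simp add: h_def mult)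
    also have "\<dots> = h x \<otimes>\<^bsub>R Quot J\<^esub> h y"
      using ring_hom_mult[OF I.rcos_ring_hom f(1) g(1)] f(3) g(3) by (simp add: R_def)
    finally show "h (x \<otimes>\<^bsub>Gr\<^esub> y) = h x \<otimes>\<^bsub>R Quot J\<^esub> h y" .
    have "h (x \<oplus>\<^bsub>Gr\<^esub> y) = J +>\<^bsub>R\<^esub> (f + g)"
      using coset[OF fg(2)] f(2) g(2) realize_add[OF x y] by (simp add: h_def add)
    also have "\<dots> = h x \<oplus>\<^bsub>R Quot J\<^esub> h y"
      using ring_hom_add[OF I.rcos_ring_hom f(1) g(1)] f(3) g(3) by (simp add: R_def)
    finally show "h (x \<oplus>\<^bsub>Gr\<^esub> y) = h x \<oplus>\<^bsub>R Quot J\<^esub> h y" .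
  next
    have "h \<one>\<^bsub>Gr\<^esub> = J +>\<^bsub>R\<^esub> 1"
      using coset[of 1] realize_one one by (simp add: h_def R_def)
    then show "h \<one>\<^bsub>Gr\<^esub> = \<one>\<^bsub>R Quot J\<^esub>" by (simp add: FactRing_def R_def)
  qed
  moreover have "bij_betw h (carrier Gr) (carrier (R Quot J))"
    unfolding bij_betw_def
  proof
    show "inj_on h (carrier Gr)"
    proof (rule inj_onI)
      fix x y assume x: "x \<in> carrier Gr" and y: "y \<in> carrier Gr" and eq: "h x = h y"
      obtain f where "f \<in> carrier R" "\<Psi> f = realize x" using hc[OF x] by blast
      then have "f \<in> h y" unfolding eq[symmetric] by (simp add: h_def)
      then have "realize x = realize y" using \<open>\<Psi> f = realize x\<close> by (simp add: h_def)
      then show "x = y" using realize_inj x y by (meson inj_onD)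
    qed
    show "h ` carrier Gr = carrier (R Quot J)"
    proof
      show "h ` carrier Gr \<subseteq> carrier (R Quot J)" using ring_hom_closed[OF hom] by blast
      show "carrier (R Quot J) \<subseteq> h ` carrier Gr"
      proof
        fix c assume "c \<in> carrier (R Quot J)"
        then obtain f where f: "f \<in> carrier R" "c = J +>\<^bsub>R\<^esub> f"
          unfolding FactRing_def A_RCOSETS_def' by auto
        have "\<Psi> f \<in> realize ` carrier Gr" unfolding img using f(1) by (rule imageI)
        then obtain x where x: "x \<in> carrier Gr" "\<Psi> f = realize x" by (rule imageE)
        have "h x = c" unfolding f(2) coset[OF f(1)] h_def x(2) ..
        then show "c \<in> h ` carrier Gr" using x by blast
      qed
    qed
  qed
  moreover have "h (\<iota> c) = J +>\<^bsub>R\<^esub> Const c" for c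
    using coset[of "Const c"] scal by (simp add: h_def R_def)
  ultimately show ?thesis
    unfolding algebra_isomorphic_def ring_iso_def by blast
qed

end

section \<open>The associated graded algebra of an iterated sequence\<close>

lemma exponent_lookup [simp]: "lookup (exponent m) k = int (lookup m k)"
  by (simp add: exponent_def Poly_Mapping.map.rep_eq when_def)

lemma exponent_add: "exponent (a + b) = exponent a + exponent b"
  and exponent_zero [simp]: "exponent 0 = 0"
  by (rule poly_mapping_eqI; simp add: lookup_add)+

lemma exponent_inj: "exponent a = exponent b \<longleftrightarrow> a = b"
proof
  assume "exponent a = exponent b"
  then have "int (lookup a k) = int (lookup b k)" for k by (metis exponent_lookup)
  then show "a = b" by (intro poly_mapping_eqI) simp
qed simp

lemma less_poly_mapping_iff:
  "a < b \<longleftrightarrow> (\<exists>k. lookup a k < lookup b k \<and> (\<forall>k'<k. lookup a k' = lookup b k'))"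
  by (simp add: less_poly_mapping.rep_eq less_fun_def)

text \<open>The order \<open>\<prec>\<^sub>\<Psi>\<close> is the lexicographic order of the library after prepending the
  weight and negating the exponents.\<close>

definition order_key :: "(nat \<times> nat) list \<Rightarrow> (nat \<Rightarrow>\<^sub>0 int) \<Rightarrow> (nat \<Rightarrow>\<^sub>0 int)" where
  "order_key S a = single 0 (seq_weight S a) - (\<Sum>k\<in>keys a. single (Suc k) (lookup a k))"

lemma seq_weight_add: "seq_weight S (a + b) = seq_weight S a + seq_weight S b"
  by (simp add: seq_weight_def lookup_add distrib_right sum.distrib)

lemma lookup_order_key:
  "lookup (order_key S a) 0 = seq_weight S a" "lookup (order_key S a) (Suc k) = - lookup a k"
  by (simp_all add: order_key_def lookup_minus lookup_sum lookup_single when_def sum.delta' in_keys_iff)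

lemma order_key_add: "order_key S (a + b) = order_key S a + order_key S b"
proof (rule poly_mapping_eqI)
  fix k show "lookup (order_key S (a + b)) k = lookup (order_key S a + order_key S b) k"
    by (cases k) (simp_all add: lookup_add lookup_order_key seq_weight_add)
qed

lemma order_key_inj: "order_key S a = order_key S b \<longleftrightarrow> a = b"
proof
  assume e: "order_key S a = order_key S b"
  show "a = b"
  proof (rule poly_mapping_eqI)
    fix k show "lookup a k = lookup b k"
      using arg_cong[OF e, of "\<lambda>p. lookup p (Suc k)"] by (simp add: lookup_order_key)
  qed
qed simp

lemma order_key_less: "order_key S a < order_key S b \<longleftrightarrow> seq_less S a b"
proof
  assume "order_key S a < order_key S b"
  then obtain k where k: "lookup (order_key S a) k < lookup (order_key S b) k"
    "\<forall>k'<k. lookup (order_key S a) k' = lookup (order_key S b) k'"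
    unfolding less_poly_mapping_iff by blast
  show "seq_less S a b"
  proof (cases k)
    case 0 then show ?thesis using k by (simp add: seq_less_def lookup_order_key)
  next
    case (Suc l)
    then have "seq_weight S a = seq_weight S b" using k(2)[rule_format, of 0] by (simp add: lookup_order_key)
    moreover have "lookup b l < lookup a l" using k(1) Suc by (simp add: lookup_order_key)
    moreover have "lookup b l' = lookup a l'" if "l' < l" for l'
      using k(2)[rule_format, of "Suc l'"] that Suc by (simp add: lookup_order_key)
    ultimately show ?thesis unfolding seq_less_def less_poly_mapping_iff by blast
  qed
next
  assume "seq_less S a b"
  then consider "seq_weight S a < seq_weight S b" | "seq_weight S a = seq_weight S b" "b < a"
    unfolding seq_less_def by blast
  then show "order_key S a < order_key S b"
  proof cases
    case 1 then show ?thesis unfolding less_poly_mapping_iff by (intro exI[of _ 0]) (simp add: lookup_order_key)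
  next
    case 2
    then obtain l where l: "lookup b l < lookup a l" "\<forall>l'<l. lookup b l' = lookup a l'"
      unfolding less_poly_mapping_iff by blast
    have "lookup (order_key S a) k' = lookup (order_key S b) k'" if "k' < Suc l" for k'
      using that l(2) 2(1) by (cases k') (auto simp: lookup_order_key)
    then show ?thesis unfolding less_poly_mapping_iff
      using l(1) by (intro exI[of _ "Suc l"]) (simp add: lookup_order_key)
  qed
qed

lemma mono_eval_scale: "mono_eval (\<lambda>e. u * x e) m = u ^ mdeg m * mono_eval x m"
  by (simp add: mono_eval_def mdeg_def power_mult_distrib prod.distrib power_sum)

lemma eval_scale:
  assumes "homogeneous r f"
  shows "cpoly_eval Const (\<lambda>e. u * x e) f = u ^ r * cpoly_eval Const x f"
proof -
  have "keys f \<subseteq> {m. mdeg m = r}" using assms by (auto simp: homogeneous_mdeg)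
  then show ?thesis
    by (induction f rule: poly_mapping_linear_induct)
      (auto simp: cpoly_eval_single mono_eval_scale cpoly_eval_add distrib_left ac_simps)
qed

lemma Var_power: "Var v ^ r = single (single v r) 1"
proof (induction r)
  case (Suc r)
  have "single v (Suc 0) + single v r = single v (Suc r)" by (simp flip: single_add)
  then show ?case by (simp only: power_Suc Suc) (simp add: Var_def mult_single)
qed simp

context iterated_seq begin

definition Mo :: "(nat \<Rightarrow>\<^sub>0 nat) \<Rightarrow> (nat \<Rightarrow>\<^sub>0 int)" where
  "Mo m = order_key S (exponent m)"

lemma Mo_add: "Mo (a + b) = Mo a + Mo b"
  by (simp add: Mo_def exponent_add order_key_add)

lemma Mo_hom: "weight_hom Mo"
  by (simp add: weight_hom_def Mo_add)

lemma seq_weight_single: "k < dm \<Longrightarrow> seq_weight S (exponent (single k 1)) = root_height (S ! k)"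
  by (simp add: seq_weight_def length_seq lookup_single when_def if_distrib if_distribR sum.delta' cong: if_cong)

lemma seq_weight_dm: "seq_weight S (exponent (single dm 1)) = 0"
  by (auto simp: seq_weight_def length_seq lookup_single when_def intro!: sum.neutral)

lemma idx_less: "3 \<le> k \<Longrightarrow> k \<le> n \<Longrightarrow> xi k < dm" "3 \<le> k \<Longrightarrow> k \<le> n \<Longrightarrow> yi k < dm"
  by (auto simp: xi_def yi_def dm_def)

text \<open>Heights telescope along the recursion of \<open>lead\<close>, so only the end indices
  remain, and \<open>3 = 1 + 2\<close> normalizes the base pair to weight zero. The leading
  monomials of all three products of a Pluecker relation therefore tie under \<Psi>.\<close>

lemma seq_weight_lead:
  assumes "a \<in> {1..n}" "b \<in> {1..n}" "a \<noteq> b"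
  shows "seq_weight S (exponent (lead a b)) = int a + int b - 3"
  using assms n_ge
proof (induction a b rule: pair_induct)
  case (swap a b) then show ?case by (simp add: lead_swap[of b a])
next
  case base show ?case unfolding lead_12 by (simp add: seq_weight_def)
next
  case (first k)
  have "seq_weight S (exponent (single (yi k) 1)) = int k - int (j k)"
    using seq_weight_single[OF idx_less(2)[OF first(1,2)]] by (simp add: seq_nth[OF first(1,2)] root_height_def)
  then show ?case unfolding lead_first[OF first(1,2)] exponent_add seq_weight_add first(3) by simp
next
  case (other k a)
  have "seq_weight S (exponent (single (xi k) 1)) = int k - int (i k)"
    using seq_weight_single[OF idx_less(1)[OF other(1,2)]] by (simp add: seq_nth[OF other(1,2)] root_height_def)
  then show ?case unfolding lead_other[OF other(1,2,4,5)] exponent_add seq_weight_add other(6) by simp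
qed

lemma keys_tlead:
  assumes "a \<in> {1..n}" "b \<in> {1..n}" "a \<noteq> b"
  shows "keys (tlead a b) \<subseteq> {2 * (n - max a b)..dm}"
proof -
  have "keys (tlead a b) \<subseteq> {dm} \<union> keys (lead a b)"
    unfolding tlead_def using Poly_Mapping.keys_add[of "single dm 1" "lead a b"] by auto
  also have "\<dots> \<subseteq> {dm} \<union> {2 * (n - max a b)..<dm}" using keys_lead[OF assms] by blast
  also have "\<dots> \<subseteq> {2 * (n - max a b)..dm}" using assms by (auto simp: dm_def)
  finally show ?thesis .
qed

text \<open>The weights under \<Psi> tie by \<open>seq_weight_lead\<close>, so the lexicographic
  rule decides. No variable before \<open>xi k\<close> occurs; \<open>xi k\<close> itself is present
  on the left and absent on the right, and the lexicographically larger exponent is the smaller one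
  in the order of the valuation.\<close>

lemma weighted_Mo: "weighted_seq n i j Mo"
proof (unfold_locales, rule Mo_hom)
  fix k a b assume k: "3 \<le> k" "k \<le> n" and ab: "1 \<le> a" "a < k" "1 \<le> b" "b < k" "a \<noteq> b" "a \<noteq> i k" "b \<noteq> i k"
  note ik = ij[OF k]
  let ?L = "tlead a k + tlead b (i k)" and ?R = "tlead a b + tlead (i k) k"
  have in_n: "a \<in> {1..n}" "b \<in> {1..n}" "i k \<in> {1..n}" "k \<in> {1..n}" using ab(1-4) k ik(1,2) by auto
  have w: "seq_weight S (exponent (tlead x y)) = int x + int y - 3" if "x \<in> {1..n}" "y \<in> {1..n}" "x \<noteq> y" for x y
    unfolding tlead_def exponent_add seq_weight_add seq_weight_dm using seq_weight_lead[OF that] by simp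
  have 1: "seq_weight S (exponent ?L) = seq_weight S (exponent ?R)"
    unfolding exponent_add seq_weight_add
    using w[OF in_n(1,4)] w[OF in_n(2,3)] w[OF in_n(1,2)] w[OF in_n(3,4)] ab(2,5,7) ik(2) by simp
  have low: "lookup (tlead x y) l = 0" if "x \<in> {1..n}" "y \<in> {1..n}" "x \<noteq> y" "x \<le> k" "y \<le> k" "l < xi k" for x y l
  proof -
    have "xi k \<le> 2 * (n - max x y)" using that by (auto simp: xi_def)
    then have "l \<notin> keys (tlead x y)" using keys_tlead[OF that(1-3)] that(6) by auto
    then show ?thesis by (simp add: in_keys_iff)
  qed
  have e: "{a, k} \<in> edges k" "{b, i k} \<in> edges k" "{a, b} \<in> edges k" "{i k, k} \<in> edges k"
    using edge_new[OF ab(1,2)] edge_new[of "i k" k] edge_old[of b k "i k"] edge_old[of a k b] edges_mono[of k] ab(1-5,7) ik(1,2)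
    by auto
  have ne: "{a, k} \<noteq> {i k, k}" using ab(2,6) by (auto simp: doubleton_eq_iff)
  have nk: "k \<notin> {b, i k}" "k \<notin> {a, b}" using ab(2,4) ik(2) by auto
  have nek: "a \<noteq> k" "b \<noteq> i k" "i k \<noteq> k" using ab(2,7) ik(2) by auto
  have le: "a \<le> k" "b \<le> k" "i k \<le> k" "k \<le> k" using ab(2,4) ik(2) by auto
  have top: "lookup (tlead a k) (xi k) = 1"
    unfolding elead_pair[OF nek(1), symmetric] lookup_elead(1)[OF e(1) k] using ne by simp
  have "lookup (tlead b (i k)) (xi k) = 0"
    unfolding elead_pair[OF nek(2), symmetric] lookup_elead(1)[OF e(2) k] using nk by simp
  moreover have "lookup (tlead a b) (xi k) = 0"
    unfolding elead_pair[OF ab(5), symmetric] lookup_elead(1)[OF e(3) k] using nk by simp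
  moreover have "lookup (tlead (i k) k) (xi k) = 0"
    unfolding elead_pair[OF nek(3), symmetric] lookup_elead(1)[OF e(4) k] by simp
  ultimately have top0: "lookup (tlead b (i k)) (xi k) = 0" "lookup (tlead a b) (xi k) = 0"
    "lookup (tlead (i k) k) (xi k) = 0" by simp_all
  have "exponent ?R < exponent ?L"
    unfolding less_poly_mapping_iff
  proof (intro exI[of _ "xi k"] conjI allI impI)
    show "lookup (exponent ?R) (xi k) < lookup (exponent ?L) (xi k)" using top top0 by (simp add: lookup_add)
    fix l assume l: "l < xi k"
    show "lookup (exponent ?R) l = lookup (exponent ?L) l"
      by (simp only: exponent_lookup lookup_add low[OF in_n(1,4) nek(1) le(1,4) l] low[OF in_n(2,3) nek(2) le(2,3) l]
          low[OF in_n(1,2) ab(5) le(1,2) l] low[OF in_n(3,4) nek(3) le(3,4) l])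
  qed
  then have "Mo ?L < Mo ?R" unfolding Mo_def order_key_less seq_less_def using 1 by blast
  then show "Mo (tlead a k) + Mo (tlead b (i k)) < Mo (tlead a b) + Mo (tlead (i k) k)" by (simp add: Mo_add)
qed

sublocale V: weighted_seq n i j Mo by (rule weighted_Mo)

section \<open>The filtration of the Pluecker algebra by the valuation\<close>

abbreviation "PR \<equiv> plucker_poly_ring n"
abbreviation "PI \<equiv> plucker_ideal n"
abbreviation "PA \<equiv> plucker_algebra n"
abbreviation cl :: "(nat \<times> nat) cpoly \<Rightarrow> (nat \<times> nat) cpoly set" where "cl f \<equiv> PI +>\<^bsub>PR\<^esub> f"

text \<open>The valuation is defined without the additional variable. On homogeneous polynomials of
  degree \<open>r\<close> the two parametrizations differ by the factor
  \<open>single (single dm r) 1\<close>.\<close>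

definition phi0 :: "(nat \<times> nat) cpoly \<Rightarrow> nat cpoly" where
  "phi0 = cpoly_eval Const (seq_poly S)"

lemmas phi0_simps = cpoly_eval_simps[OF coeff_hom_Const, where x = "seq_poly S", folded phi0_def]

lemma phi0_ideal: "f \<in> PI \<Longrightarrow> phi0 f = 0"
  using eval_plucker_ideal[of f 1] by (simp add: phi0_def)

lemma phi_phi0: "homogeneous r f \<Longrightarrow> phi f = single (single dm r) 1 * phi0 f"
  using eval_scale[of r f "Var dm" "seq_poly S"] by (simp add: phi_def phi0_def Var_power)

lemma subst_cl: "seq_subst S (cl f) = phi0 f"
proof -
  have "f \<in> cl f" unfolding coset_cpoly using ideal_cpolyD(2)[OF ideal_plucker] by force
  then have "(SOME f'. f' \<in> cl f) \<in> cl f" by (rule someI)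
  then obtain h where "h \<in> PI" "(SOME f'. f' \<in> cl f) = h + f" unfolding coset_cpoly by blast
  then show ?thesis by (simp add: seq_subst_def flip: phi0_def) (simp add: phi0_simps phi0_ideal)
qed

lemma ring_PA: "cring PA"
  unfolding plucker_algebra_def by (rule ideal.quotient_is_cring[OF ideal_plucker cring_cpoly])

lemma PA_simps:
  "\<zero>\<^bsub>PA\<^esub> = PI" "\<one>\<^bsub>PA\<^esub> = cl 1" "carrier PA = {cl f | f. f \<in> carrier PR}"
  by (auto simp: plucker_algebra_def FactRing_def A_RCOSETS_def')

lemma cl_zero: "cl 0 = PI"
  by (auto simp: coset_cpoly)

lemma cl_eq_iff: "cl f = cl g \<longleftrightarrow> f - g \<in> PI"
  by (rule coset_cpoly_eq_iff[OF ideal_plucker])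

lemma cl_eq_zero: "cl f = PI \<longleftrightarrow> f \<in> PI"
  using cl_eq_iff[of f 0] by (simp add: cl_zero)

lemma cl_mult: "f \<in> carrier PR \<Longrightarrow> g \<in> carrier PR \<Longrightarrow> cl f \<otimes>\<^bsub>PA\<^esub> cl g = cl (f * g)"
  and cl_add: "f \<in> carrier PR \<Longrightarrow> g \<in> carrier PR \<Longrightarrow> cl f \<oplus>\<^bsub>PA\<^esub> cl g = cl (f + g)"
  using ring_hom_mult[OF ideal.rcos_ring_hom[OF ideal_plucker], of f n g]
    ring_hom_add[OF ideal.rcos_ring_hom[OF ideal_plucker], of f n g]
  by (simp_all add: plucker_algebra_def)

lemma cl_neg:
  assumes "f \<in> carrier PR" shows "\<ominus>\<^bsub>PA\<^esub> cl f = cl (- f)"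
proof -
  interpret PA: cring PA by (rule ring_PA)
  have "cl (- f) \<oplus>\<^bsub>PA\<^esub> cl f = \<zero>\<^bsub>PA\<^esub>"
    using cl_add[of "- f" f] assms by (auto simp: PA_simps cl_zero)
  moreover have "cl f \<in> carrier PA" "cl (- f) \<in> carrier PA" using assms unfolding PA_simps by auto
  ultimately show ?thesis by (rule PA.minus_equality)
qed

lemma phi0_nonzero:
  assumes "f \<in> carrier PR" "homogeneous r f" "cl f \<noteq> PI"
  shows "phi0 f \<noteq> 0"
  using V.phi_eq_0_imp_ideal[OF assms(1,2)] assms(3) phi_phi0[OF assms(2)] by (auto simp: cl_eq_zero)

text \<open>The order separates exponents, so the definite description in
  \<open>seq_valuation\<close> has exactly one solution, the exponent of least weight.\<close>

lemma seq_valuation_cl: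
  assumes "phi0 f \<noteq> 0"
  shows "\<exists>m\<in>keys (phi0 f). seq_valuation S (cl f) = exponent m \<and> weight_ge Mo (Mo m) (phi0 f)"
proof -
  let ?K = "exponent ` keys (phi0 f)"
  have "Min (Mo ` keys (phi0 f)) \<in> Mo ` keys (phi0 f)" using assms by (intro Min_in) auto
  then obtain m where m: "m \<in> keys (phi0 f)" "Mo m = Min (Mo ` keys (phi0 f))" by auto
  have ge: "Mo m \<le> Mo m'" if "m' \<in> keys (phi0 f)" for m' using that m(2) by simp
  have "seq_valuation S (cl f) = exponent m"
    unfolding seq_valuation_def subst_cl
  proof (rule the_equality)
    show "exponent m \<in> ?K \<and> (\<forall>b\<in>?K. b \<noteq> exponent m \<longrightarrow> seq_less S (exponent m) b)"
    proof (intro conjI ballI impI)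
      show "exponent m \<in> ?K" using m by simp
      fix b assume "b \<in> ?K" "b \<noteq> exponent m"
      then obtain m' where m': "m' \<in> keys (phi0 f)" "b = exponent m'" "m' \<noteq> m" by auto
      then have "Mo m \<noteq> Mo m'" by (simp add: Mo_def order_key_inj exponent_inj)
      then show "seq_less S (exponent m) b"
        using ge[OF m'(1)] m'(2) unfolding Mo_def order_key_less[symmetric] by simp
    qed
  next
    fix a assume a: "a \<in> ?K \<and> (\<forall>b\<in>?K. b \<noteq> a \<longrightarrow> seq_less S a b)"
    then obtain m' where m': "m' \<in> keys (phi0 f)" "a = exponent m'" by auto
    show "a = exponent m"
    proof (rule ccontr)
      assume "a \<noteq> exponent m"
      then have "seq_less S a (exponent m)" using a m(1) by auto
      then have "Mo m' < Mo m" unfolding Mo_def m'(2) order_key_less .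
      then show False using ge[OF m'(1)] by simp
    qed
  qed
  then show ?thesis using m(1) ge by (auto simp: weight_ge_def)
qed

abbreviation N :: "(nat \<Rightarrow>\<^sub>0 int) \<Rightarrow> (nat \<Rightarrow>\<^sub>0 int)" where "N \<equiv> order_key S"

text \<open>Turns both filtrations into weight bounds on parametrized polynomials. The zero class no
  longer forms a separate case, since elements of the ideal are mapped to zero and satisfy every
  bound.\<close>

lemma filt_ge_iff:
  "X \<in> filt_ge n S (r, a) \<longleftrightarrow>
    (\<exists>f\<in>carrier PR. homogeneous r f \<and> weight_ge Mo (N a) (phi0 f) \<and> X = cl f)"
  "X \<in> filt_gt n S (r, a) \<longleftrightarrow>
    (\<exists>f\<in>carrier PR. homogeneous r f \<and> weight_gt Mo (N a) (phi0 f) \<and> X = cl f)"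
proof -
  have ge: "(seq_valuation S (cl f) = a \<or> seq_less S a (seq_valuation S (cl f))) \<longleftrightarrow> weight_ge Mo (N a) (phi0 f)"
    and gt: "seq_less S a (seq_valuation S (cl f)) \<longleftrightarrow> weight_gt Mo (N a) (phi0 f)"
    if nz: "phi0 f \<noteq> 0" for f
  proof -
    obtain m where m: "m \<in> keys (phi0 f)" "seq_valuation S (cl f) = exponent m" "weight_ge Mo (Mo m) (phi0 f)"
      using seq_valuation_cl[OF nz] by blast
    have le: "Mo m \<le> Mo m'" if "m' \<in> keys (phi0 f)" for m' using m(3) that by (simp add: weight_ge_def)
    have "exponent m = a \<longleftrightarrow> N a = Mo m" using order_key_inj[of S a "exponent m"] by (auto simp: Mo_def)
    moreover have "seq_less S a (exponent m) \<longleftrightarrow> N a < Mo m"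
      unfolding order_key_less[symmetric] Mo_def ..
    ultimately have v: "(seq_valuation S (cl f) = a \<or> seq_less S a (seq_valuation S (cl f))) \<longleftrightarrow> N a \<le> Mo m"
      "seq_less S a (seq_valuation S (cl f)) \<longleftrightarrow> N a < Mo m"
      unfolding m(2) by (simp_all only: order_le_less disj_commute)
    have "weight_ge Mo (N a) (phi0 f) \<longleftrightarrow> N a \<le> Mo m"
      using order_trans[OF _ le] m(1) by (auto simp: weight_ge_def)
    then show "(seq_valuation S (cl f) = a \<or> seq_less S a (seq_valuation S (cl f))) \<longleftrightarrow> weight_ge Mo (N a) (phi0 f)"
      using v(1) by (simp only:)
    have "weight_gt Mo (N a) (phi0 f) \<longleftrightarrow> N a < Mo m"
      using less_le_trans[OF _ le] m(1) by (auto simp: weight_gt_def)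
    then show "seq_less S a (seq_valuation S (cl f)) \<longleftrightarrow> weight_gt Mo (N a) (phi0 f)"
      using v(2) by (simp only:)
  qed
  have z: "f \<in> PI \<Longrightarrow> phi0 f = 0" for f by (rule phi0_ideal)
  show "X \<in> filt_ge n S (r, a) \<longleftrightarrow>
    (\<exists>f\<in>carrier PR. homogeneous r f \<and> weight_ge Mo (N a) (phi0 f) \<and> X = cl f)" (is "?L \<longleftrightarrow> ?R")
  proof
    assume ?L
    then consider "X = PI" | f where "f \<in> carrier PR" "homogeneous r f" "X = cl f" "cl f \<noteq> PI"
      "seq_valuation S (cl f) = a \<or> seq_less S a (seq_valuation S (cl f))"
      unfolding filt_ge_def plucker_algebra_deg_def PA_simps prod.case by blast
    then show ?R
    proof cases
      case 1 then show ?thesis by (intro bexI[of _ 0]) (simp_all add: cl_zero phi0_def)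
    next
      case 2 then show ?thesis using ge[OF phi0_nonzero[OF 2(1,2,4)]] by blast
    qed
  next
    assume ?R
    then obtain f where f: "f \<in> carrier PR" "homogeneous r f" "weight_ge Mo (N a) (phi0 f)" "X = cl f" by blast
    show ?L
    proof (cases "cl f = PI")
      case True then show ?thesis using f by (simp add: filt_ge_def PA_simps)
    next
      case False
      then show ?thesis using f ge[OF phi0_nonzero[OF f(1,2) False]]
        unfolding filt_ge_def plucker_algebra_deg_def PA_simps prod.case by blast
    qed
  qed
  show "X \<in> filt_gt n S (r, a) \<longleftrightarrow>
    (\<exists>f\<in>carrier PR. homogeneous r f \<and> weight_gt Mo (N a) (phi0 f) \<and> X = cl f)" (is "?L \<longleftrightarrow> ?R")
  proof
    assume ?L
    then consider "X = PI" | f where "f \<in> carrier PR" "homogeneous r f" "X = cl f" "cl f \<noteq> PI"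
      "seq_less S a (seq_valuation S (cl f))"
      unfolding filt_gt_def plucker_algebra_deg_def PA_simps prod.case by blast
    then show ?R
    proof cases
      case 1 then show ?thesis by (intro bexI[of _ 0]) (simp_all add: cl_zero phi0_def)
    next
      case 2 then show ?thesis using gt[OF phi0_nonzero[OF 2(1,2,4)]] by blast
    qed
  next
    assume ?R
    then obtain f where f: "f \<in> carrier PR" "homogeneous r f" "weight_gt Mo (N a) (phi0 f)" "X = cl f" by blast
    show ?L
    proof (cases "cl f = PI")
      case True then show ?thesis using f by (simp add: filt_gt_def PA_simps)
    next
      case False
      then show ?thesis using f gt[OF phi0_nonzero[OF f(1,2) False]]
        unfolding filt_gt_def plucker_algebra_deg_def PA_simps prod.case by blast
    qed
  qed
qed

text \<open>The component of grade \<open>(r, a)\<close>, tagged by a power of the additional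
  variable, so that different grades occupy disjoint sets of monomials.\<close>

definition gpart :: "nat \<times> (nat \<Rightarrow>\<^sub>0 int) \<Rightarrow> (nat \<times> nat) cpoly set \<Rightarrow> nat cpoly" where
  "gpart g X = single (single dm (fst g)) 1 * wpart Mo (N (snd g)) (seq_subst S X)"

lemma gpart_cl: "gpart (r, a) (cl f) = single (single dm r) 1 * wpart Mo (N a) (phi0 f)"
  by (simp add: gpart_def subst_cl)

lemma shift_wpart: "single k 1 * wpart Mo c q = wpart Mo (Mo k + c) (single k 1 * q)"
  by (simp add: wpart_mult_single[OF Mo_hom])

lemma weight_ge_shift: "weight_ge Mo (Mo k + c) (single k 1 * q) \<longleftrightarrow> weight_ge Mo c q"
proof -
  have "lookup (single k 1 * q) (k + m) = lookup q m" for m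
  proof (induction q rule: poly_mapping_linear_induct_UNIV)
    case (single m' a) show ?case by (auto simp: mult_single lookup_single when_def)
  qed (simp_all add: distrib_left lookup_add)
  then have "k + m \<in> keys (single k 1 * q) \<longleftrightarrow> m \<in> keys q" for m by (simp add: in_keys_iff)
  then have "keys (single k 1 * q) = (+) k ` keys q"
    by (auto elim!: keys_multE)
  then show ?thesis by (simp add: weight_ge_def Mo_add)
qed

text \<open>The lowest component of \<open>f\<close> itself may be killed by \<open>psi\<close>.
  Subduction replaces \<open>f\<close>, modulo the ideal, by a polynomial whose lowest component is
  visible through \<open>psi\<close>. The weights \<open>c\<close> and \<open>?c\<close> are then
  both the least weight of the same polynomial and must coincide.\<close>

lemma gpart_in_psi_image:
  assumes f: "f \<in> carrier PR" "homogeneous r f" "weight_ge Mo (N a) (phi0 f)"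
  shows "gpart (r, a) (cl f) \<in> psi ` carrier PR"
proof (cases "gpart (r, a) (cl f) = 0")
  case True then show ?thesis by (intro image_eqI[of _ _ 0]) simp_all
next
  case False
  let ?c = "Mo (single dm r) + N a"
  have p: "gpart (r, a) (cl f) = wpart Mo ?c (phi f)"
    by (simp add: gpart_cl shift_wpart phi_phi0[OF f(2)])
  have "f \<notin> PI" using False p phi_plucker_ideal by auto
  then obtain f' c where f': "f' \<in> carrier PR" "f - f' \<in> PI" "weight_ge V.Mp c f'" "psi (wpart V.Mp c f') \<noteq> 0"
    using V.subduction[OF f(1,2)] by blast
  have eq: "phi f = phi f'" using phi_plucker_ideal[OF f'(2)] by (simp add: phi_simps)
  have w: "wpart Mo c (phi f) = psi (wpart V.Mp c f')" unfolding eq by (rule V.wpart_phi[OF f'(1,3)])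
  have ge: "weight_ge Mo ?c (phi f)" unfolding phi_phi0[OF f(2)] weight_ge_shift by (rule f(3))
  have "weight_ge Mo c (psi (wpart V.Mp c f'))"
    unfolding w[symmetric] by (rule weight_ge_wpart)
  from weight_ge_add[OF weight_gt_imp_ge[OF V.phi_leading_part[OF f'(1,3)]] this]
  have ge': "weight_ge Mo c (phi f)" by (simp add: eq)
  obtain m where "m \<in> keys (phi f)" "Mo m = c"
    using f'(4) keys_wpart[of Mo c "phi f"] keys_eq_empty[of "wpart Mo c (phi f)"] unfolding w by blast
  moreover obtain m' where "m' \<in> keys (phi f)" "Mo m' = ?c"
    using False keys_wpart[of Mo ?c "phi f"] keys_eq_empty[of "wpart Mo ?c (phi f)"] unfolding p by blast
  ultimately have "c = ?c" using ge ge' unfolding weight_ge_def by (metis order_antisym)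
  then show ?thesis unfolding p using w f'(1) by (auto simp: wpart_carrier)
qed

text \<open>A monomial remembers its grade: \<open>a\<close> does not involve the index
  \<open>dm\<close>, so the exponent there is the degree, and removing it leaves \<open>a\<close>.
  This yields the independence of the graded pieces.\<close>

lemma keys_gpart:
  assumes "k \<in> keys (gpart (r, a) X)" "keys a \<subseteq> {..<dm}"
  shows "lookup k dm = r" "exponent k = a + exponent (single dm r)"
proof -
  obtain m where m: "k = single dm r + m" "m \<in> keys (wpart Mo (N a) (seq_subst S X))"
    using assms(1) unfolding gpart_def by (auto elim!: keys_multE split: if_splits)
  then have "exponent m = a" by (auto simp: keys_wpart Mo_def order_key_inj)
  moreover have "dm \<notin> keys a" using assms(2) by auto
  ultimately have "int (lookup m dm) = 0" by (metis exponent_lookup in_keys_iff)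
  then show "lookup k dm = r" using m by (simp add: lookup_add)
  show "exponent k = a + exponent (single dm r)" using m \<open>exponent m = a\<close> by (simp add: exponent_add add.commute)
qed

text \<open>Additivity and multiplicativity are those of lowest components, read through
  \<open>filt_ge_iff\<close>. Independence holds because a monomial occurs in at most one
  grade.\<close>

sublocale real: graded_realization PA "seq_grades S" "filt_ge n S" "filt_gt n S" gpart
proof (unfold graded_realization_def graded_realization_axioms_def, intro conjI ring_PA allI impI)
  show "0 \<in> seq_grades S" by (simp add: seq_grades_def zero_prod_def)
next
  fix g h assume "g \<in> seq_grades S" "h \<in> seq_grades S"
  then have "keys (snd g) \<subseteq> {..<length S}" "keys (snd h) \<subseteq> {..<length S}" by (auto simp: seq_grades_def)
  then have "keys (snd g + snd h) \<subseteq> {..<length S}"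
    using Poly_Mapping.keys_add[of "snd g" "snd h"] by blast
  then show "g + h \<in> seq_grades S" by (auto simp: seq_grades_def plus_prod_def)
next
  fix g :: "nat \<times> (nat \<Rightarrow>\<^sub>0 int)" and X assume "X \<in> filt_ge n S g"
  then show "X \<in> carrier PA" by (cases g) (auto simp: filt_ge_iff PA_simps)
next
  fix g :: "nat \<times> (nat \<Rightarrow>\<^sub>0 int)"
  show "\<zero>\<^bsub>PA\<^esub> \<in> filt_ge n S g" by (cases g) (simp add: filt_ge_def)
next
  fix g :: "nat \<times> (nat \<Rightarrow>\<^sub>0 int)" and X Y assume XY: "X \<in> filt_ge n S g" "Y \<in> filt_ge n S g"
  obtain r a where g: "g = (r, a)" by (cases g)
  obtain f f' where f: "f \<in> carrier PR" "homogeneous r f" "weight_ge Mo (N a) (phi0 f)" "X = cl f"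
    and f': "f' \<in> carrier PR" "homogeneous r f'" "weight_ge Mo (N a) (phi0 f')" "Y = cl f'"
    using XY unfolding g filt_ge_iff by blast
  have s: "X \<oplus>\<^bsub>PA\<^esub> Y = cl (f + f')" using f f' by (simp add: cl_add)
  show "X \<oplus>\<^bsub>PA\<^esub> Y \<in> filt_ge n S g"
    unfolding g filt_ge_iff s using f f'
    by (intro bexI[of _ "f + f'"] conjI homogeneous_add refl) (auto simp: phi0_simps intro: weight_ge_add)
  show "gpart g (X \<oplus>\<^bsub>PA\<^esub> Y) = gpart g X + gpart g Y"
    by (subst s) (simp add: g f(4) f'(4) gpart_cl phi0_simps wpart_add distrib_left)
next
  fix g :: "nat \<times> (nat \<Rightarrow>\<^sub>0 int)" and X assume X: "X \<in> filt_ge n S g"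
  obtain r a where g: "g = (r, a)" by (cases g)
  obtain f where f: "f \<in> carrier PR" "homogeneous r f" "weight_ge Mo (N a) (phi0 f)" "X = cl f"
    using X unfolding g filt_ge_iff by blast
  show "\<ominus>\<^bsub>PA\<^esub> X \<in> filt_ge n S g"
    unfolding g filt_ge_iff f(4) cl_neg[OF f(1)] using f
    by (intro bexI[of _ "- f"] conjI homogeneous_uminus refl) (auto simp: phi0_simps weight_ge_uminus)
next
  fix g :: "nat \<times> (nat \<Rightarrow>\<^sub>0 int)" and X
  obtain r a where g: "g = (r, a)" by (cases g)
  have nz: "single (single dm r) (1 :: complex) \<noteq> 0" by (metis lookup_single_eq lookup_zero zero_neq_one)
  show "X \<in> filt_gt n S g \<longleftrightarrow> X \<in> filt_ge n S g \<and> gpart g X = 0"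
  proof
    assume "X \<in> filt_gt n S g"
    then obtain f where f: "f \<in> carrier PR" "homogeneous r f" "weight_gt Mo (N a) (phi0 f)" "X = cl f"
      unfolding g filt_ge_iff by blast
    show "X \<in> filt_ge n S g \<and> gpart g X = 0"
      unfolding g filt_ge_iff f(4) gpart_cl wpart_eq_0[OF f(3)] using f(1,2) weight_gt_imp_ge[OF f(3)] by auto
  next
    assume X: "X \<in> filt_ge n S g \<and> gpart g X = 0"
    then obtain f where f: "f \<in> carrier PR" "homogeneous r f" "weight_ge Mo (N a) (phi0 f)" "X = cl f"
      unfolding g filt_ge_iff by blast
    have "wpart Mo (N a) (phi0 f) = 0"
      using X nz unfolding g f(4) gpart_cl by simp
    then have "weight_gt Mo (N a) (phi0 f)" using weight_gt_diff_wpart[OF f(3)] by simp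
    then show "X \<in> filt_gt n S g" unfolding g filt_ge_iff using f by blast
  qed
next
  fix g h :: "nat \<times> (nat \<Rightarrow>\<^sub>0 int)" and X Y assume XY: "X \<in> filt_ge n S g" "Y \<in> filt_ge n S h"
  obtain r a s b where g: "g = (r, a)" and h: "h = (s, b)" by (cases g, cases h)
  obtain f f' where f: "f \<in> carrier PR" "homogeneous r f" "weight_ge Mo (N a) (phi0 f)" "X = cl f"
    and f': "f' \<in> carrier PR" "homogeneous s f'" "weight_ge Mo (N b) (phi0 f')" "Y = cl f'"
    using XY unfolding g h filt_ge_iff by blast
  have m: "X \<otimes>\<^bsub>PA\<^esub> Y = cl (f * f')" using f f' by (simp add: cl_mult)
  have gh: "g + h = (r + s, a + b)" by (simp add: g h plus_prod_def)
  show "X \<otimes>\<^bsub>PA\<^esub> Y \<in> filt_ge n S (g + h)"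
    unfolding gh filt_ge_iff m
  proof (intro bexI[of _ "f * f'"] conjI refl)
    show "homogeneous (r + s) (f * f')" by (rule homogeneous_mult[OF f(2) f'(2)])
    show "weight_ge Mo (N (a + b)) (phi0 (f * f'))"
      unfolding phi0_simps order_key_add by (rule weight_ge_mult[OF Mo_hom f(3) f'(3)])
  qed (use f f' in auto)
  have t: "single (single dm (r + s)) (1 :: complex) = single (single dm r) 1 * single (single dm s) 1"
    by (simp add: mult_single single_add)
  show "gpart (g + h) (X \<otimes>\<^bsub>PA\<^esub> Y) = gpart g X * gpart h Y"
    by (subst m, subst gh) (simp only: g h f(4) f'(4) gpart_cl phi0_simps order_key_add t
        wpart_mult[OF Mo_hom f(3) f'(3)], simp only: ac_simps)
next
  have N0: "N 0 = 0" using order_key_add[of S 0 0] by simp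
  have w1: "weight_ge Mo 0 1" using weight_hom_zero[OF Mo_hom] by (simp add: weight_ge_def)
  show "\<one>\<^bsub>PA\<^esub> \<in> filt_ge n S 0"
    unfolding zero_prod_def filt_ge_iff PA_simps N0
    using homogeneous_Const[of 1] w1 by (intro bexI[of _ 1] conjI refl) (simp_all add: phi0_simps)
  have "wpart Mo 0 (1 :: nat cpoly) = 1"
    using wpart_single[of Mo 0 0 1] weight_hom_zero[OF Mo_hom] by simp
  then show "gpart 0 \<one>\<^bsub>PA\<^esub> = 1"
    unfolding zero_prod_def PA_simps gpart_cl N0 by (simp add: phi0_simps)
next
  fix B Xs and g :: "nat \<times> (nat \<Rightarrow>\<^sub>0 int)"
  assume B: "finite B" "B \<subseteq> seq_grades S" and sum0: "(\<Sum>g\<in>B. gpart g (Xs g)) = 0" and g: "g \<in> B"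
  show "gpart g (Xs g) = 0"
  proof (rule ccontr)
    assume "gpart g (Xs g) \<noteq> 0"
    then obtain k where k: "k \<in> keys (gpart g (Xs g))" by (metis all_not_in_conv keys_eq_empty)
    have det: "fst h = lookup k dm \<and> snd h = exponent k - exponent (single dm (lookup k dm))"
      if "h \<in> B" "k \<in> keys (gpart h (Xs h))" for h
    proof -
      have "h \<in> seq_grades S" using that(1) B(2) by blast
      then have "keys (snd h) \<subseteq> {..<dm}" unfolding seq_grades_def length_seq by force
      then show ?thesis using keys_gpart[of k "fst h" "snd h" "Xs h"] that(2) by simp
    qed
    have "lookup (gpart h (Xs h)) k = 0" if "h \<in> B - {g}" for h
    proof (rule ccontr)
      assume "lookup (gpart h (Xs h)) k \<noteq> 0"
      then have "h = g" using det[of h] det[OF g k] that by (auto simp: in_keys_iff prod_eq_iff)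
      then show False using that by simp
    qed
    then have "(\<Sum>h\<in>B. lookup (gpart h (Xs h)) k) = lookup (gpart g (Xs g)) k"
      using B g by (subst sum.remove[OF B(1) g]) simp
    moreover have "(\<Sum>h\<in>B. lookup (gpart h (Xs h)) k) = 0"
      using arg_cong[OF sum0, of "\<lambda>p. lookup p k"] by (simp add: lookup_sum)
    ultimately show False using k by (simp add: in_keys_iff)
  qed
qed

lemma keys_lmon:
  assumes "keys m \<subseteq> plucker_index n" shows "keys (lmon m) \<subseteq> {..dm}"
  using assms
proof (induction m rule: poly_mapping_linear_induct)
  case (single v r)
  obtain a b where v: "v = (a, b)" "1 \<le> a" "a < b" "b \<le> n" using single by (auto simp: plucker_index_def)
  have "keys (tlead a b) \<subseteq> {..dm}" using keys_tlead[of a b] v by auto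
  moreover have "keys (of_nat r * q) \<subseteq> keys q" for q :: "nat \<Rightarrow>\<^sub>0 nat"
  proof (induction r)
    case (Suc r) then show ?case using Poly_Mapping.keys_add[of q "of_nat r * q"] by (auto simp: distrib_right)
  qed simp
  ultimately show ?case unfolding v(1) lmon_single by blast
next
  case (add m m') then show ?case using Poly_Mapping.keys_add[of "lmon m" "lmon m'"] by (auto simp: lmon_add)
qed simp

lemma realize_image: "real.realize ` carrier (seq_graded_algebra n S) = psi ` carrier PR"
proof -
  have gr: "seq_graded_algebra n S = real.Gr" by (simp add: seq_graded_algebra_def)
  have add: "u + v \<in> psi ` carrier PR" if uv: "u \<in> psi ` carrier PR" "v \<in> psi ` carrier PR" for u v
  proof -
    obtain f g where "f \<in> carrier PR" "g \<in> carrier PR" "u = psi f" "v = psi g" using uv by blast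
    then show ?thesis by (intro image_eqI[of _ _ "f + g"]) (auto simp: psi_simps)
  qed
  have zero: "0 \<in> psi ` carrier PR" by (intro image_eqI[of _ _ 0]) simp_all
  have sum: "sum u B \<in> psi ` carrier PR" if "\<And>g. g \<in> B \<Longrightarrow> u g \<in> psi ` carrier PR"
    for u and B :: "(nat \<times> (nat \<Rightarrow>\<^sub>0 int)) set"
    using that by (induction B rule: infinite_finite_induct) (auto intro: add zero)
  have part: "gpart g X \<in> psi ` carrier PR" if X: "X \<in> filt_ge n S g" for g X
  proof -
    obtain r a where g: "g = (r, a)" by (cases g)
    obtain f where f: "f \<in> carrier PR" "homogeneous r f" "weight_ge Mo (N a) (phi0 f)" "X = cl f"
      using X unfolding g filt_ge_iff by blast
    show ?thesis unfolding g f(4) by (rule gpart_in_psi_image[OF f(1-3)])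
  qed
  have mono: "psi (single m c) \<in> real.realize ` carrier real.Gr" if m: "keys m \<subseteq> plucker_index n" for m c
  proof -
    define r where "r = mdeg m"
    \<comment> \<open>The grade that the class of the monomial represents: its leading exponent with
      the degree variable removed.\<close>
    define a where "a = exponent (lmon m) - exponent (single dm r)"
    let ?f = "single m c"
    have f: "?f \<in> carrier PR" "homogeneous r ?f" using m by (auto simp: homogeneous_mdeg r_def)
    have "lookup a dm = 0" using lookup_lmon_dm[OF m] by (simp add: a_def lookup_minus r_def)
    moreover have "lookup a k = 0" if "dm < k" for k
    proof -
      have "k \<notin> keys (lmon m)" using keys_lmon[OF m] that by auto
      then show ?thesis using that by (simp add: a_def lookup_minus lookup_single in_keys_iff)
    qed
    ultimately have "keys a \<subseteq> {..<dm}" by (auto simp: in_keys_iff) (metis linorder_neqE_nat)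
    then have g: "(r, a) \<in> seq_grades S" by (simp add: seq_grades_def length_seq)
    have c: "Mo (single dm r) + N a = Mo (lmon m)"
      unfolding Mo_def a_def by (simp flip: order_key_add)
    have gf: "weight_ge V.Mp (Mo (lmon m)) ?f" by (simp add: weight_ge_def)
    have wf: "wpart V.Mp (Mo (lmon m)) ?f = ?f" by (simp add: wpart_single)
    have "weight_ge Mo (Mo (lmon m)) (phi ?f)"
      using weight_ge_add[OF weight_gt_imp_ge[OF V.phi_leading_part[OF f(1) gf]]
          weight_ge_wpart[of Mo "Mo (lmon m)" "phi ?f"]]
      unfolding V.wpart_phi[OF f(1) gf] by simp
    then have ge: "weight_ge Mo (N a) (phi0 ?f)"
      unfolding phi_phi0[OF f(2)] c[symmetric] weight_ge_shift .
    have "psi ?f = gpart (r, a) (cl ?f)"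
      unfolding gpart_cl shift_wpart c phi_phi0[OF f(2), symmetric] V.wpart_phi[OF f(1) gf] wf ..
    moreover have "cl ?f \<in> filt_ge n S (r, a)" unfolding filt_ge_iff using f ge by blast
    ultimately show ?thesis using real.realize_image_single[OF g] by simp
  qed
  show ?thesis unfolding gr
  proof
    show "real.realize ` carrier real.Gr \<subseteq> psi ` carrier PR"
    proof clarify
      fix x assume x: "x \<in> carrier real.Gr"
      show "real.realize x \<in> psi ` carrier PR"
        unfolding real.realize_def
      proof (rule sum)
        fix g assume "g \<in> {g \<in> seq_grades S. x g \<noteq> filt_gt n S g}"
        then show "gpart g (coset_rep (x g)) \<in> psi ` carrier PR"
          using real.carrier_rep(1)[OF x] by (intro part) auto
      qed
    qed
    show "psi ` carrier PR \<subseteq> real.realize ` carrier real.Gr"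
    proof clarify
      fix f assume "f \<in> carrier PR"
      then have "keys f \<subseteq> {m. keys m \<subseteq> plucker_index n}" by (auto simp: in_cpoly_carrier)
      then show "psi f \<in> real.realize ` carrier real.Gr"
      proof (induction f rule: poly_mapping_linear_induct)
        case zero show ?case using real.realize_image_zero by simp
      next
        case (single m c) then show ?case using mono by simp
      next
        case (add g h) then show ?case using real.realize_image_add by (simp add: psi_simps)
      qed
    qed
  qed
qed

text \<open>Stated for every homomorphism with the image of \<open>psi\<close>, because a
  permutation of the leaves changes the kernel but not the image.\<close>

theorem graded_iso_of_kernel:
  assumes J: "J = {f \<in> carrier PR. \<Psi> f = 0}"
    and hom: "\<And>f g. \<Psi> (f + g) = \<Psi> f + \<Psi> g" "\<And>f g. \<Psi> (f * g) = \<Psi> f * \<Psi> g" "\<And>c. \<Psi> (Const c) = Const c"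
    and img: "\<Psi> ` carrier PR = psi ` carrier PR"
  shows "graded_algebra_iso_quotient n S J"
  unfolding graded_algebra_iso_quotient_def seq_graded_algebra_def
proof (rule real.algebra_iso_kernel[OF J hom(1,2)])
  show "\<Psi> 1 = 1" using hom(3)[of 1] by simp
  show "real.realize ` carrier real.Gr = \<Psi> ` carrier PR"
    using realize_image img by (simp add: seq_graded_algebra_def)
  fix c
  have N0: "N 0 = 0" using order_key_add[of S 0 0] by simp
  have "weight_ge Mo 0 (Const c)" using weight_hom_zero[OF Mo_hom] by (simp add: weight_ge_def Const_def)
  then have F0: "cl (Const c) \<in> filt_ge n S 0"
    unfolding zero_prod_def filt_ge_iff N0 by (intro bexI[of _ "Const c"] conjI refl) (simp_all add: phi0_simps)
  have eq: "seq_graded_scalar n S c =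
      (\<lambda>g\<in>seq_grades S. filt_gt n S g +>\<^bsub>PA\<^esub> (if g = 0 then cl (Const c) else \<zero>\<^bsub>PA\<^esub>))"
    by (simp add: seq_graded_scalar_def)
  have "wpart Mo 0 (Const c) = Const c"
    using weight_hom_zero[OF Mo_hom] by (simp add: Const_def wpart_single)
  then have "gpart 0 (cl (Const c)) = Const c"
    unfolding zero_prod_def gpart_cl N0 by (simp add: phi0_simps)
  then show "real.realize (seq_graded_scalar n S c) = \<Psi> (Const c)"
    unfolding eq real.realize_degree_zero[OF F0] hom(3) .
  have "{g \<in> seq_grades S. seq_graded_scalar n S c g \<noteq> filt_gt n S g} \<subseteq> {0}"
    using real.cs_zero unfolding eq by auto
  then have "finite {g \<in> seq_grades S. seq_graded_scalar n S c g \<noteq> filt_gt n S g}"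
    by (rule finite_subset) simp
  then show "seq_graded_scalar n S c \<in> carrier real.Gr"
    using F0 real.F_zero unfolding assoc_graded_ring_def eq by auto
qed

end

section \<open>Birationality\<close>

lemma indep2_wedge_nonzero:
  assumes "indep2 v w"
  shows "\<exists>a b. wedge v w (a, b) \<noteq> 0"
proof (rule ccontr)
  assume "\<not> ?thesis"
  then have 0: "v a * w b = v b * w a" for a b by (simp add: wedge_def)
  have "\<exists>b. v b \<noteq> 0"
  proof (rule ccontr)
    assume "\<not> ?thesis"
    then have "\<forall>l. 1 * v l + 0 * w l = 0" by simp
    then show False using assms unfolding indep2_def by (metis one_neq_zero)
  qed
  then obtain b where b: "v b \<noteq> 0" by blast
  have "\<forall>l. w b * v l + (- v b) * w l = 0" using 0[of _ b] by (simp add: algebra_simps)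
  then have "- v b = 0" using assms unfolding indep2_def by blast
  then show False using b by simp
qed

lemma span2_self: "v \<in> span2 v w" "w \<in> span2 v w"
proof -
  have "v = (\<lambda>l. 1 * v l + 0 * w l)" "w = (\<lambda>l. 0 * v l + 1 * w l)" by auto
  then show "v \<in> span2 v w" "w \<in> span2 v w" unfolding span2_def by blast+
qed

lemma span2_comb: "x \<in> span2 v w \<Longrightarrow> y \<in> span2 v w \<Longrightarrow> (\<lambda>l. a * x l + b * y l) \<in> span2 v w"
proof -
  assume "x \<in> span2 v w" "y \<in> span2 v w"
  then obtain c d e f where "x = (\<lambda>l. c * v l + d * w l)" "y = (\<lambda>l. e * v l + f * w l)"
    unfolding span2_def by blast
  then have "(\<lambda>l. a * x l + b * y l) = (\<lambda>l. (a * c + b * e) * v l + (a * d + b * f) * w l)"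
    by (auto simp: algebra_simps)
  then show ?thesis unfolding span2_def by blast
qed

lemma span2_subset: "x \<in> span2 v w \<Longrightarrow> y \<in> span2 v w \<Longrightarrow> span2 x y \<subseteq> span2 v w"
  unfolding span2_def[of x y] using span2_comb by blast

text \<open>Two bases of a plane differ by a matrix and their coordinate vectors by its determinant,
  which is nonzero because independent vectors have a nonzero wedge.\<close>

lemma plucker_coords_proportional:
  assumes "p \<in> plucker_coords W" "q \<in> plucker_coords W"
  shows "\<exists>c. c \<noteq> 0 \<and> (\<forall>e. q e = c * p e)"
proof -
  obtain v w where vw: "indep2 v w" "W = span2 v w" "p = wedge v w"
    using assms(1) unfolding plucker_coords_def by blast
  obtain x y where xy: "indep2 x y" "W = span2 x y" "q = wedge x y"
    using assms(2) unfolding plucker_coords_def by blast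
  have "span2 x y = span2 v w" using xy(2) vw(2) by metis
  then have "x \<in> span2 v w" "y \<in> span2 v w"
    using span2_self(1)[of x y] span2_self(2)[of y x] by simp_all
  then obtain a b c d where ab: "x = (\<lambda>l. a * v l + b * w l)" and cd: "y = (\<lambda>l. c * v l + d * w l)"
    unfolding span2_def by blast
  have q: "q e = (a * d - b * c) * p e" for e
    unfolding xy(3) vw(3) wedge_def ab cd by (cases e) (simp add: algebra_simps)
  moreover have "a * d - b * c \<noteq> 0"
  proof
    assume "a * d - b * c = 0"
    then have "q e = 0" for e by (simp add: q)
    then show False using indep2_wedge_nonzero[OF xy(1)] xy(3) by simp
  qed
  ultimately show ?thesis by blast
qed

definition pc :: "(nat \<times> nat \<Rightarrow> complex) \<Rightarrow> nat \<Rightarrow> nat \<Rightarrow> complex" where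
  "pc p a b = cpoly_eval id p (pvar a b)"

lemma pc_wedge: "pc (wedge v w) a b = wedge v w (a, b)"
  by (cases a b rule: linorder_cases)
    (simp_all add: pc_def pvar_def cpoly_eval_Var cpoly_eval_uminus wedge_def)

lemma pc_scale: "(\<And>e. q e = c * p e) \<Longrightarrow> pc q a b = c * pc p a b"
  by (cases a b rule: linorder_cases)
    (simp_all add: pc_def pvar_def cpoly_eval_Var cpoly_eval_uminus)

lemmas eval_id = cpoly_eval_simps[OF coeff_hom_id]

lemma pvar_homogeneous: "homogeneous 1 (pvar a b)"
  using homogeneous_Var[of "(a, b)"] homogeneous_uminus[OF homogeneous_Var[of "(b, a)"]]
  by (simp add: pvar_def del: One_nat_def)

section \<open>The open sets on which the parametrization is invertible\<close>

context iterated_seq begin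

text \<open>Where the first factor does not vanish, the plane has a basis whose first two rows form
  the identity. Where the factor for \<open>k\<close> does not vanish, the rows \<open>i k\<close>
  and \<open>j k\<close> are a basis, so row \<open>k\<close> determines its two parameters.\<close>

definition chart :: "(nat \<times> nat) cpoly" where
  "chart = pvar 1 2 * (\<Prod>k\<in>{3..n}. pvar (i k) (j k))"

lemma chart_carrier: "chart \<in> carrier PR"
  unfolding chart_def
proof (intro cpoly_carrier_mult cpoly_carrier_prod pvar_carrier)
  fix k assume "k \<in> {3..n}"
  then show "i k \<in> {1..n}" "j k \<in> {1..n}" using ij(1,3,6,7)[of k] by auto
qed (use n_ge in auto)

lemma chart_homogeneous: "\<exists>r. homogeneous r chart"
proof
  show "homogeneous (1 + (\<Sum>k\<in>{3..n}. 1)) chart"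
    unfolding chart_def by (intro homogeneous_mult homogeneous_prod pvar_homogeneous)
qed

lemma eval_chart: "cpoly_eval id p chart = pc p 1 2 * (\<Prod>k\<in>{3..n}. pc p (i k) (j k))"
  by (simp add: chart_def pc_def cpoly_eval_mult cpoly_eval_prod)

definition good_planes :: "(nat \<Rightarrow> complex) set set" where
  "good_planes = {W \<in> Gr2 n. \<exists>f\<in>{chart}. \<exists>p\<in>plucker_coords W. cpoly_eval id p f \<noteq> 0}"

definition good_params :: "(nat \<Rightarrow> complex) set" where
  "good_params = {z \<in> affine_space dm. \<exists>f\<in>{\<Prod>k\<in>{3..n}. minor Var (i k) (j k)}. cpoly_eval id z f \<noteq> 0}"

text \<open>Polynomial and numerical minors obey the same recursion, so the condition on parameters
  can be given by a polynomial and used numerically.\<close>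

lemma minor_carrier_eval:
  assumes "a \<in> {1..n}" "b \<in> {1..n}" "a \<noteq> b"
  shows "minor Var a b \<in> carrier (cpoly_ring {..<dm}) \<and> cpoly_eval id z (minor Var a b) = minor z a b"
  using assms n_ge
proof (induction a b rule: pair_induct)
  case (swap a b)
  have 1: "minor Var b a = - minor Var a b" by (rule minor_swap)
  have 2: "minor z b a = - minor z a b" by (rule minor_swap)
  show ?case unfolding 1 2 eval_id
    by (intro conjI cpoly_carrier_uminus conjunct1[OF swap(4)]) (simp only: conjunct2[OF swap(4)])
next
  case base show ?case unfolding minor_12 eval_id by simp
next
  case (first k)
  have vy: "Var (yi k) \<in> carrier (cpoly_ring {..<dm})" using idx_less[OF first(1,2)] by auto
  show ?case
    unfolding minor_rec[OF first(1,2)] minor_same mult_zero_right add_0_left eval_id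
    by (intro conjI cpoly_carrier_mult vy conjunct1[OF first(3)]) (simp only: conjunct2[OF first(3)])
next
  case (other k a)
  have v: "Var (xi k) \<in> carrier (cpoly_ring {..<dm})" "Var (yi k) \<in> carrier (cpoly_ring {..<dm})"
    using idx_less[OF other(1,2)] by auto
  have mj: "minor Var a (j k) \<in> carrier (cpoly_ring {..<dm}) \<and>
      cpoly_eval id z (minor Var a (j k)) = minor z a (j k)"
  proof (cases "a = j k")
    case True then show ?thesis by simp
  next
    case False then show ?thesis by (rule other(7))
  qed
  show ?case
    unfolding minor_rec[OF other(1,2)] eval_id
    by (intro conjI cpoly_carrier_add cpoly_carrier_mult v conjunct1[OF other(6)] conjunct1[OF mj])
      (simp only: conjunct2[OF other(6)] conjunct2[OF mj])
qed

lemma good_params_iff: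
  "z \<in> good_params \<longleftrightarrow> z \<in> affine_space dm \<and> (\<forall>k\<in>{3..n}. minor z (i k) (j k) \<noteq> 0)"
proof -
  have "cpoly_eval id z (minor Var (i k) (j k)) = minor z (i k) (j k)" if "k \<in> {3..n}" for k
  proof -
    have "3 \<le> k" "k \<le> n" using that by auto
    note k = ij[OF this]
    show ?thesis using minor_carrier_eval[of "i k" "j k" z] k(1,3,5,6,7) by simp
  qed
  then have "cpoly_eval id z (\<Prod>k\<in>{3..n}. minor Var (i k) (j k)) = (\<Prod>k\<in>{3..n}. minor z (i k) (j k))"
    by (simp add: cpoly_eval_prod)
  then show ?thesis by (simp add: good_params_def)
qed

lemma affine_open_good: "affine_open (length S) good_params"
  unfolding affine_open_def length_seq good_params_def
proof (intro exI[of _ "{\<Prod>k\<in>{3..n}. minor Var (i k) (j k)}"] conjI refl)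
  have "minor Var (i k) (j k) \<in> carrier (cpoly_ring {..<dm})" if "k \<in> {3..n}" for k
  proof -
    have "3 \<le> k" "k \<le> n" using that by auto
    note k = ij[OF this]
    show ?thesis using minor_carrier_eval[of "i k" "j k"] k(1,3,5,6,7) by simp
  qed
  then show "{\<Prod>k\<in>{3..n}. minor Var (i k) (j k)} \<subseteq> carrier (cpoly_ring {..<dm})"
    using cpoly_carrier_prod[of "{3..n}" "\<lambda>k. minor Var (i k) (j k)" "{..<dm}"] by simp
qed

lemma Gr2_open_good: "Gr2_open n good_planes"
  unfolding Gr2_open_def good_planes_def
  by (intro exI[of _ "{chart}"] conjI refl) (use chart_carrier chart_homogeneous in simp)

abbreviation col1 :: "(nat \<Rightarrow> complex) \<Rightarrow> nat \<Rightarrow> complex" where "col1 z \<equiv> seq_act S z (unit_vec 1)"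
abbreviation col2 :: "(nat \<Rightarrow> complex) \<Rightarrow> nat \<Rightarrow> complex" where "col2 z \<equiv> seq_act S z (unit_vec 2)"

lemma cols:
  "col1 z 1 = 1" "col1 z 2 = 0" "col2 z 1 = 0" "col2 z 2 = 1" "col1 z 0 = 0" "col2 z 0 = 0"
  "n < l \<Longrightarrow> col1 z l = 0" "n < l \<Longrightarrow> col2 z l = 0"
  using n_ge seq_act_outside[of l z "unit_vec 1"] seq_act_outside[of l z "unit_vec 2"]
  by (simp_all add: seq_act_outside unit_vec_def)

lemma minor_coords: "(\<lambda>(a, b). minor z a b) \<in> plucker_coords (seq_map S z)" "seq_map S z \<in> Gr2 n"
proof -
  have ind: "indep2 (col1 z) (col2 z)"
    unfolding indep2_def
  proof (intro allI impI)
    fix a b assume "\<forall>l. a * col1 z l + b * col2 z l = 0"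
    then have "a * col1 z 1 + b * col2 z 1 = 0" "a * col1 z 2 + b * col2 z 2 = 0" by blast+
    then show "a = 0 \<and> b = 0" unfolding cols by simp
  qed
  have "(\<lambda>(a, b). minor z a b) = wedge (col1 z) (col2 z)" by (auto simp: minor_def)
  then show "(\<lambda>(a, b). minor z a b) \<in> plucker_coords (seq_map S z)"
    unfolding plucker_coords_def seq_map_def using ind by blast
  have "col1 z l = 0 \<and> col2 z l = 0" if "l \<notin> {1..n}" for l
    using that cols(7,8)[of l z] cols(5,6)[of z] by (cases "l = 0") auto
  then have "col1 z \<in> complex_space n" "col2 z \<in> complex_space n" by (auto simp: complex_space_def)
  then show "seq_map S z \<in> Gr2 n" unfolding Gr2_def seq_map_def using ind by blast
qed

lemma pc_minor: "pc (\<lambda>(a, b). minor z a b) a b = minor z a b"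
proof -
  have "(\<lambda>(a, b). minor z a b) = wedge (col1 z) (col2 z)" by (auto simp: minor_def)
  then show ?thesis by (simp add: pc_wedge minor_def)
qed

lemma coords_seq_map:
  assumes "p \<in> plucker_coords (seq_map S z)"
  obtains c where "c \<noteq> 0" "\<And>a b. pc p a b = c * minor z a b"
proof -
  obtain c where c: "c \<noteq> 0" "\<forall>e. p e = c * (\<lambda>(a, b). minor z a b) e"
    using plucker_coords_proportional[OF minor_coords(1) assms] by blast
  have "pc p a b = c * minor z a b" for a b
    using pc_scale[of p c "\<lambda>(a, b). minor z a b" a b] c(2) by (simp add: pc_minor)
  then show thesis using c(1) that by blast
qed

text \<open>Cramer's rule for row \<open>k\<close> in terms of the rows \<open>i k\<close> and
  \<open>j k\<close>.\<close>

lemma recover: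
  assumes "3 \<le> k" "k \<le> n"
  shows "z (xi k) * minor z (i k) (j k) = minor z k (j k)" "z (yi k) * minor z (i k) (j k) = minor z (i k) k"
proof -
  have "minor z (j k) k = z (xi k) * minor z (j k) (i k)" using minor_rec[OF assms, of z "j k"] by simp
  then show "z (xi k) * minor z (i k) (j k) = minor z k (j k)"
    unfolding minor_swap[of z k "j k"] minor_swap[of z "j k" "i k"] by simp
  show "z (yi k) * minor z (i k) (j k) = minor z (i k) k" using minor_rec[OF assms, of z "i k"] by simp
qed

lemma index_cases:
  assumes "l < dm"
  obtains k where "3 \<le> k" "k \<le> n" "l = xi k" | k where "3 \<le> k" "k \<le> n" "l = yi k"
proof -
  define k where "k = n - l div 2"
  have "l div 2 < n - 2" using assms unfolding dm_def by auto
  then have k: "3 \<le> k" "k \<le> n" "n - k = l div 2" by (auto simp: k_def)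
  show thesis
  proof (cases "even l")
    case True
    then have "l = xi k" by (simp add: xi_def k(3))
    then show thesis using that(1) k by blast
  next
    case False
    then have "l = yi k" by (simp add: yi_def k(3))
    then show thesis using that(2) k by blast
  qed
qed

lemma seq_map_good: "z \<in> good_params \<Longrightarrow> seq_map S z \<in> good_planes"
proof -
  assume z: "z \<in> good_params"
  have "cpoly_eval id (\<lambda>(a, b). minor z a b) chart \<noteq> 0"
    using z unfolding eval_chart pc_minor minor_12 good_params_iff by simp
  then show ?thesis using minor_coords[of z] unfolding good_planes_def by blast
qed

lemma seq_map_inj: "inj_on (seq_map S) good_params"
proof (rule inj_onI)
  fix z z' assume z: "z \<in> good_params" "z' \<in> good_params" and eq: "seq_map S z = seq_map S z'"
  have mem: "(\<lambda>(a, b). minor z a b) \<in> plucker_coords (seq_map S z')"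
    using minor_coords(1)[of z] unfolding eq .
  obtain c where "c \<noteq> 0" and c: "\<And>a b. pc (\<lambda>(a, b). minor z a b) a b = c * minor z' a b"
    using coords_seq_map[OF mem] by blast
  \<comment> \<open>The factor of proportionality is \<open>1\<close>, since both coordinate vectors
    have the value \<open>1\<close> at the pair \<open>1, 2\<close>.\<close>
  have m: "minor z a b = minor z' a b" for a b
    using c[of a b] c[of 1 2] unfolding pc_minor minor_12 by simp
  show "z = z'"
  proof
    fix l show "z l = z' l"
    proof (cases "l < dm")
      case False
      then have "z l = 0" "z' l = 0" using z unfolding good_params_iff affine_space_def by auto
      then show ?thesis by simp
    next
      case True
      then show ?thesis
      proof (cases rule: index_cases)
        case (1 k)
        have nz: "minor z' (i k) (j k) \<noteq> 0" using z(2) 1 unfolding good_params_iff by simp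
        have "z (xi k) * minor z' (i k) (j k) = z' (xi k) * minor z' (i k) (j k)"
          using recover(1)[OF 1(1,2), of z] recover(1)[OF 1(1,2), of z'] unfolding m by simp
        then show ?thesis using nz 1(3) by simp
      next
        case (2 k)
        have nz: "minor z' (i k) (j k) \<noteq> 0" using z(2) 2 unfolding good_params_iff by simp
        have "z (yi k) * minor z' (i k) (j k) = z' (yi k) * minor z' (i k) (j k)"
          using recover(2)[OF 2(1,2), of z] recover(2)[OF 2(1,2), of z'] unfolding m by simp
        then show ?thesis using nz 2(3) by simp
      qed
    qed
  qed
qed

lemma seq_map_surj:
  assumes "W \<in> good_planes"
  shows "W \<in> seq_map S ` good_params"
proof -
  obtain p where W: "W \<in> Gr2 n" and p: "p \<in> plucker_coords W" "cpoly_eval id p chart \<noteq> 0"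
    using assms unfolding good_planes_def by blast
  obtain v w where vw: "indep2 v w" "W = span2 v w" "p = wedge v w"
    using p(1) unfolding plucker_coords_def by blast
  obtain v0 w0 where vw0: "v0 \<in> complex_space n" "w0 \<in> complex_space n" "W = span2 v0 w0"
    using W unfolding Gr2_def by blast
  have out: "u l = 0" if u: "u \<in> W" and l: "l \<notin> {1..n}" for u l
  proof -
    obtain a b where "u = (\<lambda>l. a * v0 l + b * w0 l)" using u unfolding vw0(3) span2_def by blast
    moreover have "v0 l = 0" "w0 l = 0" using vw0(1,2) l unfolding complex_space_def by blast+
    ultimately show ?thesis by simp
  qed
  define \<delta> where "\<delta> = v 1 * w 2 - v 2 * w 1"
  have nz: "pc p 1 2 \<noteq> 0" "\<And>k. k \<in> {3..n} \<Longrightarrow> pc p (i k) (j k) \<noteq> 0"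
    using p(2) unfolding eval_chart by auto
  have \<delta>: "\<delta> \<noteq> 0" using nz(1) unfolding vw(3) pc_wedge by (simp add: wedge_def \<delta>_def)
  \<comment> \<open>The new basis is obtained from the inverse of the matrix formed by the first two
    rows.\<close>
  define x where "x = (\<lambda>l. (w 2 / \<delta>) * v l + (- v 2 / \<delta>) * w l)"
  define y where "y = (\<lambda>l. (- w 1 / \<delta>) * v l + (v 1 / \<delta>) * w l)"
  have xW: "x \<in> W" "y \<in> W" unfolding x_def y_def vw(2) by (intro span2_comb span2_self)+
  have xy0: "x 1 = 1" "x 2 = 0" "y 1 = 0" "y 2 = 1"
    using \<delta> unfolding x_def y_def by (simp_all add: field_simps) (simp_all add: \<delta>_def field_simps)
  have wedge_xy: "wedge x y e = (1 / \<delta>) * p e" for e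
  proof -
    obtain a b where e: "e = (a, b)" by (cases e)
    have "\<delta> * \<delta> * wedge x y (a, b) = (w 2 * v a - v 2 * w a) * (v 1 * w b - w 1 * v b) -
        (w 2 * v b - v 2 * w b) * (v 1 * w a - w 1 * v a)"
      using \<delta> by (simp add: wedge_def x_def y_def field_simps)
    also have "\<dots> = \<delta> * p (a, b)" unfolding vw(3) \<delta>_def wedge_def by (simp add: algebra_simps)
    finally show ?thesis using \<delta> e by (simp add: field_simps)
  qed
  have ind: "indep2 x y"
    unfolding indep2_def
  proof (intro allI impI)
    fix a b assume "\<forall>l. a * x l + b * y l = 0"
    then have "a * x 1 + b * y 1 = 0" "a * x 2 + b * y 2 = 0" by blast+
    then show "a = 0 \<and> b = 0" unfolding xy0 by simp
  qed
  have v_eq: "v = (\<lambda>l. v 1 * x l + v 2 * y l)" and w_eq: "w = (\<lambda>l. w 1 * x l + w 2 * y l)"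
  proof -
    have "\<delta> * (v 1 * x l + v 2 * y l) = \<delta> * v l" "\<delta> * (w 1 * x l + w 2 * y l) = \<delta> * w l" for l
      using \<delta> unfolding x_def y_def by (simp_all add: field_simps) (simp_all add: \<delta>_def algebra_simps)
    then show "v = (\<lambda>l. v 1 * x l + v 2 * y l)" "w = (\<lambda>l. w 1 * x l + w 2 * y l)"
      using \<delta> by (auto simp: fun_eq_iff)
  qed
  have span: "span2 x y = W"
  proof
    show "span2 x y \<subseteq> W" unfolding vw(2) by (rule span2_subset) (use xW vw(2) in auto)
    have "v \<in> span2 x y" by (subst v_eq) (rule span2_comb[OF span2_self])
    moreover have "w \<in> span2 x y" by (subst w_eq) (rule span2_comb[OF span2_self])
    ultimately show "W \<subseteq> span2 x y" unfolding vw(2) by (rule span2_subset)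
  qed
  define q where "q a b = x a * y b - x b * y a" for a b
  have q: "wedge x y (a, b) = q a b" for a b by (simp add: wedge_def q_def)
  have qnz: "q (i k) (j k) \<noteq> 0" if "3 \<le> k" "k \<le> n" for k
  proof -
    have "pc (wedge x y) (i k) (j k) = (1 / \<delta>) * pc p (i k) (j k)"
      by (rule pc_scale) (rule wedge_xy)
    then show ?thesis using nz(2)[of k] that \<delta> unfolding pc_wedge q by simp
  qed
  \<comment> \<open>The parameters forced by \<open>recover\<close>; the parity of \<open>l\<close>
    tells whether it belongs to \<open>(i k, k)\<close> or to \<open>(j k, k)\<close>.\<close>
  define z where "z l = (if l < dm then (let k = n - l div 2 in
      (if even l then q k (j k) else q (i k) k) / q (i k) (j k)) else 0)" for l
  have z: "z (xi k) = q k (j k) / q (i k) (j k)" "z (yi k) = q (i k) k / q (i k) (j k)" if "3 \<le> k" "k \<le> n" for k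
  proof -
    have "xi k < dm" "yi k < dm" using idx_less[OF that] by auto
    moreover have "n - xi k div 2 = k" "even (xi k)" "n - yi k div 2 = k" "odd (yi k)"
      using that by (auto simp: xi_def yi_def)
    ultimately show "z (xi k) = q k (j k) / q (i k) (j k)" "z (yi k) = q (i k) k / q (i k) (j k)"
      by (simp_all add: z_def)
  qed
  have cramer: "u k = z (yi k) * u (j k) + z (xi k) * u (i k)"
    if k: "3 \<le> k" "k \<le> n" and u: "u = x \<or> u = y" for k u
  proof -
    have "q (i k) (j k) * u k = q (i k) k * u (j k) + q k (j k) * u (i k)"
      using u unfolding q_def by (auto simp: algebra_simps)
    then show ?thesis using qnz[OF k] unfolding z[OF k] by (simp add: field_simps)
  qed
  \<comment> \<open>A column is determined by its first two rows and the linear recurrence of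
    \<open>seq_act_rec\<close>, which \<open>cramer\<close> establishes for \<open>x\<close> and
    \<open>y\<close>.\<close>
  have act: "seq_act S z e l = u l"
    if u: "u = x \<or> u = y" and e: "\<And>l. l \<le> 2 \<Longrightarrow> e l = u l" "\<And>l. 3 \<le> l \<Longrightarrow> e l = 0" for e u l
  proof (induction l rule: less_induct)
    case (less l)
    consider "l \<le> 2" | "n < l" | "3 \<le> l" "l \<le> n" by linarith
    then show ?case
    proof cases
      case 1 then show ?thesis using e(1)[of l] by (simp add: seq_act_outside)
    next
      case 2
      have "u \<in> W" using u xW by blast
      then have "u l = 0" using out 2 by simp
      moreover have "e l = 0" using e(2)[of l] 2 n_ge by simp
      ultimately show ?thesis using 2 by (simp add: seq_act_outside)
    next
      case 3
      have "seq_act S z e (j l) = u (j l)" "seq_act S z e (i l) = u (i l)"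
        using less.IH ij(2,4)[OF 3] by auto
      then show ?thesis unfolding seq_act_rec[OF 3] cramer[OF 3 u] using e(2)[OF 3(1)] by simp
    qed
  qed
  have "x 0 = 0" "y 0 = 0" using out xW by simp_all
  then have "unit_vec 1 l = x l" "unit_vec 2 l = y l" if "l \<le> 2" for l
    using that xy0 by (auto simp: unit_vec_def le_Suc_eq numeral_2_eq_2)
  then have "col1 z = x" "col2 z = y"
    using act[of x "unit_vec 1"] act[of y "unit_vec 2"] by (auto simp: unit_vec_def fun_eq_iff)
  then have map: "seq_map S z = W" unfolding seq_map_def using span by simp
  have "minor z (i k) (j k) \<noteq> 0" if "k \<in> {3..n}" for k
    using qnz[of k] that \<open>col1 z = x\<close> \<open>col2 z = y\<close> by (simp add: minor_def q)
  moreover have "z \<in> affine_space dm" by (simp add: affine_space_def z_def)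
  ultimately have "z \<in> good_params" by (simp add: good_params_iff)
  then show ?thesis using map by blast
qed

lemma good_planes_nonempty: "good_planes \<noteq> {}"
proof -
  \<comment> \<open>The rows \<open>(1, 0)\<close>, \<open>(0, 1)\<close> and \<open>(1, l)\<close>
    for \<open>l \<ge> 3\<close> are pairwise independent, so every Pluecker coordinate of this
    plane is nonzero.\<close>
  define v :: "nat \<Rightarrow> complex" where "v l = (if l = 1 \<or> 3 \<le> l \<and> l \<le> n then 1 else 0)" for l
  define w :: "nat \<Rightarrow> complex" where "w l = (if l = 2 then 1 else if 3 \<le> l \<and> l \<le> n then of_nat l else 0)" for l
  have nz: "wedge v w (a, b) \<noteq> 0" if "a \<in> {1..n}" "b \<in> {1..n}" "a \<noteq> b" for a b
  proof -
    have "of_nat a \<noteq> (of_nat b :: complex)" using that(3) by simp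
    then show ?thesis using that by (auto simp: wedge_def v_def w_def)
  qed
  have vals: "v 1 = 1" "v 2 = 0" "w 1 = 0" "w 2 = 1" by (simp_all add: v_def w_def)
  have ind: "indep2 v w"
    unfolding indep2_def
  proof (intro allI impI)
    fix a b assume "\<forall>l. a * v l + b * w l = 0"
    then have "a * v 1 + b * w 1 = 0" "a * v 2 + b * w 2 = 0" by blast+
    then show "a = 0 \<and> b = 0" unfolding vals by simp
  qed
  have "v \<in> complex_space n" "w \<in> complex_space n" using n_ge by (auto simp: complex_space_def v_def w_def)
  then have "span2 v w \<in> Gr2 n" unfolding Gr2_def using ind by blast
  moreover have "wedge v w \<in> plucker_coords (span2 v w)" unfolding plucker_coords_def using ind by blast
  moreover have "cpoly_eval id (wedge v w) chart \<noteq> 0"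
  proof -
    have "wedge v w (i k, j k) \<noteq> 0" if "k \<in> {3..n}" for k
    proof -
      have "3 \<le> k" "k \<le> n" using that by auto
      from ij(1,3,5,6,7)[OF this] show ?thesis by (intro nz) auto
    qed
    then show ?thesis unfolding eval_chart pc_wedge using nz[of 1 2] n_ge by simp
  qed
  ultimately show ?thesis unfolding good_planes_def by blast
qed

text \<open>Each parameter is a quotient of two Pluecker coordinates up to sign, hence of two forms
  of degree one, and the denominator has no zero on \<open>good_planes\<close>. One open set thus
  serves for all points and all parameters.\<close>

theorem birational: "birational_sequence n S"
  unfolding birational_sequence_def
proof (intro conjI exI[of _ good_params] exI[of _ good_planes])
  show "length S = 2 * (n - 2)" by (simp add: length_seq dm_def)
  show "set S \<subseteq> positive_roots n"
  proof
    fix \<beta> assume "\<beta> \<in> set S"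
    then obtain l where l: "l < dm" "\<beta> = S ! l" by (metis in_set_conv_nth length_seq)
    from l(1) show "\<beta> \<in> positive_roots n"
    proof (cases rule: index_cases)
      case (1 k) then show ?thesis using l(2) ij(1,2)[OF 1(1,2)] by (simp add: seq_nth positive_roots_def)
    next
      case (2 k) then show ?thesis using l(2) ij(3,4)[OF 2(1,2)] by (simp add: seq_nth positive_roots_def)
    qed
  qed
  show "affine_open (length S) good_params" by (rule affine_open_good)
  show "Gr2_open n good_planes" by (rule Gr2_open_good)
  show "good_planes \<noteq> {}" by (rule good_planes_nonempty)
  show bij: "bij_betw (seq_map S) good_params good_planes"
    unfolding bij_betw_def using seq_map_inj seq_map_good seq_map_surj by blast
  show "good_params \<noteq> {}" using bij good_planes_nonempty by (auto simp: bij_betw_def)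
  show "\<forall>l<length S. Gr2_regular n good_planes (\<lambda>W. inv_into good_params (seq_map S) W l)"
  proof (intro allI impI)
    fix l assume "l < length S"
    then have l: "l < dm" by (simp add: length_seq)
    have "\<exists>a b k. 3 \<le> k \<and> k \<le> n \<and> a \<in> {1..n} \<and> b \<in> {1..n} \<and>
        (\<forall>z :: nat \<Rightarrow> complex. z l * minor z (i k) (j k) = minor z a b)"
      using l
    proof (cases rule: index_cases)
      case (1 k)
      have "\<forall>z :: nat \<Rightarrow> complex. z l * minor z (i k) (j k) = minor z k (j k)"
        unfolding 1(3) by (intro allI recover(1)[OF 1(1,2)])
      then show ?thesis using 1(1,2) ij(3,7)[OF 1(1,2)]
        by (rule_tac x = k in exI, rule_tac x = "j k" in exI, rule_tac x = k in exI) simp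
    next
      case (2 k)
      have "\<forall>z :: nat \<Rightarrow> complex. z l * minor z (i k) (j k) = minor z (i k) k"
        unfolding 2(3) by (intro allI recover(2)[OF 2(1,2)])
      then show ?thesis using 2(1,2) ij(1,6)[OF 2(1,2)]
        by (rule_tac x = "i k" in exI, rule_tac x = k in exI, rule_tac x = k in exI) simp
    qed
    then obtain a b k where k: "3 \<le> k" "k \<le> n" and ab: "a \<in> {1..n}" "b \<in> {1..n}"
      and rec: "\<And>z :: nat \<Rightarrow> complex. z l * minor z (i k) (j k) = minor z a b" by blast
    have ijn: "i k \<in> {1..n}" "j k \<in> {1..n}" using ij(1,3,6,7)[OF k] by auto
    show "Gr2_regular n good_planes (\<lambda>W. inv_into good_params (seq_map S) W l)"
      unfolding Gr2_regular_def
    proof (intro ballI exI conjI)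
      show "Gr2_open n good_planes" by (rule Gr2_open_good)
      fix W assume "W \<in> good_planes"
      then show "W \<in> good_planes" .
      show "pvar a b \<in> carrier PR" "pvar (i k) (j k) \<in> carrier PR" using ab ijn by auto
      show "homogeneous 1 (pvar a b)" "homogeneous 1 (pvar (i k) (j k))" by (rule pvar_homogeneous)+
    next
      fix W' p assume W': "W' \<in> good_planes" and p: "p \<in> plucker_coords W'"
      define z where "z = inv_into good_params (seq_map S) W'"
      have z: "z \<in> good_params" "seq_map S z = W'"
        using inv_into_into[of W' "seq_map S" good_params] bij_betw_imp_surj_on[OF bij] W'
          bij_betw_inv_into_right[OF bij W'] unfolding z_def by simp_all
      have mem: "p \<in> plucker_coords (seq_map S z)" using p unfolding z(2) .
      obtain c where c: "c \<noteq> 0" "\<And>a b. pc p a b = c * minor z a b"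
        using coords_seq_map[OF mem] by blast
      have nz: "minor z (i k) (j k) \<noteq> 0" using z(1) k unfolding good_params_iff by simp
      show "cpoly_eval id p (pvar (i k) (j k)) \<noteq> 0"
        unfolding pc_def[symmetric] c(2) using c(1) nz by simp
      show "inv_into good_params (seq_map S) W' l = cpoly_eval id p (pvar a b) / cpoly_eval id p (pvar (i k) (j k))"
        unfolding z_def[symmetric] pc_def[symmetric] c(2) using c(1) nz rec[of z] by (simp add: field_simps)
    qed simp
  qed
qed

end

section \<open>Permutations of the leaves\<close>

abbreviation inv_perm :: "(nat \<Rightarrow> nat) \<Rightarrow> nat \<Rightarrow> nat" where
  "inv_perm \<pi> \<equiv> inv_into UNIV \<pi>"

definition symw :: "(nat \<times> nat \<Rightarrow> real) \<Rightarrow> nat \<Rightarrow> nat \<Rightarrow> real" where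
  "symw w a b = w (min a b, max a b)"

lemma symw_swap: "symw w b a = symw w a b"
  by (simp add: symw_def min.commute max.commute)

lemma symw_less: "a < b \<Longrightarrow> symw w a b = w (a, b)"
  by (simp add: symw_def)

definition permute_weight :: "nat \<Rightarrow> (nat \<Rightarrow> nat) \<Rightarrow> (nat \<times> nat \<Rightarrow> real) \<Rightarrow> nat \<times> nat \<Rightarrow> real" where
  "permute_weight n \<pi> w = (\<lambda>(a, b). if (a, b) \<in> plucker_index n then symw w (\<pi> a) (\<pi> b) else 0)"

lemma permute_weight_space: "permute_weight n \<pi> w \<in> weight_space n"
  by (auto simp: weight_space_def permute_weight_def)

lemma symw_permute_weight:
  assumes "a \<in> {1..n}" "b \<in> {1..n}" "a \<noteq> b"
  shows "symw (permute_weight n \<pi> w) a b = symw w (\<pi> a) (\<pi> b)"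
proof (cases "a < b")
  case True
  then show ?thesis using assms by (simp add: symw_less) (simp add: permute_weight_def plucker_index_def)
next
  case False
  then have "b < a" using assms(3) by simp
  then show ?thesis
    using assms by (simp add: symw_swap[of _ a b] symw_less)
      (simp add: permute_weight_def plucker_index_def symw_swap[of w "\<pi> a" "\<pi> b"])
qed

lemma weight_space_eqI:
  assumes "w \<in> weight_space n" "w' \<in> weight_space n"
    "\<And>a b. a \<in> {1..n} \<Longrightarrow> b \<in> {1..n} \<Longrightarrow> a \<noteq> b \<Longrightarrow> symw w a b = symw w' a b"
  shows "w = w'"
proof
  fix e :: "nat \<times> nat" obtain a b where e: "e = (a, b)" by (cases e)
  show "w e = w' e"
  proof (cases "e \<in> plucker_index n")
    case True
    then have "1 \<le> a" "a < b" "b \<le> n" by (auto simp: e plucker_index_def)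
    then show ?thesis using assms(3)[of a b] by (simp add: e symw_less)
  next
    case False
    then have "w e = 0" "w' e = 0" using assms(1,2) unfolding weight_space_def by blast+
    then show ?thesis by simp
  qed
qed

lemma permute_weight_inverse:
  assumes "\<pi> permutes {1..n}" "w \<in> weight_space n"
  shows "permute_weight n (inv_perm \<pi>) (permute_weight n \<pi> w) = w"
proof (rule weight_space_eqI[OF permute_weight_space assms(2)])
  fix a b assume ab: "a \<in> {1..n}" "b \<in> {1..n}" "a \<noteq> b"
  have i: "inv_perm \<pi> permutes {1..n}" by (rule permutes_inv[OF assms(1)])
  have "inv_perm \<pi> a \<in> {1..n}" "inv_perm \<pi> b \<in> {1..n}" using permutes_in_image[OF i] ab by blast+
  moreover have "inv_perm \<pi> a \<noteq> inv_perm \<pi> b" using ab(3) permutes_inj[OF i] by (auto dest: injD)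
  ultimately show "symw (permute_weight n (inv_perm \<pi>) (permute_weight n \<pi> w)) a b = symw w a b"
    by (simp add: symw_permute_weight[OF ab] symw_permute_weight permutes_inverses(1)[OF assms(1)])
qed

text \<open>The action by \<open>pvar\<close> brings in the signs without which the Pluecker ideal
  would not be preserved.\<close>

definition relabel :: "(nat \<Rightarrow> nat) \<Rightarrow> (nat \<times> nat) cpoly \<Rightarrow> (nat \<times> nat) cpoly" where
  "relabel \<pi> = cpoly_eval Const (\<lambda>e. pvar (\<pi> (fst e)) (\<pi> (snd e)))"

lemma relabel_simps:
  "relabel \<pi> (f + g) = relabel \<pi> f + relabel \<pi> g" "relabel \<pi> (f - g) = relabel \<pi> f - relabel \<pi> g"
  "relabel \<pi> (f * g) = relabel \<pi> f * relabel \<pi> g" "relabel \<pi> (- f) = - relabel \<pi> f"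
  "relabel \<pi> (Var (a, b)) = pvar (\<pi> a) (\<pi> b)" "relabel \<pi> (Const c) = Const c" "relabel \<pi> 0 = 0"
  by (simp_all add: relabel_def cpoly_eval_simps[OF coeff_hom_Const])

lemma relabel_pvar: "relabel \<pi> (pvar a b) = pvar (\<pi> a) (\<pi> b)"
proof (cases a b rule: linorder_cases)
  case greater
  then show ?thesis by (simp add: pvar_def[of a b] relabel_simps pvar_swap[of "\<pi> a" "\<pi> b"])
qed (simp_all add: pvar_def[of a b] relabel_simps, simp_all add: pvar_def relabel_simps)

lemma cpoly_eval_hom:
  fixes f :: "'v cpoly" and x :: "'v \<Rightarrow> 'u cpoly" and h :: "'u cpoly \<Rightarrow> 'w cpoly"
  assumes "\<And>f g. h (f + g) = h f + h g" "\<And>f g. h (f * g) = h f * h g" "\<And>c. h (Const c) = Const c"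
  shows "h (cpoly_eval Const x f) = cpoly_eval Const (\<lambda>v. h (x v)) f"
proof -
  have h0: "h 0 = 0" and h1: "h 1 = 1" using assms(3)[of 0] assms(3)[of 1] by simp_all
  have hpow: "h (p ^ r) = h p ^ r" for p r by (induction r) (simp_all add: h1 assms)
  have hprod: "h (prod g A) = (\<Prod>a\<in>A. h (g a))" for g and A :: "'v set"
    by (induction A rule: infinite_finite_induct) (simp_all add: h1 assms)
  have hsum: "h (sum g A) = (\<Sum>a\<in>A. h (g a))" for g and A :: "('v \<Rightarrow>\<^sub>0 nat) set"
    by (induction A rule: infinite_finite_induct) (simp_all add: h0 assms)
  show ?thesis unfolding cpoly_eval_def hsum assms(2,3) hprod hpow ..
qed

lemma cpoly_eval_Var_id: "cpoly_eval Const Var f = f"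
proof (induction f rule: poly_mapping_linear_induct_UNIV)
  case (single m a)
  have "mono_eval Var m = single m 1"
  proof (induction m rule: poly_mapping_linear_induct_UNIV)
    case (single v r) then show ?case by (simp add: Var_power)
  qed (simp_all add: mono_eval_add mult_single)
  then show ?case
    unfolding cpoly_eval_single[OF coeff_hom_Const] by (simp add: Const_def mult_single)
qed (simp_all add: cpoly_eval_add)

lemma relabel_inverse:
  assumes "f \<in> carrier (plucker_poly_ring n)" "\<And>a. a \<in> {1..n} \<Longrightarrow> \<pi> (\<sigma> a) = a"
  shows "relabel \<pi> (relabel \<sigma> f) = f"
proof -
  have "relabel \<pi> (relabel \<sigma> f) = cpoly_eval Const (\<lambda>e. relabel \<pi> (pvar (\<sigma> (fst e)) (\<sigma> (snd e)))) f"
    unfolding relabel_def[of \<sigma>] by (rule cpoly_eval_hom) (simp_all add: relabel_simps)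
  also have "\<dots> = cpoly_eval Const Var f"
  proof (rule cpoly_eval_cong[OF assms(1)])
    fix e assume "e \<in> plucker_index n"
    then obtain a b where e: "e = (a, b)" "1 \<le> a" "a < b" "b \<le> n" by (auto simp: plucker_index_def)
    then show "relabel \<pi> (pvar (\<sigma> (fst e)) (\<sigma> (snd e))) = Var e"
      using assms(2)[of a] assms(2)[of b] by (simp add: relabel_pvar) (simp add: pvar_def)
  qed
  finally show ?thesis by (simp add: cpoly_eval_Var_id)
qed

lemma cpoly_eval_carrier:
  assumes "f \<in> carrier (cpoly_ring V)" "\<And>v. v \<in> V \<Longrightarrow> x v \<in> carrier (cpoly_ring U)"
  shows "cpoly_eval Const x f \<in> carrier (cpoly_ring U)"
  unfolding cpoly_eval_def
proof (intro cpoly_carrier_sum cpoly_carrier_mult cpoly_carrier_prod cpoly_carrier_power Const_carrier)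
  fix m v assume "m \<in> keys f" "v \<in> keys m"
  then have "v \<in> V" using assms(1) by (auto simp: in_cpoly_carrier)
  then show "x v \<in> carrier (cpoly_ring U)" by (rule assms(2))
qed

section \<open>Invariance of the Pluecker ideal and transport of initial ideals\<close>

context
  fixes n :: nat and \<pi> :: "nat \<Rightarrow> nat"
  assumes \<pi>: "\<pi> permutes {1..n}"
begin

lemma pi_in: "a \<in> {1..n} \<Longrightarrow> \<pi> a \<in> {1..n}"
  using permutes_in_image[OF \<pi>] by blast

lemma pi_neq: "a \<noteq> b \<Longrightarrow> \<pi> a \<noteq> \<pi> b"
  using permutes_inj[OF \<pi>] by (auto dest: injD)

lemma relabel_carrier: "f \<in> carrier (plucker_poly_ring n) \<Longrightarrow> relabel \<pi> f \<in> carrier (plucker_poly_ring n)"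
  unfolding relabel_def
proof (erule cpoly_eval_carrier)
  fix e assume "e \<in> plucker_index n"
  then have "fst e \<in> {1..n}" "snd e \<in> {1..n}" by (auto simp: plucker_index_def)
  then show "pvar (\<pi> (fst e)) (\<pi> (snd e)) \<in> carrier (plucker_poly_ring n)" by (intro pvar_carrier pi_in)
qed

lemma ideal_relabel_vimage:
  assumes "ideal J (plucker_poly_ring n)"
  shows "ideal {f \<in> carrier (plucker_poly_ring n). relabel \<pi> f \<in> J} (plucker_poly_ring n)"
proof (rule ideal_cpolyI)
  show "0 \<in> {f \<in> carrier (plucker_poly_ring n). relabel \<pi> f \<in> J}"
    using ideal_cpolyD(2)[OF assms] by (simp add: relabel_def)
next
  fix f g assume "f \<in> {f \<in> carrier (plucker_poly_ring n). relabel \<pi> f \<in> J}"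
    "g \<in> {f \<in> carrier (plucker_poly_ring n). relabel \<pi> f \<in> J}"
  then show "f + g \<in> {f \<in> carrier (plucker_poly_ring n). relabel \<pi> f \<in> J}"
    using ideal_cpolyD(3)[OF assms] by (auto simp: relabel_simps)
next
  fix f g assume "f \<in> {f \<in> carrier (plucker_poly_ring n). relabel \<pi> f \<in> J}"
    "g \<in> carrier (plucker_poly_ring n)"
  then show "g * f \<in> {f \<in> carrier (plucker_poly_ring n). relabel \<pi> f \<in> J}"
    using ideal_cpolyD(4)[OF assms] relabel_carrier by (auto simp: relabel_simps)
qed auto

lemma relabel_plucker_ideal:
  assumes "f \<in> plucker_ideal n" shows "relabel \<pi> f \<in> plucker_ideal n"
proof -
  let ?K = "{f \<in> carrier (plucker_poly_ring n). relabel \<pi> f \<in> plucker_ideal n}"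
  have "plucker_ideal n \<subseteq> ?K"
    unfolding plucker_ideal_def[of n]
  proof (rule ring.genideal_minimal[OF ring_cpoly])
    show "ideal {f \<in> carrier (plucker_poly_ring n). relabel \<pi> f \<in> genideal (plucker_poly_ring n)
        {Var (i, j) * Var (k, l) - Var (i, k) * Var (j, l) + Var (i, l) * Var (j, k) | i j k l.
          1 \<le> i \<and> i < j \<and> j < k \<and> k < l \<and> l \<le> n}} (plucker_poly_ring n)"
      using ideal_relabel_vimage[OF ideal_plucker] unfolding plucker_ideal_def .
    have "relabel \<pi> (Var (a, b) * Var (c, d) - Var (a, c) * Var (b, d) + Var (a, d) * Var (b, c)) \<in>
        plucker_ideal n" if "1 \<le> a" "a < b" "b < c" "c < d" "d \<le> n" for a b c d
    proof -
      have "plucker_rel (\<pi> a) (\<pi> b) (\<pi> c) (\<pi> d) \<in> plucker_ideal n"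
        by (intro plucker_rel_in_ideal pi_in) (use that in auto)
      then show ?thesis by (simp add: relabel_simps plucker_rel_def)
    qed
    note gens = this
    show "{Var (i, j) * Var (k, l) - Var (i, k) * Var (j, l) + Var (i, l) * Var (j, k) | i j k l.
          1 \<le> i \<and> i < j \<and> j < k \<and> k < l \<and> l \<le> n} \<subseteq> {f \<in> carrier (plucker_poly_ring n).
        relabel \<pi> f \<in> genideal (plucker_poly_ring n)
        {Var (i, j) * Var (k, l) - Var (i, k) * Var (j, l) + Var (i, l) * Var (j, k) | i j k l.
          1 \<le> i \<and> i < j \<and> j < k \<and> k < l \<and> l \<le> n}}"
      unfolding plucker_ideal_def[symmetric]
      by (intro subsetI CollectI conjI, erule subsetD[OF plucker_gens_carrier]) (auto simp: gens)
  qed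
  then show ?thesis using assms by blast
qed

text \<open>A relabelled monomial is a monomial up to sign. Phrasing the claim through the support
  avoids tracking that sign.\<close>

lemma relabel_mono_weight:
  assumes "keys m \<subseteq> plucker_index n" "k \<in> keys (mono_eval (\<lambda>e. pvar (\<pi> (fst e)) (\<pi> (snd e))) m)"
  shows "monomial_weight w k = monomial_weight (permute_weight n \<pi> w) m"
  using assms
proof (induction m arbitrary: k rule: poly_mapping_linear_induct)
  case zero then show ?case by (simp add: monomial_weight_def)
next
  case (single v r)
  obtain a b where v: "v = (a, b)" "1 \<le> a" "a < b" "b \<le> n" using single(1) by (auto simp: plucker_index_def)
  have "monomial_weight w k = permute_weight n \<pi> w v * real r" if "k \<in> keys (pvar (\<pi> a) (\<pi> b) ^ r)" for k
    using that
  proof (induction r arbitrary: k)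
    case 0 then show ?case by (simp add: monomial_weight_def)
  next
    case (Suc r)
    then obtain k1 k2 where k: "k = k1 + k2" "k1 \<in> keys (pvar (\<pi> a) (\<pi> b))" "k2 \<in> keys (pvar (\<pi> a) (\<pi> b) ^ r)"
      by (auto elim: keys_multE)
    have "monomial_weight w k1 = symw w (\<pi> a) (\<pi> b)"
      using k(2) by (cases "\<pi> a" "\<pi> b" rule: linorder_cases) (auto simp: pvar_def Var_def symw_def)
    moreover have "permute_weight n \<pi> w v = symw w (\<pi> a) (\<pi> b)"
      using v by (simp add: permute_weight_def plucker_index_def)
    ultimately show ?case using Suc.IH[OF k(3)] by (simp add: k(1) monomial_weight_add algebra_simps)
  qed
  then show ?case using single(2) v(1) by simp
next
  case (add m m')
  from add.prems obtain k1 k2 where "k = k1 + k2" "k1 \<in> keys (mono_eval (\<lambda>e. pvar (\<pi> (fst e)) (\<pi> (snd e))) m)"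
    "k2 \<in> keys (mono_eval (\<lambda>e. pvar (\<pi> (fst e)) (\<pi> (snd e))) m')"
    unfolding mono_eval_add by (auto elim: keys_multE)
  then show ?case using add.IH by (simp add: monomial_weight_add)
qed

lemma relabel_single_weight:
  assumes "keys m \<subseteq> plucker_index n" "k \<in> keys (relabel \<pi> (single m a))"
  shows "monomial_weight w k = monomial_weight (permute_weight n \<pi> w) m"
proof -
  have "k \<in> keys (Const a * mono_eval (\<lambda>e. pvar (\<pi> (fst e)) (\<pi> (snd e))) m)"
    using assms(2) by (simp add: relabel_def cpoly_eval_single)
  then obtain k1 k2 where "k = k1 + k2" "k1 \<in> keys (Const a)" "k2 \<in> keys (mono_eval (\<lambda>e. pvar (\<pi> (fst e)) (\<pi> (snd e))) m)"
    by (rule keys_multE)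
  moreover from this(2) have "k1 = 0" by (auto simp: Const_def split: if_splits)
  ultimately show ?thesis using relabel_mono_weight[OF assms(1)] by simp
qed

lemma relabel_weight:
  assumes "f \<in> carrier (plucker_poly_ring n)"
  shows "wpart (monomial_weight w) c (relabel \<pi> f) = relabel \<pi> (wpart (monomial_weight (permute_weight n \<pi> w)) c f)"
    "weight_ge (monomial_weight (permute_weight n \<pi> w)) c f \<Longrightarrow> weight_ge (monomial_weight w) c (relabel \<pi> f)"
proof -
  have "keys f \<subseteq> {m. keys m \<subseteq> plucker_index n}" using assms by (auto simp: in_cpoly_carrier)
  then show "wpart (monomial_weight w) c (relabel \<pi> f) =
      relabel \<pi> (wpart (monomial_weight (permute_weight n \<pi> w)) c f)"
  proof (induction f rule: poly_mapping_linear_induct)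
    case (single m a)
    have "lookup (wpart (monomial_weight w) c (relabel \<pi> (single m a))) k =
        lookup (relabel \<pi> (wpart (monomial_weight (permute_weight n \<pi> w)) c (single m a))) k" for k
    proof (cases "k \<in> keys (relabel \<pi> (single m a))")
      case True
      then have "monomial_weight w k = monomial_weight (permute_weight n \<pi> w) m"
        using relabel_single_weight[of m k a w] single by simp
      then show ?thesis by (auto simp: lookup_wpart wpart_single relabel_def)
    next
      case False
      then have "lookup (relabel \<pi> (single m a)) k = 0" by (simp add: in_keys_iff)
      then show ?thesis by (auto simp: lookup_wpart wpart_single relabel_def)
    qed
    then show ?case by (rule poly_mapping_eqI)
  qed (simp_all add: wpart_add relabel_simps)
  assume "weight_ge (monomial_weight (permute_weight n \<pi> w)) c f"
  then have "keys f \<subseteq> {m. keys m \<subseteq> plucker_index n \<and> c \<le> monomial_weight (permute_weight n \<pi> w) m}"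
    using assms by (auto simp: in_cpoly_carrier weight_ge_def)
  then show "weight_ge (monomial_weight w) c (relabel \<pi> f)"
  proof (induction f rule: poly_mapping_linear_induct)
    case (single m a)
    then show ?case using relabel_single_weight[of m _ a w] by (simp add: weight_ge_def)
  next
    case (add g h) then show ?case by (simp add: relabel_simps weight_ge_add)
  qed (simp add: relabel_def)
qed

lemma relabel_initial_ideal:
  assumes "f \<in> initial_ideal n (permute_weight n \<pi> w)"
  shows "relabel \<pi> f \<in> initial_ideal n w"
proof -
  have "initial_ideal n (permute_weight n \<pi> w) \<subseteq> {f \<in> carrier (plucker_poly_ring n). relabel \<pi> f \<in> initial_ideal n w}"
  proof (rule initial_ideal_subset[OF ideal_relabel_vimage[OF ideal_initial]])
    fix f c assume f: "f \<in> plucker_ideal n" "weight_ge (monomial_weight (permute_weight n \<pi> w)) c f"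
    have fc: "f \<in> carrier (plucker_poly_ring n)" using f(1) ideal_cpolyD(1)[OF ideal_plucker] by blast
    have "wpart (monomial_weight w) c (relabel \<pi> f) \<in> initial_ideal n w"
      by (rule wpart_in_initial_ideal[OF relabel_plucker_ideal[OF f(1)] relabel_weight(2)[OF fc f(2)]])
    then show "wpart (monomial_weight (permute_weight n \<pi> w)) c f \<in>
        {f \<in> carrier (plucker_poly_ring n). relabel \<pi> f \<in> initial_ideal n w}"
      using wpart_carrier[OF fc] by (simp add: relabel_weight(1)[OF fc])
  qed
  then show ?thesis using assms by blast
qed

end

text \<open>One inclusion comes from relabelling by \<open>\<pi>\<close>, the other from its
  inverse; on the weight space the two permutations of weights cancel.\<close>

lemma initial_ideal_permute:
  assumes \<pi>: "\<pi> permutes {1..n}" and w: "w \<in> weight_space n"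
  shows "initial_ideal n w =
    {f \<in> carrier (plucker_poly_ring n). relabel (inv_perm \<pi>) f \<in> initial_ideal n (permute_weight n \<pi> w)}" (is "_ = ?R")
proof
  have inv: "inv_perm \<pi> permutes {1..n}" by (rule permutes_inv[OF \<pi>])
  show "initial_ideal n w \<subseteq> ?R"
  proof
    fix f assume f: "f \<in> initial_ideal n w"
    have "relabel (inv_perm \<pi>) f \<in> initial_ideal n (permute_weight n \<pi> w)"
      by (rule relabel_initial_ideal[OF inv]) (simp add: permute_weight_inverse[OF \<pi> w] f)
    then show "f \<in> ?R" using f ideal_cpolyD(1)[OF ideal_initial] by blast
  qed
  show "?R \<subseteq> initial_ideal n w"
  proof clarify
    fix f assume f: "f \<in> carrier (plucker_poly_ring n)" "relabel (inv_perm \<pi>) f \<in> initial_ideal n (permute_weight n \<pi> w)"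
    have "relabel \<pi> (relabel (inv_perm \<pi>) f) \<in> initial_ideal n w" by (rule relabel_initial_ideal[OF \<pi> f(2)])
    then show "f \<in> initial_ideal n w"
      using relabel_inverse[OF f(1), of \<pi> "inv_perm \<pi>"] permutes_inverses(1)[OF \<pi>] by simp
  qed
qed

text \<open>The equality says that \<open>u a k - u a (i k)\<close> does not depend on
  \<open>a\<close>, so \<open>i k\<close> and \<open>k\<close> look alike from the other leaves up
  to a shift. For negative path lengths, the inequality says that the path separating the cherry
  from \<open>a\<close> and \<open>b\<close> has positive length.\<close>

definition strict_cherries :: "nat \<Rightarrow> (nat \<Rightarrow> nat) \<Rightarrow> (nat \<Rightarrow> nat \<Rightarrow> real) \<Rightarrow> bool" where
  "strict_cherries n i u \<longleftrightarrow> (\<forall>k\<in>{3..n}. \<forall>a\<in>{1..<k} - {i k}. \<forall>b\<in>{1..<k} - {i k}.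
     u a k + u b (i k) = u b k + u a (i k) \<and> (a \<noteq> b \<longrightarrow> u a k + u b (i k) < u a b + u (i k) k))"

definition weak_cherries :: "nat \<Rightarrow> (nat \<Rightarrow> nat) \<Rightarrow> (nat \<Rightarrow> nat \<Rightarrow> real) \<Rightarrow> bool" where
  "weak_cherries n i u \<longleftrightarrow> (\<forall>k\<in>{3..n}. \<forall>a\<in>{1..<k} - {i k}. \<forall>b\<in>{1..<k} - {i k}.
     u a k + u b (i k) = u b k + u a (i k) \<and> (a \<noteq> b \<longrightarrow> u a k + u b (i k) \<le> u a b + u (i k) k))"

context iterated_seq begin

text \<open>The equalities are what allows \<open>w\<close> to be induced by weights of the
  parameters; the inequalities are then the assumption of \<open>weighted_seq\<close>.\<close>

lemma strict_cherries_kernel: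
  assumes "strict_cherries n i (symw w)"
  shows "initial_ideal n w = {f \<in> carrier PR. psi f = 0}"
proof -
  \<comment> \<open>Solves \<open>?M (tlead a b) = symw w a b\<close> recursively: the pair
    \<open>1, 2\<close> fixes the weight of \<open>dm\<close>, the pair \<open>i k, k\<close> that
    of \<open>yi k\<close>, and the pair \<open>j k, k\<close> that of \<open>xi k\<close>. That the
    last value also fits the leaves other than \<open>j k\<close> is the equality in
    \<open>strict_cherries\<close>.\<close>
  define lam where "lam l = (if l = dm then symw w 1 2 else let k = n - l div 2 in
     if even l then symw w (j k) k - symw w (j k) (i k) else symw w (i k) k - symw w (i k) (j k))" for l
  have lx: "lam (xi k) = symw w (j k) k - symw w (j k) (i k)" and ly: "lam (yi k) = symw w (i k) k - symw w (i k) (j k)"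
    if "3 \<le> k" "k \<le> n" for k
  proof -
    have "xi k \<noteq> dm" "yi k \<noteq> dm" using idx_less[OF that] by auto
    moreover have "n - xi k div 2 = k" "even (xi k)" "n - yi k div 2 = k" "odd (yi k)"
      using that by (auto simp: xi_def yi_def)
    ultimately show "lam (xi k) = symw w (j k) k - symw w (j k) (i k)" "lam (yi k) = symw w (i k) k - symw w (i k) (j k)"
      by (simp_all add: lam_def)
  qed
  let ?M = "monomial_weight lam"
  have M: "?M (tlead a b) = symw w a b" if "a \<in> {1..n}" "b \<in> {1..n}" "a \<noteq> b" for a b
    using that n_ge
  proof (induction a b rule: pair_induct)
    case (swap a b) then show ?case by (simp add: tlead_swap[of b a] symw_swap[of w b a])
  next
    case base show ?case by (simp add: tlead_def lead_12 lam_def del: One_nat_def)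
  next
    case (first k)
    have "tlead (i k) k = single (yi k) 1 + tlead (i k) (j k)"
      by (simp add: tlead_def lead_first[OF first(1,2)] ac_simps)
    then show ?case using first(3) by (simp add: monomial_weight_add ly[OF first(1,2)])
  next
    case (other k a)
    note ik = ij[OF other(1,2)]
    have "symw w a k + symw w (j k) (i k) = symw w (j k) k + symw w a (i k)"
      using assms other(1-5) ik(3,4,5) unfolding strict_cherries_def by auto
    then show ?case unfolding tlead_other[OF other(1,2,4,5)] monomial_weight_add other(6)
      by (simp add: lx[OF other(1,2)])
  qed
  have "weighted_seq n i j ?M"
  proof (unfold_locales, rule weight_hom_monomial_weight)
    fix k a b assume k: "3 \<le> k" "k \<le> n" and ab: "1 \<le> a" "a < k" "1 \<le> b" "b < k" "a \<noteq> b" "a \<noteq> i k" "b \<noteq> i k"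
    note ik = ij[OF k]
    have in_n: "a \<in> {1..n}" "b \<in> {1..n}" "i k \<in> {1..n}" "k \<in> {1..n}" "a \<noteq> k" "i k \<noteq> k" using ab(1-4) k ik(1,2) by auto
    have "symw w a k + symw w b (i k) < symw w a b + symw w (i k) k"
      using assms k ab unfolding strict_cherries_def by auto
    then show "?M (tlead a k) + ?M (tlead b (i k)) < ?M (tlead a b) + ?M (tlead (i k) k)"
      unfolding M[OF in_n(1,4,5)] M[OF in_n(2,3) ab(7)] M[OF in_n(1,2) ab(5)] M[OF in_n(3,4,6)] .
  qed
  then show ?thesis
  proof (rule initial_ideal_eq_kernel)
    fix a b assume "1 \<le> a" "a < b" "b \<le> n"
    then show "w (a, b) = ?M (tlead a b)" using M[of a b] by (simp add: symw_less)
  qed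
qed

definition kernel_map :: "(nat \<Rightarrow> nat) \<Rightarrow> (nat \<times> nat) cpoly \<Rightarrow> nat cpoly" where
  "kernel_map \<pi> f = psi (relabel (inv_perm \<pi>) f)"

context
  fixes \<pi> :: "nat \<Rightarrow> nat"
  assumes \<pi>: "\<pi> permutes {1..n}"
begin

lemma initial_ideal_kernel_map:
  assumes "w \<in> weight_space n" "strict_cherries n i (\<lambda>a b. symw w (\<pi> a) (\<pi> b))"
  shows "initial_ideal n w = {f \<in> carrier PR. kernel_map \<pi> f = 0}"
proof -
  let ?u = "symw (permute_weight n \<pi> w)"
  have u: "?u a b = symw w (\<pi> a) (\<pi> b)" if "a \<in> {1..n}" "b \<in> {1..n}" "a \<noteq> b" for a b
    by (rule symw_permute_weight[OF that])
  have "strict_cherries n i ?u"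
    unfolding strict_cherries_def
  proof (intro ballI)
    fix k a b assume k: "k \<in> {3..n}" and a: "a \<in> {1..<k} - {i k}" and b: "b \<in> {1..<k} - {i k}"
    have ik: "i k \<in> {1..n}" "i k \<noteq> k" "k \<in> {1..n}" using ij(1,6,10)[of k] k by auto
    have ab: "a \<in> {1..n}" "b \<in> {1..n}" "a \<noteq> k" "b \<noteq> k" "a \<noteq> i k" "b \<noteq> i k" using a b k by auto
    note c = assms(2)[unfolded strict_cherries_def, rule_format, OF k a b]
    show "?u a k + ?u b (i k) = ?u b k + ?u a (i k) \<and> (a \<noteq> b \<longrightarrow> ?u a k + ?u b (i k) < ?u a b + ?u (i k) k)"
    proof (intro conjI impI)
      show "?u a k + ?u b (i k) = ?u b k + ?u a (i k)"
        unfolding u[OF ab(1) ik(3) ab(3)] u[OF ab(2) ik(1) ab(6)] u[OF ab(2) ik(3) ab(4)] u[OF ab(1) ik(1) ab(5)]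
        by (rule conjunct1[OF c])
      assume ne: "a \<noteq> b"
      show "?u a k + ?u b (i k) < ?u a b + ?u (i k) k"
        unfolding u[OF ab(1) ik(3) ab(3)] u[OF ab(2) ik(1) ab(6)] u[OF ab(1,2) ne] u[OF ik(1,3,2)]
        by (rule conjunct2[OF c, rule_format, OF ne])
    qed
  qed
  from strict_cherries_kernel[OF this]
  have "initial_ideal n w = {f \<in> carrier PR. relabel (inv_perm \<pi>) f \<in> {f \<in> carrier PR. psi f = 0}}"
    using initial_ideal_permute[OF \<pi> assms(1)] by simp
  then show ?thesis
    using relabel_carrier[OF permutes_inv[OF \<pi>]] by (auto simp: kernel_map_def)
qed

lemma kernel_map_simps:
  "kernel_map \<pi> (f + g) = kernel_map \<pi> f + kernel_map \<pi> g"
  "kernel_map \<pi> (f * g) = kernel_map \<pi> f * kernel_map \<pi> g"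
  "kernel_map \<pi> (Const c) = Const c"
  by (simp_all add: kernel_map_def relabel_simps psi_simps)

lemma kernel_map_image: "kernel_map \<pi> ` carrier PR = psi ` carrier PR"
proof
  show "kernel_map \<pi> ` carrier PR \<subseteq> psi ` carrier PR"
    using relabel_carrier[OF permutes_inv[OF \<pi>]] by (auto simp: kernel_map_def)
  show "psi ` carrier PR \<subseteq> kernel_map \<pi> ` carrier PR"
  proof clarify
    fix f assume f: "f \<in> carrier PR"
    have "psi f = kernel_map \<pi> (relabel \<pi> f)"
      using relabel_inverse[OF f, of "inv_perm \<pi>" \<pi>] permutes_inverses(2)[OF \<pi>] by (simp add: kernel_map_def)
    then show "psi f \<in> kernel_map \<pi> ` carrier PR" using relabel_carrier[OF \<pi> f] by blast
  qed
qed

text \<open>Every variable is sent to a single nonzero term, so the image of a monomial is a product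
  of nonzero terms.\<close>

lemma kernel_map_monomial:
  assumes "keys m \<subseteq> plucker_index n" "c \<noteq> 0"
  shows "kernel_map \<pi> (single m c) \<noteq> 0"
proof -
  have inv: "inv_perm \<pi> permutes {1..n}" by (rule permutes_inv[OF \<pi>])
  have "kernel_map \<pi> (single m c) = psi (relabel (inv_perm \<pi>) (single m c))" by (simp add: kernel_map_def)
  also have "\<dots> = cpoly_eval Const (\<lambda>e. psi (pvar (inv_perm \<pi> (fst e)) (inv_perm \<pi> (snd e)))) (single m c)"
    unfolding relabel_def by (rule cpoly_eval_hom) (simp_all add: psi_simps)
  also have "\<dots> = Const c * (\<Prod>e\<in>keys m. psi (pvar (inv_perm \<pi> (fst e)) (inv_perm \<pi> (snd e))) ^ lookup m e)"
    by (simp add: cpoly_eval_single mono_eval_def)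
  also have "\<dots> \<noteq> 0"
  proof -
    have nz: "single q x \<noteq> 0" if "x \<noteq> 0" for q and x :: complex
      using that by (metis lookup_single_eq lookup_zero)
    have "psi (pvar (inv_perm \<pi> (fst e)) (inv_perm \<pi> (snd e))) \<noteq> 0" if "e \<in> keys m" for e
    proof -
      have "fst e \<in> {1..n}" "snd e \<in> {1..n}" "fst e \<noteq> snd e"
        using that assms(1) by (auto simp: plucker_index_def)
      then have *: "inv_perm \<pi> (fst e) \<in> {1..n}" "inv_perm \<pi> (snd e) \<in> {1..n}" "inv_perm \<pi> (fst e) \<noteq> inv_perm \<pi> (snd e)"
        using pi_in[OF inv] pi_neq[OF inv] by blast+
      then show ?thesis unfolding psi_pvar[OF *] using sg_cases[OF *] by (intro nz) auto
    qed
    then show ?thesis using nz[OF assms(2)] by (simp add: Const_def)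
  qed
  finally show ?thesis .
qed

lemma graded_iso_permuted:
  assumes "w \<in> weight_space n" "strict_cherries n i (\<lambda>a b. symw w (\<pi> a) (\<pi> b))"
  shows "graded_algebra_iso_quotient n S (initial_ideal n w)"
  by (rule graded_iso_of_kernel[OF initial_ideal_kernel_map[OF assms] kernel_map_simps kernel_map_image])

end

end

section \<open>Path lengths in iterated trees\<close>

fun inner_edges :: "tree_vertex list \<Rightarrow> nat" where
  "inner_edges (x # y # p) = (if x \<in> range Inner \<and> y \<in> range Inner then 1 else 0) + inner_edges (y # p)"
| "inner_edges p = 0"

lemma path_edges_simps:
  "path_edges [] = {}" "path_edges [x] = {}" "path_edges (x # y # p) = insert {x, y} (path_edges (y # p))"
proof -
  show "path_edges (x # y # p) = insert {x, y} (path_edges (y # p))"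
  proof
    show "path_edges (x # y # p) \<subseteq> insert {x, y} (path_edges (y # p))"
    proof
      fix e assume "e \<in> path_edges (x # y # p)"
      then obtain l where l: "Suc l < length (x # y # p)" "e = {(x # y # p) ! l, (x # y # p) ! Suc l}"
        unfolding path_edges_def by blast
      show "e \<in> insert {x, y} (path_edges (y # p))"
      proof (cases l)
        case 0 then show ?thesis using l by simp
      next
        case (Suc l')
        then have "Suc l' < length (y # p)" "e = {(y # p) ! l', (y # p) ! Suc l'}" using l by auto
        then show ?thesis unfolding path_edges_def by blast
      qed
    qed
    have "{x, y} \<in> path_edges (x # y # p)" unfolding path_edges_def by (auto intro!: exI[of _ 0])
    moreover have "e \<in> path_edges (x # y # p)" if e: "e \<in> path_edges (y # p)" for e
    proof -
      obtain l where "Suc l < length (y # p)" "e = {(y # p) ! l, (y # p) ! Suc l}"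
        using e unfolding path_edges_def by blast
      then have "Suc (Suc l) < length (x # y # p)" "e = {(x # y # p) ! Suc l, (x # y # p) ! Suc (Suc l)}" by auto
      then show ?thesis unfolding path_edges_def by blast
    qed
    ultimately show "insert {x, y} (path_edges (y # p)) \<subseteq> path_edges (x # y # p)" by blast
  qed
qed (auto simp: path_edges_def)

lemma path_edges_vertices: "e \<in> path_edges p \<Longrightarrow> e \<subseteq> set p"
  by (induction p rule: induct_list012) (auto simp: path_edges_simps)

lemma finite_path_edges: "finite (path_edges p)"
  by (induction p rule: induct_list012) (auto simp: path_edges_simps)

lemma card_inner_edges:
  "distinct p \<Longrightarrow> card {e \<in> path_edges p. e \<subseteq> range Inner} = inner_edges p"
proof (induction p rule: inner_edges.induct)
  case (1 x y p)
  have new: "{x, y} \<notin> path_edges (y # p)" using 1(2) path_edges_vertices[of "{x, y}" "y # p"] by auto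
  let ?A = "{e \<in> path_edges (y # p). e \<subseteq> range Inner}"
  have fin: "finite ?A" using finite_path_edges[of "y # p"] by simp
  have IH: "card ?A = inner_edges (y # p)" using 1 by simp
  show ?case
  proof (cases "x \<in> range Inner \<and> y \<in> range Inner")
    case True
    then have "{e \<in> path_edges (x # y # p). e \<subseteq> range Inner} = insert {x, y} ?A"
      unfolding path_edges_simps by blast
    moreover have "{x, y} \<notin> ?A" using new by blast
    ultimately show ?thesis using True IH fin by simp
  next
    case False
    then have "{e \<in> path_edges (x # y # p). e \<subseteq> range Inner} = ?A"
      unfolding path_edges_simps by blast
    then show ?thesis using False IH by simp
  qed
qed (simp_all add: path_edges_simps)

lemma path_edges_successively: "path_edges p \<subseteq> E \<longleftrightarrow> successively (\<lambda>x y. {x, y} \<in> E) p"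
  by (induction p rule: induct_list012) (simp_all add: path_edges_simps)

lemma successively_mono_on:
  "successively P p \<Longrightarrow> (\<And>x y. x \<in> set p \<Longrightarrow> y \<in> set p \<Longrightarrow> P x y \<Longrightarrow> Q x y) \<Longrightarrow> successively Q p"
  by (induction p rule: induct_list012) auto

section \<open>Simple paths in a graph given by its edges\<close>

definition vertex_path :: "'v set set \<Rightarrow> 'v \<Rightarrow> 'v \<Rightarrow> 'v list \<Rightarrow> bool" where
  "vertex_path E x y p \<longleftrightarrow> p \<noteq> [] \<and> hd p = x \<and> last p = y \<and> distinct p \<and> successively (\<lambda>x y. {x, y} \<in> E) p"

text \<open>An interior vertex of a simple path has two different neighbours on it. So leaves never
  lie inside a path, and other vertices are controlled by listing their neighbours.\<close>

lemma vertex_path_interior: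
  assumes "vertex_path E x y p" "v \<in> set p" "v \<noteq> x" "v \<noteq> y"
  shows "\<exists>a b. a \<noteq> b \<and> a \<in> set p \<and> b \<in> set p \<and> {a, v} \<in> E \<and> {v, b} \<in> E"
proof -
  obtain q r where p: "p = q @ v # r" using split_list[OF assms(2)] by blast
  have "q \<noteq> []" using assms(1,3) p by (auto simp: vertex_path_def)
  then obtain q' a where q: "q = q' @ [a]" by (metis rev_exhaust)
  have "r \<noteq> []" using assms(1,4) p by (auto simp: vertex_path_def)
  then obtain b r' where r: "r = b # r'" by (cases r) auto
  have "distinct p" "successively (\<lambda>x y. {x, y} \<in> E) p" using assms(1) by (auto simp: vertex_path_def)
  then have "a \<noteq> b" "{a, v} \<in> E" "{v, b} \<in> E"
    unfolding p q r by (auto simp: successively_append_iff)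
  then show ?thesis unfolding p q r by (intro exI[of _ a] exI[of _ b]) auto
qed

lemma vertex_path_snoc:
  assumes "vertex_path E x y p" shows "\<exists>r. p = r @ [y]"
proof -
  have ne: "p \<noteq> []" and l: "last p = y" using assms unfolding vertex_path_def by blast+
  show ?thesis using append_butlast_last_id[OF ne] unfolding l by (intro exI[of _ "butlast p"]) simp
qed

lemma vertex_path_rev: "vertex_path E x y p \<Longrightarrow> vertex_path E y x (rev p)"
  by (auto simp: vertex_path_def hd_rev last_rev insert_commute)

lemma inner_edges_append:
  "inner_edges (p @ [x, y]) = inner_edges (p @ [x]) + (if x \<in> range Inner \<and> y \<in> range Inner then 1 else 0)"
  by (induction p rule: inner_edges.induct) auto

lemma inner_edges_rev: "inner_edges (rev p) = inner_edges p"
proof (induction p rule: inner_edges.induct)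
  case (1 x y p)
  then show ?case using inner_edges_append[of "rev p" y x] by auto
qed auto

text \<open>Uniqueness is built in because \<open>tree_path\<close> is a definite description; this
  is also the only form in which acyclicity of the trees enters.\<close>

definition unique_path :: "tree_vertex set set \<Rightarrow> tree_vertex \<Rightarrow> tree_vertex \<Rightarrow> nat \<Rightarrow> bool" where
  "unique_path E x y c \<longleftrightarrow> (\<exists>p. vertex_path E x y p \<and> inner_edges p = c \<and> (\<forall>p'. vertex_path E x y p' \<longrightarrow> p' = p))"

lemma unique_pathE:
  assumes "unique_path E x y c"
  obtains p where "vertex_path E x y p" "inner_edges p = c" "\<forall>p'. vertex_path E x y p' \<longrightarrow> p' = p"
  using assms unfolding unique_path_def by blast

lemma unique_pathI:
  assumes "vertex_path E x y p" "inner_edges p = c" "\<And>p'. vertex_path E x y p' \<Longrightarrow> p' = p"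
  shows "unique_path E x y c"
  unfolding unique_path_def by (intro exI[of _ p] conjI allI impI assms)

lemma unique_path_sym:
  assumes "unique_path E x y c" shows "unique_path E y x c"
proof -
  obtain p where p: "vertex_path E x y p" "inner_edges p = c" "\<forall>p'. vertex_path E x y p' \<longrightarrow> p' = p"
    by (rule unique_pathE[OF assms])
  show ?thesis
  proof (rule unique_pathI[OF vertex_path_rev[OF p(1)]])
    show "inner_edges (rev p) = c" by (simp add: inner_edges_rev p(2))
    fix p' assume "vertex_path E y x p'"
    from p(3)[rule_format, OF vertex_path_rev[OF this]] show "p' = rev p" by (metis rev_rev_ident)
  qed
qed

lemma unique_path_weight:
  assumes "unique_path E (Leaf a) (Leaf b) c" "(a, b) \<in> plucker_index n"
  shows "tree_weight n E (a, b) = - real c"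
proof -
  obtain p where p: "vertex_path E (Leaf a) (Leaf b) p" "inner_edges p = c"
    "\<forall>p'. vertex_path E (Leaf a) (Leaf b) p' \<longrightarrow> p' = p"
    by (rule unique_pathE[OF assms(1)])
  have "tree_path E (Leaf a) (Leaf b) = p"
    unfolding tree_path_def path_edges_successively
  proof (rule the_equality)
    show "p \<noteq> [] \<and> hd p = Leaf a \<and> last p = Leaf b \<and> distinct p \<and> successively (\<lambda>x y. {x, y} \<in> E) p"
      using p(1) unfolding vertex_path_def .
    fix p' assume "p' \<noteq> [] \<and> hd p' = Leaf a \<and> last p' = Leaf b \<and> distinct p' \<and> successively (\<lambda>x y. {x, y} \<in> E) p'"
    then show "p' = p" by (intro p(3)[rule_format]) (simp add: vertex_path_def)
  qed
  moreover have "distinct p" using p(1) by (simp add: vertex_path_def)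
  ultimately show ?thesis
    using assms(2) card_inner_edges[of p] p(2) by (simp add: tree_weight_def)
qed

lemma unique_path_cherry:
  assumes "{x, v} \<in> E" "{v, y} \<in> E" "x \<noteq> y" "x \<noteq> v" "y \<noteq> v"
    and x: "\<And>z. {x, z} \<in> E \<Longrightarrow> z = v" and y: "\<And>z. {z, y} \<in> E \<Longrightarrow> z = v"
    and leaves: "x \<notin> range Inner" "y \<notin> range Inner"
  shows "unique_path E x y 0"
proof (rule unique_pathI)
  show "vertex_path E x y [x, v, y]" using assms(1-5) by (simp add: vertex_path_def)
  show "inner_edges [x, v, y] = 0" using leaves by simp
  fix p assume p: "vertex_path E x y p"
  obtain p1 where p1: "p = x # p1" using p unfolding vertex_path_def by (cases p) auto
  have "p1 \<noteq> []" using p assms(3) unfolding p1 vertex_path_def by auto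
  then obtain z r where "p1 = z # r" by (cases p1) auto
  then have r: "p = x # z # r" using p1 by simp
  have "{x, z} \<in> E" using p unfolding r vertex_path_def by simp
  then have z: "z = v" by (rule x)
  have "r \<noteq> []" using p z assms(5) unfolding r vertex_path_def by auto
  moreover from this have "last r = y" using p unfolding r vertex_path_def by simp
  ultimately obtain r' where r': "r = r' @ [y]" using append_butlast_last_id[of r] by metis
  have "r' = []"
  proof (rule ccontr)
    assume "r' \<noteq> []"
    then obtain r'' a where "r' = r'' @ [a]" by (metis rev_exhaust)
    then have pp: "p = (x # v # r'') @ [a, y]" using r r' z by simp
    have "successively (\<lambda>x y. {x, y} \<in> E) ((x # v # r'') @ [a, y])" "distinct ((x # v # r'') @ [a, y])"
      using p unfolding pp vertex_path_def by blast+
    then have "{a, y} \<in> E" "a \<noteq> v" unfolding successively_append_iff by auto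
    then show False using y by blast
  qed
  then show "p = [x, v, y]" using r r' z by simp
qed

text \<open>The effect on paths of replacing the edge from \<open>u\<close> to the leaf \<open>l\<close> by a cherry with centre
  \<open>c\<close> and leaves \<open>l\<close>, \<open>l'\<close>.\<close>

locale graft =
  fixes E E' :: "tree_vertex set set" and u c l l' :: tree_vertex
  assumes verts: "u \<in> range Inner" "c \<in> range Inner" "l \<notin> range Inner" "l' \<notin> range Inner" "u \<noteq> c" "l \<noteq> l'"
    and old_leaf: "{u, l} \<in> E" "\<And>x. {x, l} \<in> E \<Longrightarrow> x = u"
    and fresh: "\<And>x. {x, c} \<notin> E" "\<And>x. {x, l'} \<notin> E"
    and new: "{u, c} \<in> E'" "{c, l} \<in> E'" "{c, l'} \<in> E'"
    and new_leaf: "\<And>x. {x, l} \<in> E' \<Longrightarrow> x = c" "\<And>x. {x, l'} \<in> E' \<Longrightarrow> x = c"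
    and new_inner: "\<And>x. {x, c} \<in> E' \<Longrightarrow> x \<in> {u, l, l'}"
    and same: "\<And>x y. x \<notin> {c, l, l'} \<Longrightarrow> y \<notin> {c, l, l'} \<Longrightarrow> {x, y} \<in> E' \<longleftrightarrow> {x, y} \<in> E"
begin

lemma neqs: "u \<noteq> l" "u \<noteq> l'" "c \<noteq> l" "c \<noteq> l'"
  using verts by auto

lemma avoid_new_leaf:
  assumes "vertex_path E' x y p" "z \<in> {l, l'}" "z \<noteq> x" "z \<noteq> y"
  shows "z \<notin> set p"
proof
  assume "z \<in> set p"
  then obtain a b where ab: "a \<noteq> b" "{a, z} \<in> E'" "{z, b} \<in> E'"
    using vertex_path_interior[OF assms(1) _ assms(3,4)] by blast
  have "{b, z} \<in> E'" using ab(3) by (simp add: insert_commute)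
  then have "a = c" "b = c" using assms(2) ab(2) new_leaf by blast+
  then show False using ab(1) by simp
qed

lemma avoid_old:
  assumes "vertex_path E x y p" "x \<notin> {c, l'}" "y \<notin> {c, l'}"
  shows "c \<notin> set p" "l' \<notin> set p" "l \<noteq> x \<Longrightarrow> l \<noteq> y \<Longrightarrow> l \<notin> set p"
proof -
  show "c \<notin> set p"
  proof
    assume "c \<in> set p"
    moreover have "c \<noteq> x" "c \<noteq> y" using assms by auto
    ultimately show False using vertex_path_interior[OF assms(1), of c] fresh(1) by blast
  qed
  show "l' \<notin> set p"
  proof
    assume "l' \<in> set p"
    moreover have "l' \<noteq> x" "l' \<noteq> y" using assms by auto
    ultimately show False using vertex_path_interior[OF assms(1), of l'] fresh(2) by blast
  qed
  show "l \<notin> set p" if lxy: "l \<noteq> x" "l \<noteq> y"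
  proof
    assume "l \<in> set p"
    then obtain a b where ab: "a \<noteq> b" "{a, l} \<in> E" "{l, b} \<in> E"
      using vertex_path_interior[OF assms(1) _ lxy] by blast
    have "{b, l} \<in> E" using ab(3) by (simp add: insert_commute)
    then have "a = u" "b = u" using ab(2) old_leaf(2) by blast+
    then show False using ab(1) by simp
  qed
qed

lemma successively_same:
  assumes "set p \<inter> {c, l, l'} = {}"
  shows "successively (\<lambda>x y. {x, y} \<in> E') p \<longleftrightarrow> successively (\<lambda>x y. {x, y} \<in> E) p"
proof -
  have "x \<notin> {c, l, l'}" if "x \<in> set p" for x using that assms by blast
  then show ?thesis using same by (metis (no_types, lifting) successively_mono_on)
qed

lemma vertex_path_other:
  assumes "x \<notin> {c, l, l'}" "y \<notin> {c, l, l'}"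
  shows "vertex_path E' x y p \<longleftrightarrow> vertex_path E x y p"
proof -
  have "set p \<inter> {c, l, l'} = {}" if p: "vertex_path E' x y p"
  proof -
    have nl: "l \<notin> set p" "l' \<notin> set p" using avoid_new_leaf[OF p] assms by auto
    have "c \<notin> set p"
    proof
      assume "c \<in> set p"
      moreover have "c \<noteq> x" "c \<noteq> y" using assms by auto
      ultimately obtain a b where ab: "a \<noteq> b" "a \<in> set p" "b \<in> set p" "{a, c} \<in> E'" "{c, b} \<in> E'"
        using vertex_path_interior[OF p] by blast
      have "{b, c} \<in> E'" using ab(5) by (simp add: insert_commute)
      then have "a = u" "b = u" using new_inner[OF ab(4)] new_inner[of b] ab(2,3) nl by auto
      then show False using ab(1) by simp
    qed
    then show ?thesis using nl by auto
  qed
  moreover have "set p \<inter> {c, l, l'} = {}" if p: "vertex_path E x y p"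
    using avoid_old[OF p] assms by auto
  ultimately show ?thesis using successively_same[of p] unfolding vertex_path_def by blast
qed

text \<open>Paths to either leaf of the cherry correspond to old paths to \<open>l\<close>, with the
  last step diverted to \<open>c\<close>. As the path avoids the other leaf, it can enter
  \<open>c\<close> only from \<open>u\<close>.\<close>

lemma vertex_path_new:
  assumes x: "x \<notin> {c, l, l'}" and z: "z \<in> {l, l'}"
  shows "vertex_path E' x z p \<longleftrightarrow> (\<exists>q. p = q @ [c, z] \<and> vertex_path E x l (q @ [l]))"
proof
  assume p: "vertex_path E' x z p"
  have zx: "z \<noteq> x" "z \<noteq> c" using x z neqs by auto
  obtain r where r: "p = r @ [z]" using vertex_path_snoc[OF p] by blast
  have "r \<noteq> []" using p zx unfolding r vertex_path_def by auto
  then obtain q a where q: "r = q @ [a]" by (metis rev_exhaust)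
  have "{a, z} \<in> E'" using p unfolding vertex_path_def r q by (auto simp: successively_append_iff)
  then have a: "a = c" using z new_leaf by blast
  have pq: "p = q @ [c, z]" using r q a by simp
  have "q \<noteq> []" using p x unfolding pq vertex_path_def by auto
  then obtain q' b where q': "q = q' @ [b]" by (metis rev_exhaust)
  have "{b, c} \<in> E'" using p unfolding vertex_path_def pq q' by (auto simp: successively_append_iff)
  moreover have dist: "distinct p" using p by (simp add: vertex_path_def)
  moreover have nz: "z' \<notin> set q" if "z' \<in> {l, l'}" for z'
  proof (cases "z' = z")
    case True then show ?thesis using dist unfolding pq by auto
  next
    case False
    then have "z' \<notin> set p" using avoid_new_leaf[OF p that] that x by auto
    then show ?thesis unfolding pq by simp
  qed
  moreover have "b \<in> set q" unfolding q' by simp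
  ultimately have b: "b = u" using new_inner[of b] by blast
  have disj: "set q \<inter> {c, l, l'} = {}" using nz dist unfolding pq by auto
  have "successively (\<lambda>x y. {x, y} \<in> E') q"
    using p unfolding vertex_path_def pq by (auto simp: successively_append_iff)
  then have "successively (\<lambda>x y. {x, y} \<in> E) q" using successively_same[OF disj] by simp
  moreover have "last q = u" using b q' by simp
  ultimately have "successively (\<lambda>x y. {x, y} \<in> E) (q @ [l])"
    using old_leaf(1) by (simp add: successively_append_iff)
  moreover have "hd q = x" using p \<open>q \<noteq> []\<close> unfolding vertex_path_def pq by simp
  moreover have "distinct (q @ [l])" using dist disj unfolding pq by auto
  ultimately have "vertex_path E x l (q @ [l])" using \<open>q \<noteq> []\<close> unfolding vertex_path_def by simp
  then show "\<exists>q. p = q @ [c, z] \<and> vertex_path E x l (q @ [l])" using pq by blast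
next
  assume "\<exists>q. p = q @ [c, z] \<and> vertex_path E x l (q @ [l])"
  then obtain q where pq: "p = q @ [c, z]" and q: "vertex_path E x l (q @ [l])" by blast
  have "q \<noteq> []" using q x unfolding vertex_path_def by auto
  then obtain q' b where q': "q = q' @ [b]" by (metis rev_exhaust)
  have "{b, l} \<in> E" using q unfolding vertex_path_def q' by (auto simp: successively_append_iff)
  then have b: "b = u" by (rule old_leaf(2))
  have "c \<notin> set (q @ [l])" "l' \<notin> set (q @ [l])" using avoid_old(1,2)[OF q] x verts neqs by auto
  moreover have "l \<notin> set q" using q unfolding vertex_path_def by simp
  ultimately have disj: "set q \<inter> {c, l, l'} = {}" by auto
  have "successively (\<lambda>x y. {x, y} \<in> E) q" using q unfolding vertex_path_def by (simp add: successively_append_iff)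
  then have "successively (\<lambda>x y. {x, y} \<in> E') q" using successively_same[OF disj] by simp
  moreover have "last q = u" using b q' by simp
  moreover have "{c, z} \<in> E'" using z new by blast
  ultimately have "successively (\<lambda>x y. {x, y} \<in> E') p"
    unfolding pq using new(1) by (simp add: successively_append_iff)
  moreover have "distinct p" using q disj z neqs unfolding pq vertex_path_def by auto
  moreover have "hd p = x" using q \<open>q \<noteq> []\<close> unfolding pq vertex_path_def by simp
  ultimately show "vertex_path E' x z p" unfolding vertex_path_def pq by simp
qed

lemma unique_path_other:
  assumes "x \<notin> {c, l, l'}" "y \<notin> {c, l, l'}" "unique_path E x y d"
  shows "unique_path E' x y d"
  using assms(3) unfolding unique_path_def vertex_path_other[OF assms(1,2)] .

lemma unique_path_new:
  assumes x: "x \<notin> {c, l, l'}" and z: "z \<in> {l, l'}" and up: "unique_path E x l d"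
  shows "unique_path E' x z (d + 1)"
proof -
  obtain p where p: "vertex_path E x l p" "inner_edges p = d" "\<forall>p'. vertex_path E x l p' \<longrightarrow> p' = p"
    by (rule unique_pathE[OF up])
  obtain q where q: "p = q @ [l]" using vertex_path_snoc[OF p(1)] by blast
  have "q \<noteq> []" using p(1) x unfolding q vertex_path_def by auto
  then obtain q' b where q': "q = q' @ [b]" by (metis rev_exhaust)
  have "{b, l} \<in> E" using p(1) unfolding vertex_path_def q q' by (auto simp: successively_append_iff)
  then have b: "b = u" by (rule old_leaf(2))
  \<comment> \<open>The old pendant edge did not count, while the new edge from \<open>u\<close> to
    \<open>c\<close> does; the final step to a leaf again does not.\<close>
  have "inner_edges (q @ [c, z]) = inner_edges (q' @ [u, c])"
    using inner_edges_append[of q c z] verts z q' b by auto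
  also have "\<dots> = inner_edges (q' @ [u]) + 1" using inner_edges_append[of q' u c] verts by simp
  also have "inner_edges (q' @ [u]) = d" using inner_edges_append[of q' u l] verts p(2) q q' b by simp
  finally have ie: "inner_edges (q @ [c, z]) = d + 1" .
  show ?thesis
  proof (rule unique_pathI[OF _ ie])
    show "vertex_path E' x z (q @ [c, z])" using vertex_path_new[OF x z] p(1) q by blast
    fix p' assume "vertex_path E' x z p'"
    then obtain r where r: "p' = r @ [c, z]" "vertex_path E x l (r @ [l])"
      unfolding vertex_path_new[OF x z] by blast
    then show "p' = q @ [c, z]" using p(3)[rule_format, OF r(2)] q by simp
  qed
qed

lemma unique_path_pair: "unique_path E' l l' 0"
proof (rule unique_path_cherry[of l c E' l'])
  show "{l, c} \<in> E'" using new(2) by (simp add: insert_commute)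
  show "{c, l'} \<in> E'" by (rule new(3))
  show "z = c" if "{l, z} \<in> E'" for z
  proof (rule new_leaf(1))
    show "{z, l} \<in> E'" using that by (simp add: insert_commute)
  qed
  show "z = c" if "{z, l'} \<in> E'" for z by (rule new_leaf(2)[OF that])
qed (use verts neqs in auto)

end

text \<open>Only what the next attachment requires: bounded vertex numbers, so that the new vertices
  are fresh, and exactly one edge at each leaf.\<close>

definition tree_ok :: "nat \<Rightarrow> tree_vertex set set \<Rightarrow> bool" where
  "tree_ok m E \<longleftrightarrow> (\<forall>e\<in>E. e \<subseteq> Leaf ` {1..m} \<union> Inner ` {3..m}) \<and>
     (\<forall>a\<in>{1..m}. \<exists>u\<in>range Inner. \<forall>e. e \<in> E \<and> Leaf a \<in> e \<longleftrightarrow> e = {u, Leaf a})"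

lemma tree_okD:
  assumes "tree_ok m E"
  shows "e \<in> E \<Longrightarrow> e \<subseteq> Leaf ` {1..m} \<union> Inner ` {3..m}"
    "a \<in> {1..m} \<Longrightarrow> \<exists>u\<in>range Inner. \<forall>e. e \<in> E \<and> Leaf a \<in> e \<longleftrightarrow> e = {u, Leaf a}"
  using assms unfolding tree_ok_def by simp_all

lemma tree_ok_tripod: "tree_ok 3 tripod"
  unfolding tree_ok_def
proof (intro conjI ballI)
  fix e assume "e \<in> tripod" then show "e \<subseteq> Leaf ` {1..3} \<union> Inner ` {3..3}" by (auto simp: tripod_def)
next
  fix a :: nat assume "a \<in> {1..3}"
  then have a: "a = 1 \<or> a = 2 \<or> a = 3" by auto
  have "e \<in> tripod \<and> Leaf a \<in> e \<longleftrightarrow> e = {Inner 3, Leaf a}" for e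
    using a by (auto simp: tripod_def)
  then show "\<exists>u\<in>range Inner. \<forall>e. e \<in> tripod \<and> Leaf a \<in> e \<longleftrightarrow> e = {u, Leaf a}" by blast
qed

lemma attach_leaf_iff:
  assumes "tree_ok m E" "i \<in> {1..m}" "k = Suc m" "\<forall>e. e \<in> E \<and> Leaf i \<in> e \<longleftrightarrow> e = {u, Leaf i}" "u \<in> range Inner"
  shows "e \<in> attach_leaf i k E \<longleftrightarrow> e \<in> E \<and> Leaf i \<notin> e \<or> e = {u, Inner k} \<or> e = {Inner k, Leaf i} \<or> e = {Inner k, Leaf k}"
proof -
  let ?f = "\<lambda>e. if Leaf i \<in> e then insert (Inner k) (e - {Leaf i}) else e"
  have u: "u \<noteq> Leaf i" using assms(5) by auto
  have f: "?f {u, Leaf i} = {u, Inner k}" using u by auto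
  have "?f ` E = {e \<in> E. Leaf i \<notin> e} \<union> {{u, Inner k}}"
  proof
    show "?f ` E \<subseteq> {e \<in> E. Leaf i \<notin> e} \<union> {{u, Inner k}}"
    proof clarify
      fix e assume e: "e \<in> E" "?f e \<notin> {}" "?f e \<noteq> {u, Inner k}"
      have "Leaf i \<notin> e"
      proof
        assume "Leaf i \<in> e"
        then have "e = {u, Leaf i}" using e(1) assms(4) by blast
        then show False using e(3) f by simp
      qed
      then show "?f e \<in> E \<and> Leaf i \<notin> ?f e" using e(1) by simp
    qed
    have "{u, Leaf i} \<in> E" using assms(4) by blast
    then have "{u, Inner k} \<in> ?f ` E" by (rule rev_image_eqI) (rule f[symmetric])
    moreover have "e \<in> ?f ` E" if e: "e \<in> E" "Leaf i \<notin> e" for e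
      by (rule image_eqI[of _ _ e]) (use e in simp_all)
    ultimately show "{e \<in> E. Leaf i \<notin> e} \<union> {{u, Inner k}} \<subseteq> ?f ` E" by blast
  qed
  then show ?thesis unfolding attach_leaf_def by auto
qed

lemma attach_leaf_graft:
  assumes ok: "tree_ok m E" and i: "i \<in> {1..m}" and k: "k = Suc m"
  shows "tree_ok k (attach_leaf i k E)" "\<exists>u. graft E (attach_leaf i k E) u (Inner k) (Leaf i) (Leaf k)"
proof -
  let ?E = "attach_leaf i k E"
  obtain u where u: "u \<in> range Inner" "\<forall>e. e \<in> E \<and> Leaf i \<in> e \<longleftrightarrow> e = {u, Leaf i}"
    by (rule bexE[OF tree_okD(2)[OF ok i]])
  note E' = attach_leaf_iff[OF ok i k u(2,1)]
  have V: "e \<subseteq> Leaf ` {1..m} \<union> Inner ` {3..m}" if "e \<in> E" for e by (rule tree_okD(1)[OF ok that])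
  have uE: "{u, Leaf i} \<in> E" using u(2) by blast
  have uV: "u \<in> Inner ` {3..m}" using V[OF uE] u(1) by auto
  have fr: "Leaf k \<notin> e" "Inner k \<notin> e" if "e \<in> E" for e using V[OF that] k by auto
  have uk: "u \<noteq> Inner k" using uV k by auto
  have ik: "i \<noteq> k" using i k by auto
  have m3: "3 \<le> k" using uV k by auto
  obtain u' where u': "u = Inner u'" using u(1) by blast
  show "tree_ok k ?E"
    unfolding tree_ok_def
  proof (intro conjI ballI)
    fix e assume "e \<in> ?E"
    then consider "e \<in> E" | "e = {u, Inner k}" | "e = {Inner k, Leaf i}" | "e = {Inner k, Leaf k}" unfolding E' by blast
    then show "e \<subseteq> Leaf ` {1..k} \<union> Inner ` {3..k}"
    proof cases
      case 1
      have "Leaf ` {1..m} \<union> Inner ` {3..m} \<subseteq> Leaf ` {1..k} \<union> Inner ` {3..k}" using k by auto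
      then show ?thesis using V[OF 1] by blast
    qed (use uV i k m3 in auto)
  next
    fix a assume a: "a \<in> {1..k}"
    consider "a = i" | "a = k" | "a \<in> {1..m}" "a \<noteq> i" "a \<noteq> k" using a k by fastforce
    then show "\<exists>u\<in>range Inner. \<forall>e. e \<in> ?E \<and> Leaf a \<in> e \<longleftrightarrow> e = {u, Leaf a}"
    proof cases
      case 1
      have "e \<in> ?E \<and> Leaf i \<in> e \<longleftrightarrow> e = {Inner k, Leaf i}" for e
      proof
        assume "e \<in> ?E \<and> Leaf i \<in> e"
        then show "e = {Inner k, Leaf i}" unfolding E' using ik u' by (elim conjE disjE) auto
      qed (simp add: E')
      then show ?thesis unfolding 1 by blast
    next
      case 2
      have "e \<in> ?E \<and> Leaf k \<in> e \<longleftrightarrow> e = {Inner k, Leaf k}" for e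
      proof
        assume e: "e \<in> ?E \<and> Leaf k \<in> e"
        then have "e \<notin> E" using fr(1) by blast
        then show "e = {Inner k, Leaf k}" using e unfolding E' using ik u' by (elim conjE disjE) auto
      qed (simp add: E')
      then show ?thesis unfolding 2 by blast
    next
      case 3
      obtain v where v: "v \<in> range Inner" "\<forall>e. e \<in> E \<and> Leaf a \<in> e \<longleftrightarrow> e = {v, Leaf a}"
        by (rule bexE[OF tree_okD(2)[OF ok 3(1)]])
      obtain v' where v': "v = Inner v'" using v(1) by blast
      have "e \<in> ?E \<and> Leaf a \<in> e \<longleftrightarrow> e = {v, Leaf a}" for e
      proof
        assume e: "e \<in> ?E \<and> Leaf a \<in> e"
        then have "e \<in> E" unfolding E' using 3(2,3) u' by (elim conjE disjE) auto
        then show "e = {v, Leaf a}" using v(2) e by blast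
      next
        assume e: "e = {v, Leaf a}"
        then have "e \<in> E" using v(2) by blast
        moreover have "Leaf i \<notin> e" using e 3(2) v' by auto
        ultimately show "e \<in> ?E \<and> Leaf a \<in> e" unfolding E' using e by blast
      qed
      then show ?thesis using v(1) by blast
    qed
  qed
  have "graft E ?E u (Inner k) (Leaf i) (Leaf k)"
  proof
    show "x = u" if "{x, Leaf i} \<in> E" for x
    proof -
      have "{x, Leaf i} = {u, Leaf i}" by (rule u(2)[rule_format, THEN iffD1]) (use that in simp)
      then show ?thesis using u' by (auto simp: doubleton_eq_iff)
    qed
    show "{x, Inner k} \<notin> E" "{x, Leaf k} \<notin> E" for x using fr by blast+
    show "x = Inner k" if "{x, Leaf i} \<in> ?E" for x
      using that unfolding E' u' using ik by (auto simp: doubleton_eq_iff)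
    show "x = Inner k" if "{x, Leaf k} \<in> ?E" for x
      using that fr(1)[of "{x, Leaf k}"] unfolding E' u' using ik by (auto simp: doubleton_eq_iff)
    show "x \<in> {u, Leaf i, Leaf k}" if "{x, Inner k} \<in> ?E" for x
      using that fr(2)[of "{x, Inner k}"] unfolding E' u' by (auto simp: doubleton_eq_iff)
    show "{x, y} \<in> ?E \<longleftrightarrow> {x, y} \<in> E" if "x \<notin> {Inner k, Leaf i, Leaf k}" "y \<notin> {Inner k, Leaf i, Leaf k}" for x y
      using that unfolding E' by (auto simp: doubleton_eq_iff)
  qed (use u(1) uE uk ik E' in auto)
  then show "\<exists>u. graft E ?E u (Inner k) (Leaf i) (Leaf k)" by blast
qed

lemma iterated_tree_Suc: "3 \<le> m \<Longrightarrow> iterated_tree (Suc m) i = attach_leaf (i (Suc m)) (Suc m) (iterated_tree m i)"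
  by (simp add: iterated_tree_def)

text \<open>The triangle inequality is carried along because it supplies the strict inequality at
  the new cherry: both leaves of the cherry lie one inner edge farther out than the old leaf
  \<open>i k\<close>. At earlier levels the conditions survive since both sides change by the same
  shifts.\<close>

lemma tree_distances:
  assumes "3 \<le> m" "\<And>k. 3 \<le> k \<Longrightarrow> k \<le> m \<Longrightarrow> i k \<in> {1..<k}"
  shows "tree_ok m (iterated_tree m i) \<and> (\<exists>d. (\<forall>a\<in>{1..m}. \<forall>b\<in>{1..m}. a \<noteq> b \<longrightarrow>
      unique_path (iterated_tree m i) (Leaf a) (Leaf b) (d a b) \<and> d a b = d b a) \<and>
    (\<forall>a\<in>{1..m}. \<forall>b\<in>{1..m}. \<forall>c\<in>{1..m}. a \<noteq> b \<longrightarrow> a \<noteq> c \<longrightarrow> b \<noteq> c \<longrightarrow> d a b \<le> d a c + d c b) \<and>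
    strict_cherries m i (\<lambda>a b. - real (d a b)))"
  using assms
proof (induction m rule: dec_induct)
  case base
  have E: "iterated_tree 3 i = tripod" by (simp add: iterated_tree_def)
  have "unique_path tripod (Leaf a) (Leaf b) 0" if "a \<in> {1..3}" "b \<in> {1..3}" "a \<noteq> b" for a b
  proof (rule unique_path_cherry[of _ "Inner 3"])
    have ab: "a = 1 \<or> a = 2 \<or> a = 3" "b = 1 \<or> b = 2 \<or> b = 3" using that by auto
    show "{Leaf a, Inner 3} \<in> tripod" "{Inner 3, Leaf b} \<in> tripod" using ab by (auto simp: tripod_def insert_commute)
    show "z = Inner 3" if "{Leaf a, z} \<in> tripod" for z using that by (auto simp: tripod_def doubleton_eq_iff)
    show "z = Inner 3" if "{z, Leaf b} \<in> tripod" for z using that by (auto simp: tripod_def doubleton_eq_iff)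
  qed (use that in auto)
  moreover have "strict_cherries 3 i (\<lambda>a b. - real 0)"
    unfolding strict_cherries_def
  proof (intro ballI)
    fix k a b :: nat assume k: "k \<in> {3..3}" and a: "a \<in> {1..<k} - {i k}" and b: "b \<in> {1..<k} - {i k}"
    have "a = b" using a b base(1)[of 3] k by auto
    then show "- real 0 + - real 0 = - real 0 + - real 0 \<and> (a \<noteq> b \<longrightarrow> - real 0 + - real 0 < - real 0 + - real 0)"
      by simp
  qed
  ultimately show ?case
    unfolding E using tree_ok_tripod by (intro conjI exI[of _ "\<lambda>a b. 0"] ballI impI) simp_all
next
  case (step m)
  define k where "k = Suc m"
  define E where "E = iterated_tree m i"
  define E' where "E' = iterated_tree k i"
  have ik: "i k \<in> {1..m}" using step.prems[of k] step.hyps by (auto simp: k_def)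
  have E'E: "E' = attach_leaf (i k) k E" unfolding E'_def E_def k_def using step.hyps by (simp add: iterated_tree_Suc)
  have IH: "tree_ok m E \<and> (\<exists>d. (\<forall>a\<in>{1..m}. \<forall>b\<in>{1..m}. a \<noteq> b \<longrightarrow>
      unique_path E (Leaf a) (Leaf b) (d a b) \<and> d a b = d b a) \<and>
    (\<forall>a\<in>{1..m}. \<forall>b\<in>{1..m}. \<forall>c\<in>{1..m}. a \<noteq> b \<longrightarrow> a \<noteq> c \<longrightarrow> b \<noteq> c \<longrightarrow> d a b \<le> d a c + d c b) \<and>
    strict_cherries m i (\<lambda>a b. - real (d a b)))"
    unfolding E_def by (rule step.IH) (rule step.prems, simp_all)
  note ok = conjunct1[OF IH]
  obtain d where d: "(\<forall>a\<in>{1..m}. \<forall>b\<in>{1..m}. a \<noteq> b \<longrightarrow>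
      unique_path E (Leaf a) (Leaf b) (d a b) \<and> d a b = d b a) \<and>
    (\<forall>a\<in>{1..m}. \<forall>b\<in>{1..m}. \<forall>c\<in>{1..m}. a \<noteq> b \<longrightarrow> a \<noteq> c \<longrightarrow> b \<noteq> c \<longrightarrow> d a b \<le> d a c + d c b) \<and>
    strict_cherries m i (\<lambda>a b. - real (d a b))"
    using conjunct2[OF IH] by (rule exE)
  have up: "unique_path E (Leaf a) (Leaf b) (d a b)" and sym: "d a b = d b a"
    if "a \<in> {1..m}" "b \<in> {1..m}" "a \<noteq> b" for a b
    using conjunct1[OF d, rule_format, OF that] by blast+
  note tri = conjunct1[OF conjunct2[OF d], rule_format]
  note ch = conjunct2[OF conjunct2[OF d]]
  obtain u where G: "graft E E' u (Inner k) (Leaf (i k)) (Leaf k)"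
    using attach_leaf_graft(2)[OF ok ik k_def] unfolding E'E by blast
  have ok': "tree_ok k E'" using attach_leaf_graft(1)[OF ok ik k_def] unfolding E'E .
  \<comment> \<open>The leaf \<open>i k\<close> moves outward by one inner edge, so distances among
    the old leaves change by a contribution of each endpoint.\<close>
  define h where "h x = (if x = i k then 1 else 0 :: nat)" for x
  define d' where "d' a b = (if a = k then (if b = i k then 0 else d b (i k) + 1)
    else if b = k then (if a = i k then 0 else d a (i k) + 1) else d a b + h a + h b)" for a b
  have ikk: "i k \<noteq> k" using ik by (auto simp: k_def)
  have leafk: "a \<noteq> k" if "a \<in> {1..m}" for a using that by (auto simp: k_def)
  have other: "unique_path E' (Leaf a) z (d a (i k) + 1)" if "a \<in> {1..m}" "a \<noteq> i k" "z \<in> {Leaf (i k), Leaf k}" for a z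
    by (rule graft.unique_path_new[OF G _ that(3) up]) (use that ik leafk[of a] in auto)
  have up': "unique_path E' (Leaf a) (Leaf b) (d' a b)" if ab: "a \<in> {1..k}" "b \<in> {1..k}" "a \<noteq> b" for a b
  proof -
    have pk: "unique_path E' (Leaf c) (Leaf k) (d' c k)" if "c \<in> {1..m}" for c
    proof (cases "c = i k")
      case True then show ?thesis using graft.unique_path_pair[OF G] leafk[OF that] by (simp add: d'_def)
    next
      case False then show ?thesis using other[OF that False, of "Leaf k"] leafk[OF that] by (simp add: d'_def)
    qed
    consider "a = k" "b \<in> {1..m}" | "b = k" "a \<in> {1..m}" | "a \<in> {1..m}" "b \<in> {1..m}"
      using ab by (fastforce simp: k_def)
    then show ?thesis
    proof cases
      case 1
      have "d' k b = d' b k" using leafk[OF 1(2)] by (simp add: d'_def)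
      then show ?thesis using unique_path_sym[OF pk[OF 1(2)]] 1 by simp
    next
      case 2 then show ?thesis using pk by simp
    next
      case 3
      note nk = leafk[OF 3(1)] leafk[OF 3(2)]
      consider "a = i k" | "b = i k" | "a \<noteq> i k" "b \<noteq> i k" by blast
      then show ?thesis
      proof cases
        case a: 1
        have "b \<noteq> i k" using a ab(3) by simp
        then have "unique_path E' (Leaf b) (Leaf (i k)) (d b (i k) + 1)" using other[OF 3(2)] by simp
        moreover have "d' a b = d b (i k) + 1"
          using a nk \<open>b \<noteq> i k\<close> sym[OF 3(2) ik] by (simp add: d'_def h_def)
        ultimately show ?thesis using unique_path_sym a by simp
      next
        case b: 2
        have "a \<noteq> i k" using b ab(3) by simp
        then show ?thesis using other[OF 3(1), of "Leaf (i k)"] b nk by (simp add: d'_def h_def)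
      next
        case n: 3
        have "unique_path E' (Leaf a) (Leaf b) (d a b)"
          by (rule graft.unique_path_other[OF G _ _ up[OF 3 ab(3)]]) (use n nk in auto)
        then show ?thesis using n nk by (simp add: d'_def h_def)
      qed
    qed
  qed
  have d'k: "d' a k = (if a = i k then 0 else d a (i k) + 1)" "d' k a = d' a k" if "a \<in> {1..m}" for a
    using leafk[OF that] by (simp_all add: d'_def)
  have d'm: "d' a b = d a b + h a + h b" if "a \<in> {1..m}" "b \<in> {1..m}" for a b
    using leafk[OF that(1)] leafk[OF that(2)] by (simp add: d'_def)
  have in_k: "c = k \<or> c \<in> {1..m}" if "c \<in> {1..k}" for c using that by (auto simp: k_def)
  have sym': "d' a b = d' b a" if "a \<in> {1..k}" "b \<in> {1..k}" "a \<noteq> b" for a b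
    using in_k[OF that(1)] in_k[OF that(2)] that(3) d'k d'm sym by (elim disjE) auto
  have trik: "d' a k \<le> d' a c + d' c k" "d' a c \<le> d' a k + d' k c" if ac: "a \<in> {1..m}" "c \<in> {1..m}" "a \<noteq> c" for a c
  proof -
    note e = d'k(2)[OF ac(2)] d'k(1)[OF ac(1)] d'k(1)[OF ac(2)] d'm[OF ac(1,2)] h_def
    consider "a = i k" "c \<noteq> i k" | "c = i k" "a \<noteq> i k" | "a \<noteq> i k" "c \<noteq> i k" using ac(3) by blast
    then have "d' a k \<le> d' a c + d' c k \<and> d' a c \<le> d' a k + d' k c"
    proof cases
      case 1
      then show ?thesis using sym[OF ac(2) ik] unfolding e by simp
    next
      case 2
      then show ?thesis unfolding e by simp
    next
      case 3
      have "d a (i k) \<le> d a c + d c (i k)" "d a c \<le> d a (i k) + d (i k) c"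
        using tri[OF ac(1) ik ac(2)] tri[OF ac(1,2) ik] 3 ac(3) by auto
      then show ?thesis using 3 sym[OF ac(2) ik] unfolding e by simp
    qed
    then show "d' a k \<le> d' a c + d' c k" "d' a c \<le> d' a k + d' k c" by auto
  qed
  have tri': "d' a b \<le> d' a c + d' c b"
    if abc: "a \<in> {1..k}" "b \<in> {1..k}" "c \<in> {1..k}" and ne: "a \<noteq> b" "a \<noteq> c" "b \<noteq> c" for a b c
  proof -
    consider "a = k" | "b = k" | "c = k" | "a \<noteq> k" "b \<noteq> k" "c \<noteq> k" by blast
    then show ?thesis
    proof cases
      case 1
      then have bc: "b \<in> {1..m}" "c \<in> {1..m}" using in_k abc ne by blast+
      have "d' c b = d' b c" using sym' abc ne by metis
      then show ?thesis using trik(1)[OF bc] ne d'k(2)[OF bc(1)] d'k(2)[OF bc(2)] 1 by simp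
    next
      case 2
      then have "a \<in> {1..m}" "c \<in> {1..m}" using in_k abc ne by blast+
      then show ?thesis using trik(1) ne 2 by simp
    next
      case 3
      then have "a \<in> {1..m}" "b \<in> {1..m}" using in_k abc ne by blast+
      then show ?thesis using trik(2) ne 3 by simp
    next
      case 4
      then have m: "a \<in> {1..m}" "b \<in> {1..m}" "c \<in> {1..m}" using in_k abc by blast+
      show ?thesis
        using tri[OF m ne] unfolding d'm[OF m(1,2)] d'm[OF m(1,3)] d'm[OF m(3,2)] by simp
    qed
  qed
  have ch': "strict_cherries k i (\<lambda>a b. - real (d' a b))"
    unfolding strict_cherries_def
  proof (intro ballI)
    fix q a b assume q: "q \<in> {3..k}" and a: "a \<in> {1..<q} - {i q}" and b: "b \<in> {1..<q} - {i q}"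
    show "- real (d' a q) + - real (d' b (i q)) = - real (d' b q) + - real (d' a (i q)) \<and>
      (a \<noteq> b \<longrightarrow> - real (d' a q) + - real (d' b (i q)) < - real (d' a b) + - real (d' (i q) q))"
    proof (cases "q = k")
      case True
      have am: "a \<in> {1..m}" "a \<noteq> i k" and bm: "b \<in> {1..m}" "b \<noteq> i k" using a b True by (auto simp: k_def)
      have "d a b \<le> d a (i k) + d b (i k)" if "a \<noteq> b"
        using tri[OF am(1) bm(1) ik that am(2) bm(2)] sym[OF ik bm(1)] bm(2) by auto
      then show ?thesis unfolding True
        using am(2) bm(2) by (auto simp: d'k[OF am(1)] d'k[OF bm(1)] d'k[OF ik] d'm[OF am(1) ik] d'm[OF bm(1) ik]
            d'm[OF am(1) bm(1)] h_def)
    next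
      case False
      then have q': "q \<in> {3..m}" using q by (auto simp: k_def)
      have iq: "i q \<in> {1..<q}" using step.prems[of q] q' by auto
      have m: "a \<in> {1..m}" "b \<in> {1..m}" "q \<in> {1..m}" "i q \<in> {1..m}" using a b q' iq by auto
      have c1: "- real (d a q) + - real (d b (i q)) = - real (d b q) + - real (d a (i q))"
        and c2: "a \<noteq> b \<Longrightarrow> - real (d a q) + - real (d b (i q)) < - real (d a b) + - real (d (i q) q)"
        using ch q' a b unfolding strict_cherries_def by blast+
      note e = d'm[OF m(1,3)] d'm[OF m(2,4)] d'm[OF m(2,3)] d'm[OF m(1,4)] d'm[OF m(1,2)] d'm[OF m(4,3)]
      show ?thesis
      proof (intro conjI impI)
        show "- real (d' a q) + - real (d' b (i q)) = - real (d' b q) + - real (d' a (i q))"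
          using c1 unfolding e by simp
        assume "a \<noteq> b"
        from c2[OF this] show "- real (d' a q) + - real (d' b (i q)) < - real (d' a b) + - real (d' (i q) q)"
          unfolding e by simp
      qed
    qed
  qed
  show ?case
    unfolding k_def[symmetric] E'_def[symmetric]
  proof (intro conjI exI[of _ d'] ballI impI)
    show "tree_ok k E'" by (rule ok')
    show "strict_cherries k i (\<lambda>a b. - real (d' a b))" by (rule ch')
    fix a b assume "a \<in> {1..k}" "b \<in> {1..k}" "a \<noteq> b"
    then show "unique_path E' (Leaf a) (Leaf b) (d' a b)" "d' a b = d' b a" by (rule up', rule sym')
  next
    fix a b c assume "a \<in> {1..k}" "b \<in> {1..k}" "c \<in> {1..k}" "a \<noteq> b" "a \<noteq> c" "b \<noteq> c"
    then show "d' a b \<le> d' a c + d' c b" by (rule tri')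
  qed
qed

theorem strict_cherries_tree:
  assumes "3 \<le> n" "\<And>k. 3 \<le> k \<Longrightarrow> k \<le> n \<Longrightarrow> i k \<in> {1..<k}"
  shows "strict_cherries n i (symw (tree_weight n (iterated_tree n i)))"
proof -
  let ?E = "iterated_tree n i"
  obtain d where d: "(\<forall>a\<in>{1..n}. \<forall>b\<in>{1..n}. a \<noteq> b \<longrightarrow>
      unique_path ?E (Leaf a) (Leaf b) (d a b) \<and> d a b = d b a) \<and>
    (\<forall>a\<in>{1..n}. \<forall>b\<in>{1..n}. \<forall>c\<in>{1..n}. a \<noteq> b \<longrightarrow> a \<noteq> c \<longrightarrow> b \<noteq> c \<longrightarrow> d a b \<le> d a c + d c b) \<and>
    strict_cherries n i (\<lambda>a b. - real (d a b))"
    using conjunct2[OF tree_distances[OF assms]] by (rule exE)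
  have up: "unique_path ?E (Leaf a) (Leaf b) (d a b)" and sym: "d a b = d b a"
    if "a \<in> {1..n}" "b \<in> {1..n}" "a \<noteq> b" for a b
    using conjunct1[OF d, rule_format, OF that] by blast+
  note ch = conjunct2[OF conjunct2[OF d]]
  have w: "symw (tree_weight n ?E) a b = - real (d a b)" if ab: "a \<in> {1..n}" "b \<in> {1..n}" "a \<noteq> b" for a b
  proof (cases "a < b")
    case True
    then have "(a, b) \<in> plucker_index n" using ab by (auto simp: plucker_index_def)
    then show ?thesis using unique_path_weight[OF up[OF ab]] True by (simp add: symw_less)
  next
    case False
    then have "b < a" using ab(3) by simp
    moreover from this have "(b, a) \<in> plucker_index n" using ab by (auto simp: plucker_index_def)
    ultimately show ?thesis
      using unique_path_weight[OF up[OF ab(2,1) ab(3)[symmetric]]] sym[OF ab] by (simp add: symw_swap[of _ a b] symw_less)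
  qed
  show ?thesis
    unfolding strict_cherries_def
  proof (intro ballI)
    fix k a b assume k: "k \<in> {3..n}" and a: "a \<in> {1..<k} - {i k}" and b: "b \<in> {1..<k} - {i k}"
    have ik: "i k \<in> {1..<k}" using assms(2)[of k] k by auto
    have m: "a \<in> {1..n}" "b \<in> {1..n}" "k \<in> {1..n}" "i k \<in> {1..n}"
      "a \<noteq> k" "b \<noteq> k" "a \<noteq> i k" "b \<noteq> i k" "i k \<noteq> k" using k a b ik by auto
    have c1: "- real (d a k) + - real (d b (i k)) = - real (d b k) + - real (d a (i k))"
      and c2: "a \<noteq> b \<Longrightarrow> - real (d a k) + - real (d b (i k)) < - real (d a b) + - real (d (i k) k)"
      using ch k a b unfolding strict_cherries_def by blast+
    let ?w = "symw (tree_weight n ?E)"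
    have "?w a k + ?w b (i k) = ?w b k + ?w a (i k)"
      unfolding w[OF m(1,3,5)] w[OF m(2,4,8)] w[OF m(2,3,6)] w[OF m(1,4,7)] by (rule c1)
    moreover have "?w a k + ?w b (i k) < ?w a b + ?w (i k) k" if "a \<noteq> b"
      unfolding w[OF m(1,3,5)] w[OF m(2,4,8)] w[OF m(1,2) that] w[OF m(4,3,9)] by (rule c2[OF that])
    ultimately show "?w a k + ?w b (i k) = ?w b k + ?w a (i k) \<and> (a \<noteq> b \<longrightarrow> ?w a k + ?w b (i k) < ?w a b + ?w (i k) k)"
      by blast
  qed
qed

section \<open>The four-point condition\<close>

text \<open>No pairing is strictly smaller than both others; as the order of the four leaves varies,
  this says that the minimum of the three sums is attained at least twice.\<close>

definition four_point :: "nat set \<Rightarrow> (nat \<Rightarrow> nat \<Rightarrow> real) \<Rightarrow> bool" where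
  "four_point V u \<longleftrightarrow> (\<forall>a\<in>V. \<forall>b\<in>V. \<forall>c\<in>V. \<forall>d\<in>V. distinct [a, b, c, d] \<longrightarrow>
     u a c + u b d \<le> u a b + u c d \<or> u a d + u b c \<le> u a b + u c d)"

lemma four_pointD:
  assumes "four_point V u" "a \<in> V" "b \<in> V" "c \<in> V" "d \<in> V" "distinct [a, b, c, d]"
  shows "u a c + u b d \<le> u a b + u c d \<or> u a d + u b c \<le> u a b + u c d"
  using assms unfolding four_point_def by blast

lemma four_point_subset: "four_point V u \<Longrightarrow> W \<subseteq> V \<Longrightarrow> four_point W u"
  unfolding four_point_def by blast

text \<open>The pair \<open>i, k\<close> is the one whose path branches off farthest from the root \<open>r\<close>.\<close>

lemma exists_cherry:
  fixes u :: "nat \<Rightarrow> nat \<Rightarrow> real"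
  assumes fin: "finite V" and card: "3 \<le> card V" and u_sym: "\<And>a b. u b a = u a b"
    and fp: "four_point V u"
  obtains i k where "i \<in> V" "k \<in> V" "i \<noteq> k"
    "\<And>a b. a \<in> V - {i, k} \<Longrightarrow> b \<in> V - {i, k} \<Longrightarrow> u a k + u b i = u b k + u a i"
    "\<And>a b. a \<in> V - {i, k} \<Longrightarrow> b \<in> V - {i, k} \<Longrightarrow> a \<noteq> b \<Longrightarrow> u a k + u b i \<le> u a b + u i k"
proof -
  have "V \<noteq> {}" using card by auto
  then obtain r where r: "r \<in> V" by blast
  have c2: "2 \<le> card (V - {r})" using card r fin by simp
  then obtain x where x: "x \<in> V - {r}" by (metis card.empty ex_in_conv not_numeral_le_zero)
  have "1 \<le> card (V - {r} - {x})" using c2 x fin by (simp add: card_Diff_singleton_if)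
  then obtain y where y: "y \<in> V - {r} - {x}" by (metis card.empty ex_in_conv not_one_le_zero)
  define Q where "Q = {(i, k). i \<in> V - {r} \<and> k \<in> V - {r} \<and> i \<noteq> k}"
  \<comment> \<open>For negative path lengths this is twice the Gromov product of \<open>i\<close>
    and \<open>k\<close> at \<open>r\<close>, the doubled length of the common beginning of the two
    paths.\<close>
  define f where "f = (\<lambda>(i, k). u i k - u r i - u r k)"
  have "Q \<subseteq> V \<times> V" by (auto simp: Q_def)
  then have finQ: "finite Q" using fin finite_subset by blast
  have "(x, y) \<in> Q" using x y by (auto simp: Q_def)
  then have "Max (f ` Q) \<in> f ` Q" using finQ by (intro Max_in) auto
  then obtain p where p: "p \<in> Q" "f p = Max (f ` Q)" by auto
  obtain i k where ik: "p = (i, k)" by (cases p)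
  have mx: "f q \<le> f (i, k)" if "q \<in> Q" for q using that p finQ by (simp add: ik[symmetric])
  have i: "i \<in> V" "i \<noteq> r" and k: "k \<in> V" "k \<noteq> r" and ne: "i \<noteq> k" using p(1) by (auto simp: ik Q_def)
  have far: "u r i + u a k \<le> u r a + u i k" "u r k + u a i \<le> u r a + u i k"
      "u r i + u a k = u r k + u a i"
    if a: "a \<in> V" "a \<noteq> r" "a \<noteq> i" "a \<noteq> k" for a
  proof -
    have "(a, k) \<in> Q" "(i, a) \<in> Q" using a i k by (auto simp: Q_def)
    from mx[OF this(1)] mx[OF this(2)]
    show 1: "u r i + u a k \<le> u r a + u i k" and 2: "u r k + u a i \<le> u r a + u i k"
      using u_sym[of a i] by (simp_all add: f_def)
    \<comment> \<open>By maximality the sum pairing \<open>i\<close> with \<open>k\<close> is at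
      least as large as the two others; since the minimum is attained twice, these two
      agree.\<close>
    have d: "distinct [r, i, a, k]" "distinct [r, k, a, i]" using a i k ne by auto
    from four_pointD[OF fp r i(1) a(1) k(1) d(1)] four_pointD[OF fp r k(1) a(1) i(1) d(2)]
    show "u r i + u a k = u r k + u a i"
      using 1 2 u_sym[of a i] u_sym[of a k] u_sym[of k i] by linarith
  qed
  show thesis
  proof (rule that[OF i(1) k(1) ne])
    fix a b assume a: "a \<in> V - {i, k}" and b: "b \<in> V - {i, k}"
    show eq: "u a k + u b i = u b k + u a i"
      using far(3)[of a] far(3)[of b] a b by (cases "a = r"; cases "b = r") auto
    assume ab: "a \<noteq> b"
    consider "a = r" | "b = r" | "a \<noteq> r" "b \<noteq> r" by blast
    then show "u a k + u b i \<le> u a b + u i k"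
    proof cases
      case 1 then show ?thesis using far(2)[of b] b ab by auto
    next
      case 2 then show ?thesis using far(1)[of a] a ab u_sym[of r a] by auto
    next
      case 3
      \<comment> \<open>Adding a bound from \<open>far\<close> to either alternative of the
        four-point condition cancels the root.\<close>
      have d: "distinct [a, b, r, i]" using 3 ab a b i by auto
      from four_pointD[OF fp _ _ r i(1) d]
      have "u a r + u b i \<le> u a b + u r i \<or> u a i + u b r \<le> u a b + u r i" using a b by blast
      then show ?thesis
        using far(1)[of a] far(1)[of b] 3 a b u_sym[of a r] u_sym[of b r] eq by auto
    qed
  qed
qed

text \<open>One leaf \<open>k0\<close> of a cherry receives the largest number and is removed, and
  \<open>i'\<close> records the number of its partner. Fewer than three leaves carry no
  conditions.\<close>

lemma weak_structure:
  fixes u :: "nat \<Rightarrow> nat \<Rightarrow> real"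
  assumes "finite V" "card V = m" "\<And>a b. u b a = u a b" "four_point V u"
  shows "\<exists>\<rho> i. bij_betw \<rho> {1..m} V \<and> (\<forall>k\<in>{3..m}. i k \<in> {1..<k}) \<and>
    weak_cherries m i (\<lambda>a b. u (\<rho> a) (\<rho> b))"
  using assms
proof (induction m arbitrary: V)
  case 0
  then show ?case by (auto simp: weak_cherries_def bij_betw_def)
next
  case (Suc m)
  show ?case
  proof (cases "Suc m < 3")
    case True
    obtain h where "bij_betw h {1..Suc m} V"
      using ex_bij_betw_nat_finite_1[OF Suc.prems(1)] Suc.prems(2) by auto
    then show ?thesis using True
      by (intro exI[where x = h] exI[where x = "\<lambda>k. k"]) (auto simp: weak_cherries_def)
  next
    case False
    then have "3 \<le> card V" using Suc.prems(2) by simp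
    then obtain i0 k0 where c: "i0 \<in> V" "k0 \<in> V" "i0 \<noteq> k0"
      "\<And>a b. a \<in> V - {i0, k0} \<Longrightarrow> b \<in> V - {i0, k0} \<Longrightarrow> u a k0 + u b i0 = u b k0 + u a i0"
      "\<And>a b. a \<in> V - {i0, k0} \<Longrightarrow> b \<in> V - {i0, k0} \<Longrightarrow> a \<noteq> b \<Longrightarrow> u a k0 + u b i0 \<le> u a b + u i0 k0"
      using exists_cherry[OF Suc.prems(1) _ Suc.prems(3) Suc.prems(4)] by blast
    have "card (V - {k0}) = m" using c(2) Suc.prems by simp
    from Suc.IH[OF _ this Suc.prems(3) four_point_subset[OF Suc.prems(4) Diff_subset]]
    obtain \<rho> i where \<rho>: "bij_betw \<rho> {1..m} (V - {k0})" and i: "\<forall>k\<in>{3..m}. i k \<in> {1..<k}"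
      and w: "weak_cherries m i (\<lambda>a b. u (\<rho> a) (\<rho> b))"
      using Suc.prems(1) by blast
    have "i0 \<in> V - {k0}" using c(1,3) by simp
    then have "i0 \<in> \<rho> ` {1..m}" unfolding bij_betw_imp_surj_on[OF \<rho>] .
    then obtain i1 where i1: "i1 \<in> {1..m}" "\<rho> i1 = i0" by (elim imageE) simp
    define \<rho>' where "\<rho>' = \<rho>(Suc m := k0)"
    define i' where "i' = i(Suc m := i1)"
    have \<rho>'_old: "\<rho>' a = \<rho> a" if "a \<le> m" for a using that by (simp add: \<rho>'_def)
    have \<rho>'_new: "\<rho>' (Suc m) = k0" by (simp add: \<rho>'_def)
    have "bij_betw \<rho>' {1..m} (V - {k0})"
      using \<rho> \<rho>'_old by (subst bij_betw_cong[of _ _ \<rho>]) auto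
    moreover have "bij_betw \<rho>' {Suc m} {k0}" by (simp add: bij_betw_def \<rho>'_new)
    ultimately have "bij_betw \<rho>' ({1..m} \<union> {Suc m}) (V - {k0} \<union> {k0})"
      by (rule bij_betw_combine) blast
    moreover have "{1..m} \<union> {Suc m} = {1..Suc m}" "V - {k0} \<union> {k0} = V" using c(2) by auto
    ultimately have bij: "bij_betw \<rho>' {1..Suc m} V" by simp
    have ran: "i' k \<in> {1..<k}" if "k \<in> {3..Suc m}" for k
      using that i i1 by (cases "k = Suc m") (auto simp: i'_def)
    have "weak_cherries (Suc m) i' (\<lambda>a b. u (\<rho>' a) (\<rho>' b))"
      unfolding weak_cherries_def
    proof (intro ballI)
      fix k a b assume k: "k \<in> {3..Suc m}" and a: "a \<in> {1..<k} - {i' k}" and b: "b \<in> {1..<k} - {i' k}"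
      show "u (\<rho>' a) (\<rho>' k) + u (\<rho>' b) (\<rho>' (i' k)) = u (\<rho>' b) (\<rho>' k) + u (\<rho>' a) (\<rho>' (i' k)) \<and>
        (a \<noteq> b \<longrightarrow> u (\<rho>' a) (\<rho>' k) + u (\<rho>' b) (\<rho>' (i' k)) \<le> u (\<rho>' a) (\<rho>' b) + u (\<rho>' (i' k)) (\<rho>' k))"
      proof (cases "k = Suc m")
        case True
        have in_V: "\<rho> z \<in> V - {i0, k0}" if "z \<in> {1..m} - {i1}" for z
        proof -
          have "\<rho> z \<noteq> \<rho> i1" using inj_on_eq_iff[OF bij_betw_imp_inj_on[OF \<rho>], of z i1] that i1(1) by simp
          moreover have "\<rho> z \<in> V - {k0}" using bij_betwE[OF \<rho>] that by simp
          ultimately show ?thesis using i1(2) by simp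
        qed
        have ab: "a \<in> {1..m} - {i1}" "b \<in> {1..m} - {i1}" using a b True by (auto simp: i'_def)
        have "a \<noteq> b \<Longrightarrow> \<rho> a \<noteq> \<rho> b"
          using inj_on_eq_iff[OF bij_betw_imp_inj_on[OF \<rho>], of a b] ab by simp
        then show ?thesis
          using c(4)[OF in_V[OF ab(1)] in_V[OF ab(2)]] c(5)[OF in_V[OF ab(1)] in_V[OF ab(2)]] ab i1
          by (simp add: True \<rho>'_new i'_def \<rho>'_old)
      next
        case False
        then have km: "k \<in> {3..m}" using k by simp
        have ik: "i' k = i k" using False by (simp add: i'_def)
        have "i k \<in> {1..<k}" using i km by blast
        then have "\<rho>' (i k) = \<rho> (i k)" "\<rho>' k = \<rho> k" "\<rho>' a = \<rho> a" "\<rho>' b = \<rho> b"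
          using km a b by (auto intro!: \<rho>'_old)
        then show ?thesis using w km a b unfolding weak_cherries_def ik by auto
      qed
    qed
    then show ?thesis using bij ran by blast
  qed
qed

lemma weak_normal_form:
  assumes n: "3 \<le> n" and fp: "four_point {1..n} (symw w)"
  shows "\<exists>\<pi> i j. \<pi> permutes {1..n} \<and> iterated_choice n i j \<and>
    weak_cherries n i (\<lambda>a b. symw w (\<pi> a) (\<pi> b))"
proof -
  obtain \<rho> i where \<rho>: "bij_betw \<rho> {1..n} {1..n}" and i: "\<forall>k\<in>{3..n}. i k \<in> {1..<k}"
    and w: "weak_cherries n i (\<lambda>a b. symw w (\<rho> a) (\<rho> b))"
    using weak_structure[of "{1..n}" n "symw w"] fp symw_swap by auto
  define \<pi> where "\<pi> a = (if a \<in> {1..n} then \<rho> a else a)" for a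
  have "bij_betw \<pi> {1..n} {1..n}" using \<rho> by (subst bij_betw_cong[of _ _ \<rho>]) (auto simp: \<pi>_def)
  then have \<pi>: "\<pi> permutes {1..n}" by (rule bij_imp_permutes) (auto simp: \<pi>_def)
  have "weak_cherries n i (\<lambda>a b. symw w (\<pi> a) (\<pi> b))"
    unfolding weak_cherries_def
  proof (intro ballI)
    fix k a b assume k: "k \<in> {3..n}" and a: "a \<in> {1..<k} - {i k}" and b: "b \<in> {1..<k} - {i k}"
    have "i k \<in> {1..<k}" using i k by blast
    then have "\<pi> (i k) = \<rho> (i k)" "\<pi> k = \<rho> k" "\<pi> a = \<rho> a" "\<pi> b = \<rho> b" using k a b by (auto simp: \<pi>_def)
    then show "symw w (\<pi> a) (\<pi> k) + symw w (\<pi> b) (\<pi> (i k)) = symw w (\<pi> b) (\<pi> k) + symw w (\<pi> a) (\<pi> (i k)) \<and>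
        (a \<noteq> b \<longrightarrow> symw w (\<pi> a) (\<pi> k) + symw w (\<pi> b) (\<pi> (i k)) \<le> symw w (\<pi> a) (\<pi> b) + symw w (\<pi> (i k)) (\<pi> k))"
      using w k a b unfolding weak_cherries_def by simp
  qed
  \<comment> \<open>Any second index different from \<open>i k\<close> is admissible, and
    \<open>1\<close> and \<open>2\<close> are both available for \<open>k \<ge> 3\<close>.\<close>
  moreover have "iterated_choice n i (\<lambda>k. if i k = 1 then 2 else 1)"
    unfolding iterated_choice_def
  proof (intro ballI)
    fix k assume k: "k \<in> {3..n}"
    then have "i k \<in> {1..<k}" using i by blast
    then show "i k \<in> {1..k - 1} \<and> (if i k = 1 then 2 else 1) \<in> {1..k - 1} \<and> i k \<noteq> (if i k = 1 then 2 else 1)"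
      using k by auto
  qed
  ultimately show ?thesis using \<pi> by blast
qed

section \<open>Generic weights and the types of their quadruples\<close>

definition generic :: "nat \<Rightarrow> (nat \<times> nat \<Rightarrow> real) \<Rightarrow> bool" where
  "generic n w \<longleftrightarrow> w \<in> weight_space n \<and> (\<forall>a\<in>{1..n}. \<forall>b\<in>{1..n}. \<forall>c\<in>{1..n}. \<forall>d\<in>{1..n}.
     distinct [a, b, c, d] \<longrightarrow>
     (let x = symw w a b + symw w c d; y = symw w a c + symw w b d; z = symw w a d + symw w b c
      in x = y \<and> x < z \<or> x = z \<and> x < y \<or> y = z \<and> y < x))"

definition normal_form ::
  "nat \<Rightarrow> (nat \<times> nat \<Rightarrow> real) \<Rightarrow> (nat \<Rightarrow> nat) \<Rightarrow> (nat \<Rightarrow> nat) \<Rightarrow> (nat \<Rightarrow> nat) \<Rightarrow> bool" where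
  "normal_form n w \<pi> i j \<longleftrightarrow> \<pi> permutes {1..n} \<and> iterated_choice n i j \<and>
     strict_cherries n i (\<lambda>a b. symw w (\<pi> a) (\<pi> b))"

lemma genericD:
  assumes "generic n w" "a \<in> {1..n}" "b \<in> {1..n}" "c \<in> {1..n}" "d \<in> {1..n}" "distinct [a, b, c, d]"
  shows "symw w a b + symw w c d = symw w a c + symw w b d \<and> symw w a b + symw w c d < symw w a d + symw w b c \<or>
    symw w a b + symw w c d = symw w a d + symw w b c \<and> symw w a b + symw w c d < symw w a c + symw w b d \<or>
    symw w a c + symw w b d = symw w a d + symw w b c \<and> symw w a c + symw w b d < symw w a b + symw w c d"
  using assms unfolding generic_def Let_def by blast

lemma generic_four_point: "generic n w \<Longrightarrow> four_point {1..n} (symw w)"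
  unfolding four_point_def
proof (intro ballI impI)
  fix a b c d assume "generic n w" "a \<in> {1..n}" "b \<in> {1..n}" "c \<in> {1..n}" "d \<in> {1..n}" "distinct [a, b, c, d]"
  from genericD[OF this] show "symw w a c + symw w b d \<le> symw w a b + symw w c d \<or>
    symw w a d + symw w b c \<le> symw w a b + symw w c d" by linarith
qed

lemma cherry_indices:
  assumes "\<pi> permutes {1..n}" "iterated_choice n i j" "k \<in> {3..n}"
    "a \<in> {1..<k} - {i k}" "b \<in> {1..<k} - {i k}"
  shows "\<pi> a \<in> {1..n}" "\<pi> b \<in> {1..n}" "\<pi> (i k) \<in> {1..n}" "\<pi> k \<in> {1..n}"
    "a \<noteq> b \<Longrightarrow> distinct [\<pi> a, \<pi> b, \<pi> (i k), \<pi> k]"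
proof -
  have ik: "i k \<in> {1..k - 1}" using assms(2,3) unfolding iterated_choice_def by blast
  then have mem: "a \<in> {1..n}" "b \<in> {1..n}" "i k \<in> {1..n}" "k \<in> {1..n}" using assms(3-5) by auto
  then show "\<pi> a \<in> {1..n}" "\<pi> b \<in> {1..n}" "\<pi> (i k) \<in> {1..n}" "\<pi> k \<in> {1..n}"
    using permutes_in_image[OF assms(1)] by blast+
  assume "a \<noteq> b"
  then have "distinct [a, b, i k, k]" using assms(3-5) ik by auto
  then show "distinct [\<pi> a, \<pi> b, \<pi> (i k), \<pi> k]"
    by (simp add: inj_eq[OF permutes_inj[OF assms(1)]])
qed

text \<open>If a weak cherry inequality were an equality, all three sums of the quadruple would
  agree, which a generic weight excludes.\<close>

lemma generic_normal_form:
  assumes "3 \<le> n" and gen: "generic n w"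
  shows "\<exists>\<pi> i j. normal_form n w \<pi> i j"
proof -
  obtain \<pi> i j where \<pi>: "\<pi> permutes {1..n}" and ij: "iterated_choice n i j"
    and w: "weak_cherries n i (\<lambda>a b. symw w (\<pi> a) (\<pi> b))"
    using weak_normal_form[OF assms(1) generic_four_point[OF gen]] by blast
  have "strict_cherries n i (\<lambda>a b. symw w (\<pi> a) (\<pi> b))"
    unfolding strict_cherries_def
  proof (intro ballI conjI impI)
    fix k a b assume k: "k \<in> {3..n}" and a: "a \<in> {1..<k} - {i k}" and b: "b \<in> {1..<k} - {i k}"
    note weak = w[unfolded weak_cherries_def, rule_format, OF k a b]
    show "symw w (\<pi> a) (\<pi> k) + symw w (\<pi> b) (\<pi> (i k)) = symw w (\<pi> b) (\<pi> k) + symw w (\<pi> a) (\<pi> (i k))"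
      using weak by blast
    assume ab: "a \<noteq> b"
    note idx = cherry_indices[OF \<pi> ij k a b]
    from genericD[OF gen idx(1-4) idx(5)[OF ab]] weak ab
    show "symw w (\<pi> a) (\<pi> k) + symw w (\<pi> b) (\<pi> (i k)) < symw w (\<pi> a) (\<pi> b) + symw w (\<pi> (i k)) (\<pi> k)"
      by linarith
  qed
  then show ?thesis using \<pi> ij unfolding normal_form_def by blast
qed

definition strict_quad :: "(nat \<Rightarrow> nat \<Rightarrow> real) \<Rightarrow> nat \<Rightarrow> nat \<Rightarrow> nat \<Rightarrow> nat \<Rightarrow> bool" where
  "strict_quad u a b c d \<longleftrightarrow> u a b + u c d = u a c + u b d \<and> u a b + u c d < u a d + u b c"

definition weak_quad :: "(nat \<Rightarrow> nat \<Rightarrow> real) \<Rightarrow> nat \<Rightarrow> nat \<Rightarrow> nat \<Rightarrow> nat \<Rightarrow> bool" where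
  "weak_quad u a b c d \<longleftrightarrow> u a b + u c d = u a c + u b d \<and> u a b + u c d \<le> u a d + u b c"

definition quad_in :: "nat \<Rightarrow> nat \<Rightarrow> nat \<Rightarrow> nat \<Rightarrow> nat \<Rightarrow> bool" where
  "quad_in n a b c d \<longleftrightarrow>
     a \<in> {1..n} \<and> b \<in> {1..n} \<and> c \<in> {1..n} \<and> d \<in> {1..n} \<and> distinct [a, b, c, d]"

text \<open>Intended for generic \<open>w0\<close>: each quadruple then prescribes which two sums
  agree, and the result is the closed cone of the tree type of \<open>w0\<close>. Its relative
  interior is described by \<open>strict_in\<close>.\<close>

definition quad_cone :: "nat \<Rightarrow> (nat \<times> nat \<Rightarrow> real) \<Rightarrow> (nat \<times> nat \<Rightarrow> real) set" where
  "quad_cone n w0 = {w \<in> weight_space n. \<forall>a b c d. quad_in n a b c d \<longrightarrow>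
     strict_quad (symw w0) a b c d \<longrightarrow> weak_quad (symw w) a b c d}"

definition strict_in :: "nat \<Rightarrow> (nat \<times> nat \<Rightarrow> real) \<Rightarrow> (nat \<times> nat \<Rightarrow> real) \<Rightarrow> bool" where
  "strict_in n w0 w \<longleftrightarrow> w \<in> weight_space n \<and> (\<forall>a b c d. quad_in n a b c d \<longrightarrow>
     strict_quad (symw w0) a b c d \<longrightarrow> strict_quad (symw w) a b c d)"

lemma generic_quad_cases:
  assumes "generic n w" "quad_in n a b c d"
  shows "strict_quad (symw w) a b c d \<or> strict_quad (symw w) a b d c \<or> strict_quad (symw w) a c d b"
proof -
  have "a \<in> {1..n}" "b \<in> {1..n}" "c \<in> {1..n}" "d \<in> {1..n}" "distinct [a, b, c, d]"
    using assms(2) unfolding quad_in_def by blast+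
  from genericD[OF assms(1) this] show ?thesis
    using symw_swap[of w b c] symw_swap[of w c d] symw_swap[of w b d]
    unfolding strict_quad_def by linarith
qed

lemma quad_in_permute:
  assumes "quad_in n a b c d"
  shows "quad_in n a b d c" "quad_in n a c d b"
  using assms unfolding quad_in_def by auto

lemma normal_form_strict_in:
  assumes nf: "normal_form n w0 \<pi> i j" and w: "strict_in n w0 w"
  shows "normal_form n w \<pi> i j"
proof -
  have \<pi>: "\<pi> permutes {1..n}" and ij: "iterated_choice n i j"
    and s: "strict_cherries n i (\<lambda>a b. symw w0 (\<pi> a) (\<pi> b))"
    using nf unfolding normal_form_def by blast+
  have "strict_cherries n i (\<lambda>a b. symw w (\<pi> a) (\<pi> b))"
    unfolding strict_cherries_def
  proof (intro ballI)
    fix k a b assume k: "k \<in> {3..n}" and a: "a \<in> {1..<k} - {i k}" and b: "b \<in> {1..<k} - {i k}"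
    show "symw w (\<pi> a) (\<pi> k) + symw w (\<pi> b) (\<pi> (i k)) = symw w (\<pi> b) (\<pi> k) + symw w (\<pi> a) (\<pi> (i k)) \<and>
      (a \<noteq> b \<longrightarrow> symw w (\<pi> a) (\<pi> k) + symw w (\<pi> b) (\<pi> (i k)) < symw w (\<pi> a) (\<pi> b) + symw w (\<pi> (i k)) (\<pi> k))"
    proof (cases "a = b")
      case False
      note idx = cherry_indices[OF \<pi> ij k a b]
      have q: "quad_in n (\<pi> a) (\<pi> k) (\<pi> (i k)) (\<pi> b)"
        using idx(1-4) idx(5)[OF False] unfolding quad_in_def by auto
      have sw: "symw v (\<pi> (i k)) (\<pi> b) = symw v (\<pi> b) (\<pi> (i k))" "symw v (\<pi> k) (\<pi> (i k)) = symw v (\<pi> (i k)) (\<pi> k)"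
        "symw v (\<pi> k) (\<pi> b) = symw v (\<pi> b) (\<pi> k)" for v by (rule symw_swap)+
      have "strict_quad (symw w0) (\<pi> a) (\<pi> k) (\<pi> (i k)) (\<pi> b)"
        using s[unfolded strict_cherries_def, rule_format, OF k a b] False sw[of w0]
        unfolding strict_quad_def by linarith
      then have "strict_quad (symw w) (\<pi> a) (\<pi> k) (\<pi> (i k)) (\<pi> b)"
        using w q unfolding strict_in_def by blast
      then show ?thesis using sw[of w] unfolding strict_quad_def by linarith
    qed simp
  qed
  then show ?thesis using \<pi> ij unfolding normal_form_def by blast
qed

lemma strict_in_refl: "w \<in> weight_space n \<Longrightarrow> strict_in n w w"
  by (simp add: strict_in_def)

text \<open>A quadruple of a generic weight has exactly one of three types. A weight that is strict
  wherever \<open>w0\<close> is therefore leaves no room for another type, and the implication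
  becomes an equivalence.\<close>

lemma strict_in_generic:
  assumes "generic n w0" "strict_in n w0 w"
  shows "generic n w" and "\<And>a b c d. quad_in n a b c d \<Longrightarrow>
    strict_quad (symw w) a b c d \<longleftrightarrow> strict_quad (symw w0) a b c d"
proof -
  have tr: "quad_in n a b c d \<Longrightarrow> strict_quad (symw w0) a b c d \<Longrightarrow> strict_quad (symw w) a b c d" for a b c d
    using assms(2) unfolding strict_in_def by blast
  note sw = symw_swap[of w _ _]
  show "generic n w" unfolding generic_def Let_def
  proof (intro conjI ballI impI)
    show "w \<in> weight_space n" using assms(2) by (simp add: strict_in_def)
    fix a b c d assume "a \<in> {1..n}" "b \<in> {1..n}" "c \<in> {1..n}" "d \<in> {1..n}" "distinct [a, b, c, d]"
    then have q: "quad_in n a b c d" by (simp add: quad_in_def)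
    have "strict_quad (symw w) a b c d \<or> strict_quad (symw w) a b d c \<or> strict_quad (symw w) a c d b"
      using generic_quad_cases[OF assms(1) q] tr[OF q] tr[OF quad_in_permute(1)[OF q]]
        tr[OF quad_in_permute(2)[OF q]] by blast
    then show "symw w a b + symw w c d = symw w a c + symw w b d \<and> symw w a b + symw w c d < symw w a d + symw w b c \<or>
      symw w a b + symw w c d = symw w a d + symw w b c \<and> symw w a b + symw w c d < symw w a c + symw w b d \<or>
      symw w a c + symw w b d = symw w a d + symw w b c \<and> symw w a c + symw w b d < symw w a b + symw w c d"
      using symw_swap[of w b c] symw_swap[of w c d] symw_swap[of w a c] symw_swap[of w a d] symw_swap[of w b d]
      unfolding strict_quad_def by linarith
  qed
  fix a b c d assume q: "quad_in n a b c d"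
  show "strict_quad (symw w) a b c d \<longleftrightarrow> strict_quad (symw w0) a b c d"
  proof
    assume s: "strict_quad (symw w) a b c d"
    have "\<not> strict_quad (symw w) a b d c" "\<not> strict_quad (symw w) a c d b"
      using s symw_swap[of w b c] symw_swap[of w c d] symw_swap[of w a c] symw_swap[of w a d] symw_swap[of w b d]
      unfolding strict_quad_def by linarith+
    then show "strict_quad (symw w0) a b c d"
      using generic_quad_cases[OF assms(1) q] tr[OF quad_in_permute(1)[OF q]]
        tr[OF quad_in_permute(2)[OF q]] by blast
  qed (rule tr[OF q])
qed

text \<open>The first three numbers attain their minimum exactly twice, and the last three show the
  same pattern weakly. The form is symmetric in the three pairings, so leaves can be permuted
  freely.\<close>

definition compatible :: "real \<Rightarrow> real \<Rightarrow> real \<Rightarrow> real \<Rightarrow> real \<Rightarrow> real \<Rightarrow> bool" where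
  "compatible x y z x' y' z' \<longleftrightarrow>
     x = y \<and> x < z \<and> x' = y' \<and> x' \<le> z' \<or> x = z \<and> x < y \<and> x' = z' \<and> x' \<le> y' \<or>
     y = z \<and> y < x \<and> y' = z' \<and> y' \<le> x'"

lemma compatible_permute:
  "compatible x y z x' y' z' = compatible y x z y' x' z'"
  "compatible x y z x' y' z' = compatible x z y x' z' y'"
  unfolding compatible_def by auto

lemma compatible_shift:
  "compatible (x + d) (y + d) (z + d) (x' + d') (y' + d') (z' + d') = compatible x y z x' y' z'"
  unfolding compatible_def by auto

text \<open>The cherry conditions mention only quadruples \<open>a, b, i k, k\<close>. In an
  arbitrary quadruple let \<open>d\<close> be the largest index: if \<open>i d\<close> is among the
  others, the condition at \<open>d\<close> decides; if not, replacing \<open>d\<close> by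
  \<open>i d\<close> shifts the three sums by one common amount and lowers the sum of the
  indices.\<close>

lemma cherries_compatible:
  fixes g u :: "nat \<Rightarrow> nat \<Rightarrow> real"
  assumes i: "\<And>k. k \<in> {3..n} \<Longrightarrow> i k \<in> {1..<k}"
    and g: "strict_cherries n i g" "\<And>a b. g b a = g a b"
    and u: "weak_cherries n i u" "\<And>a b. u b a = u a b"
    and "quad_in n a b c d"
  shows "compatible (g a b + g c d) (g a c + g b d) (g a d + g b c)
    (u a b + u c d) (u a c + u b d) (u a d + u b c)"
proof -
  define Q where "Q a b c d = compatible (g a b + g c d) (g a c + g b d) (g a d + g b c)
    (u a b + u c d) (u a c + u b d) (u a d + u b c)" for a b c d
  have Q1: "Q a b c d = Q a c b d" for a b c d
    unfolding Q_def g(2)[of c b] u(2)[of c b] by (subst compatible_permute(1)) simp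
  have Q2: "Q a b c d = Q b a d c" for a b c d
    unfolding Q_def g(2)[of b a] u(2)[of b a] g(2)[of d c] u(2)[of d c]
    by (simp add: add.commute)
  have Q3: "Q a b c d = Q a b d c" for a b c d
    unfolding Q_def g(2)[of d c] u(2)[of d c] by (subst compatible_permute(2)) simp
  have "Q a b c d" if "quad_in n a b c d" for a b c d
    using that
  proof (induction "a + b + c + d" arbitrary: a b c d rule: less_induct)
    case less
    have main: "Q a b c d"
      if eq: "s = a + b + c + d" and q: "quad_in n a b c d" and m: "a < d" "b < d" "c < d"
        and IH: "\<And>a' b' c' d'. a' + b' + c' + d' < s \<Longrightarrow> quad_in n a' b' c' d' \<Longrightarrow> Q a' b' c' d'"
      for a b c d s
    proof -
      have mem: "a \<in> {1..n}" "b \<in> {1..n}" "c \<in> {1..n}" "d \<in> {1..n}" and ne: "a \<noteq> b" "a \<noteq> c" "b \<noteq> c"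
        using q unfolding quad_in_def by auto
      have d3: "d \<in> {3..n}" using mem ne m by auto
      have G: "g x d + g y (i d) = g y d + g x (i d) \<and> (x \<noteq> y \<longrightarrow> g x d + g y (i d) < g x y + g (i d) d)"
        if "x \<in> {1..<d}" "x \<noteq> i d" "y \<in> {1..<d}" "y \<noteq> i d" for x y
        using g(1) d3 that unfolding strict_cherries_def by blast
      have U: "u x d + u y (i d) = u y d + u x (i d) \<and> (x \<noteq> y \<longrightarrow> u x d + u y (i d) \<le> u x y + u (i d) d)"
        if "x \<in> {1..<d}" "x \<noteq> i d" "y \<in> {1..<d}" "y \<noteq> i d" for x y
        using u(1) d3 that unfolding weak_cherries_def by blast
      have a: "a \<in> {1..<d}" and b: "b \<in> {1..<d}" and c: "c \<in> {1..<d}" using mem m by auto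
      consider "i d = a" | "i d = b" | "i d = c" | "a \<noteq> i d" "b \<noteq> i d" "c \<noteq> i d" by metis
      then show "Q a b c d"
      proof cases
        case 1
        have "g b d + g c a = g c d + g b a \<and> g b d + g c a < g b c + g a d"
          "u b d + u c a = u c d + u b a \<and> u b d + u c a \<le> u b c + u a d"
          using G[OF b _ c] U[OF b _ c] ne 1 by auto
        then show ?thesis using g(2)[of a c] u(2)[of a c] g(2)[of a b] u(2)[of a b]
          unfolding Q_def compatible_def by linarith
      next
        case 2
        have "g a d + g c b = g c d + g a b \<and> g a d + g c b < g a c + g b d"
          "u a d + u c b = u c d + u a b \<and> u a d + u c b \<le> u a c + u b d"
          using G[OF a _ c] U[OF a _ c] ne 2 by auto
        then show ?thesis using g(2)[of b c] u(2)[of b c] unfolding Q_def compatible_def by linarith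
      next
        case 3
        have "g a d + g b c = g b d + g a c \<and> g a d + g b c < g a b + g c d"
          "u a d + u b c = u b d + u a c \<and> u a d + u b c \<le> u a b + u c d"
          using G[OF a _ b] U[OF a _ b] ne 3 by auto
        then show ?thesis unfolding Q_def compatible_def by linarith
      next
        case 4
        have id: "i d \<in> {1..<d}" using i d3 by blast
        then have q': "quad_in n a b c (i d)" using q 4 mem unfolding quad_in_def by auto
        have "Q a b c (i d)" using IH[OF _ q'] id eq by auto
        moreover
        have "g b d = g b (i d) + (g a d - g a (i d))" "g c d = g c (i d) + (g a d - g a (i d))"
          "u b d = u b (i d) + (u a d - u a (i d))" "u c d = u c (i d) + (u a d - u a (i d))"
          using G[OF a _ b] G[OF a _ c] U[OF a _ b] U[OF a _ c] 4 by auto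
        then have "g a b + g c d = (g a b + g c (i d)) + (g a d - g a (i d))"
          "g a c + g b d = (g a c + g b (i d)) + (g a d - g a (i d))"
          "g a d + g b c = (g a (i d) + g b c) + (g a d - g a (i d))"
          "u a b + u c d = (u a b + u c (i d)) + (u a d - u a (i d))"
          "u a c + u b d = (u a c + u b (i d)) + (u a d - u a (i d))"
          "u a d + u b c = (u a (i d) + u b c) + (u a d - u a (i d))" by auto
        note eqs = this
        ultimately show ?thesis unfolding Q_def
          by (subst eqs(1), subst eqs(2), subst eqs(3), subst eqs(4), subst eqs(5), subst eqs(6))
            (simp only: compatible_shift)
      qed
    qed
    have IH: "Q a' b' c' d'" if "a' + b' + c' + d' < a + b + c + d" "quad_in n a' b' c' d'" for a' b' c' d'
      using less.hyps[OF that] .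
    have dist: "a \<noteq> b" "a \<noteq> c" "a \<noteq> d" "b \<noteq> c" "b \<noteq> d" "c \<noteq> d"
      using less.prems unfolding quad_in_def by auto
    have perm: "quad_in n a b c d" "quad_in n d c b a" "quad_in n a c d b" "quad_in n a b d c"
      "quad_in n b d c a"
      using less.prems unfolding quad_in_def by auto
    \<comment> \<open>\<open>main\<close> expects the largest index in the fourth position; the
      symmetries \<open>Q1\<close>, \<open>Q2\<close> and \<open>Q3\<close> bring it there and
      back.\<close>
    consider "a < d" "b < d" "c < d" | "a < c" "b < c" "d < c" | "a < b" "c < b" "d < b" | "b < a" "c < a" "d < a"
      using dist by linarith
    then show ?case
    proof cases
      case 1 then show ?thesis by (intro main[OF refl perm(1) _ _ _ IH])
    next
      case 2 then have "Q a b d c" by (intro main[OF _ perm(4) _ _ _ IH, of "a + b + c + d"]) simp_all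
      then show ?thesis using Q3 by blast
    next
      case 3 then have "Q a c d b" by (intro main[OF _ perm(3) _ _ _ IH, of "a + b + c + d"]) simp_all
      then have "Q a c b d" using Q3[of a c b d] by simp
      then show ?thesis using Q1[of a b c d] by simp
    next
      case 4 then have "Q b d c a" by (intro main[OF _ perm(5) _ _ _ IH, of "a + b + c + d"]) simp_all
      then have "Q b c d a" using Q1[of b d c a] by simp
      then have "Q b c a d" using Q3[of b c a d] by simp
      then have "Q b a c d" using Q1[of b a c d] by simp
      then have "Q b a d c" using Q3[of b a c d] by simp
      then show ?thesis using Q2[of a b c d] by simp
    qed
  qed
  from this[OF assms(6)] show ?thesis unfolding Q_def .
qed

lemma iterated_choice_range: "iterated_choice n i j \<Longrightarrow> k \<in> {3..n} \<Longrightarrow> i k \<in> {1..<k}"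
  unfolding iterated_choice_def by fastforce

lemma compatible_imp_generic_cone:
  assumes w0: "w0 \<in> weight_space n" and w: "w \<in> weight_space n"
    and c: "\<And>a b c d. quad_in n a b c d \<Longrightarrow>
      compatible (symw w0 a b + symw w0 c d) (symw w0 a c + symw w0 b d) (symw w0 a d + symw w0 b c)
        (symw w a b + symw w c d) (symw w a c + symw w b d) (symw w a d + symw w b c)"
  shows "generic n w0" "w \<in> quad_cone n w0"
proof -
  show "generic n w0" unfolding generic_def Let_def
  proof (intro conjI ballI impI w0)
    fix a b c' d assume "a \<in> {1..n}" "b \<in> {1..n}" "c' \<in> {1..n}" "d \<in> {1..n}" "distinct [a, b, c', d]"
    then have "quad_in n a b c' d" by (simp add: quad_in_def)
    from c[OF this]
    show "symw w0 a b + symw w0 c' d = symw w0 a c' + symw w0 b d \<and> symw w0 a b + symw w0 c' d < symw w0 a d + symw w0 b c' \<or>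
      symw w0 a b + symw w0 c' d = symw w0 a d + symw w0 b c' \<and> symw w0 a b + symw w0 c' d < symw w0 a c' + symw w0 b d \<or>
      symw w0 a c' + symw w0 b d = symw w0 a d + symw w0 b c' \<and> symw w0 a c' + symw w0 b d < symw w0 a b + symw w0 c' d"
      unfolding compatible_def by linarith
  qed
  have "weak_quad (symw w) a b c' d" if "quad_in n a b c' d" "strict_quad (symw w0) a b c' d" for a b c' d
    using c[OF that(1)] that(2) unfolding compatible_def strict_quad_def weak_quad_def by linarith
  then show "w \<in> quad_cone n w0" using w by (simp add: quad_cone_def)
qed

text \<open>The candidate is the weight of the iterated tree built from the cherries of
  \<open>w\<close>, with the leaves permuted back.\<close>

lemma four_point_in_generic_cone:
  assumes n: "3 \<le> n" and w: "w \<in> weight_space n" and fp: "four_point {1..n} (symw w)"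
  shows "\<exists>w0. generic n w0 \<and> w \<in> quad_cone n w0"
proof -
  obtain \<pi> i j where \<pi>: "\<pi> permutes {1..n}" and ij: "iterated_choice n i j"
    and weak: "weak_cherries n i (\<lambda>a b. symw w (\<pi> a) (\<pi> b))"
    using weak_normal_form[OF n fp] by blast
  define t where "t = tree_weight n (iterated_tree n i)"
  define w0 where "w0 = permute_weight n (inv_perm \<pi>) t"
  have st: "strict_cherries n i (symw t)"
    unfolding t_def using iterated_choice_range[OF ij] by (intro strict_cherries_tree n) auto
  have \<sigma>: "inv_perm \<pi> permutes {1..n}" by (rule permutes_inv[OF \<pi>])
  have cp: "compatible (symw w0 a b + symw w0 c d) (symw w0 a c + symw w0 b d) (symw w0 a d + symw w0 b c)
        (symw w a b + symw w c d) (symw w a c + symw w b d) (symw w a d + symw w b c)"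
    if q: "quad_in n a b c d" for a b c d
  proof -
    let ?s = "inv_perm \<pi>"
    have q': "quad_in n (?s a) (?s b) (?s c) (?s d)"
      using q permutes_in_image[OF \<sigma>] permutes_inj[OF \<sigma>] unfolding quad_in_def
      by (auto dest: injD)
    have t: "symw w0 x y = symw t (?s x) (?s y)" if "x \<in> {1..n}" "y \<in> {1..n}" "x \<noteq> y" for x y
      unfolding w0_def by (rule symw_permute_weight[OF that])
    have "compatible (symw t (?s a) (?s b) + symw t (?s c) (?s d)) (symw t (?s a) (?s c) + symw t (?s b) (?s d))
      (symw t (?s a) (?s d) + symw t (?s b) (?s c))
      (symw w a b + symw w c d) (symw w a c + symw w b d) (symw w a d + symw w b c)"
      using cherries_compatible[OF iterated_choice_range[OF ij] st symw_swap weak symw_swap q']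
      by (simp only: permutes_inverses(1)[OF \<pi>])
    then show ?thesis using q t unfolding quad_in_def by simp
  qed
  have "w0 \<in> weight_space n" unfolding w0_def by (rule permute_weight_space)
  from compatible_imp_generic_cone[OF this w cp] show ?thesis by blast
qed

lemma tree_weight_space: "tree_weight n E \<in> weight_space n"
  by (auto simp: weight_space_def tree_weight_def)

lemma tree_weight_generic:
  assumes n: "3 \<le> n" and ij: "iterated_choice n i j"
  shows "generic n (tree_weight n (iterated_tree n i))"
    "normal_form n (tree_weight n (iterated_tree n i)) id i j"
proof -
  let ?t = "tree_weight n (iterated_tree n i)"
  have st: "strict_cherries n i (symw ?t)"
    using iterated_choice_range[OF ij] by (intro strict_cherries_tree n) auto
  then have wk: "weak_cherries n i (symw ?t)"
    unfolding strict_cherries_def weak_cherries_def by (meson less_imp_le)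
  show "generic n ?t"
    using compatible_imp_generic_cone(1)[OF tree_weight_space tree_weight_space
      cherries_compatible[OF iterated_choice_range[OF ij] st symw_swap wk symw_swap]] .
  show "normal_form n ?t id i j" using ij st by (simp add: normal_form_def permutes_id)
qed

text \<open>Both ideals are the kernel of one map, which depends on \<open>\<pi>\<close>,
  \<open>i\<close> and \<open>j\<close> but not on the weight.\<close>

lemma normal_form_initial_ideal:
  assumes n: "3 \<le> n" and w: "w \<in> weight_space n" "normal_form n w \<pi> i j"
    and w': "w' \<in> weight_space n" "normal_form n w' \<pi> i j"
  shows "initial_ideal n w = initial_ideal n w'"
proof -
  interpret iterated_seq n i j using w(2) n by unfold_locales (auto simp: normal_form_def)
  have \<pi>: "\<pi> permutes {1..n}" using w(2) by (simp add: normal_form_def)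
  show ?thesis
    using initial_ideal_kernel_map[OF \<pi> w(1)] initial_ideal_kernel_map[OF \<pi> w'(1)] w(2) w'(2)
    unfolding normal_form_def by simp
qed

lemma normal_form_no_monomial:
  assumes n: "3 \<le> n" and w: "w \<in> weight_space n" "normal_form n w \<pi> i j" and c: "c \<noteq> 0"
  shows "single m c \<notin> initial_ideal n w"
proof
  interpret iterated_seq n i j using w(2) n by unfold_locales (auto simp: normal_form_def)
  have \<pi>: "\<pi> permutes {1..n}" using w(2) by (simp add: normal_form_def)
  assume "single m c \<in> initial_ideal n w"
  then have "single m c \<in> carrier (plucker_poly_ring n)" "kernel_map \<pi> (single m c) = 0"
    using initial_ideal_kernel_map[OF \<pi> w(1)] w(2) unfolding normal_form_def by auto
  moreover from this(1) have "keys m \<subseteq> plucker_index n" using c by (simp add: in_cpoly_carrier)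
  ultimately show False using kernel_map_monomial[OF \<pi> _ c] by blast
qed

lemma normal_form_graded_iso:
  assumes n: "3 \<le> n" and w: "w \<in> weight_space n" "normal_form n w \<pi> i j"
  shows "graded_algebra_iso_quotient n (iterated_sequence n i j) (initial_ideal n w)"
    "birational_sequence n (iterated_sequence n i j)"
proof -
  interpret iterated_seq n i j using w(2) n by unfold_locales (auto simp: normal_form_def)
  have \<pi>: "\<pi> permutes {1..n}" using w(2) by (simp add: normal_form_def)
  show "graded_algebra_iso_quotient n (iterated_sequence n i j) (initial_ideal n w)"
    using graded_iso_permuted[OF \<pi> w(1)] w(2) unfolding normal_form_def by simp
  show "birational_sequence n (iterated_sequence n i j)" by (rule birational)
qed

section \<open>Cones of the tropical Grassmannian\<close>

abbreviation "mw \<equiv> monomial_weight"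

text \<open>An element of the initial ideal is in general a sum of multiples of initial forms, yet
  each of its components is the lowest component of a single element of the Pluecker ideal. The
  polynomials with this property form an ideal; a term of a multiplier shifts \<open>c\<close>,
  which is why all \<open>c\<close> are treated at once.\<close>

lemma initial_ideal_lift:
  assumes u: "u \<in> initial_ideal n w"
  shows "\<exists>g\<in>plucker_ideal n. weight_ge (mw w) c g \<and> wpart (mw w) c g = wpart (mw w) c u"
proof -
  let ?PR = "plucker_poly_ring n" and ?I = "plucker_ideal n"
  let ?L = "\<lambda>u c. \<exists>g\<in>?I. weight_ge (mw w) c g \<and> wpart (mw w) c g = wpart (mw w) c u"
  have zero_L: "?L 0 c" for c using ideal_cpolyD(2)[OF ideal_plucker] by (intro bexI[of _ 0]) auto
  have add_L: "?L (u + v) c" if "?L u c" "?L v c" for u v c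
  proof -
    from that obtain g h where g: "g \<in> ?I" "weight_ge (mw w) c g" "wpart (mw w) c g = wpart (mw w) c u"
      and h: "h \<in> ?I" "weight_ge (mw w) c h" "wpart (mw w) c h = wpart (mw w) c v" by blast
    show ?thesis
    proof (rule bexI[of _ "g + h"], intro conjI)
      show "weight_ge (mw w) c (g + h)" by (rule weight_ge_add[OF g(2) h(2)])
      show "wpart (mw w) c (g + h) = wpart (mw w) c (u + v)" by (simp add: wpart_add g(3) h(3))
      show "g + h \<in> ?I" by (rule ideal_cpolyD(3)[OF ideal_plucker g(1) h(1)])
    qed
  qed
  have mult_L: "?L (f * u) c" if f: "f \<in> carrier ?PR" and u: "\<And>c. ?L u c" for f u c
  proof -
    have "keys f \<subseteq> {m. keys m \<subseteq> plucker_index n}" using f by (auto simp: in_cpoly_carrier)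
    then show ?thesis
    proof (induction f rule: poly_mapping_linear_induct)
      case zero show ?case using zero_L[of c] by simp
    next
      case (single m a)
      obtain g where g: "g \<in> ?I" "weight_ge (mw w) (c - mw w m) g"
        "wpart (mw w) (c - mw w m) g = wpart (mw w) (c - mw w m) u"
        using u[of "c - mw w m"] by blast
      show ?case
      proof (rule bexI[of _ "single m a * g"], intro conjI)
        have "weight_ge (mw w) (mw w m) (single m a)" by (simp add: weight_ge_def)
        from weight_ge_mult[OF weight_hom_monomial_weight this g(2)]
        show "weight_ge (mw w) c (single m a * g)" by simp
        show "wpart (mw w) c (single m a * g) = wpart (mw w) c (single m a * u)"
          by (simp only: wpart_mult_single[OF weight_hom_monomial_weight] g(3))
        have "single m a \<in> carrier ?PR" using single by (simp add: in_cpoly_carrier)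
        then show "single m a * g \<in> ?I" by (rule ideal_cpolyD(4)[OF ideal_plucker g(1)])
      qed
    next
      case (add p q)
      show ?case unfolding distrib_right by (rule add_L[OF add(3,4)])
    qed
  qed
  have "ideal {u \<in> carrier ?PR. \<forall>c. ?L u c} ?PR"
  proof (rule ideal_cpolyI)
    show "0 \<in> {u \<in> carrier ?PR. \<forall>c. ?L u c}" using zero_L by simp
  next
    fix f g assume "f \<in> {u \<in> carrier ?PR. \<forall>c. ?L u c}" "g \<in> {u \<in> carrier ?PR. \<forall>c. ?L u c}"
    then have f: "f \<in> carrier ?PR" "\<And>c. ?L f c" and g: "g \<in> carrier ?PR" "\<And>c. ?L g c" by blast+
    have "f + g \<in> carrier ?PR" by (rule cpoly_carrier_add[OF f(1) g(1)])
    then show "f + g \<in> {u \<in> carrier ?PR. \<forall>c. ?L u c}" using add_L[OF f(2) g(2)] by blast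
  next
    fix f g assume "f \<in> {u \<in> carrier ?PR. \<forall>c. ?L u c}" and g: "g \<in> carrier ?PR"
    then have f: "f \<in> carrier ?PR" "\<And>c. ?L f c" by blast+
    have "g * f \<in> carrier ?PR" by (rule cpoly_carrier_mult[OF g f(1)])
    then show "g * f \<in> {u \<in> carrier ?PR. \<forall>c. ?L u c}" using mult_L[OF g f(2)] by blast
  qed blast
  then have "initial_ideal n w \<subseteq> {u \<in> carrier ?PR. \<forall>c. ?L u c}"
  proof (rule initial_ideal_subset)
    fix f c0 assume f: "f \<in> ?I" "weight_ge (mw w) c0 f"
    have fc: "f \<in> carrier ?PR" using f(1) ideal_cpolyD(1)[OF ideal_plucker] by blast
    have wL: "?L (wpart (mw w) c0 f) c" for c
    proof (cases "c = c0")
      case True then show ?thesis using f by (intro bexI[of _ f]) (simp_all add: wpart_wpart)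
    next
      case False then show ?thesis using zero_L[of c] by (simp add: wpart_wpart)
    qed
    show "wpart (mw w) c0 f \<in> {u \<in> carrier ?PR. \<forall>c. ?L u c}"
      by (rule CollectI, rule conjI, rule wpart_carrier[OF fc], rule allI, rule wL)
  qed
  from subsetD[OF this u] show ?thesis by simp
qed

lemma wpart_initial_ideal:
  assumes "u \<in> initial_ideal n w" shows "wpart (mw w) c u \<in> initial_ideal n w"
proof -
  obtain g where g: "g \<in> plucker_ideal n" "weight_ge (mw w) c g" "wpart (mw w) c g = wpart (mw w) c u"
    using initial_ideal_lift[OF assms] by blast
  show ?thesis using wpart_in_initial_ideal[OF g(1,2)] unfolding g(3) .
qed

section \<open>Perturbation of a weight into the interior of a cone\<close>

lemma perturbation_eventually_less:
  fixes A B :: "'b \<Rightarrow> real"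
  assumes "finite F" "\<And>m. m \<in> F \<Longrightarrow> a < A m"
  obtains e where "0 < e" "\<And>m. m \<in> F \<Longrightarrow> a + e * b < A m + e * B m"
proof -
  have "\<forall>\<^sub>F e in at_right 0. \<forall>m\<in>F. 0 < (A m - a) + e * (B m - b)"
  proof (rule eventually_ball_finite[OF assms(1)], rule)
    fix m assume "m \<in> F"
    have "((\<lambda>e. (A m - a) + e * (B m - b)) \<longlongrightarrow> (A m - a) + 0 * (B m - b)) (at_right 0)"
      by (intro tendsto_intros)
    from order_tendstoD(1)[OF this, of 0]
    show "\<forall>\<^sub>F e in at_right 0. 0 < (A m - a) + e * (B m - b)"
      using assms(2)[OF \<open>m \<in> F\<close>] by simp
  qed
  then have "\<forall>\<^sub>F e in at_right 0. 0 < e \<and> (\<forall>m\<in>F. 0 < (A m - a) + e * (B m - b))"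
    using eventually_at_right_less[of "0::real"] by (intro eventually_conj)
  then obtain e :: real where "0 < e" "\<forall>m\<in>F. 0 < (A m - a) + e * (B m - b)"
    using eventually_happens'[OF trivial_limit_at_right_real] by blast
  then show thesis by (intro that[of e]) (simp_all add: right_diff_distrib algebra_simps)
qed

definition perturb :: "('e \<Rightarrow> real) \<Rightarrow> real \<Rightarrow> ('e \<Rightarrow> real) \<Rightarrow> 'e \<Rightarrow> real" where
  "perturb w e w0 = (\<lambda>x. w x + e * w0 x)"

lemma symw_perturb: "symw (perturb w e w0) a b = symw w a b + e * symw w0 a b"
  by (simp add: symw_def perturb_def)

lemma mw_perturb: "mw (perturb w e w0) m = mw w m + e * mw w0 m"
  by (simp add: monomial_weight_def perturb_def sum.distrib sum_distrib_left algebra_simps)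

lemma perturb_space: "w \<in> weight_space n \<Longrightarrow> w0 \<in> weight_space n \<Longrightarrow> perturb w e w0 \<in> weight_space n"
  by (simp add: weight_space_def perturb_def)

lemma perturb_strict_in:
  assumes "w \<in> quad_cone n w0" "w0 \<in> weight_space n" "0 < e"
  shows "strict_in n w0 (perturb w e w0)"
  unfolding strict_in_def
proof (intro conjI allI impI)
  show "perturb w e w0 \<in> weight_space n" using assms by (intro perturb_space) (auto simp: quad_cone_def)
  fix a b c d assume q: "quad_in n a b c d" and s: "strict_quad (symw w0) a b c d"
  have w: "weak_quad (symw w) a b c d" using assms(1) q s unfolding quad_cone_def by blast
  have "e * (symw w0 a b + symw w0 c d) < e * (symw w0 a d + symw w0 b c)"
    "e * (symw w0 a b + symw w0 c d) = e * (symw w0 a c + symw w0 b d)"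
    using s assms(3) unfolding strict_quad_def by simp_all
  then show "strict_quad (symw (perturb w e w0)) a b c d"
    using w unfolding strict_quad_def weak_quad_def symw_perturb distrib_left by linarith
qed

lemma quad_cone_space: "w \<in> quad_cone n w0 \<Longrightarrow> w \<in> weight_space n"
  by (simp add: quad_cone_def)

lemma generic_space: "generic n w \<Longrightarrow> w \<in> weight_space n"
  by (simp add: generic_def)

lemma generic_in_quad_cone: "generic n w \<Longrightarrow> w \<in> quad_cone n w"
  by (auto simp: quad_cone_def generic_space strict_quad_def weak_quad_def)

lemma strict_in_initial_ideal:
  assumes "3 \<le> n" "generic n w0" "strict_in n w0 w"
  shows "initial_ideal n w = initial_ideal n w0"
proof -
  obtain \<pi> i j where nf: "normal_form n w0 \<pi> i j" using generic_normal_form[OF assms(1,2)] by blast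
  show ?thesis
    using normal_form_initial_ideal[OF assms(1) _ normal_form_strict_in[OF nf assms(3)] generic_space[OF assms(2)] nf]
      assms(3) by (simp add: strict_in_def)
qed

text \<open>A monomial in the initial ideal of \<open>w\<close> is the initial form of one element
  \<open>g\<close>, and it remains so when a small multiple of \<open>w0\<close> is added to
  \<open>w\<close>. But the perturbed weight has the initial ideal of \<open>w0\<close>, which
  contains no monomial.\<close>

lemma quad_cone_no_monomial:
  assumes n: "3 \<le> n" and gen: "generic n w0" and w: "w \<in> quad_cone n w0"
  shows "single m 1 \<notin> initial_ideal n w"
proof
  assume "single m 1 \<in> initial_ideal n w"
  from initial_ideal_lift[OF this, of "mw w m"]
  obtain g where g: "g \<in> plucker_ideal n" "weight_ge (mw w) (mw w m) g" "wpart (mw w) (mw w m) g = single m 1"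
    by (auto simp: wpart_single)
  have lk: "lookup g m = 1" using arg_cong[OF g(3), of "\<lambda>f. lookup f m"] by (simp add: lookup_wpart)
  have gt: "mw w m < mw w m'" if "m' \<in> keys g - {m}" for m'
  proof -
    have "m' \<notin> keys (wpart (mw w) (mw w m) g)" unfolding g(3) using that by simp
    then have "mw w m' \<noteq> mw w m" using that unfolding keys_wpart by blast
    then show ?thesis using g(2) that unfolding weight_ge_def by force
  qed
  obtain e where e: "0 < e" "\<And>m'. m' \<in> keys g - {m} \<Longrightarrow> mw w m + e * mw w0 m < mw w m' + e * mw w0 m'"
    using perturbation_eventually_less[of "keys g - {m}" "mw w m" "mw w" "mw w0 m" "mw w0"] gt by auto
  let ?v = "perturb w e w0"
  have lt: "mw ?v m < mw ?v m'" if "m' \<in> keys g - {m}" for m' using e(2)[OF that] by (simp only: mw_perturb)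
  have "weight_ge (mw ?v) (mw ?v m) g" unfolding weight_ge_def
  proof
    fix m' assume "m' \<in> keys g" then show "mw ?v m \<le> mw ?v m'"
      using lt[of m'] by (cases "m' = m") auto
  qed
  then have "wpart (mw ?v) (mw ?v m) g \<in> initial_ideal n ?v" by (rule wpart_in_initial_ideal[OF g(1)])
  moreover have "wpart (mw ?v) (mw ?v m) g = single m 1"
  proof (rule poly_mapping_eqI)
    fix m' show "lookup (wpart (mw ?v) (mw ?v m) g) m' = lookup (single m 1) m'"
    proof (cases "m' \<in> keys g - {m}")
      case True then show ?thesis using lt[OF True] by (auto simp: lookup_wpart lookup_single when_def)
    next
      case False then show ?thesis using lk by (auto simp: lookup_wpart lookup_single when_def in_keys_iff)
    qed
  qed
  moreover have st: "strict_in n w0 ?v" by (rule perturb_strict_in[OF w generic_space[OF gen] e(1)])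
  obtain \<pi> i j where nf: "normal_form n w0 \<pi> i j" using generic_normal_form[OF n gen] by blast
  ultimately show False
    using normal_form_no_monomial[OF n generic_space[OF gen] nf, of 1 m] strict_in_initial_ideal[OF n gen st] by simp
qed

lemma quad_cone_subset_trop: "3 \<le> n \<Longrightarrow> generic n w0 \<Longrightarrow> quad_cone n w0 \<subseteq> trop_Gr2 n"
  using quad_cone_no_monomial quad_cone_space unfolding trop_Gr2_def by blast

lemma trop_no_monomial:
  assumes "w \<in> trop_Gr2 n" "c \<noteq> 0" shows "single m c \<notin> initial_ideal n w"
proof
  assume "single m c \<in> initial_ideal n w"
  then have "Const (1 / c) * single m c \<in> initial_ideal n w"
    by (rule ideal_cpolyD(4)[OF ideal_initial]) (rule Const_carrier)
  moreover have "Const (1 / c) * single m c = single m 1" using assms(2) by (simp add: Const_def mult_single)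
  ultimately show False using assms(1) by (simp add: trop_Gr2_def)
qed

lemma plucker_rel_monomials:
  assumes "distinct [a, b, c, d]"
  obtains m1 m2 m3 :: "(nat \<times> nat) \<Rightarrow>\<^sub>0 nat" and s1 s2 s3 :: complex
  where "plucker_rel a b c d = single m1 s1 + single m2 s2 + single m3 s3" "s1 \<noteq> 0" "s2 \<noteq> 0" "s3 \<noteq> 0"
    "\<And>w. mw w m1 = symw w a b + symw w c d" "\<And>w. mw w m2 = symw w a c + symw w b d"
    "\<And>w. mw w m3 = symw w a d + symw w b c"
proof -
  define pm :: "nat \<Rightarrow> nat \<Rightarrow> (nat \<times> nat) \<Rightarrow>\<^sub>0 nat" where "pm a b = single (min a b, max a b) 1" for a b
  define sg :: "nat \<Rightarrow> nat \<Rightarrow> complex" where "sg a b = (if a < b then 1 else - 1)" for a b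
  have p: "pvar a b = single (pm a b) (sg a b)" if "a \<noteq> b" for a b
    using that by (auto simp: pvar_def Var_def pm_def sg_def single_uminus)
  have sg: "sg a b \<noteq> 0" for a b by (simp add: sg_def)
  have w: "mw w (pm a b + pm c d) = symw w a b + symw w c d" for w a b c d
    by (simp add: monomial_weight_add pm_def symw_def)
  show thesis
  proof (rule that[of "pm a b + pm c d" "sg a b * sg c d" "pm a c + pm b d" "- (sg a c * sg b d)"
        "pm a d + pm b c" "sg a d * sg b c"])
    show "plucker_rel a b c d = single (pm a b + pm c d) (sg a b * sg c d)
      + single (pm a c + pm b d) (- (sg a c * sg b d)) + single (pm a d + pm b c) (sg a d * sg b c)"
      using assms by (simp add: plucker_rel_def p mult_single single_uminus)
  qed (simp_all add: sg w)
qed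

lemma plucker_rel_wpart:
  assumes "quad_in n a b c d" "x \<le> symw w a b + symw w c d" "x \<le> symw w a c + symw w b d"
    "x \<le> symw w a d + symw w b c"
  shows "wpart (mw w) x (plucker_rel a b c d) \<in> initial_ideal n w"
proof (rule wpart_in_initial_ideal)
  have q: "a \<in> {1..n}" "b \<in> {1..n}" "c \<in> {1..n}" "d \<in> {1..n}" "distinct [a, b, c, d]"
    using assms(1) unfolding quad_in_def by blast+
  then show "plucker_rel a b c d \<in> plucker_ideal n" by (intro plucker_rel_in_ideal)
  obtain m1 m2 m3 s1 s2 s3 where m: "plucker_rel a b c d = single m1 s1 + single m2 s2 + single m3 s3"
    "\<And>w. mw w m1 = symw w a b + symw w c d" "\<And>w. mw w m2 = symw w a c + symw w b d"
    "\<And>w. mw w m3 = symw w a d + symw w b c"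
    using plucker_rel_monomials[OF q(5)] by metis
  have s: "weight_ge (mw w) x (single m s)" if "x \<le> mw w m" for m s
    using that by (simp add: weight_ge_def)
  show "weight_ge (mw w) x (plucker_rel a b c d)"
    unfolding m(1) using assms(2-4) by (intro weight_ge_add s) (simp_all only: m(2-4))
qed

text \<open>If one sum were strictly smallest, the initial form of the three-term relation would be
  a single term.\<close>

lemma trop_four_point:
  assumes "w \<in> trop_Gr2 n" shows "four_point {1..n} (symw w)"
  unfolding four_point_def
proof (intro ballI impI)
  fix a b c d assume "a \<in> {1..n}" "b \<in> {1..n}" "c \<in> {1..n}" "d \<in> {1..n}" and d: "distinct [a, b, c, d]"
  then have q: "quad_in n a b c d" by (simp add: quad_in_def)
  let ?x = "symw w a b + symw w c d"
  show "symw w a c + symw w b d \<le> ?x \<or> symw w a d + symw w b c \<le> ?x"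
  proof (rule ccontr)
    assume "\<not> ?thesis"
    then have lt: "?x < symw w a c + symw w b d" "?x < symw w a d + symw w b c" by linarith+
    obtain m1 m2 m3 s1 s2 s3 where m: "plucker_rel a b c d = single m1 s1 + single m2 s2 + single m3 s3"
      "s1 \<noteq> 0" "\<And>w. mw w m1 = symw w a b + symw w c d" "\<And>w. mw w m2 = symw w a c + symw w b d"
      "\<And>w. mw w m3 = symw w a d + symw w b c"
      using plucker_rel_monomials[OF d] by metis
    have "wpart (mw w) ?x (plucker_rel a b c d) \<in> initial_ideal n w"
      using lt by (intro plucker_rel_wpart[OF q]) simp_all
    moreover have "wpart (mw w) ?x (plucker_rel a b c d) = single m1 s1"
      using lt by (simp add: m(1) wpart_add wpart_single m(3-5))
    ultimately show False using trop_no_monomial[OF assms m(2)] by simp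
  qed
qed

text \<open>The initial form for \<open>w\<close> of a three-term relation contains the first two
  products. It also lies in the initial ideal of \<open>w'\<close>, and so do its components for
  \<open>w'\<close>; if the two products had different weights there, one component would be a
  single term.\<close>

lemma same_initial_ideal_quad_cone:
  assumes w: "w \<in> quad_cone n w0" "w \<in> trop_Gr2 n" and w': "w' \<in> weight_space n"
    and eq: "initial_ideal n w' = initial_ideal n w"
  shows "w' \<in> quad_cone n w0"
  unfolding quad_cone_def
proof (intro CollectI conjI allI impI w')
  fix a b c d assume q: "quad_in n a b c d" and s: "strict_quad (symw w0) a b c d"
  have w't: "w' \<in> trop_Gr2 n" using w(2) w' eq by (simp add: trop_Gr2_def)
  have q': "a \<in> {1..n}" "b \<in> {1..n}" "c \<in> {1..n}" "d \<in> {1..n}" "distinct [a, b, c, d]"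
    using q unfolding quad_in_def by blast+
  have d: "distinct [a, d, b, c]" using q'(5) by auto
  have fp: "symw w' a c + symw w' b d \<le> symw w' a d + symw w' b c \<or>
      symw w' a b + symw w' c d \<le> symw w' a d + symw w' b c"
    using four_pointD[OF trop_four_point[OF w't] q'(1) q'(4) q'(2) q'(3) d]
      symw_swap[of w' c d] symw_swap[of w' b d] by linarith
  have wk: "symw w a b + symw w c d = symw w a c + symw w b d"
      "symw w a b + symw w c d \<le> symw w a d + symw w b c"
    using w(1) q s unfolding quad_cone_def weak_quad_def by blast+
  obtain m1 m2 m3 s1 s2 s3 where m: "plucker_rel a b c d = single m1 s1 + single m2 s2 + single m3 s3"
    "s1 \<noteq> 0" "s2 \<noteq> 0" "s3 \<noteq> 0" "\<And>w. mw w m1 = symw w a b + symw w c d"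
    "\<And>w. mw w m2 = symw w a c + symw w b d" "\<And>w. mw w m3 = symw w a d + symw w b c"
    by (rule plucker_rel_monomials[OF q'(5)]) (rule that)
  let ?x = "symw w a b + symw w c d"
  define u where "u = wpart (mw w) ?x (plucker_rel a b c d)"
  have u_in: "u \<in> initial_ideal n w'" unfolding eq u_def using wk by (intro plucker_rel_wpart[OF q]) simp_all
  have no: "wpart (mw w') y u \<noteq> single m s" if "s \<noteq> 0" for y m s
    using wpart_initial_ideal[OF u_in, of y] trop_no_monomial[OF w't that] by metis
  have uu: "u = single m1 s1 + single m2 s2 + (if symw w a d + symw w b c = ?x then single m3 s3 else 0)"
    using wk(1) by (simp add: u_def m(1) wpart_add wpart_single m(5-7))
  have XY: "symw w' a b + symw w' c d = symw w' a c + symw w' b d"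
  proof (rule ccontr)
    assume ne: "\<not> ?thesis"
    show False
    \<comment> \<open>If the third product is present and stays with the first, the second is
      isolated; otherwise the first is.\<close>
    proof (cases "symw w a d + symw w b c = ?x \<and> symw w' a d + symw w' b c = symw w' a b + symw w' c d")
      case True
      then have "wpart (mw w') (mw w' m2) u = single m2 s2"
        using ne by (simp add: uu wpart_add wpart_single m(5-7))
      then show False using no[OF m(3)] by blast
    next
      case False
      then have "wpart (mw w') (mw w' m1) u = single m1 s1"
        using ne by (auto simp add: uu wpart_add wpart_single m(5-7))
      then show False using no[OF m(2)] by blast
    qed
  qed
  then show "weak_quad (symw w') a b c d" using fp unfolding weak_quad_def by linarith
qed

section \<open>Maximal cones as closures, and their relative interiors\<close>

lemma continuous_symw: "continuous_on S (\<lambda>w. symw w a b)"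
  unfolding symw_def by (rule continuous_on_subset[OF continuous_on_product_coordinates subset_UNIV])

lemma closed_quad_cone: "closed (quad_cone n w0)"
proof -
  have 1: "closed {w :: nat \<times> nat \<Rightarrow> real. \<forall>e. e \<notin> plucker_index n \<longrightarrow> w e = 0}"
    by (intro closed_Collect_all closed_Collect_imp open_Collect_const closed_Collect_eq
        continuous_on_const continuous_on_product_coordinates)
  have 2: "closed {w. \<forall>a b c d. quad_in n a b c d \<longrightarrow> strict_quad (symw w0) a b c d \<longrightarrow> weak_quad (symw w) a b c d}"
    unfolding weak_quad_def
    by (intro closed_Collect_all closed_Collect_imp open_Collect_const closed_Collect_conj
        closed_Collect_eq closed_Collect_le continuous_on_add continuous_symw)
  have "quad_cone n w0 = weight_space n \<inter>
      {w. \<forall>a b c d. quad_in n a b c d \<longrightarrow> strict_quad (symw w0) a b c d \<longrightarrow> weak_quad (symw w) a b c d}"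
    unfolding quad_cone_def by blast
  then show ?thesis using closed_Int[OF 1 2] unfolding weight_space_def by simp
qed

lemma continuous_perturb: "continuous_on S (\<lambda>e. perturb w e w0)"
  unfolding perturb_def
  by (intro continuous_on_coordinatewise_then_product continuous_intros)

text \<open>Weights with the initial ideal of \<open>w0\<close> lie in the closed cone. Conversely,
  a point \<open>w\<close> of the cone is the limit, as \<open>e\<close> tends to zero, of the
  weights \<open>perturb w e w0\<close>, which have that initial ideal.\<close>

lemma quad_cone_eq_closure:
  assumes n: "3 \<le> n" and gen: "generic n w0"
  shows "closure {w \<in> weight_space n. initial_ideal n w = initial_ideal n w0} = quad_cone n w0" (is "closure ?E = _")
proof
  have w0: "w0 \<in> quad_cone n w0" "w0 \<in> trop_Gr2 n"
    using generic_in_quad_cone[OF gen] quad_cone_subset_trop[OF n gen] by blast+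
  show "closure ?E \<subseteq> quad_cone n w0"
  proof (rule closure_minimal[OF _ closed_quad_cone])
    show "?E \<subseteq> quad_cone n w0" using same_initial_ideal_quad_cone[OF w0] by blast
  qed
  show "quad_cone n w0 \<subseteq> closure ?E"
  proof
    fix w assume w: "w \<in> quad_cone n w0"
    have "(\<lambda>e. perturb w e w0) ` {0<..} \<subseteq> closure ?E"
    proof (rule image_subsetI)
      fix e :: real assume "e \<in> {0<..}"
      then have st: "strict_in n w0 (perturb w e w0)"
        by (intro perturb_strict_in[OF w generic_space[OF gen]]) simp
      then have "perturb w e w0 \<in> ?E"
        using strict_in_initial_ideal[OF n gen st] by (simp add: strict_in_def)
      then show "perturb w e w0 \<in> closure ?E" by (rule subsetD[OF closure_subset])
    qed
    from image_closure_subset[OF continuous_perturb closed_closure this]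
    have "(\<lambda>e. perturb w e w0) ` closure {0<..} \<subseteq> closure ?E" .
    from subsetD[OF this imageI[of 0]] have "perturb w 0 w0 \<in> closure ?E" by simp
    then show "w \<in> closure ?E" by (simp add: perturb_def)
  qed
qed

lemma quad_cone_in_trop_fan:
  assumes "3 \<le> n" "generic n w0" shows "quad_cone n w0 \<in> trop_fan n"
  unfolding trop_fan_def groebner_fan_def
proof (intro CollectI conjI quad_cone_subset_trop[OF assms])
  show "\<exists>w. quad_cone n w0 = closure {w' \<in> weight_space n. initial_ideal n w' = initial_ideal n w} \<and>
      w \<in> weight_space n"
    by (intro exI[of _ w0] conjI quad_cone_eq_closure[OF assms, symmetric] generic_space[OF assms(2)])
qed

text \<open>It suffices to place the weight defining the cone: it lies in some
  \<open>quad_cone\<close>, and all weights with the same initial ideal follow it there.\<close>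

lemma trop_fan_subset_quad_cone:
  assumes n: "3 \<le> n" and C: "C \<in> trop_fan n"
  shows "\<exists>w0. generic n w0 \<and> C \<subseteq> quad_cone n w0"
proof -
  obtain w where w: "w \<in> weight_space n" "C = closure {w' \<in> weight_space n. initial_ideal n w' = initial_ideal n w}"
    using C unfolding trop_fan_def groebner_fan_def by blast
  have "w \<in> C" unfolding w(2) by (rule subsetD[OF closure_subset]) (simp add: w(1))
  then have wt: "w \<in> trop_Gr2 n" using C unfolding trop_fan_def by blast
  obtain w0 where w0: "generic n w0" "w \<in> quad_cone n w0"
    using four_point_in_generic_cone[OF n w(1) trop_four_point[OF wt]] by blast
  have "C \<subseteq> quad_cone n w0" unfolding w(2)
  proof (rule closure_minimal[OF _ closed_quad_cone])
    show "{w' \<in> weight_space n. initial_ideal n w' = initial_ideal n w} \<subseteq> quad_cone n w0"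
      using same_initial_ideal_quad_cone[OF w0(2) wt] by blast
  qed
  then show ?thesis using w0(1) by blast
qed

lemma strict_in_quad_cone_eq:
  assumes "generic n w1" "strict_in n w1 w0" shows "quad_cone n w1 = quad_cone n w0"
  using strict_in_generic(2)[OF assms] unfolding quad_cone_def by blast

text \<open>For a generic weight exactly two of the three sums are minimal, so a weak condition is
  automatically strict.\<close>

lemma generic_quad_cone_strict_in:
  assumes gen: "generic n w0" and "w0 \<in> quad_cone n w1"
  shows "strict_in n w1 w0"
  unfolding strict_in_def
proof (intro conjI allI impI generic_space[OF gen])
  fix a b c d assume q: "quad_in n a b c d" and "strict_quad (symw w1) a b c d"
  then have "weak_quad (symw w0) a b c d" using assms(2) unfolding quad_cone_def by blast
  then show "strict_quad (symw w0) a b c d"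
    using generic_quad_cases[OF gen q] symw_swap[of w0 b c] symw_swap[of w0 c d] symw_swap[of w0 b d]
    unfolding weak_quad_def strict_quad_def by linarith
qed

lemma trop_maximal_cone_eq:
  assumes n: "3 \<le> n" and C: "C \<in> trop_maximal_cones n"
  shows "\<exists>w0. generic n w0 \<and> C = quad_cone n w0"
proof -
  obtain w0 where w0: "generic n w0" "C \<subseteq> quad_cone n w0"
    using trop_fan_subset_quad_cone[OF n] C unfolding trop_maximal_cones_def by blast
  then have "quad_cone n w0 = C"
    using C quad_cone_in_trop_fan[OF n w0(1)] unfolding trop_maximal_cones_def by blast
  then show ?thesis using w0(1) by blast
qed

text \<open>A larger cone of the fan lies in some \<open>quad_cone n w1\<close>. This contains the
  generic \<open>w0\<close>, so both weights have the same strict quadruples and the cones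
  coincide.\<close>

lemma quad_cone_maximal:
  assumes n: "3 \<le> n" and gen: "generic n w0"
  shows "quad_cone n w0 \<in> trop_maximal_cones n"
  unfolding trop_maximal_cones_def
proof (intro CollectI conjI ballI impI quad_cone_in_trop_fan[OF n gen])
  fix D assume D: "D \<in> trop_fan n" "quad_cone n w0 \<subseteq> D"
  obtain w1 where w1: "generic n w1" "D \<subseteq> quad_cone n w1" using trop_fan_subset_quad_cone[OF n D(1)] by blast
  have "w0 \<in> quad_cone n w1" using generic_in_quad_cone[OF gen] D(2) w1(2) by blast
  from strict_in_quad_cone_eq[OF w1(1) generic_quad_cone_strict_in[OF gen this]]
  show "D = quad_cone n w0" using D(2) w1(2) by blast
qed

text \<open>The segment from \<open>w0\<close> to \<open>w\<close> can be prolonged a little beyond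
  \<open>w\<close> inside the cone. An inequality that is weak at the new endpoint and strict at
  \<open>w0\<close> is strict in between.\<close>

lemma rel_interior_strict_in:
  assumes gen: "generic n w0" and w: "w \<in> fun_rel_interior (quad_cone n w0)"
  shows "strict_in n w0 w"
proof -
  obtain T where T: "openin (top_of_set (fun_affine_hull (quad_cone n w0))) T" "T \<subseteq> quad_cone n w0" "w \<in> T"
    using w unfolding fun_rel_interior_def interior_of_def by blast
  have wC: "w \<in> quad_cone n w0" using T by blast
  show ?thesis
  proof (cases "w = w0")
    case True then show ?thesis using strict_in_refl[OF generic_space[OF gen]] by simp
  next
    case False
    define f where "f e = (\<lambda>x. (1 + e) * w x + (- e) * w0 x)" for e :: real
    have f_hull: "f e \<in> fun_affine_hull (quad_cone n w0)" for e
    proof -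
      define u where "u v = (if v = w then 1 + e else - e)" for v
      have "f e = (\<lambda>x. \<Sum>v\<in>{w, w0}. u v * v x)" "sum u {w, w0} = 1"
        using False by (auto simp: f_def u_def)
      moreover have "finite {w, w0}" "{w, w0} \<subseteq> quad_cone n w0"
        using wC generic_in_quad_cone[OF gen] by auto
      ultimately show ?thesis unfolding fun_affine_hull_def by blast
    qed
    obtain U where U: "open U" "T = fun_affine_hull (quad_cone n w0) \<inter> U"
      using T(1) unfolding openin_open by blast
    have "continuous_on UNIV f" unfolding f_def
      by (intro continuous_on_coordinatewise_then_product continuous_intros)
    then have "open (f -` U)" using U(1) open_vimage by blast
    moreover have "0 \<in> f -` U" using T(3) U(2) by (simp add: f_def)
    ultimately obtain r where r: "0 < r" "\<And>y. dist y 0 < r \<Longrightarrow> y \<in> f -` U"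
      unfolding open_dist by blast
    define e where "e = r / 2"
    have e: "0 < e" "f e \<in> U" using r(1) r(2)[of e] by (simp_all add: e_def)
    then have fe: "f e \<in> quad_cone n w0" using f_hull[of e] U(2) T(2) by blast
    have sf: "symw (f e) a b = (1 + e) * symw w a b - e * symw w0 a b" for a b
      by (simp add: symw_def f_def)
    show ?thesis unfolding strict_in_def
    proof (intro conjI allI impI quad_cone_space[OF wC])
      fix a b c d assume q: "quad_in n a b c d" and s: "strict_quad (symw w0) a b c d"
      have k: "weak_quad (symw w) a b c d" "weak_quad (symw (f e)) a b c d"
        using wC fe q s unfolding quad_cone_def by blast+
      have "(1 + e) * (symw w a b + symw w c d) - e * (symw w0 a b + symw w0 c d)
        \<le> (1 + e) * (symw w a d + symw w b c) - e * (symw w0 a d + symw w0 b c)"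
        using k(2) unfolding weak_quad_def sf by (simp add: algebra_simps)
      moreover have "e * (symw w0 a b + symw w0 c d) < e * (symw w0 a d + symw w0 b c)"
        using s e(1) unfolding strict_quad_def by simp
      ultimately have "(1 + e) * (symw w a b + symw w c d) < (1 + e) * (symw w a d + symw w b c)" by linarith
      then have "symw w a b + symw w c d < symw w a d + symw w b c" using e(1) by simp
      then show "strict_quad (symw w) a b c d" using k(1) unfolding strict_quad_def weak_quad_def by blast
    qed
  qed
qed

text \<open>The linear equalities of the cone hold on its whole affine hull. Inside the hull only
  finitely many inequalities remain, and their strict versions define an open set that contains
  \<open>w0\<close>.\<close>

lemma generic_in_rel_interior:
  assumes gen: "generic n w0"
  shows "w0 \<in> fun_rel_interior (quad_cone n w0)"
proof -
  let ?H = "fun_affine_hull (quad_cone n w0)"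
  define Q where "Q = {(a, b, c, d). quad_in n a b c d \<and> strict_quad (symw w0) a b c d}"
  define U where "U = (\<Inter>(a, b, c, d)\<in>Q. {w. symw w a b + symw w c d < symw w a d + symw w b c})"
  have "Q \<subseteq> {1..n} \<times> {1..n} \<times> {1..n} \<times> {1..n}" unfolding Q_def quad_in_def by auto
  then have "finite Q" by (rule finite_subset) simp
  then have "open U" unfolding U_def
    by (intro open_INT) (auto intro!: open_Collect_less continuous_on_add continuous_symw)
  then have op: "openin (top_of_set ?H) (?H \<inter> U)" by (rule openin_open_Int)
  have hull: "w \<in> weight_space n \<and> (\<forall>a b c d. quad_in n a b c d \<longrightarrow> strict_quad (symw w0) a b c d \<longrightarrow>
      symw w a b + symw w c d = symw w a c + symw w b d)" if wH: "w \<in> ?H" for w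
  proof -
    obtain A u where A: "w = (\<lambda>x. \<Sum>v\<in>A. u v * v x)" "A \<subseteq> quad_cone n w0"
      using wH unfolding fun_affine_hull_def by blast
    have s: "symw w a b = (\<Sum>v\<in>A. u v * symw v a b)" for a b by (simp add: A(1) symw_def)
    have "w \<in> weight_space n" unfolding weight_space_def
    proof (intro CollectI allI impI)
      fix x assume "x \<notin> plucker_index n"
      have "u v * v x = 0" if "v \<in> A" for v
      proof -
        have "v \<in> weight_space n" by (rule quad_cone_space[OF subsetD[OF A(2) that]])
        then have "v x = 0" using \<open>x \<notin> _\<close> unfolding weight_space_def by blast
        then show ?thesis by simp
      qed
      then show "w x = 0" unfolding A(1) by (intro sum.neutral ballI)
    qed
    moreover have "symw w a b + symw w c d = symw w a c + symw w b d"
      if "quad_in n a b c d" "strict_quad (symw w0) a b c d" for a b c d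
      unfolding s sum.distrib[symmetric] distrib_left[symmetric]
    proof (rule sum.cong[OF refl])
      fix v assume "v \<in> A"
      then have "weak_quad (symw v) a b c d" using A(2) that unfolding quad_cone_def by blast
      then show "u v * (symw v a b + symw v c d) = u v * (symw v a c + symw v b d)"
        unfolding weak_quad_def by simp
    qed
    ultimately show ?thesis by blast
  qed
  have sub: "?H \<inter> U \<subseteq> quad_cone n w0"
  proof
    fix w assume "w \<in> ?H \<inter> U"
    then have w: "w \<in> ?H" "w \<in> U" by simp_all
    have lt: "symw w a b + symw w c d < symw w a d + symw w b c"
      if "quad_in n a b c d" "strict_quad (symw w0) a b c d" for a b c d
      using w(2) that unfolding U_def Q_def by fast
    show "w \<in> quad_cone n w0"
      unfolding quad_cone_def weak_quad_def
    proof (intro CollectI conjI allI impI)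
      fix a b c d assume q: "quad_in n a b c d" "strict_quad (symw w0) a b c d"
      show "symw w a b + symw w c d = symw w a c + symw w b d" using hull[OF w(1)] q by blast
      show "symw w a b + symw w c d \<le> symw w a d + symw w b c" using lt[OF q] by simp
    qed (use hull[OF w(1)] in blast)
  qed
  have "w0 \<in> ?H" unfolding fun_affine_hull_def
  proof (rule CollectI, rule exI, rule exI, intro conjI)
    show "w0 = (\<lambda>x. \<Sum>v\<in>{w0}. 1 * v x)" by simp
  qed (use generic_in_quad_cone[OF gen] in simp_all)
  moreover have "w0 \<in> U" unfolding U_def Q_def strict_quad_def by blast
  ultimately have "w0 \<in> ?H \<inter> U" by (rule IntI)
  then show ?thesis unfolding fun_rel_interior_def interior_of_def
    by (intro CollectI exI[of _ "?H \<inter> U"] conjI op sub)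
qed

text \<open>The definition picks some weight from the relative interior; all of them have the
  initial ideal of \<open>w0\<close>.\<close>

lemma cone_initial_ideal_quad_cone:
  assumes n: "3 \<le> n" and gen: "generic n w0"
  shows "cone_initial_ideal n (quad_cone n w0) = initial_ideal n w0"
proof -
  have "(SOME w. w \<in> fun_rel_interior (quad_cone n w0)) \<in> fun_rel_interior (quad_cone n w0)"
    by (rule someI[of "\<lambda>w. w \<in> fun_rel_interior (quad_cone n w0)"]) (rule generic_in_rel_interior[OF gen])
  from strict_in_initial_ideal[OF n gen rel_interior_strict_in[OF gen this]]
  show ?thesis unfolding cone_initial_ideal_def .
qed

text \<open>The definite description is justified because a point in the relative interior of a
  maximal cone has the same strict quadruples as the generic weight of that cone, and these
  determine it.\<close>

lemma tree_cone_eq: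
  assumes n: "3 \<le> n" and ij: "iterated_choice n i j"
  shows "tree_cone n (iterated_tree n i) = quad_cone n (tree_weight n (iterated_tree n i))"
proof -
  let ?t = "tree_weight n (iterated_tree n i)"
  have gen: "generic n ?t" by (rule tree_weight_generic(1)[OF n ij])
  show ?thesis unfolding tree_cone_def
  proof (rule the_equality)
    show "quad_cone n ?t \<in> trop_maximal_cones n \<and> ?t \<in> fun_rel_interior (quad_cone n ?t)"
      using quad_cone_maximal[OF n gen] generic_in_rel_interior[OF gen] by blast
  next
    fix C assume C: "C \<in> trop_maximal_cones n \<and> ?t \<in> fun_rel_interior C"
    then obtain w0 where w0: "generic n w0" "C = quad_cone n w0" using trop_maximal_cone_eq[OF n] by blast
    have "strict_in n w0 ?t" using rel_interior_strict_in[OF w0(1)] C w0(2) by blast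
    from strict_in_quad_cone_eq[OF w0(1) this] show "C = quad_cone n ?t" using w0(2) by simp
  qed
qed

theorem theorem11:
  fixes n :: nat
  assumes "n \<ge> 4"
  shows "(\<forall>i j. iterated_choice n i j \<longrightarrow>
            graded_algebra_iso_quotient n (iterated_sequence n i j)
              (cone_initial_ideal n (tree_cone n (iterated_tree n i)))) \<and>
         (\<forall>C. C \<in> trop_maximal_cones n \<and> prime_cone n C \<longrightarrow>
            (\<exists>S. birational_sequence n S \<and>
               graded_algebra_iso_quotient n S (cone_initial_ideal n C)))"
proof (intro conjI allI impI)
  have n: "3 \<le> n" using assms by simp
  fix i j assume ij: "iterated_choice n i j"
  show "graded_algebra_iso_quotient n (iterated_sequence n i j)
    (cone_initial_ideal n (tree_cone n (iterated_tree n i)))"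
    unfolding tree_cone_eq[OF n ij] cone_initial_ideal_quad_cone[OF n tree_weight_generic(1)[OF n ij]]
    by (rule normal_form_graded_iso(1)[OF n tree_weight_space tree_weight_generic(2)[OF n ij]])
next
  have n: "3 \<le> n" using assms by simp
  fix C assume "C \<in> trop_maximal_cones n \<and> prime_cone n C"
  then obtain w0 where w0: "generic n w0" "C = quad_cone n w0" using trop_maximal_cone_eq[OF n] by blast
  \<comment> \<open>The iterated sequence belongs to the relabelled tree. Permuting the variables
    changes the initial ideal but not the isomorphism class of the quotient, so this sequence also
    realizes \<open>C\<close>.\<close>
  obtain \<pi> i j where nf: "normal_form n w0 \<pi> i j" using generic_normal_form[OF n w0(1)] by blast
  show "\<exists>S. birational_sequence n S \<and> graded_algebra_iso_quotient n S (cone_initial_ideal n C)"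
    unfolding w0(2) cone_initial_ideal_quad_cone[OF n w0(1)]
    using normal_form_graded_iso[OF n generic_space[OF w0(1)] nf] by blast
qed

end
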